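(* Consider the linear mixed model described in the context. Suppose that $\limsup_{i\to\infty}r_i<\infty$ and that there exist $M\in(0,\infty)$ and $\delta>0$ such that, for every $i=1,2,\dots$, $$M^{-1}\le\underline{e}(Z_i^{\mathsf T}Z_i)\le\bar e(Z_i^{\mathsf T}Z_i)\le M,\qquad M^{-1}\le\underline e\{\mathbb E(X_i^{\mathsf T}X_i)\},\qquad \mathbb E(\|X_i\|^{4+\delta})\le M,$$ where $\underline e(\cdot)$ and $\bar e(\cdot)$ are the smallest and largest eigenvalues and $\|\cdot\|$ is the spectral norm. Then the common null sets condition, the smoothness and moment condition, the comparable information condition, the non-degenerate modified score condition, and the dense non-critical points condition (all stated in the context, for the observations $(Y_i,X_i)$) hold. Hence: (a) for any $n\ge1$ there is a set $\mathcal Y^n$ of full measure such that $T_n$, defined at non-critical $\theta$ by $T_n=s_n^{\mathsf T}\mathcal I_n(\theta)^{-1}s_n$, has a continuous extension on $\Theta\times\mathcal Y^n$, and that extension is $T_n=\tilde s_n^{\mathsf T}\tilde{\mathcal I}_n(\theta)^{-1}\tilde s_n$, where $\tilde s_n,\tilde{\mathcal I}_n$ are formed with orders and eigenvectors as in the non-degenerate modified score condition; (b) with $T_n$ denoting this extension, $d=d_1+d_2$, and $\mathcal R_n(\alpha)=\{\theta\in\Theta:T_n(\theta;Y^n,X^n)\le q_{d,1-\alpha}\}$, where $q_{d,1-\alpha}$ is the $(1-\alpha)$th quantile of the chi-square distribution with $d$ degrees of freedom, it holds for every $\alpha\in(0,1)$ and every non-empty compact $C\subseteq\Theta$ that $$\lim_{n\to\infty}\inf_{\theta\in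 C}\mathsf P_\theta\{\theta\in\mathcal R_n(\alpha)\}=1-\alpha .$$
   Context: Linear mixed model. Independently for $i=1,2,\dots$, $$Y_i\mid X_i,W_i\sim\mathcal N(X_i\psi+Z_i\Lambda W_i,\sigma^2I_{r_i}),\qquad W_i\mid X_i\sim\mathcal N(0,I_q),$$ where $Y_i\in\mathbb R^{r_i}$, $Z_i\in\mathbb R^{r_i\times q}$ is a (non-random) design matrix, $X_i\in\mathbb R^{r_i\times d_2}$ is a matrix of predictors that is either non-stochastic or has a distribution not depending on $\theta$ (possibly different for different $i$), $\sigma^2>0$ is known, $\psi\in\mathbb R^{d_2}$, and $\Lambda=\Lambda(\lambda)=\operatorname{diag}(\lambda_{(1)},\dots,\lambda_{(q)})$ with each $\lambda_{(l)}$ being one of $\lambda_1,\dots,\lambda_{d_1}$ and each $\lambda_j$ appearing at least once. The parameter is $\theta=(\lambda,\psi)\in\Theta=[0,\infty)^{d_1}\times\mathbb R^{d_2}$. Notation. The observations are the pairs $(Y_i,X_i)$; $f_\theta(y_i)$ is the density of $Y_i$ given $X_i$ against Lebesgue measure (equivalently the density of the pair against Lebesgue measure times the law of $X_i$, which is $\gamma_i$ below). $Y^n=(Y_1,\dots,Y_n)$, $X^n=(X_1,\dots,X_n)$. Below "$y_i$" stands for the observation $(y_i,X_i)$ and $y^n$ for $n$ observations. A subscript $\theta$ on $\mathsf P,\mathbb E,\operatorname{cov}$ means the data have the distribution indexed by $\theta$. $\nabla$ is the gradient in $\theta$, $\nabla^l_j$ the $l$th order partial derivative in $\theta_j$, $\ell^i=\log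 f_\theta(y_i)$, $\ell_n=\sum_{i\le n}\ell^i$, $s^i=\nabla\ell^i$, $s_n=\nabla\ell_n$, $\mathcal I^i(\theta)=\operatorname{cov}_\theta(s^i)$, $\mathcal I_n(\theta)=\operatorname{cov}_\theta(s_n)$. $\theta$ is critical if $\mathcal I_n(\theta)$ is singular, non-critical otherwise. "Almost every" and "full measure" refer to the distribution of the data under any $\theta\in\Theta$. $A\preceq B$ means $B-A$ is positive semi-definite. Common null sets condition: for every $i$, the distributions $f_\theta(y_i)\gamma_i(\mathrm{d}y_i)$, $\theta\in\Theta$, all have the same null sets. Smoothness and moment condition: for every $\theta'\in\Theta$ there is an open ball $B=B(\theta')\subseteq\mathbb{R}^d$ centered at $\theta'$ on which, for every $i$ and almost every $y_i$, partial derivatives of $\theta\mapsto\ell^i(\theta;y_i)$ of an order $k=k(\theta')\ge2$ exist and are jointly continuous in $(\theta,y_i)$; moreover there is a $\delta'=\delta'(\theta')>0$ such that for all non-negative integers $l_1,\dots,l_d$ summing to $l\le k$, $$\sup_{i}\ \sup_{\theta\in B\cap\Theta,\ \tilde\theta\in B}\int\left|\frac{\partial^l}{\partial\theta_1^{l_1}\cdots\partial\theta_d^{l_d}}\ell^i(\theta;y_i)\Big|_{\theta=\tilde\theta}\right|^{2+\delta'}f_\theta(y_i)\,\gamma_i(\mathrm{d}y_i)<\infty .$$ If $B\not\subseteq\Theta$ this means that extensions of the partial derivatives to $B\times\mathcal{Y}_i$, for some set $\mathcal{Y}_i$ of full measure, exist and satisfy these conditions. Comparable information condition: there exist continuous $c_1,c_2:\Theta\to(0,\infty)$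 such that, for every $i=1,2,\dots$ and $\theta\in\Theta$, $c_1(\theta)\mathcal I^1(\theta)\preceq\mathcal I^i(\theta)\preceq c_2(\theta)\mathcal I^1(\theta)$. Modified score: given, for each $\theta\in\Theta$ and $n$, positive integers $k_j=k_j(\theta,n)$ and orthonormal eigenvectors $v^n_{\theta1},\dots,v^n_{\theta d}$ of $\mathcal{I}_n(\theta)$, let $\tilde s_n(\theta;y^n)\in\mathbb R^d$ have $j$th element $\sum_{i=1}^n\{\nabla_j^{k_j-1}s^i(\theta;y_i)\}^{\mathsf T}v^n_{\theta j}$ and let $\tilde{\mathcal I}_n(\theta)=\operatorname{cov}_\theta(\tilde s_n)$. Non-degenerate modified score condition: for every $\theta\in\Theta$ and $n=1,2,\dots$ there exist integers $k_j=k_j(\theta,n)\in\{1,2,\dots\}$ ($j=1,\dots,d$) and a set of orthonormal eigenvectors $\{v^n_{\theta1},\dots,v^n_{\theta d}\}$ of $\mathcal I_n(\theta)$ such that (i) $\tilde{\mathcal I}_n(\theta)$ is positive definite; (ii) $\{\nabla_j^l s_n(\tilde\theta;y^n)\}^{\mathsf T}v^n_{\theta j}=0$, $l=0,\dots,k_j-2$, for every $\tilde\theta$ with $\tilde\theta_j=\theta_j$ and almost every $y^n$; (iii) $k_j(\theta,n)$ is upper bounded by the $k=k(\theta)$ in the smoothness and moment condition for every $j,\theta,n$. Dense non-critical points condition: for every $\theta\in\Theta$ there is a sequence of non-critical points in $\Theta$ tending to $\theta$. *)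

theory Defs
  imports "HOL-Probability.Probability"
begin

section \<open>Matrices and distributions\<close>

definition eigenvalues :: "real^'n^'n \<Rightarrow> real set" where
  "eigenvalues A = {c. \<exists>v. v \<noteq> 0 \<and> A *v v = c *\<^sub>R v}"

definition min_eigenvalue :: "real^'n^'n \<Rightarrow> real" where
  "min_eigenvalue A = Min (eigenvalues A)"

definition max_eigenvalue :: "real^'n^'n \<Rightarrow> real" where
  "max_eigenvalue A = Max (eigenvalues A)"

definition pos_semidef :: "real^'n^'n \<Rightarrow> bool" where
  "pos_semidef A \<longleftrightarrow> transpose A = A \<and> (\<forall>v. 0 \<le> v \<bullet> (A *v v))"

definition pos_def :: "real^'n^'n \<Rightarrow> bool" where
  "pos_def A \<longleftrightarrow> transpose A = A \<and> (\<forall>v. v \<noteq> 0 \<longrightarrow> 0 < v \<bullet> (A *v v))"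

definition loewner_le :: "real^'n^'n \<Rightarrow> real^'n^'n \<Rightarrow> bool" where
  "loewner_le A B \<longleftrightarrow> pos_semidef (B - A)"

definition cov_matrix :: "'y measure \<Rightarrow> ('y \<Rightarrow> real^'n) \<Rightarrow> real^'n^'n" where
  "cov_matrix M S = (\<chi> a b. \<integral>y. (S y $ a - (\<integral>u. S u $ a \<partial>M)) * (S y $ b - (\<integral>u. S u $ b \<partial>M)) \<partial>M)"

text \<open>
  A matrix with \<open>m\<close> rows, where \<open>m\<close> may vary with the observation, is the function
  \<open>x :: nat \<Rightarrow> real^'c\<close> listing its rows \<open>x 0, \<dots>, x (m - 1)\<close>.
\<close>

definition gram :: "nat \<Rightarrow> (nat \<Rightarrow> real^'c) \<Rightarrow> real^'c^'c" where
  "gram m x = (\<chi> a b. \<Sum>k<m. x k $ a * x k $ b)"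

definition spectral_norm :: "nat \<Rightarrow> (nat \<Rightarrow> real^'c) \<Rightarrow> real" where
  "spectral_norm m x = (SUP v\<in>{v. norm v = 1}. L2_set (\<lambda>k. x k \<bullet> v) {..<m})"

definition chi_square :: "nat \<Rightarrow> real measure" where
  "chi_square d = distr (PiM {..<d} (\<lambda>_. density lborel (\<lambda>t. ennreal (std_normal_density t)))) borel
     (\<lambda>z. \<Sum>i<d. (z i)\<^sup>2)"

definition quantile :: "real measure \<Rightarrow> real \<Rightarrow> real" where
  "quantile M p = Inf {x. p \<le> cdf M x}"

section \<open>Independent observations from a parametric family\<close>

text \<open>
  The observations are numbered \<open>1, 2, \<dots>\<close>; the \<open>i\<close>-th has density \<open>f i \<theta>\<close> against \<open>\<nu> i\<close>
  for \<open>\<theta> \<in> \<Theta>\<close>. A sample of size \<open>n\<close> is a point of the product over \<open>{1..n}\<close>.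
\<close>

definition obs_law ::
  "(nat \<Rightarrow> 'p \<Rightarrow> 'y \<Rightarrow> real) \<Rightarrow> (nat \<Rightarrow> 'y measure) \<Rightarrow> 'p \<Rightarrow> nat \<Rightarrow> 'y measure" where
  "obs_law f \<nu> \<theta> i = density (\<nu> i) (\<lambda>y. ennreal (f i \<theta> y))"

definition sample_law ::
  "(nat \<Rightarrow> 'p \<Rightarrow> 'y \<Rightarrow> real) \<Rightarrow> (nat \<Rightarrow> 'y measure) \<Rightarrow> nat \<Rightarrow> 'p \<Rightarrow> (nat \<Rightarrow> 'y) measure" where
  "sample_law f \<nu> n \<theta> = PiM {1..n} (obs_law f \<nu> \<theta>)"

definition full_measure :: "'p set \<Rightarrow> ('p \<Rightarrow> 'y measure) \<Rightarrow> 'y set \<Rightarrow> bool" where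
  "full_measure \<Theta> P S \<longleftrightarrow> (\<forall>\<theta>\<in>\<Theta>. S \<in> sets (P \<theta>) \<and> (AE y in P \<theta>. y \<in> S))"

text \<open>
  Partial derivatives are taken within \<open>\<Theta>\<close>: they are one-sided at points where moving
  in one of the two coordinate directions leaves \<open>\<Theta>\<close>.
\<close>

definition partial ::
  "(real^'d) set \<Rightarrow> 'd \<Rightarrow> (real^'d \<Rightarrow> 'b::real_normed_vector) \<Rightarrow> real^'d \<Rightarrow> 'b" where
  "partial \<Theta> j g \<theta> =
     vector_derivative (\<lambda>t. g (\<theta> + t *\<^sub>R axis j 1)) (at 0 within {t. \<theta> + t *\<^sub>R axis j 1 \<in> \<Theta>})"

definition gradient :: "(real^'d) set \<Rightarrow> (real^'d \<Rightarrow> real) \<Rightarrow> real^'d \<Rightarrow> real^'d" where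
  "gradient \<Theta> g \<theta> = (\<chi> j. partial \<Theta> j g \<theta>)"

definition loglik :: "(nat \<Rightarrow> 'p \<Rightarrow> 'y \<Rightarrow> real) \<Rightarrow> nat \<Rightarrow> 'p \<Rightarrow> 'y \<Rightarrow> real" where
  "loglik f i \<theta> y = ln (f i \<theta> y)"

definition loglik_n :: "(nat \<Rightarrow> 'p \<Rightarrow> 'y \<Rightarrow> real) \<Rightarrow> nat \<Rightarrow> 'p \<Rightarrow> (nat \<Rightarrow> 'y) \<Rightarrow> real" where
  "loglik_n f n \<theta> y = (\<Sum>i=1..n. loglik f i \<theta> (y i))"

definition score ::
  "(real^'d) set \<Rightarrow> (nat \<Rightarrow> real^'d \<Rightarrow> 'y \<Rightarrow> real) \<Rightarrow> nat \<Rightarrow> real^'d \<Rightarrow> 'y \<Rightarrow> real^'d" where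
  "score \<Theta> f i \<theta> y = gradient \<Theta> (\<lambda>\<theta>. loglik f i \<theta> y) \<theta>"

definition score_n ::
  "(real^'d) set \<Rightarrow> (nat \<Rightarrow> real^'d \<Rightarrow> 'y \<Rightarrow> real) \<Rightarrow> nat \<Rightarrow> real^'d \<Rightarrow> (nat \<Rightarrow> 'y) \<Rightarrow> real^'d" where
  "score_n \<Theta> f n \<theta> y = gradient \<Theta> (\<lambda>\<theta>. loglik_n f n \<theta> y) \<theta>"

definition info ::
  "(real^'d) set \<Rightarrow> (nat \<Rightarrow> real^'d \<Rightarrow> 'y \<Rightarrow> real) \<Rightarrow> (nat \<Rightarrow> 'y measure) \<Rightarrow> nat \<Rightarrow> real^'d \<Rightarrow> real^'d^'d" where
  "info \<Theta> f \<nu> i \<theta> = cov_matrix (obs_law f \<nu> \<theta> i) (score \<Theta> f i \<theta>)"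

definition info_n ::
  "(real^'d) set \<Rightarrow> (nat \<Rightarrow> real^'d \<Rightarrow> 'y \<Rightarrow> real) \<Rightarrow> (nat \<Rightarrow> 'y measure) \<Rightarrow> nat \<Rightarrow> real^'d \<Rightarrow> real^'d^'d" where
  "info_n \<Theta> f \<nu> n \<theta> = cov_matrix (sample_law f \<nu> n \<theta>) (score_n \<Theta> f n \<theta>)"

definition noncritical ::
  "(real^'d) set \<Rightarrow> (nat \<Rightarrow> real^'d \<Rightarrow> 'y \<Rightarrow> real) \<Rightarrow> (nat \<Rightarrow> 'y measure) \<Rightarrow> nat \<Rightarrow> real^'d \<Rightarrow> bool" where
  "noncritical \<Theta> f \<nu> n \<theta> \<longleftrightarrow> invertible (info_n \<Theta> f \<nu> n \<theta>)"

definition score_statistic ::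
  "(real^'d) set \<Rightarrow> (nat \<Rightarrow> real^'d \<Rightarrow> 'y \<Rightarrow> real) \<Rightarrow> (nat \<Rightarrow> 'y measure) \<Rightarrow> nat
     \<Rightarrow> real^'d \<Rightarrow> (nat \<Rightarrow> 'y) \<Rightarrow> real" where
  "score_statistic \<Theta> f \<nu> n \<theta> y =
     score_n \<Theta> f n \<theta> y \<bullet> (matrix_inv (info_n \<Theta> f \<nu> n \<theta>) *v score_n \<Theta> f n \<theta> y)"

text \<open>
  The modified score at a given \<open>\<theta>\<close>, for orders \<open>\<kappa> j\<close> and vectors \<open>v j\<close>; the latter
  stay fixed when the score is differentiated.
\<close>

definition mod_score ::
  "(real^'d) set \<Rightarrow> (nat \<Rightarrow> real^'d \<Rightarrow> 'y \<Rightarrow> real) \<Rightarrow> nat \<Rightarrow> ('d \<Rightarrow> nat) \<Rightarrow> ('d \<Rightarrow> real^'d)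
     \<Rightarrow> real^'d \<Rightarrow> (nat \<Rightarrow> 'y) \<Rightarrow> real^'d" where
  "mod_score \<Theta> f n \<kappa> v \<theta> y =
     (\<chi> j. \<Sum>i=1..n. (partial \<Theta> j ^^ (\<kappa> j - 1)) (\<lambda>\<theta>. score \<Theta> f i \<theta> (y i)) \<theta> \<bullet> v j)"

definition mod_info ::
  "(real^'d) set \<Rightarrow> (nat \<Rightarrow> real^'d \<Rightarrow> 'y \<Rightarrow> real) \<Rightarrow> (nat \<Rightarrow> 'y measure) \<Rightarrow> nat
     \<Rightarrow> ('d \<Rightarrow> nat) \<Rightarrow> ('d \<Rightarrow> real^'d) \<Rightarrow> real^'d \<Rightarrow> real^'d^'d" where
  "mod_info \<Theta> f \<nu> n \<kappa> v \<theta> = cov_matrix (sample_law f \<nu> n \<theta>) (mod_score \<Theta> f n \<kappa> v \<theta>)"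

definition mod_statistic ::
  "(real^'d) set \<Rightarrow> (nat \<Rightarrow> real^'d \<Rightarrow> 'y \<Rightarrow> real) \<Rightarrow> (nat \<Rightarrow> 'y measure) \<Rightarrow> nat
     \<Rightarrow> ('d \<Rightarrow> nat) \<Rightarrow> ('d \<Rightarrow> real^'d) \<Rightarrow> real^'d \<Rightarrow> (nat \<Rightarrow> 'y) \<Rightarrow> real" where
  "mod_statistic \<Theta> f \<nu> n \<kappa> v \<theta> y =
     mod_score \<Theta> f n \<kappa> v \<theta> y \<bullet> (matrix_inv (mod_info \<Theta> f \<nu> n \<kappa> v \<theta>) *v mod_score \<Theta> f n \<kappa> v \<theta> y)"

section \<open>The conditions\<close>

definition common_null_sets ::
  "'p set \<Rightarrow> (nat \<Rightarrow> 'p \<Rightarrow> 'y \<Rightarrow> real) \<Rightarrow> (nat \<Rightarrow> 'y measure) \<Rightarrow> bool" where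
  "common_null_sets \<Theta> f \<nu> \<longleftrightarrow>
     (\<forall>i\<ge>1. \<forall>\<theta>\<in>\<Theta>. \<forall>\<theta>'\<in>\<Theta>. null_sets (obs_law f \<nu> \<theta> i) = null_sets (obs_law f \<nu> \<theta>' i))"

text \<open>
  \<open>D i m\<close> is the partial derivative of the (extended) log-likelihood \<open>loglik f i\<close> with
  multi-index \<open>m\<close>, on the ball times \<open>\<Y> i\<close>. The derivatives at \<open>t = 0\<close> are
  two-sided, so where the ball leaves \<open>\<Theta>\<close> the extensions are again partial derivatives of
  the extended log-likelihood; inside \<open>\<Theta>\<close> they are the partial derivatives of \<open>loglik f i\<close>.
\<close>

definition smoothness_moment ::
  "(real^'d) set \<Rightarrow> (nat \<Rightarrow> real^'d \<Rightarrow> ('y::topological_space) \<Rightarrow> real) \<Rightarrow> (nat \<Rightarrow> 'y measure)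
     \<Rightarrow> (real^'d \<Rightarrow> nat) \<Rightarrow> bool" where
  "smoothness_moment \<Theta> f \<nu> k \<longleftrightarrow>
     (\<forall>\<theta>'\<in>\<Theta>. k \<theta>' \<ge> 2 \<and>
       (\<exists>\<epsilon>>0. \<exists>\<delta>>0. \<exists>(D :: nat \<Rightarrow> ('d \<Rightarrow> nat) \<Rightarrow> real^'d \<Rightarrow> 'y \<Rightarrow> real) \<Y>.
          (\<forall>i\<ge>1. full_measure \<Theta> (\<lambda>\<theta>. obs_law f \<nu> \<theta> i) (\<Y> i) \<and>
             (\<forall>\<theta>\<in>ball \<theta>' \<epsilon> \<inter> \<Theta>. \<forall>y\<in>\<Y> i. D i (\<lambda>_. 0) \<theta> y = loglik f i \<theta> y) \<and>
             (\<forall>m j. sum m UNIV < k \<theta>' \<longrightarrow>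
                (\<forall>\<theta>\<in>ball \<theta>' \<epsilon>. \<forall>y\<in>\<Y> i.
                   ((\<lambda>t. D i m (\<theta> + t *\<^sub>R axis j 1) y) has_real_derivative
                      D i (m(j := m j + 1)) \<theta> y) (at 0))) \<and>
             (\<forall>m. sum m UNIV \<le> k \<theta>' \<longrightarrow>
                continuous_on (ball \<theta>' \<epsilon> \<times> \<Y> i) (\<lambda>(\<theta>, y). D i m \<theta> y))) \<and>
          (\<forall>m. sum m UNIV \<le> k \<theta>' \<longrightarrow>
             (SUP i\<in>{1..}. SUP \<theta>\<in>ball \<theta>' \<epsilon> \<inter> \<Theta>. SUP \<theta>t\<in>ball \<theta>' \<epsilon>.
                \<integral>\<^sup>+y. ennreal (\<bar>D i m \<theta>t y\<bar> powr (2 + \<delta>)) \<partial>obs_law f \<nu> \<theta> i) < \<infinity>)))"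

definition comparable_information ::
  "(real^'d) set \<Rightarrow> (nat \<Rightarrow> real^'d \<Rightarrow> 'y \<Rightarrow> real) \<Rightarrow> (nat \<Rightarrow> 'y measure) \<Rightarrow> bool" where
  "comparable_information \<Theta> f \<nu> \<longleftrightarrow>
     (\<exists>c1 c2 :: real^'d \<Rightarrow> real. continuous_on \<Theta> c1 \<and> continuous_on \<Theta> c2 \<and>
        (\<forall>\<theta>\<in>\<Theta>. 0 < c1 \<theta> \<and> 0 < c2 \<theta>) \<and>
        (\<forall>i\<ge>1. \<forall>\<theta>\<in>\<Theta>. loewner_le (c1 \<theta> *\<^sub>R info \<Theta> f \<nu> 1 \<theta>) (info \<Theta> f \<nu> i \<theta>) \<and>
           loewner_le (info \<Theta> f \<nu> i \<theta>) (c2 \<theta> *\<^sub>R info \<Theta> f \<nu> 1 \<theta>)))"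

text \<open>
  Orders \<open>\<kappa> j\<close> and eigenvectors \<open>v j\<close> that are allowed at one \<open>\<theta>\<close> and \<open>n\<close>, with \<open>k\<close> the
  bound on the orders.
\<close>

definition admissible_orders ::
  "(real^'d) set \<Rightarrow> (nat \<Rightarrow> real^'d \<Rightarrow> 'y \<Rightarrow> real) \<Rightarrow> (nat \<Rightarrow> 'y measure) \<Rightarrow> nat \<Rightarrow> nat \<Rightarrow> real^'d
     \<Rightarrow> ('d \<Rightarrow> nat) \<Rightarrow> ('d \<Rightarrow> real^'d) \<Rightarrow> bool" where
  "admissible_orders \<Theta> f \<nu> k n \<theta> \<kappa> v \<longleftrightarrow>
     (\<forall>j. 1 \<le> \<kappa> j) \<and>
     (\<forall>j. \<exists>c. info_n \<Theta> f \<nu> n \<theta> *v v j = c *\<^sub>R v j) \<and>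
     (\<forall>j l. v j \<bullet> v l = (if j = l then 1 else 0)) \<and>
     pos_def (mod_info \<Theta> f \<nu> n \<kappa> v \<theta>) \<and>
     (\<forall>j l. l + 2 \<le> \<kappa> j \<longrightarrow>
        (\<forall>\<theta>t\<in>\<Theta>. \<theta>t $ j = \<theta> $ j \<longrightarrow>
           (\<forall>\<theta>0\<in>\<Theta>. AE y in sample_law f \<nu> n \<theta>0.
              (partial \<Theta> j ^^ l) (\<lambda>\<theta>. score_n \<Theta> f n \<theta> y) \<theta>t \<bullet> v j = 0))) \<and>
     (\<forall>j. \<kappa> j \<le> k)"

definition nondegenerate_modified_score ::
  "(real^'d) set \<Rightarrow> (nat \<Rightarrow> real^'d \<Rightarrow> 'y \<Rightarrow> real) \<Rightarrow> (nat \<Rightarrow> 'y measure)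
     \<Rightarrow> (real^'d \<Rightarrow> nat) \<Rightarrow> bool" where
  "nondegenerate_modified_score \<Theta> f \<nu> k \<longleftrightarrow>
     (\<forall>\<theta>\<in>\<Theta>. \<forall>n\<ge>1. \<exists>\<kappa> v. admissible_orders \<Theta> f \<nu> (k \<theta>) n \<theta> \<kappa> v)"

text \<open>One approximating sequence serves all sample sizes \<open>n\<close>.\<close>

definition dense_noncritical ::
  "(real^'d) set \<Rightarrow> (nat \<Rightarrow> real^'d \<Rightarrow> 'y \<Rightarrow> real) \<Rightarrow> (nat \<Rightarrow> 'y measure) \<Rightarrow> bool" where
  "dense_noncritical \<Theta> f \<nu> \<longleftrightarrow>
     (\<forall>\<theta>\<in>\<Theta>. \<exists>u. (\<forall>m. u m \<in> \<Theta> \<and> (\<forall>n\<ge>1. noncritical \<Theta> f \<nu> n (u m))) \<and> u \<longlonglongrightarrow> \<theta>)"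

definition continuous_extension ::
  "(real^'d) set \<Rightarrow> (nat \<Rightarrow> real^'d \<Rightarrow> ('y::topological_space) \<Rightarrow> real) \<Rightarrow> (nat \<Rightarrow> 'y measure)
     \<Rightarrow> nat \<Rightarrow> (nat \<Rightarrow> 'y) set \<Rightarrow> (real^'d \<Rightarrow> (nat \<Rightarrow> 'y) \<Rightarrow> real) \<Rightarrow> bool" where
  "continuous_extension \<Theta> f \<nu> n \<Y> T \<longleftrightarrow>
     continuous_on (\<Theta> \<times> \<Y>) (\<lambda>(\<theta>, y). T \<theta> y) \<and>
     (\<forall>\<theta>\<in>\<Theta>. noncritical \<Theta> f \<nu> n \<theta> \<longrightarrow> (\<forall>y\<in>\<Y>. T \<theta> y = score_statistic \<Theta> f \<nu> n \<theta> y))"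

definition conf_region ::
  "(real^'d) set \<Rightarrow> (real^'d \<Rightarrow> 'x \<Rightarrow> real) \<Rightarrow> nat \<Rightarrow> real \<Rightarrow> 'x \<Rightarrow> (real^'d) set" where
  "conf_region \<Theta> T d \<alpha> y = {\<theta>\<in>\<Theta>. T \<theta> y \<le> quantile (chi_square d) (1 - \<alpha>)}"

section \<open>The linear mixed model\<close>

text \<open>
  The parameter \<open>\<theta> = (\<lambda>, \<psi>)\<close> has its \<open>\<lambda>\<close>-coordinates at \<open>Inl\<close> and its \<open>\<psi>\<close>-coordinates at
  \<open>Inr\<close>. The map \<open>a\<close> gives the pattern of \<open>\<Lambda>\<close>: its \<open>l\<close>-th diagonal entry is \<open>\<lambda>\<close> at \<open>a l\<close>.
\<close>

definition lmm_lambda :: "real^('d1::finite + 'd2::finite) \<Rightarrow> real^'d1" where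
  "lmm_lambda \<theta> = (\<chi> j. \<theta> $ Inl j)"

definition lmm_psi :: "real^('d1::finite + 'd2::finite) \<Rightarrow> real^'d2" where
  "lmm_psi \<theta> = (\<chi> j. \<theta> $ Inr j)"

definition lmm_Theta :: "(real^('d1::finite + 'd2::finite)) set" where
  "lmm_Theta = {\<theta>. \<forall>j. 0 \<le> lmm_lambda \<theta> $ j}"

definition lmm_Lambda :: "('q \<Rightarrow> 'd1) \<Rightarrow> real^'d1 \<Rightarrow> real^'q^'q" where
  "lmm_Lambda a lam = (\<chi> l m. if l = m then lam $ a l else 0)"

text \<open>
  Joint density of \<open>(W, Y)\<close> given \<open>X = x\<close>, for an observation with \<open>m\<close> responses and rows
  \<open>z k\<close> of the design matrix: \<open>W\<close> is standard normal, and given \<open>W = w\<close> the responses are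
  independent normal with means the entries of \<open>x \<psi> + z \<Lambda> w\<close> and standard deviation \<open>\<sigma>\<close>.
\<close>

definition lmm_joint_density ::
  "nat \<Rightarrow> (nat \<Rightarrow> real^'q) \<Rightarrow> ('q \<Rightarrow> 'd1) \<Rightarrow> real \<Rightarrow> real^('d1::finite + 'd2::finite)
     \<Rightarrow> real^'q \<Rightarrow> (nat \<Rightarrow> real) \<Rightarrow> (nat \<Rightarrow> real^'d2) \<Rightarrow> real" where
  "lmm_joint_density m z a \<sigma> \<theta> w y x =
     (\<Prod>l\<in>UNIV. std_normal_density (w $ l)) *
     (\<Prod>k<m. normal_density (x k \<bullet> lmm_psi \<theta> + z k \<bullet> (lmm_Lambda a (lmm_lambda \<theta>) *v w)) \<sigma> (y k))"

text \<open>
  The density of \<open>Y\<close> given \<open>X\<close>, as a function of the parameter and the pair \<open>(Y, X)\<close>.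
\<close>

definition lmm_density ::
  "(nat \<Rightarrow> nat) \<Rightarrow> (nat \<Rightarrow> nat \<Rightarrow> real^'q) \<Rightarrow> ('q \<Rightarrow> 'd1) \<Rightarrow> real
     \<Rightarrow> nat \<Rightarrow> real^('d1::finite + 'd2::finite) \<Rightarrow> (nat \<Rightarrow> real) \<times> (nat \<Rightarrow> real^'d2) \<Rightarrow> real" where
  "lmm_density r Z a \<sigma> i \<theta> = (\<lambda>(y, x). \<integral>w. lmm_joint_density (r i) (Z i) a \<sigma> \<theta> w y x \<partial>lborel)"

definition lmm_dominating ::
  "(nat \<Rightarrow> nat) \<Rightarrow> (nat \<Rightarrow> (nat \<Rightarrow> real^'d2) measure)
     \<Rightarrow> nat \<Rightarrow> ((nat \<Rightarrow> real) \<times> (nat \<Rightarrow> real^'d2)) measure" where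
  "lmm_dominating r \<gamma> i = PiM {..<r i} (\<lambda>_. lborel) \<Otimes>\<^sub>M \<gamma> i"

text \<open>
  \<open>P\<close> is the probability measure under the parameter \<open>\<theta>\<close>, and \<open>\<gamma> i\<close> the distribution of
  \<open>X i\<close> (a point mass if the predictors are non-stochastic).
\<close>

definition linear_mixed_model ::
  "(nat \<Rightarrow> nat) \<Rightarrow> (nat \<Rightarrow> nat \<Rightarrow> real^'q) \<Rightarrow> ('q \<Rightarrow> 'd1) \<Rightarrow> real
     \<Rightarrow> (nat \<Rightarrow> (nat \<Rightarrow> real^'d2) measure) \<Rightarrow> real^('d1::finite + 'd2::finite) \<Rightarrow> 'w measure
     \<Rightarrow> (nat \<Rightarrow> 'w \<Rightarrow> nat \<Rightarrow> real) \<Rightarrow> (nat \<Rightarrow> 'w \<Rightarrow> real^'q) \<Rightarrow> (nat \<Rightarrow> 'w \<Rightarrow> nat \<Rightarrow> real^'d2) \<Rightarrow> bool" where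
  "linear_mixed_model r Z a \<sigma> \<gamma> \<theta> P Y W X \<longleftrightarrow>
     prob_space P \<and>
     prob_space.indep_vars P (\<lambda>i. lborel \<Otimes>\<^sub>M lmm_dominating r \<gamma> i)
       (\<lambda>i \<omega>. (W i \<omega>, Y i \<omega>, X i \<omega>)) {1..} \<and>
     (\<forall>i\<ge>1. distributed P (lborel \<Otimes>\<^sub>M lmm_dominating r \<gamma> i) (\<lambda>\<omega>. (W i \<omega>, Y i \<omega>, X i \<omega>))
        (\<lambda>(w, y, x). ennreal (lmm_joint_density (r i) (Z i) a \<sigma> \<theta> w y x)))"

definition lmm_sample ::
  "(nat \<Rightarrow> 'w \<Rightarrow> 'y) \<Rightarrow> (nat \<Rightarrow> 'w \<Rightarrow> 'x) \<Rightarrow> nat \<Rightarrow> 'w \<Rightarrow> nat \<Rightarrow> 'y \<times> 'x" where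
  "lmm_sample Y X n \<omega> = (\<lambda>i\<in>{1..n}. (Y i \<omega>, X i \<omega>))"

end

theory Submission
  imports Defs
begin

text \<open>
  Write \<open>u = y - x \<psi>\<close> and \<open>D = diag (\<lambda>, 1)\<close>. The marginal density of one observation is an
  explicit Gaussian density, and differentiating it shows that the score is \<open>D U\<close>, where the
  reduced score \<open>U\<close> stays regular on the boundary \<open>\<lambda> = 0\<close>: its covariance matrix \<open>V\<close> is bounded
  above and below by positive multiples of the identity, uniformly in the observation and locally
  uniformly in \<open>\<theta>\<close>. So the information is \<open>D V D\<close>, singular exactly where some \<open>\<lambda>\<close>-coordinate
  vanishes, and an admissible modified score is \<open>A U\<close> with \<open>A\<close> invertible. At non-critical points
  the score statistic, and at every point the modified statistic, equals \<open>U \<bullet> (V\<^sup>-\<^sup>1 U)\<close> for the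
  summed \<open>U\<close> and \<open>V\<close>, which is jointly continuous in the parameter and the data. Uniform coverage
  on compact sets is convergence along arbitrary sequences of parameters: there a Lyapunov
  argument, run on Laplace transforms, gives the chi-square limit of \<open>U \<bullet> (V\<^sup>-\<^sup>1 U)\<close>.
\<close>

section \<open>Symmetric matrices\<close>

text \<open>The number of responses varies with the observation and the information degenerates at
  \<lambda> = 0, so the computations run in the fixed dimension of the random effects and for
  \<open>rscore\<close> instead of the score. Wick's formula makes the covariance of
  \<open>rscore\<close> explicit: the \<lambda>-block is twice an aggregated entrywise square of
  \<open>Km\<close>, the \<psi>-block a mean weighted Gram matrix of the predictors, and the mixed
  block an odd Gaussian moment, hence zero. Positivity of the first block comes from a spectral
  bound on entrywise squares, that of the second from the eigenvalue hypothesis on the predictors.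
  Log density, score and Hessian grow at most quadratically in noise and predictors; predictor
  moments of order 4 + \<delta> therefore give moments of order 2 + \<delta> / 2, with constants
  free of the observation. Orders above two never occur: the score component of a vanishing
  \<lambda>_j is zero on the whole hyperplane, and its derivative across it is a nondegenerate
  component of \<open>rscore\<close>. Admissibility forces this shape, so the identity in (a) covers
  every admissible choice.\<close>

lemma sym_dot:
  fixes A :: "real^'n^'n"
  assumes "transpose A = A"
  shows "(A *v x) \<bullet> y = x \<bullet> (A *v y)"
  using dot_lmul_matrix[of x A y] by (simp add: assms flip: transpose_matrix_vector)

text \<open>The relative form, for an invariant subspace, is what the induction needs: after one
  eigenvector is split off, its orthogonal complement in S is again invariant. It is used once more
  in this form to find eigenvectors of the information inside a coordinate subspace.\<close>

lemma spectral_subspace: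
  fixes A :: "real^'n^'n"
  assumes sym: "transpose A = A" and "subspace S" and "\<And>x. x \<in> S \<Longrightarrow> A *v x \<in> S"
  shows "\<exists>B. B \<subseteq> S \<and> pairwise orthogonal B \<and> (\<forall>x\<in>B. norm x = 1 \<and> (\<exists>c. A *v x = c *\<^sub>R x))
    \<and> span B = S \<and> card B = dim S"
  using assms(2,3)
proof (induction "dim S" arbitrary: S rule: less_induct)
  case less
  show ?case
  proof (cases "S = {0}")
    case True
    then show ?thesis by (intro exI[of _ "{}"]) auto
  next
    case False
    let ?q = "\<lambda>x. x \<bullet> (A *v x)"
    let ?K = "sphere 0 1 \<inter> S"
    have "compact ?K"
      by (intro compact_Int_closed compact_sphere closed_subspace less.prems)
    moreover obtain x where "x \<in> S" "x \<noteq> 0"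
      using False less.prems(1) subspace_0 by blast
    then have "x /\<^sub>R norm x \<in> ?K"
      using less.prems(1) by (auto intro: subspace_scale)
    then have "?K \<noteq> {}" by blast
    moreover have "continuous_on ?K ?q"
      by (intro continuous_intros)
    \<comment> \<open>A maximiser of the quadratic form on the unit sphere of S; the next steps show
      that it is an eigenvector.\<close>
    ultimately obtain e where e: "e \<in> ?K" and max: "\<And>y. y \<in> ?K \<Longrightarrow> ?q y \<le> ?q e"
      using continuous_attains_sup[of ?K ?q] by blast
    have eS: "e \<in> S" and ne: "norm e = 1" using e by auto
    have ee: "e \<bullet> e = 1" using ne by (simp add: norm_eq_1)
    define c where "c = ?q e"
    have bound: "?q y \<le> c * (y \<bullet> y)" if "y \<in> S" for y
    proof (cases "y = 0")
      case False
      have "y /\<^sub>R norm y \<in> ?K" using that False less.prems(1) by (auto intro: subspace_scale)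
      from max[OF this] have "?q y / (norm y)\<^sup>2 \<le> c"
        by (simp add: c_def power2_eq_square field_simps matrix_vector_mult_scaleR)
      then show ?thesis using False by (simp add: power2_norm_eq_inner divide_simps)
    qed simp
    \<comment> \<open>First-order condition at the maximum: along e + t y the form may not grow
      linearly in t, while the slack is only quadratic in t.\<close>
    have ortho: "y \<bullet> (A *v e) = 0" if y: "y \<in> S" "y \<bullet> e = 0" for y
    proof (rule ccontr)
      assume ne0: "y \<bullet> (A *v e) \<noteq> 0"
      define p where "p = y \<bullet> (A *v e)"
      define r where "r = c * (y \<bullet> y) - ?q y"
      have r: "r \<ge> 0" using bound[OF y(1)] by (simp add: r_def)
      have *: "2 * t * p \<le> t\<^sup>2 * r" for t
      proof -
        have "e + t *\<^sub>R y \<in> S" using eS y less.prems(1) by (auto intro: subspace_add subspace_scale)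
        from bound[OF this] have "?q (e + t *\<^sub>R y) \<le> c * ((e + t *\<^sub>R y) \<bullet> (e + t *\<^sub>R y))" .
        moreover have "e \<bullet> (A *v y) = p"
          using sym_dot[OF sym, of e y] by (simp add: p_def inner_commute)
        then have "?q (e + t *\<^sub>R y) = c + 2 * t * p + t\<^sup>2 * ?q y"
          by (simp add: matrix_vector_right_distrib matrix_vector_mult_scaleR inner_simps p_def c_def
            power2_eq_square algebra_simps)
        moreover have "(e + t *\<^sub>R y) \<bullet> (e + t *\<^sub>R y) = 1 + t\<^sup>2 * (y \<bullet> y)"
          using y(2) ee by (simp add: inner_simps power2_eq_square algebra_simps inner_commute)
        ultimately have "c + 2 * t * p + t\<^sup>2 * ?q y \<le> c * (1 + t\<^sup>2 * (y \<bullet> y))" by (simp only:)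
        then show ?thesis by (simp add: r_def algebra_simps)
      qed
      \<comment> \<open>With r + 1 in place of r the denominator cannot vanish, and 2 t p - t^2 r
        becomes (r + 2) t^2, which is positive.\<close>
      define t where "t = p / (r + 1)"
      have p: "p = t * (r + 1)" using r by (simp add: t_def)
      have "t \<noteq> 0" using ne0 r by (simp add: t_def p_def)
      then have "0 < (r + 2) * t\<^sup>2" using r by (intro mult_pos_pos) auto
      also have "(r + 2) * t\<^sup>2 = 2 * t * p - t\<^sup>2 * r"
        by (simp add: p power2_eq_square algebra_simps)
      finally show False using *[of t] by simp
    qed
    \<comment> \<open>The defect A e - c e lies in S and is orthogonal to e, hence to A e by
      \<open>ortho\<close>, hence to itself.\<close>
    have Ae: "A *v e = c *\<^sub>R e"
    proof -
      let ?y = "A *v e - c *\<^sub>R e"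
      have "?y \<in> S" using eS less.prems by (auto intro: subspace_diff subspace_scale)
      moreover have ye: "?y \<bullet> e = 0"
        using ee by (simp add: inner_simps c_def inner_commute)
      ultimately have "?y \<bullet> (A *v e) = 0" by (rule ortho)
      then have "?y \<bullet> ?y = 0" using ye by (simp add: inner_diff_right)
      then show ?thesis by simp
    qed
    let ?S = "{y\<in>S. y \<bullet> e = 0}"
    have sub: "subspace ?S"
      using less.prems(1) by (auto simp: subspace_def inner_simps)
    have inv: "A *v y \<in> ?S" if "y \<in> ?S" for y
      using that less.prems(2) Ae by (auto simp: sym_dot[OF sym] )
    have "e \<notin> ?S" using ee by simp
    have "span ?S \<subset> span S"
      unfolding span_eq_iff[THEN iffD2, OF sub] span_eq_iff[THEN iffD2, OF less.prems(1)]
      using \<open>e \<notin> ?S\<close> eS by blast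
    then have "dim ?S < dim S" by (rule dim_psubset)
    from less.hyps[OF this sub inv] obtain B where
      B: "B \<subseteq> ?S" "pairwise orthogonal B" "\<And>x. x \<in> B \<Longrightarrow> norm x = 1"
      "\<And>x. x \<in> B \<Longrightarrow> \<exists>c. A *v x = c *\<^sub>R x" "span B = ?S" "card B = dim ?S" by metis
    have Sp: "span (insert e B) = S"
    proof
      show "span (insert e B) \<subseteq> S"
        using B(1) eS less.prems(1) by (intro span_minimal) auto
      show "S \<subseteq> span (insert e B)"
      proof
        fix y assume y: "y \<in> S"
        have "y - (y \<bullet> e) *\<^sub>R e \<in> ?S"
          using y eS less.prems(1) ee by (auto intro: subspace_diff subspace_scale simp: inner_simps)
        then have "y - (y \<bullet> e) *\<^sub>R e \<in> span B" using B(5) by simp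
        then show "y \<in> span (insert e B)" unfolding span_insert by blast
      qed
    qed
    have po: "pairwise orthogonal (insert e B)"
      using B(1,2) by (auto simp: pairwise_insert orthogonal_def inner_commute)
    have "0 \<notin> insert e B" using B(3) ne by force
    then have "independent (insert e B)"
      using po pairwise_orthogonal_independent by blast
    then have "card (insert e B) = dim S"
      using Sp by (metis dim_span_eq_card_independent)
    then show ?thesis
      using B po Sp ne Ae eS by (intro exI[of _ "insert e B"]) auto
  qed
qed

lemma spectral_basis:
  fixes A :: "real^'n^'n"
  assumes sym: "transpose A = A"
  obtains v :: "'n \<Rightarrow> real^'n" and c where
    "\<forall>j k. v j \<bullet> v k = (if j = k then 1 else 0)" "\<forall>j. A *v v j = c j *\<^sub>R v j"
proof -
  obtain B where B: "pairwise orthogonal B" "\<And>x. x \<in> B \<Longrightarrow> norm x = 1"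
    "\<And>x. x \<in> B \<Longrightarrow> \<exists>c. A *v x = c *\<^sub>R x" "card B = CARD('n)"
    using spectral_subspace[OF sym subspace_UNIV] by (auto simp: dim_UNIV)
  have "finite B" using B(4) by (metis card.infinite zero_less_card_finite less_irrefl)
  with B(4) obtain v where v: "bij_betw v (UNIV :: 'n set) B"
    by (metis finite_same_card_bij finite)
  then have vB: "v j \<in> B" for j by (auto simp: bij_betw_def)
  have "v j \<bullet> v k = (if j = k then 1 else 0)" for j k
  proof -
    have "v j \<noteq> v k" if "j \<noteq> k" using that v by (auto simp: bij_betw_def inj_on_def)
    then show ?thesis
      using B(1,2) vB[of j] vB[of k] by (auto simp: norm_eq_1 pairwise_def orthogonal_def)
  qed
  moreover have "\<forall>j. \<exists>c. A *v v j = c *\<^sub>R v j" using B(3) vB by blast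
  from choice[OF this] obtain c where "\<forall>j. A *v v j = c j *\<^sub>R v j" by blast
  ultimately show ?thesis by (intro that[of v c]) auto
qed

text \<open>Orthonormality says Q Q^T = 1 for the matrix Q with rows v j. For a square matrix this
  gives Q^T Q = 1 as well, which is completeness of the basis.\<close>

lemma orthonormal_expand:
  fixes v :: "'n::finite \<Rightarrow> real^'n"
  assumes on: "\<And>j k. v j \<bullet> v k = (if j = k then 1 else 0)"
  shows "(\<Sum>j\<in>UNIV. (v j \<bullet> x) *\<^sub>R v j) = x"
    and "(\<Sum>j\<in>UNIV. (v j \<bullet> x) * (v j \<bullet> y)) = x \<bullet> y"
proof -
  define Q :: "real^'n^'n" where "Q = (\<chi> i. v i)"
  have "Q ** transpose Q = mat 1"
    by (auto simp: Q_def matrix_matrix_mult_def transpose_def mat_def vec_eq_iff on[unfolded inner_vec_def, simplified])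
  then have QT: "transpose Q ** Q = mat 1"
    using matrix_left_right_inverse by blast
  have Qx: "Q *v x = (\<chi> j. v j \<bullet> x)" for x
    by (simp add: Q_def vec_eq_iff matrix_vector_mult_def inner_vec_def)
  have "transpose Q *v (Q *v x) = x" for x
    by (simp add: matrix_vector_mul_assoc QT)
  moreover have "transpose Q *v (Q *v x) = (\<Sum>j\<in>UNIV. (v j \<bullet> x) *\<^sub>R v j)" for x
    unfolding Qx by (simp add: Q_def vec_eq_iff matrix_vector_mult_def transpose_def mult.commute del: transpose_matrix_vector)
  ultimately show *: "(\<Sum>j\<in>UNIV. (v j \<bullet> x) *\<^sub>R v j) = x" by simp
  have "x \<bullet> y = (\<Sum>j\<in>UNIV. (v j \<bullet> x) *\<^sub>R v j) \<bullet> y" by (simp add: *)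
  then show "(\<Sum>j\<in>UNIV. (v j \<bullet> x) * (v j \<bullet> y)) = x \<bullet> y"
    by (simp add: inner_sum_left)
qed

lemma spectral_form:
  fixes A :: "real^'n^'n" and v :: "'n \<Rightarrow> real^'n"
  assumes on: "\<And>j k. v j \<bullet> v k = (if j = k then 1 else 0)" and ev: "\<And>j. A *v v j = c j *\<^sub>R v j"
  shows "x \<bullet> (A *v y) = (\<Sum>j\<in>UNIV. c j * (v j \<bullet> x) * (v j \<bullet> y))"
proof -
  have "A *v y = A *v (\<Sum>j\<in>UNIV. (v j \<bullet> y) *\<^sub>R v j)"
    by (simp add: orthonormal_expand(1)[of v, OF on])
  also have "\<dots> = (\<Sum>j\<in>UNIV. ((v j \<bullet> y) * c j) *\<^sub>R v j)"
    by (simp add: linear_sum[OF matrix_vector_mul_linear] matrix_vector_mult_scaleR ev mult.commute)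
  finally show ?thesis
    by (simp add: inner_sum_right) (intro sum.cong refl, simp add: inner_commute algebra_simps)
qed


text \<open>In an eigenbasis the form is a weighted sum of squares. The set of eigenvalues is the
  range of the finitely many weights, so \<open>Min\<close> and \<open>Max\<close> in the
  definitions of the extreme eigenvalues are taken over a finite nonempty set.\<close>

lemma rayleigh_bounds:
  fixes A :: "real^'n^'n"
  assumes sym: "transpose A = A"
  shows "min_eigenvalue A * (x \<bullet> x) \<le> x \<bullet> (A *v x)" "x \<bullet> (A *v x) \<le> max_eigenvalue A * (x \<bullet> x)"
proof -
  obtain v :: "'n \<Rightarrow> real^'n" and c where on': "\<forall>j k. v j \<bullet> v k = (if j = k then 1 else 0)"
    and ev': "\<forall>j. A *v v j = c j *\<^sub>R v j"
    by (rule spectral_basis[OF sym])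
  note on = on'[rule_format] and ev = ev'[rule_format]
  have "eigenvalues A = range c"
  proof
    show "range c \<subseteq> eigenvalues A"
    proof clarify
      fix j
      have "v j \<noteq> 0" using on[of j j] by auto
      then show "c j \<in> eigenvalues A" using ev by (auto simp: eigenvalues_def)
    qed
    show "eigenvalues A \<subseteq> range c"
    proof
      fix e assume "e \<in> eigenvalues A"
      then obtain y where y: "y \<noteq> 0" "A *v y = e *\<^sub>R y" by (auto simp: eigenvalues_def)
      obtain j where j: "v j \<bullet> y \<noteq> 0"
      proof (rule ccontr)
        assume "\<not> thesis"
        then have "\<And>j. v j \<bullet> y = 0" using that by blast
        then have "y = 0" using orthonormal_expand(1)[of v y, OF on] by simp
        then show False using y by simp
      qed
      have "e * (v j \<bullet> y) = c j * (v j \<bullet> y)"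
        using sym_dot[OF sym, of "v j" y] by (auto simp: ev y)
      then have "e = c j" using j by (metis mult_right_cancel)
      then show "e \<in> range c" by simp
    qed
  qed
  then have c: "min_eigenvalue A \<le> c j" "c j \<le> max_eigenvalue A" for j
    by (auto simp: min_eigenvalue_def max_eigenvalue_def)
  have q: "x \<bullet> (A *v x) = (\<Sum>j\<in>UNIV. c j * (v j \<bullet> x)\<^sup>2)"
    using spectral_form[of v A c x x, OF on ev] by (simp add: power2_eq_square mult.assoc)
  have n: "x \<bullet> x = (\<Sum>j\<in>UNIV. (v j \<bullet> x)\<^sup>2)"
    using orthonormal_expand(2)[of v x x, OF on] by (simp add: power2_eq_square)
  show "min_eigenvalue A * (x \<bullet> x) \<le> x \<bullet> (A *v x)" "x \<bullet> (A *v x) \<le> max_eigenvalue A * (x \<bullet> x)"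
    unfolding q n sum_distrib_left using c by (auto intro!: sum_mono mult_right_mono)
qed

lemma matrix_inv_cancel:
  fixes A :: "real^'n^'n"
  assumes "invertible A"
  shows "A *v (matrix_inv A *v x) = x" "matrix_inv A *v (A *v x) = x"
    "A ** matrix_inv A = mat 1" "matrix_inv A ** A = mat 1"
proof -
  have "A ** matrix_inv A = mat 1 \<and> matrix_inv A ** A = mat 1"
    unfolding matrix_inv_def using assms unfolding invertible_def by (rule someI_ex)
  then show "A ** matrix_inv A = mat 1" "matrix_inv A ** A = mat 1"
    "A *v (matrix_inv A *v x) = x" "matrix_inv A *v (A *v x) = x"
    by (simp_all add: matrix_vector_mul_assoc)
qed

lemma transpose_matrix_inv:
  fixes A :: "real^'n^'n"
  assumes "invertible A" "transpose A = A"
  shows "transpose (matrix_inv A) = matrix_inv A"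
proof -
  have "transpose (matrix_inv A) ** A = mat 1"
    using arg_cong[OF matrix_inv_cancel(3)[OF assms(1)], of transpose] assms(2)
    by (simp add: matrix_transpose_mul)
  then have "transpose (matrix_inv A) ** (A ** matrix_inv A) = matrix_inv A"
    by (simp add: matrix_mul_assoc)
  then show ?thesis by (simp add: matrix_inv_cancel(3)[OF assms(1)])
qed

lemma coercive_invertible:
  fixes A :: "real^'n^'n"
  assumes "0 < \<kappa>" "\<And>x. \<kappa> * (x \<bullet> x) \<le> x \<bullet> (A *v x)"
  shows "invertible A"
proof -
  have "x = 0" if "A *v x = 0" for x
  proof -
    have "x \<bullet> x \<le> 0" using assms(2)[of x] assms(1) that by (simp add: mult_le_0_iff)
    then show ?thesis using inner_ge_zero[of x] by (simp add: order_antisym_conv)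
  qed
  then show ?thesis
    using invertible_left_inverse matrix_left_invertible_ker by blast
qed

text \<open>For y the preimage of x, coercivity and Cauchy-Schwarz give \<kappa> |y|^2 \<le> y . A y
  = y . x \<le> |y| |x|; the other two bounds follow from this one.\<close>

lemma coercive_inverse_bounds:
  fixes A :: "real^'n^'n"
  assumes k: "0 < \<kappa>" "\<And>x. \<kappa> * (x \<bullet> x) \<le> x \<bullet> (A *v x)"
  shows "norm (matrix_inv A *v x) \<le> norm x / \<kappa>"
    and "x \<bullet> (matrix_inv A *v x) \<le> (x \<bullet> x) / \<kappa>"
    and "\<bar>matrix_inv A $ i $ j\<bar> \<le> 1 / \<kappa>"
proof -
  let ?K = "matrix_inv A"
  note inv = coercive_invertible[OF k]
  show 1: "norm (?K *v x) \<le> norm x / \<kappa>" for x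
  proof (cases "?K *v x = 0")
    case False
    have "\<kappa> * (norm (?K *v x))\<^sup>2 \<le> (?K *v x) \<bullet> (A *v (?K *v x))"
      using k(2) by (simp add: power2_norm_eq_inner)
    also have "\<dots> \<le> norm (?K *v x) * norm x"
      by (simp add: matrix_inv_cancel[OF inv] norm_cauchy_schwarz)
    finally have "\<kappa> * norm (?K *v x) \<le> norm x"
      using False by (simp add: power2_eq_square)
    then show ?thesis using k by (simp add: field_simps)
  qed (use k in simp)
  have "x \<bullet> (?K *v x) \<le> norm x * norm (?K *v x)" by (rule norm_cauchy_schwarz)
  also have "\<dots> \<le> norm x * (norm x / \<kappa>)" by (intro mult_left_mono 1) simp
  finally show "x \<bullet> (?K *v x) \<le> (x \<bullet> x) / \<kappa>" by (simp add: power2_norm_eq_inner power2_eq_square flip: power2_norm_eq_inner)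
  have "\<bar>?K $ i $ j\<bar> = \<bar>(?K *v axis j 1) $ i\<bar>" by (simp add: matrix_vector_mult_basis column_def)
  also have "\<dots> \<le> norm (?K *v axis j 1)" by (rule component_le_norm_cart)
  also have "\<dots> \<le> 1 / \<kappa>" using 1[of "axis j 1"] by (simp add: norm_axis_1)
  finally show "\<bar>?K $ i $ j\<bar> \<le> 1 / \<kappa>" .
qed

text \<open>Expand the nonnegative number y . A y at y = A^-1 x - x / \<mu> and estimate the
  remaining x . A x from above.\<close>

lemma coercive_inverse_lower:
  fixes A :: "real^'n^'n"
  assumes k: "0 < \<kappa>" "\<And>x. \<kappa> * (x \<bullet> x) \<le> x \<bullet> (A *v x)"
    and sym: "transpose A = A" and u: "0 < \<mu>" "\<And>x. x \<bullet> (A *v x) \<le> \<mu> * (x \<bullet> x)"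
  shows "(x \<bullet> x) / \<mu> \<le> x \<bullet> (matrix_inv A *v x)"
proof -
  let ?K = "matrix_inv A"
  note inv = coercive_invertible[OF k]
  let ?y = "?K *v x - x /\<^sub>R \<mu>"
  have "0 \<le> \<kappa> * (?y \<bullet> ?y)" using k by simp
  also have "\<dots> \<le> ?y \<bullet> (A *v ?y)" by (rule k)
  also have "A *v ?y = x - (A *v x) /\<^sub>R \<mu>"
    by (simp add: matrix_vector_mult_diff_distrib matrix_inv_cancel[OF inv] matrix_vector_mult_scaleR)
  also have "?y \<bullet> (x - (A *v x) /\<^sub>R \<mu>) = x \<bullet> (?K *v x) - 2 * (x \<bullet> x) / \<mu> + (x \<bullet> (A *v x)) / \<mu>\<^sup>2"
  proof -
    have "(?K *v x) \<bullet> (A *v x) = x \<bullet> x"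
      using sym_dot[OF sym, of "?K *v x" x] by (simp add: matrix_inv_cancel[OF inv])
    then show ?thesis
      using u(1) by (simp add: inner_simps inner_commute power2_eq_square field_simps)
  qed
  also have "\<dots> \<le> x \<bullet> (?K *v x) - 2 * (x \<bullet> x) / \<mu> + (\<mu> * (x \<bullet> x)) / \<mu>\<^sup>2"
    using u by (intro add_left_mono divide_right_mono) auto
  finally show ?thesis using u(1) by (simp add: power2_eq_square field_simps)
qed

lemma sum_swap4:
  "(\<Sum>l\<in>A. \<Sum>m\<in>B. \<Sum>j\<in>C. \<Sum>k\<in>D. F l m j k) = (\<Sum>j\<in>C. \<Sum>k\<in>D. \<Sum>l\<in>A. \<Sum>m\<in>B. F l m j k)"
proof -
  have "(\<Sum>l\<in>A. \<Sum>m\<in>B. \<Sum>j\<in>C. \<Sum>k\<in>D. F l m j k) = (\<Sum>l\<in>A. \<Sum>j\<in>C. \<Sum>m\<in>B. \<Sum>k\<in>D. F l m j k)"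
    by (rule sum.cong[OF refl], rule sum.swap)
  also have "\<dots> = (\<Sum>j\<in>C. \<Sum>l\<in>A. \<Sum>k\<in>D. \<Sum>m\<in>B. F l m j k)"
    by (subst sum.swap, (rule sum.cong[OF refl])+, rule sum.swap)
  also have "\<dots> = (\<Sum>j\<in>C. \<Sum>k\<in>D. \<Sum>l\<in>A. \<Sum>m\<in>B. F l m j k)"
    by (rule sum.cong[OF refl], rule sum.swap)
  finally show ?thesis .
qed

text \<open>With K = sum of c_j v_j v_j^T, the form of the entrywise square at d is the sum of c_j
  c_k g_jk^2, where g_jk are the entries of diag(d) in the basis v. Their squares sum to |d|^2, and
  every product c_j c_k lies between \<kappa>^2 and \<mu>^2. Applied to \<open>Km\<close>, this
  keeps the \<lambda>-block of the covariance away from singularity.\<close>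

lemma hadamard_square_bounds:
  fixes K :: "real^'n^'n"
  assumes sym: "transpose K = K" and "0 \<le> \<kappa>"
    and lo: "\<And>x. \<kappa> * (x \<bullet> x) \<le> x \<bullet> (K *v x)" and up: "\<And>x. x \<bullet> (K *v x) \<le> \<mu> * (x \<bullet> x)"
  shows "\<kappa>\<^sup>2 * (\<Sum>l\<in>UNIV. (d l)\<^sup>2) \<le> (\<Sum>l\<in>UNIV. \<Sum>m\<in>UNIV. d l * d m * (K $ l $ m)\<^sup>2)"
    and "(\<Sum>l\<in>UNIV. \<Sum>m\<in>UNIV. d l * d m * (K $ l $ m)\<^sup>2) \<le> \<mu>\<^sup>2 * (\<Sum>l\<in>UNIV. (d l)\<^sup>2)"
proof -
  obtain v :: "'n \<Rightarrow> real^'n" and c where on': "\<forall>j k. v j \<bullet> v k = (if j = k then 1 else 0)"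
    and ev': "\<forall>j. K *v v j = c j *\<^sub>R v j"
    by (rule spectral_basis[OF sym])
  note on = on'[rule_format] and ev = ev'[rule_format]
  have c: "\<kappa> \<le> c j" "c j \<le> \<mu>" for j
    using lo[of "v j"] up[of "v j"] on by (auto simp: ev)
  have K: "K $ l $ m = (\<Sum>j\<in>UNIV. c j * v j $ l * v j $ m)" for l m
    using spectral_form[of v K c "axis l 1" "axis m 1", OF on ev]
    by (simp add: matrix_vector_mult_basis column_def inner_axis' inner_axis)
  define g where "g j k = (\<Sum>l\<in>UNIV. d l * v j $ l * v k $ l)" for j k
  have "(\<Sum>l\<in>UNIV. \<Sum>m\<in>UNIV. d l * d m * (K $ l $ m)\<^sup>2)
    = (\<Sum>l\<in>UNIV. \<Sum>m\<in>UNIV. \<Sum>j\<in>UNIV. \<Sum>k\<in>UNIV. c j * c k * ((d l * v j $ l * v k $ l) * (d m * v j $ m * v k $ m)))"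
    by (simp add: K power2_eq_square sum_product sum_distrib_left mult_ac)
  also have "\<dots> = (\<Sum>j\<in>UNIV. \<Sum>k\<in>UNIV. \<Sum>l\<in>UNIV. \<Sum>m\<in>UNIV. c j * c k * ((d l * v j $ l * v k $ l) * (d m * v j $ m * v k $ m)))"
    by (rule sum_swap4)
  also have "\<dots> = (\<Sum>j\<in>UNIV. \<Sum>k\<in>UNIV. c j * c k * (g j k)\<^sup>2)"
    by (simp add: g_def sum_product power2_eq_square flip: sum_distrib_left)
  finally have eq: "(\<Sum>l\<in>UNIV. \<Sum>m\<in>UNIV. d l * d m * (K $ l $ m)\<^sup>2) = (\<Sum>j\<in>UNIV. \<Sum>k\<in>UNIV. c j * c k * (g j k)\<^sup>2)" .
  have "(\<Sum>k\<in>UNIV. (g j k)\<^sup>2) = (\<Sum>l\<in>UNIV. (d l * v j $ l)\<^sup>2)" for j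
    using orthonormal_expand(2)[of v "\<chi> l. d l * v j $ l" "\<chi> l. d l * v j $ l", OF on]
    by (simp add: g_def inner_vec_def power2_eq_square mult_ac)
  moreover have "(\<Sum>j\<in>UNIV. (v j $ l)\<^sup>2) = 1" for l
    using orthonormal_expand(2)[of v "axis l 1" "axis l 1", OF on]
    by (simp add: inner_axis power2_eq_square)
  ultimately have n: "(\<Sum>j\<in>UNIV. \<Sum>k\<in>UNIV. (g j k)\<^sup>2) = (\<Sum>l\<in>UNIV. (d l)\<^sup>2)"
    by (simp add: power_mult_distrib) (subst sum.swap, simp flip: sum_distrib_left)
  have "\<kappa>\<^sup>2 \<le> c j * c k \<and> c j * c k \<le> \<mu>\<^sup>2" for j k
    using c[of j] c[of k] \<open>0 \<le> \<kappa>\<close> by (auto simp: power2_eq_square intro!: mult_mono)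
  then show "\<kappa>\<^sup>2 * (\<Sum>l\<in>UNIV. (d l)\<^sup>2) \<le> (\<Sum>l\<in>UNIV. \<Sum>m\<in>UNIV. d l * d m * (K $ l $ m)\<^sup>2)"
    and "(\<Sum>l\<in>UNIV. \<Sum>m\<in>UNIV. d l * d m * (K $ l $ m)\<^sup>2) \<le> \<mu>\<^sup>2 * (\<Sum>l\<in>UNIV. (d l)\<^sup>2)"
    unfolding eq n[symmetric] sum_distrib_left by (auto intro!: sum_mono mult_right_mono)
qed

section \<open>Calculus of matrix inverses\<close>

text \<open>Turns continuity of inversion into continuity of determinants, which are polynomials in
  the entries.\<close>

lemma matrix_inv_cramer:
  fixes A :: "real^'n^'n"
  assumes "invertible A"
  shows "matrix_inv A $ i $ j = det (\<chi> k l. if l = i then axis j 1 $ k else A $ k $ l) / det A"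
proof -
  have "det A \<noteq> 0" using assms invertible_det_nz by blast
  have "matrix_inv A *v axis j 1 = (\<chi> i. det (\<chi> k l. if l = i then axis j 1 $ k else A $ k $ l) / det A)"
    using cramer[OF \<open>det A \<noteq> 0\<close>, of "matrix_inv A *v axis j 1" "axis j 1"] matrix_inv_cancel[OF assms]
    by simp
  moreover have "(matrix_inv A *v axis j 1) $ i = matrix_inv A $ i $ j"
    by (simp add: matrix_vector_mult_basis column_def)
  ultimately show ?thesis by simp
qed

lemma tendsto_det:
  fixes A :: "'a \<Rightarrow> real^'n^'n"
  assumes "\<And>i j. ((\<lambda>t. A t $ i $ j) \<longlongrightarrow> B $ i $ j) F"
  shows "((\<lambda>t. det (A t)) \<longlongrightarrow> det B) F"
  unfolding det_def by (intro tendsto_intros assms)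

lemma tendsto_matrix_inv:
  fixes A :: "'a \<Rightarrow> real^'n^'n"
  assumes A: "\<And>i j. ((\<lambda>t. A t $ i $ j) \<longlongrightarrow> B $ i $ j) F" and inv: "invertible B"
  shows "((\<lambda>t. matrix_inv (A t) $ i $ j) \<longlongrightarrow> matrix_inv B $ i $ j) F"
    and "eventually (\<lambda>t. invertible (A t)) F"
proof -
  have nz: "det B \<noteq> 0" using inv invertible_det_nz by blast
  have "eventually (\<lambda>t. det (A t) \<noteq> 0) F"
    using tendsto_imp_eventually_ne[OF tendsto_det[of A B F, OF A] nz] .
  then show ev: "eventually (\<lambda>t. invertible (A t)) F"
    by eventually_elim (simp add: invertible_det_nz)
  have "((\<lambda>t. det (\<chi> k l. if l = i then axis j 1 $ k else A t $ k $ l) / det (A t)) \<longlongrightarrow>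
     det (\<chi> k l. if l = i then axis j 1 $ k else B $ k $ l) / det B) F"
    by (intro tendsto_divide tendsto_det A nz) (auto intro!: A)
  then show "((\<lambda>t. matrix_inv (A t) $ i $ j) \<longlongrightarrow> matrix_inv B $ i $ j) F"
    unfolding matrix_inv_cramer[OF inv]
    by (rule Lim_transform_eventually) (use ev in eventually_elim, simp add: matrix_inv_cramer)
qed

text \<open>Resolvent identity: the increment of the inverse is - K_s (A_s - A_t) K_t. After
  division by s - t only the convergence of K_s to K_t is needed.\<close>

lemma has_real_derivative_matrix_inv:
  fixes A :: "real \<Rightarrow> real^'n^'n"
  assumes A: "\<And>i j. ((\<lambda>t. A t $ i $ j) has_real_derivative A' $ i $ j) (at t)"
    and inv: "invertible (A t)"
  shows "((\<lambda>s. matrix_inv (A s) $ i $ j) has_real_derivative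
    - (matrix_inv (A t) ** A' ** matrix_inv (A t)) $ i $ j) (at t)"
proof -
  let ?K = "\<lambda>s. matrix_inv (A s)"
  have A0: "((\<lambda>s. A s $ i $ j) \<longlongrightarrow> A t $ i $ j) (at t)" for i j
    using DERIV_isCont[OF A] by (simp add: isCont_def)
  note K0 = tendsto_matrix_inv[of A "A t" "at t", OF A0 inv]
  have A1: "((\<lambda>s. ((A s $ i $ j - A t $ i $ j) / (s - t))) \<longlongrightarrow> A' $ i $ j) (at t)" for i j
    using A by (simp add: has_field_derivative_iff)
  have "((\<lambda>s. - (\<Sum>l\<in>UNIV. (\<Sum>k\<in>UNIV. ?K s $ i $ k * ((A s $ k $ l - A t $ k $ l) / (s - t))) * ?K t $ l $ j))
    \<longlongrightarrow> - (\<Sum>l\<in>UNIV. (\<Sum>k\<in>UNIV. ?K t $ i $ k * A' $ k $ l) * ?K t $ l $ j)) (at t)"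
    by (intro tendsto_intros K0 A1)
  also have "- (\<Sum>l\<in>UNIV. (\<Sum>k\<in>UNIV. ?K t $ i $ k * A' $ k $ l) * ?K t $ l $ j) = - (?K t ** A' ** ?K t) $ i $ j"
    by (simp add: matrix_matrix_mult_def)
  finally have "((\<lambda>s. (?K s $ i $ j - ?K t $ i $ j) / (s - t)) \<longlongrightarrow> - (?K t ** A' ** ?K t) $ i $ j) (at t)"
  proof (rule Lim_transform_eventually)
    show "\<forall>\<^sub>F s in at t. - (\<Sum>l\<in>UNIV. (\<Sum>k\<in>UNIV. ?K s $ i $ k * ((A s $ k $ l - A t $ k $ l) / (s - t))) * ?K t $ l $ j)
      = (?K s $ i $ j - ?K t $ i $ j) / (s - t)"
      using K0(2)
    proof eventually_elim
      fix s assume s: "invertible (A s)"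
      have "?K s ** (A s - A t) ** ?K t = ?K t - ?K s"
        unfolding matrix_eq
        by (simp add: matrix_vector_mult_diff_distrib matrix_vector_mult_diff_rdistrib matrix_inv_cancel[OF s]
          matrix_inv_cancel[OF inv] flip: matrix_vector_mul_assoc)
      then have "(?K s ** (A s - A t) ** ?K t) $ i $ j = ?K t $ i $ j - ?K s $ i $ j" by simp
      moreover have "(\<Sum>l\<in>UNIV. (\<Sum>k\<in>UNIV. ?K s $ i $ k * ((A s $ k $ l - A t $ k $ l) / (s - t))) * ?K t $ l $ j)
        = (?K s ** (A s - A t) ** ?K t) $ i $ j / (s - t)"
        by (simp add: matrix_matrix_mult_def sum_divide_distrib sum_distrib_right)
      ultimately show "- (\<Sum>l\<in>UNIV. (\<Sum>k\<in>UNIV. ?K s $ i $ k * ((A s $ k $ l - A t $ k $ l) / (s - t))) * ?K t $ l $ j)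
        = (?K s $ i $ j - ?K t $ i $ j) / (s - t)"
        by (simp only: minus_divide_left) simp
    qed
  qed
  then show ?thesis by (simp add: has_field_derivative_iff)
qed

section \<open>Gaussian product measures\<close>

abbreviation "std_normal \<equiv> density lborel (\<lambda>t. ennreal (std_normal_density t))"

text \<open>The standard normal moments of orders 0 to 4. The value 0 at even orders above four is a
  default and not a moment; only orders up to four are used.\<close>

definition normal_moment4 :: "nat \<Rightarrow> real" where
  "normal_moment4 k = (if k = 0 then 1 else if k = 2 then 1 else if k = 4 then 3 else 0)"

lemma std_normal_moments:
  assumes "k \<le> 4"
  shows "(\<integral>x. x ^ k \<partial>std_normal) = normal_moment4 k"
proof -
  have "k = 2 * 0 \<or> k = 2 * 0 + 1 \<or> k = 2 * 1 \<or> k = 2 * 1 + 1 \<or> k = 2 * 2" using assms by auto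
  then have "(\<integral>x. x ^ k \<partial>std_normal) = integral\<^sup>L lborel (\<lambda>x. std_normal_density x * x ^ k)"
    by (subst integral_density) auto
  also have "\<dots> = normal_moment4 k"
    using \<open>k = 2 * 0 \<or> _\<close> integral_std_normal_moment_even[of 0] integral_std_normal_moment_odd[of 0]
      integral_std_normal_moment_even[of 1] integral_std_normal_moment_odd[of 1] integral_std_normal_moment_even[of 2]
    by (auto simp: normal_moment4_def fact_numeral)
  finally show ?thesis .
qed

lemma prob_space_std_normal: "prob_space std_normal"
  by (rule prob_space_normal_density) simp

lemma product_prob_space_std_normal: "product_prob_space (\<lambda>_. std_normal)"
  by (intro product_prob_spaceI prob_space_std_normal)

lemma prob_space_PiM_std_normal: "prob_space (PiM I (\<lambda>_. std_normal))"
  by (intro prob_space_PiM prob_space_std_normal)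

type_synonym 'q noise = "('q \<Rightarrow> real) \<times> (nat \<Rightarrow> real)"

text \<open>Standardised random effects paired with standardised errors. The errors are indexed by a
  set and not a type, because their number changes from one observation to the next;
  \<open>coord\<close> merges both families into one index set.\<close>

definition noise :: "nat \<Rightarrow> 'q::finite noise measure" where
  "noise m = PiM UNIV (\<lambda>_. std_normal) \<Otimes>\<^sub>M PiM {..<m} (\<lambda>_. std_normal)"

definition coord :: "'q + nat \<Rightarrow> 'q noise \<Rightarrow> real" where
  "coord s \<omega> = (case s of Inl l \<Rightarrow> fst \<omega> l | Inr k \<Rightarrow> snd \<omega> k)"

lemma prob_space_noise: "prob_space (noise m)"
proof -
  interpret A: prob_space "PiM UNIV (\<lambda>_::'a. std_normal)" by (rule prob_space_PiM_std_normal)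
  interpret B: prob_space "PiM {..<m} (\<lambda>_. std_normal)" by (rule prob_space_PiM_std_normal)
  interpret pair_prob_space "PiM UNIV (\<lambda>_::'a. std_normal)" "PiM {..<m} (\<lambda>_. std_normal)" ..
  show ?thesis unfolding noise_def by (rule prob_space_axioms)
qed

lemma measurable_coord [measurable]:
  assumes "s \<in> UNIV <+> {..<m}"
  shows "coord s \<in> borel_measurable (noise m)"
proof (cases s)
  case (Inl l)
  have "(\<lambda>\<omega>. fst \<omega> l) \<in> borel_measurable (noise m)"
    unfolding noise_def by measurable
  then show ?thesis using Inl by (simp add: coord_def[abs_def])
next
  case (Inr k)
  then have [measurable]: "k \<in> {..<m}" using assms by auto
  have "(\<lambda>\<omega>. snd \<omega> k) \<in> borel_measurable (noise m)"
    unfolding noise_def by measurable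
  then show ?thesis using Inr by (simp add: coord_def[abs_def])
qed

lemma PiM_std_normal_prod:
  fixes c :: "'i \<Rightarrow> nat"
  assumes "finite I" "\<And>i. i \<in> I \<Longrightarrow> c i \<le> 4"
  shows "integrable (PiM I (\<lambda>_. std_normal)) (\<lambda>x. \<Prod>i\<in>I. x i ^ c i)"
    and "(\<integral>x. (\<Prod>i\<in>I. x i ^ c i) \<partial>PiM I (\<lambda>_. std_normal)) = (\<Prod>i\<in>I. normal_moment4 (c i))"
proof -
  interpret product_prob_space "\<lambda>_. std_normal" UNIV by (rule product_prob_space_std_normal)
  show "integrable (PiM I (\<lambda>_. std_normal)) (\<lambda>x. \<Prod>i\<in>I. x i ^ c i)"
    by (intro product_integrable_prod assms integrable_std_normal_distribution_moment)
  show "(\<integral>x. (\<Prod>i\<in>I. x i ^ c i) \<partial>PiM I (\<lambda>_. std_normal)) = (\<Prod>i\<in>I. normal_moment4 (c i))"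
    by (subst product_integral_prod)
      (auto intro!: assms integrable_std_normal_distribution_moment prod.cong std_normal_moments)
qed

lemma integrable_pair_product:
  fixes f :: "'a \<Rightarrow> real" and g :: "'b \<Rightarrow> real"
  assumes "sigma_finite_measure M" "sigma_finite_measure N"
    and f: "integrable M f" and g: "integrable N g"
  shows "integrable (M \<Otimes>\<^sub>M N) (\<lambda>\<omega>. f (fst \<omega>) * g (snd \<omega>))"
proof -
  interpret pair_sigma_finite M N using assms(1,2) by (simp add: pair_sigma_finite_def)
  have [measurable]: "f \<in> borel_measurable M" "g \<in> borel_measurable N" using f g by auto
  show ?thesis
    by (rule Fubini_integrable) (use f g in \<open>auto simp: abs_mult\<close>)
qed

lemma noise_prod_moment:
  fixes c :: "'q::finite + nat \<Rightarrow> nat" and m :: nat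
  assumes c: "\<And>s. c s \<le> 4"
  defines "I \<equiv> (UNIV :: 'q set) <+> {..<m}"
  shows "integrable (noise m) (\<lambda>\<omega>. \<Prod>s\<in>I. coord s \<omega> ^ c s)"
    and "(\<integral>\<omega>. (\<Prod>s\<in>I. coord s \<omega> ^ c s) \<partial>noise m) = (\<Prod>s\<in>I. normal_moment4 (c s))"
proof -
  let ?A = "PiM (UNIV :: 'q set) (\<lambda>_. std_normal)" and ?B = "PiM {..<m} (\<lambda>_. std_normal)"
  interpret A: prob_space ?A by (rule prob_space_PiM_std_normal)
  interpret B: prob_space ?B by (rule prob_space_PiM_std_normal)
  interpret P: pair_prob_space ?A ?B ..
  have split: "(\<Prod>s\<in>I. F s) = (\<Prod>l\<in>UNIV. F (Inl l)) * (\<Prod>k<m. F (Inr k))" for F :: "_ \<Rightarrow> real"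
    unfolding I_def Plus_def
    by (subst prod.union_disjoint) (auto simp: prod.reindex inj_on_def)
  note a = PiM_std_normal_prod[of UNIV "\<lambda>l. c (Inl l)"]
  note b = PiM_std_normal_prod[of "{..<m}" "\<lambda>l. c (Inr l)"]
  let ?f = "\<lambda>\<omega>. (\<Prod>l\<in>UNIV. fst \<omega> l ^ c (Inl l)) * (\<Prod>k<m. snd \<omega> k ^ c (Inr k))"
  have eq: "(\<lambda>\<omega>. \<Prod>s\<in>I. coord s \<omega> ^ c s) = ?f"
    by (simp add: split coord_def fun_eq_iff)
  have i: "integrable (?A \<Otimes>\<^sub>M ?B) ?f"
    using c by (intro integrable_pair_product a b A.sigma_finite_measure_axioms B.sigma_finite_measure_axioms) auto
  then show "integrable (noise m) (\<lambda>\<omega>. \<Prod>s\<in>I. coord s \<omega> ^ c s)"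
    unfolding eq noise_def .
  have "(\<integral>\<omega>. ?f \<omega> \<partial>(?A \<Otimes>\<^sub>M ?B)) = (\<integral>x. (\<integral>y. ?f (x, y) \<partial>?B) \<partial>?A)"
    using P.integral_fst'[OF i] by simp
  also have "\<dots> = (\<Prod>l\<in>UNIV. normal_moment4 (c (Inl l))) * (\<Prod>k<m. normal_moment4 (c (Inr k)))"
    using a b c by simp
  finally show "(\<integral>\<omega>. (\<Prod>s\<in>I. coord s \<omega> ^ c s) \<partial>noise m) = (\<Prod>s\<in>I. normal_moment4 (c s))"
    unfolding eq noise_def split[of "\<lambda>s. normal_moment4 (c s)"] .
qed

text \<open>Isserlis' formula for independent standard coordinates. A product of up to four
  coordinates is written as a product over all coordinates with exponents counting the occurrences;
  the product measure then factorises, and what remains is a case distinction on coincidences among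
  the indices.\<close>

lemma coord_moments:
  fixes i j k l :: "'q::finite + nat" and m :: nat
  defines "I \<equiv> (UNIV :: 'q set) <+> {..<m}" and "\<delta> \<equiv> \<lambda>s t :: 'q + nat. if s = t then 1 else 0 :: real"
  assumes I: "i \<in> I" "j \<in> I" "k \<in> I" "l \<in> I"
  shows "integrable (noise m) (coord i)" "(\<integral>\<omega>. coord i \<omega> \<partial>noise m) = 0"
    "integrable (noise m) (\<lambda>\<omega>. coord i \<omega> * coord j \<omega>)"
    "(\<integral>\<omega>. coord i \<omega> * coord j \<omega> \<partial>noise m) = \<delta> i j"
    "integrable (noise m) (\<lambda>\<omega>. coord i \<omega> * coord j \<omega> * coord k \<omega>)"
    "(\<integral>\<omega>. coord i \<omega> * coord j \<omega> * coord k \<omega> \<partial>noise m) = 0"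
    "integrable (noise m) (\<lambda>\<omega>. coord i \<omega> * coord j \<omega> * coord k \<omega> * coord l \<omega>)"
    "(\<integral>\<omega>. coord i \<omega> * coord j \<omega> * coord k \<omega> * coord l \<omega> \<partial>noise m)
      = \<delta> i j * \<delta> k l + \<delta> i k * \<delta> j l + \<delta> i l * \<delta> j k"
proof -
  have fin: "finite I" by (simp add: I_def)
  have one: "coord t \<omega> = (\<Prod>s\<in>I. coord s \<omega> ^ of_bool (s = t))" if "t \<in> I" for t \<omega>
    using fin that by (simp add: prod.remove[of I t])
  \<comment> \<open>Coordinates of exponent zero contribute the factor 1, so the product over I
    shrinks to the indices that actually occur.\<close>
  have restr: "(\<Prod>s\<in>I. normal_moment4 (c s)) = (\<Prod>s\<in>S. normal_moment4 (c s))"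
    if "S \<subseteq> I" "\<And>s. s \<notin> S \<Longrightarrow> c s = 0" for S c
    using fin that by (intro prod.mono_neutral_right) (auto simp: normal_moment4_def)
  have e1: "coord i \<omega> = (\<Prod>s\<in>I. coord s \<omega> ^ of_bool (s = i))"
    and e2: "coord i \<omega> * coord j \<omega> = (\<Prod>s\<in>I. coord s \<omega> ^ (of_bool (s = i) + of_bool (s = j)))"
    and e3: "coord i \<omega> * coord j \<omega> * coord k \<omega>
      = (\<Prod>s\<in>I. coord s \<omega> ^ (of_bool (s = i) + of_bool (s = j) + of_bool (s = k)))"
    and e4: "coord i \<omega> * coord j \<omega> * coord k \<omega> * coord l \<omega>
      = (\<Prod>s\<in>I. coord s \<omega> ^ (of_bool (s = i) + of_bool (s = j) + of_bool (s = k) + of_bool (s = l)))"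
    for \<omega>
    using I by (simp_all only: power_add prod.distrib one)
  note m = noise_prod_moment[where 'q = 'q and m = m, folded I_def]
  show "integrable (noise m) (coord i)"
    using m(1)[of "\<lambda>s. of_bool (s = i)"] unfolding e1[symmetric] by simp
  show "(\<integral>\<omega>. coord i \<omega> \<partial>noise m) = 0"
    unfolding e1 using I by (subst m(2), simp, subst restr[of "{i}"]) (auto simp: normal_moment4_def)
  show "integrable (noise m) (\<lambda>\<omega>. coord i \<omega> * coord j \<omega>)"
    unfolding e2 by (rule m(1)) simp
  show "(\<integral>\<omega>. coord i \<omega> * coord j \<omega> \<partial>noise m) = \<delta> i j"
    unfolding e2 using I by (subst m(2), simp, subst restr[of "{i, j}"])
      (auto simp: normal_moment4_def \<delta>_def)
  show "integrable (noise m) (\<lambda>\<omega>. coord i \<omega> * coord j \<omega> * coord k \<omega>)"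
    unfolding e3 by (rule m(1)) simp
  show "(\<integral>\<omega>. coord i \<omega> * coord j \<omega> * coord k \<omega> \<partial>noise m) = 0"
    unfolding e3 using I
    by (subst m(2), simp, subst restr[of "{i, j, k}"], simp, simp,
        cases "i = j"; cases "i = k"; cases "j = k") (auto simp: normal_moment4_def)
  show "integrable (noise m) (\<lambda>\<omega>. coord i \<omega> * coord j \<omega> * coord k \<omega> * coord l \<omega>)"
    unfolding e4 by (rule m(1)) simp
  show "(\<integral>\<omega>. coord i \<omega> * coord j \<omega> * coord k \<omega> * coord l \<omega> \<partial>noise m)
      = \<delta> i j * \<delta> k l + \<delta> i k * \<delta> j l + \<delta> i l * \<delta> j k"
    unfolding e4 using I
    by (subst m(2), simp, subst restr[of "{i, j, k, l}"], simp, simp,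
        cases "i = j"; cases "i = k"; cases "i = l"; cases "j = k"; cases "j = l"; cases "k = l")
      (auto simp: normal_moment4_def \<delta>_def prod.insert_if)
qed

definition lin :: "nat \<Rightarrow> ('q::finite + nat \<Rightarrow> real) \<Rightarrow> 'q noise \<Rightarrow> real" where
  "lin m p \<omega> = (\<Sum>s\<in>UNIV <+> {..<m}. p s * coord s \<omega>)"

definition dotp :: "nat \<Rightarrow> ('q::finite + nat \<Rightarrow> real) \<Rightarrow> ('q + nat \<Rightarrow> real) \<Rightarrow> real" where
  "dotp m p p' = (\<Sum>s\<in>UNIV <+> {..<m}. p s * p' s)"

lemma measurable_lin [measurable]: "lin m p \<in> borel_measurable (noise m)"
  unfolding lin_def[abs_def] by measurable

text \<open>Wick's formula for linear forms, by multilinear expansion. The reduced score is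
  quadratic in the noise, so its covariance needs exactly the moments up to order four.\<close>

lemma lin_moments:
  shows "integrable (noise m) (lin m p)" "(\<integral>\<omega>. lin m p \<omega> \<partial>noise m) = 0"
    "integrable (noise m) (\<lambda>\<omega>. lin m p \<omega> * lin m p' \<omega>)"
    "(\<integral>\<omega>. lin m p \<omega> * lin m p' \<omega> \<partial>noise m) = dotp m p p'"
    "integrable (noise m) (\<lambda>\<omega>. lin m p \<omega> * lin m p' \<omega> * lin m q \<omega>)"
    "(\<integral>\<omega>. lin m p \<omega> * lin m p' \<omega> * lin m q \<omega> \<partial>noise m) = 0"
    "integrable (noise m) (\<lambda>\<omega>. lin m p \<omega> * lin m p' \<omega> * lin m q \<omega> * lin m q' \<omega>)"
    "(\<integral>\<omega>. lin m p \<omega> * lin m p' \<omega> * lin m q \<omega> * lin m q' \<omega> \<partial>noise m)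
      = dotp m p p' * dotp m q q' + dotp m p q * dotp m p' q' + dotp m p q' * dotp m p' q"
proof -
  let ?I = "(UNIV :: 'a set) <+> {..<m}"
  have fin: "finite ?I" by simp
  have e2: "lin m p \<omega> * lin m p' \<omega> = (\<Sum>i\<in>?I. \<Sum>j\<in>?I. p i * p' j * (coord i \<omega> * coord j \<omega>))" for \<omega>
    unfolding lin_def sum_product by (intro sum.cong refl) (simp add: mult_ac)
  have e3: "lin m p \<omega> * lin m p' \<omega> * lin m q \<omega>
      = (\<Sum>i\<in>?I. \<Sum>j\<in>?I. \<Sum>k\<in>?I. p i * p' j * q k * (coord i \<omega> * coord j \<omega> * coord k \<omega>))" for \<omega>
    unfolding e2 unfolding sum_distrib_right unfolding lin_def[of m q] sum_distrib_left by (intro sum.cong refl) (simp add: mult_ac)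
  have e4: "lin m p \<omega> * lin m p' \<omega> * lin m q \<omega> * lin m q' \<omega>
      = (\<Sum>i\<in>?I. \<Sum>j\<in>?I. \<Sum>k\<in>?I. \<Sum>l\<in>?I.
          p i * p' j * q k * q' l * (coord i \<omega> * coord j \<omega> * coord k \<omega> * coord l \<omega>))" for \<omega>
    unfolding e3 unfolding sum_distrib_right unfolding lin_def[of m q'] sum_distrib_left by (intro sum.cong refl) (simp add: mult_ac)
  note cm = coord_moments
  show "integrable (noise m) (lin m p)" "(\<integral>\<omega>. lin m p \<omega> \<partial>noise m) = 0"
    unfolding lin_def[abs_def] by (auto simp: cm intro!: sum.neutral)
  show "integrable (noise m) (\<lambda>\<omega>. lin m p \<omega> * lin m p' \<omega>)"
    unfolding e2 by (intro Bochner_Integration.integrable_sum integrable_mult_right cm) auto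
  show "(\<integral>\<omega>. lin m p \<omega> * lin m p' \<omega> \<partial>noise m) = dotp m p p'"
    unfolding e2 using fin
    by (simp add: cm dotp_def if_distrib[of "\<lambda>x. _ * x"] sum.delta cong: if_cong)
  show "integrable (noise m) (\<lambda>\<omega>. lin m p \<omega> * lin m p' \<omega> * lin m q \<omega>)"
    unfolding e3 by (intro Bochner_Integration.integrable_sum integrable_mult_right cm) auto
  show "(\<integral>\<omega>. lin m p \<omega> * lin m p' \<omega> * lin m q \<omega> \<partial>noise m) = 0"
    unfolding e3 by (simp add: cm)
  show "integrable (noise m) (\<lambda>\<omega>. lin m p \<omega> * lin m p' \<omega> * lin m q \<omega> * lin m q' \<omega>)"
    unfolding e4 by (intro Bochner_Integration.integrable_sum integrable_mult_right cm) auto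
  let ?d = "\<lambda>s t :: 'a + nat. if s = t then 1 else 0 :: real"
  have "(\<integral>\<omega>. lin m p \<omega> * lin m p' \<omega> * lin m q \<omega> * lin m q' \<omega> \<partial>noise m)
    = (\<Sum>i\<in>?I. \<Sum>j\<in>?I. \<Sum>k\<in>?I. \<Sum>l\<in>?I. p i * p' j * q k * q' l *
        (?d i j * ?d k l + ?d i k * ?d j l + ?d i l * ?d j k))"
    unfolding e4 by (simp add: cm)
  \<comment> \<open>One fourfold sum for each pairing of the four indices; within each, the
    Kronecker deltas separate it into a product of two values of \<open>dotp\<close>.\<close>
  also have "\<dots> = (\<Sum>i\<in>?I. \<Sum>j\<in>?I. \<Sum>k\<in>?I. \<Sum>l\<in>?I. (p i * p' j * ?d i j) * (q k * q' l * ?d k l))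
    + (\<Sum>i\<in>?I. \<Sum>j\<in>?I. \<Sum>k\<in>?I. \<Sum>l\<in>?I. (p i * q k * ?d i k) * (p' j * q' l * ?d j l))
    + (\<Sum>i\<in>?I. \<Sum>j\<in>?I. \<Sum>k\<in>?I. \<Sum>l\<in>?I. (p i * q' l * ?d i l) * (p' j * q k * ?d j k))"
    unfolding sum.distrib[symmetric] by (intro sum.cong refl) (auto simp: algebra_simps)
  also have "(\<Sum>i\<in>?I. \<Sum>j\<in>?I. \<Sum>k\<in>?I. \<Sum>l\<in>?I. (p i * p' j * ?d i j) * (q k * q' l * ?d k l)) = dotp m p p' * dotp m q q'"
    using fin by (simp add: dotp_def if_distrib[of "\<lambda>x. _ * x"] sum.delta flip: sum_distrib_left sum_distrib_right cong: if_cong)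
  also have "(\<Sum>i\<in>?I. \<Sum>j\<in>?I. \<Sum>k\<in>?I. \<Sum>l\<in>?I. (p i * q k * ?d i k) * (p' j * q' l * ?d j l)) = dotp m p q * dotp m p' q'"
    using fin by (simp add: dotp_def if_distrib[of "\<lambda>x. _ * x"] if_distrib[of "\<lambda>x. x * _"] sum.delta sum_product mult_ac cong: if_cong)
  also have "(\<Sum>i\<in>?I. \<Sum>j\<in>?I. \<Sum>k\<in>?I. \<Sum>l\<in>?I. (p i * q' l * ?d i l) * (p' j * q k * ?d j k))
    = (\<Sum>i\<in>?I. \<Sum>j\<in>?I. \<Sum>l\<in>?I. \<Sum>k\<in>?I. (p i * q' l * ?d i l) * (p' j * q k * ?d j k))"
    by (rule sum.cong[OF refl], rule sum.cong[OF refl], rule sum.swap)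
  also have "\<dots> = dotp m p q' * dotp m p' q"
    using fin by (simp add: dotp_def if_distrib[of "\<lambda>x. _ * x"] if_distrib[of "\<lambda>x. x * _"] sum.delta sum_product mult_ac cong: if_cong)
  finally show "(\<integral>\<omega>. lin m p \<omega> * lin m p' \<omega> * lin m q \<omega> * lin m q' \<omega> \<partial>noise m)
      = dotp m p p' * dotp m q q' + dotp m p q * dotp m p' q' + dotp m p q' * dotp m p' q" .
qed


text \<open>A product measure is determined on rectangles, where the product density integrates
  factor by factor.\<close>

lemma PiM_lborel_density:
  fixes d :: "'i \<Rightarrow> real \<Rightarrow> real"
  assumes fin: "finite I" and meas: "\<And>i. d i \<in> borel_measurable borel"
    and prob: "\<And>i. prob_space (density lborel (\<lambda>t. ennreal (d i t)))" and nn: "\<And>i t. 0 \<le> d i t"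
  shows "density (PiM I (\<lambda>_. lborel)) (\<lambda>y. ennreal (\<Prod>i\<in>I. d i (y i))) = PiM I (\<lambda>i. density lborel (\<lambda>t. ennreal (d i t)))"
proof -
  interpret D: product_prob_space "\<lambda>i. density lborel (\<lambda>t. ennreal (d i t))" UNIV
    by (intro product_prob_spaceI prob)
  interpret L: product_sigma_finite "\<lambda>_. lborel :: real measure"
    by (simp add: product_sigma_finite_def sigma_finite_lborel)
  note meas[measurable]
  show ?thesis
  proof (rule D.PiM_eqI[OF fin])
    show "sets (density (PiM I (\<lambda>_. lborel)) (\<lambda>y. ennreal (\<Prod>i\<in>I. d i (y i)))) = sets (PiM I (\<lambda>i. density lborel (\<lambda>t. ennreal (d i t))))"
      by (simp cong: sets_PiM_cong)
    fix A assume "\<And>i. i \<in> I \<Longrightarrow> A i \<in> sets (density lborel (\<lambda>t. ennreal (d i t)))"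
    then have A[measurable]: "\<And>i. i \<in> I \<Longrightarrow> A i \<in> sets borel" by simp
    have "emeasure (density (PiM I (\<lambda>_. lborel)) (\<lambda>y. ennreal (\<Prod>i\<in>I. d i (y i)))) (Pi\<^sub>E I A)
      = (\<integral>\<^sup>+y. ennreal (\<Prod>i\<in>I. d i (y i)) * indicator (Pi\<^sub>E I A) y \<partial>PiM I (\<lambda>_. lborel))"
      using fin by (subst emeasure_density) (auto intro!: sets_PiM_I_finite)
    also have "\<dots> = (\<integral>\<^sup>+y. (\<Prod>i\<in>I. ennreal (d i (y i)) * indicator (A i) (y i)) \<partial>PiM I (\<lambda>_. lborel))"
    proof (intro nn_integral_cong)
      fix y assume y: "y \<in> space (PiM I (\<lambda>_. lborel :: real measure))"
      have "indicator (Pi\<^sub>E I A) y = (\<Prod>i\<in>I. indicator (A i) (y i) :: ennreal)"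
      proof (cases "y \<in> Pi\<^sub>E I A")
        case False
        with y obtain i where "i \<in> I" "y i \<notin> A i" by (auto simp: space_PiM PiE_def)
        then show ?thesis using fin False by (auto intro!: bexI[of _ i] prod_zero)
      qed (auto simp: PiE_iff intro!: prod.neutral[symmetric])
      then show "ennreal (\<Prod>i\<in>I. d i (y i)) * indicator (Pi\<^sub>E I A) y = (\<Prod>i\<in>I. ennreal (d i (y i)) * indicator (A i) (y i))"
        by (simp add: prod.distrib prod_ennreal nn)
    qed
    also have "\<dots> = (\<Prod>i\<in>I. \<integral>\<^sup>+t. ennreal (d i t) * indicator (A i) t \<partial>lborel)"
      by (rule L.product_nn_integral_prod[OF fin]) measurable
    also have "\<dots> = (\<Prod>i\<in>I. emeasure (density lborel (\<lambda>t. ennreal (d i t))) (A i))"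
      by (intro prod.cong refl) (simp add: emeasure_density)
    finally show "emeasure (density (PiM I (\<lambda>_. lborel)) (\<lambda>y. ennreal (\<Prod>i\<in>I. d i (y i)))) (Pi\<^sub>E I A)
      = (\<Prod>i\<in>I. emeasure (density lborel (\<lambda>t. ennreal (d i t))) (A i))" .
  qed
qed

lemma normal_density_eq_distr:
  assumes "0 < \<sigma>"
  shows "density lborel (\<lambda>t. ennreal (normal_density \<mu> \<sigma> t)) = distr std_normal borel (\<lambda>x. \<mu> + \<sigma> * x)"
proof -
  interpret prob_space std_normal by (rule prob_space_std_normal)
  have "distributed std_normal lborel (\<lambda>x. x) std_normal_density"
    by (simp add: distributed_def distr_id2)
  then have "distributed std_normal lborel (\<lambda>x. \<mu> + \<sigma> * x) (normal_density \<mu> \<sigma>)"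
    using normal_density_affine[of "\<lambda>x. x" 0 1 \<sigma> \<mu>] assms by simp
  then show ?thesis
    by (simp add: distributed_def cong: distr_cong)
qed

text \<open>The substitution y_k = \<mu>_k + \<sigma> \<epsilon>_k. Moving parameters from the
  density into the integrand lets later moments be taken under one fixed noise measure.\<close>

lemma nn_integral_normal_product:
  fixes m :: nat
  assumes "0 < \<sigma>" and F[measurable]: "F \<in> borel_measurable (PiM {..<m} (\<lambda>_. lborel))"
  shows "(\<integral>\<^sup>+y. ennreal (\<Prod>k<m. normal_density (\<mu> k) \<sigma> (y k)) * F y \<partial>PiM {..<m} (\<lambda>_. lborel))
    = (\<integral>\<^sup>+\<epsilon>. F (\<lambda>k\<in>{..<m}. \<mu> k + \<sigma> * \<epsilon> k) \<partial>PiM {..<m} (\<lambda>_. std_normal))"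
proof -
  let ?N = "PiM {..<m} (\<lambda>_. std_normal)" and ?L = "PiM {..<m} (\<lambda>_. lborel :: real measure)"
  let ?T = "\<lambda>\<epsilon>. \<lambda>k\<in>{..<m}. \<mu> k + \<sigma> * \<epsilon> k"
  have pn: "prob_space (density lborel (\<lambda>t. ennreal (normal_density (\<mu> k) \<sigma> t)))" for k
    by (rule prob_space_normal_density[OF assms(1)])
  interpret D: product_prob_space "\<lambda>k. density lborel (\<lambda>t. ennreal (normal_density (\<mu> k) \<sigma> t))" UNIV
    by (intro product_prob_spaceI pn)
  interpret N: product_prob_space "\<lambda>_. std_normal" UNIV by (rule product_prob_space_std_normal)
  have T[measurable]: "?T \<in> measurable ?N ?L" by measurable
  have "distr ?N ?L ?T = PiM {..<m} (\<lambda>k. density lborel (\<lambda>t. ennreal (normal_density (\<mu> k) \<sigma> t)))"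
  proof (rule D.PiM_eqI)
    show "sets (distr ?N ?L ?T) = sets (PiM {..<m} (\<lambda>k. density lborel (\<lambda>t. ennreal (normal_density (\<mu> k) \<sigma> t))))"
      by (simp cong: sets_PiM_cong)
    fix A assume "\<And>i. i \<in> {..<m} \<Longrightarrow> A i \<in> sets (density lborel (\<lambda>t. ennreal (normal_density (\<mu> i) \<sigma> t)))"
    then have A[measurable]: "\<And>i. i \<in> {..<m} \<Longrightarrow> A i \<in> sets borel" by simp
    have "emeasure (distr ?N ?L ?T) (Pi\<^sub>E {..<m} A) = emeasure ?N (?T -` Pi\<^sub>E {..<m} A \<inter> space ?N)"
      by (subst emeasure_distr) (auto intro!: sets_PiM_I_finite)
    also have "?T -` Pi\<^sub>E {..<m} A \<inter> space ?N = Pi\<^sub>E {..<m} (\<lambda>k. (\<lambda>x. \<mu> k + \<sigma> * x) -` A k)"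
      by (auto simp: space_PiM PiE_iff)
    also have "emeasure ?N \<dots> = (\<Prod>k<m. emeasure std_normal ((\<lambda>x. \<mu> k + \<sigma> * x) -` A k))"
    proof (rule N.emeasure_PiM)
      fix k assume "k \<in> {..<m}"
      then have [measurable]: "A k \<in> sets borel" by (rule A)
      show "(\<lambda>x. \<mu> k + \<sigma> * x) -` A k \<in> sets std_normal"
        using measurable_sets[of "\<lambda>x. \<mu> k + \<sigma> * x" borel borel "A k"] by simp
    qed simp
    also have "\<dots> = (\<Prod>k<m. emeasure (density lborel (\<lambda>t. ennreal (normal_density (\<mu> k) \<sigma> t))) (A k))"
      unfolding normal_density_eq_distr[OF assms(1)] by (intro prod.cong refl) (simp add: emeasure_distr A)
    finally show "emeasure (distr ?N ?L ?T) (Pi\<^sub>E {..<m} A)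
      = (\<Prod>k<m. emeasure (density lborel (\<lambda>t. ennreal (normal_density (\<mu> k) \<sigma> t))) (A k))" .
  qed simp
  also have "\<dots> = density ?L (\<lambda>y. ennreal (\<Prod>k<m. normal_density (\<mu> k) \<sigma> (y k)))"
    by (rule PiM_lborel_density[symmetric]) (auto intro: pn)
  finally have "(\<integral>\<^sup>+y. F y \<partial>density ?L (\<lambda>y. ennreal (\<Prod>k<m. normal_density (\<mu> k) \<sigma> (y k)))) = (\<integral>\<^sup>+y. F y \<partial>distr ?N ?L ?T)"
    by simp
  then show ?thesis by (simp add: nn_integral_density nn_integral_distr)
qed

text \<open>Random effects are integrated over vectors in the model, but over functions in a product
  measure. Both versions of Lebesgue measure agree on boxes.\<close>

lemma lborel_vec_eq_distr: "(lborel :: (real^'n) measure) = distr (PiM UNIV (\<lambda>_. lborel)) borel (\<lambda>f. \<chi> l. f l)"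
proof (rule lborel_eqI)
  interpret L: product_sigma_finite "\<lambda>_::'n. lborel :: real measure"
    by (simp add: product_sigma_finite_def sigma_finite_lborel)
  have [measurable]: "(\<lambda>f. \<chi> l. f l :: real^'n) \<in> borel_measurable (PiM UNIV (\<lambda>_. lborel))"
    by (subst borel_measurable_euclidean_space) (auto simp: Basis_vec_def inner_axis)
  fix l u :: "real^'n" assume lu: "\<And>b. b \<in> Basis \<Longrightarrow> l \<bullet> b \<le> u \<bullet> b"
  have le: "l $ i \<le> u $ i" for i using lu[of "axis i 1"] by (auto simp: inner_axis Basis_vec_def)
  have "emeasure (distr (PiM UNIV (\<lambda>_. lborel)) borel (\<lambda>f. \<chi> l. f l)) (box l u)
    = emeasure (PiM UNIV (\<lambda>_. lborel)) (Pi\<^sub>E UNIV (\<lambda>i. {l $ i <..< u $ i}))"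
    by (subst emeasure_distr) (auto simp: mem_box_cart space_PiM PiE_iff intro!: arg_cong[where f="emeasure _"])
  also have "\<dots> = (\<Prod>i\<in>UNIV. emeasure lborel {l $ i <..< u $ i})"
    by (rule L.emeasure_PiM) auto
  also have "\<dots> = (\<Prod>i\<in>UNIV. ennreal ((u - l) $ i))"
    by (intro prod.cong refl) (simp add: le)
  also have "\<dots> = ennreal (\<Prod>b\<in>Basis. (u - l) \<bullet> b)"
    by (subst prod_ennreal) (simp_all add: le Basis_vec_def prod.UNION_disjoint axis_eq_axis inner_axis)
  finally show "emeasure (distr (PiM UNIV (\<lambda>_. lborel)) borel (\<lambda>f. \<chi> l. f l)) (box l u) = (\<Prod>b\<in>Basis. (u - l) \<bullet> b)" .
qed simp

lemma nn_integral_std_normal_vec: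
  fixes F :: "real^'n \<Rightarrow> ennreal"
  assumes F[measurable]: "F \<in> borel_measurable borel"
  shows "(\<integral>\<^sup>+w. ennreal (\<Prod>l\<in>UNIV. std_normal_density (w $ l)) * F w \<partial>lborel)
    = (\<integral>\<^sup>+v. F (\<chi> l. v l) \<partial>PiM UNIV (\<lambda>_. std_normal))"
proof -
  let ?L = "PiM (UNIV :: 'n set) (\<lambda>_. lborel :: real measure)"
  have m[measurable]: "(\<lambda>f. \<chi> l. f l :: real^'n) \<in> measurable ?L borel"
    by (subst borel_measurable_euclidean_space) (auto simp: Basis_vec_def inner_axis)
  have "(\<integral>\<^sup>+w. ennreal (\<Prod>l\<in>UNIV. std_normal_density (w $ l)) * F w \<partial>lborel)
    = (\<integral>\<^sup>+v. ennreal (\<Prod>l\<in>UNIV. std_normal_density (v l)) * F (\<chi> l. v l) \<partial>?L)"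
    by (subst lborel_vec_eq_distr, subst nn_integral_distr) auto
  also have "\<dots> = (\<integral>\<^sup>+v. F (\<chi> l. v l) \<partial>density ?L (\<lambda>v. ennreal (\<Prod>l\<in>UNIV. std_normal_density (v l))))"
    by (subst nn_integral_density) auto
  also have "density ?L (\<lambda>v. ennreal (\<Prod>l\<in>UNIV. std_normal_density (v l))) = PiM UNIV (\<lambda>_. std_normal)"
    by (rule PiM_lborel_density) (auto intro: prob_space_std_normal)
  finally show ?thesis .
qed

section \<open>Convergence in distribution through Laplace transforms\<close>

text \<open>
  Integer values of the Laplace variable suffice: they give the integrals of all polynomials in
  \<open>exp (- x)\<close>, which are uniformly dense in the continuous functions of \<open>exp (- x) \<in> {0..1}\<close>.
\<close>

lemma weak_conv_laplace:
  assumes mu: "\<And>n. real_distribution (\<mu> n)" and nu: "real_distribution \<nu>"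
    and pos: "\<And>n. AE x in \<mu> n. 0 \<le> x" "AE x in \<nu>. 0 \<le> x"
    and conv: "\<And>k::nat. (\<lambda>n. \<integral>x. exp (- (k * x)) \<partial>\<mu> n) \<longlonglongrightarrow> (\<integral>x. exp (- (k * x)) \<partial>\<nu>)"
  shows "weak_conv_m \<mu> \<nu>"
proof (rule integral_cts_step_conv_imp_weak_conv[OF mu nu])
  fix x y :: real assume xy: "x < y"
  \<comment> \<open>The step function read through u = exp (- t). The inverse - ln u is cut off at t
    = y + 1 so that h stays continuous at u = 0; beyond y the step function vanishes, so the cut
    changes nothing.\<close>
  define h where "h u = cts_step x y (- ln (max u (exp (- (y + 1)))))" for u
  have h: "h (exp (- t)) = cts_step x y t" for t
  proof (cases "t \<le> y + 1")
    case True
    then have "max (exp (- t)) (exp (- (y + 1))) = exp (- t)" by (simp add: max_def)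
    then show ?thesis by (simp add: h_def)
  next
    case False
    then have "max (exp (- t)) (exp (- (y + 1))) = exp (- (y + 1))" by (simp add: max_def)
    then have "h (exp (- t)) = cts_step x y (y + 1)" by (simp add: h_def add.commute)
    then show ?thesis using False xy by (simp add: cts_step_def)
  qed
  have ch: "continuous_on {0..1} h"
  proof -
    have "continuous_on UNIV (cts_step x y)"
      using cts_step_uniformly_continuous[OF xy] uniformly_continuous_imp_continuous by blast
    moreover have "continuous_on {0..1} (\<lambda>u. - ln (max u (exp (- (y + 1)))))"
      by (intro continuous_intros) (auto simp: max_def)
    ultimately show ?thesis
      unfolding h_def by (rule continuous_on_compose2) auto
  qed
  show "(\<lambda>n. integral\<^sup>L (\<mu> n) (cts_step x y)) \<longlonglongrightarrow> integral\<^sup>L \<nu> (cts_step x y)"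
  proof (rule LIMSEQ_I)
    fix e :: real assume e: "0 < e"
    obtain p where p: "real_polynomial_function p" "\<And>u. u \<in> {0..1} \<Longrightarrow> \<bar>h u - p u\<bar> < e / 3"
      using Stone_Weierstrass_real_polynomial_function[OF _ ch, of "e / 3"] e by (auto intro: compact_Icc)
    obtain a N where a: "p = (\<lambda>u. \<Sum>i\<le>N. a i * u ^ i)"
      using p(1) real_polynomial_function_iff_sum by metis
    have pe: "p (exp (- t)) = (\<Sum>i\<le>N. a i * exp (- (real i * t)))" for t
      by (simp add: a exp_of_nat_mult[symmetric])
    have ie: "integrable M (\<lambda>t. exp (- (real i * t)))" if "real_distribution M" "AE x in M. 0 \<le> x" for M i
    proof -
      interpret real_distribution M by fact
      show ?thesis
        by (rule integrable_const_bound[of _ 1]) (use that(2) in auto)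
    qed
    have ip: "integrable M (\<lambda>t. p (exp (- t)))" "(\<integral>t. p (exp (- t)) \<partial>M) = (\<Sum>i\<le>N. a i * (\<integral>t. exp (- (real i * t)) \<partial>M))"
      if "real_distribution M" "AE x in M. 0 \<le> x" for M
      unfolding pe using ie[OF that] by auto
    have close: "\<bar>integral\<^sup>L M (cts_step x y) - (\<integral>t. p (exp (- t)) \<partial>M)\<bar> \<le> e / 3"
      if M: "real_distribution M" "AE x in M. 0 \<le> x" for M
    proof -
      interpret real_distribution M by fact
      have "\<bar>integral\<^sup>L M (cts_step x y) - (\<integral>t. p (exp (- t)) \<partial>M)\<bar> = \<bar>\<integral>t. cts_step x y t - p (exp (- t)) \<partial>M\<bar>"
        by (simp add: Bochner_Integration.integral_diff integrable_cts_step[OF xy] ip[OF M])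
      also have "\<dots> \<le> (\<integral>t. \<bar>cts_step x y t - p (exp (- t))\<bar> \<partial>M)"
        by (rule integral_abs_bound)
      also have "\<dots> \<le> (\<integral>t. e / 3 \<partial>M)"
      proof (rule integral_mono_AE)
        show "integrable M (\<lambda>t. \<bar>cts_step x y t - p (exp (- t))\<bar>)"
          by (intro integrable_abs Bochner_Integration.integrable_diff integrable_cts_step[OF xy] ip[OF M])
        show "AE t in M. \<bar>cts_step x y t - p (exp (- t))\<bar> \<le> e / 3"
          using M(2) by eventually_elim (use p(2) in \<open>auto simp flip: h intro: less_imp_le\<close>)
      qed simp
      also have "\<dots> = e / 3" using prob_space by (simp del: space_eq_univ)
      finally show ?thesis .
    qed
    have "(\<lambda>n. \<integral>t. p (exp (- t)) \<partial>\<mu> n) \<longlonglongrightarrow> (\<integral>t. p (exp (- t)) \<partial>\<nu>)"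
      unfolding ip(2)[OF mu pos(1)] ip(2)[OF nu pos(2)] by (intro tendsto_intros conv)
    then obtain n0 where n0: "\<And>n. n \<ge> n0 \<Longrightarrow> norm ((\<integral>t. p (exp (- t)) \<partial>\<mu> n) - (\<integral>t. p (exp (- t)) \<partial>\<nu>)) < e / 3"
      using e LIMSEQ_D[of _ _ "e / 3"] by (metis zero_less_divide_iff zero_less_numeral)
    have "norm (integral\<^sup>L (\<mu> n) (cts_step x y) - integral\<^sup>L \<nu> (cts_step x y)) < e" if "n \<ge> n0" for n
      using n0[OF that] close[OF mu pos(1), of n] close[OF nu pos(2)] unfolding real_norm_def by linarith
    then show "\<exists>n0. \<forall>n\<ge>n0. norm (integral\<^sup>L (\<mu> n) (cts_step x y) - integral\<^sup>L \<nu> (cts_step x y)) < e" by blast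
  qed
qed

section \<open>The chi-square distribution\<close>

lemma measurable_sum_squares [measurable]:
  "(\<lambda>z. \<Sum>i<d. (z i)\<^sup>2 :: real) \<in> borel_measurable (PiM {..<d} (\<lambda>_. std_normal))"
  by measurable

lemma real_distribution_chi_square: "real_distribution (chi_square d)"
proof -
  interpret prob_space "PiM {..<d} (\<lambda>_. std_normal)" by (rule prob_space_PiM_std_normal)
  show ?thesis unfolding chi_square_def by (rule real_distribution_distr) measurable
qed

lemma AE_chi_square_nonneg: "AE x in chi_square d. 0 \<le> x"
  unfolding chi_square_def by (subst AE_distr_iff) (auto intro!: sum_nonneg AE_I2)

text \<open>Given all coordinates but the last, the sum of squares equals c for at most two values
  of the last one, a null set for the normal law; integrate over the others.\<close>

lemma chi_square_atomless:
  assumes "0 < d"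
  shows "measure (chi_square d) {c} = 0"
proof -
  obtain d' where d: "d = Suc d'" using assms gr0_conv_Suc by blast
  interpret product_prob_space "\<lambda>_. std_normal" UNIV by (rule product_prob_space_std_normal)
  let ?f = "\<lambda>z. indicator {c} (\<Sum>i<d. (z i)\<^sup>2 :: real) :: ennreal"
  have [measurable]: "?f \<in> borel_measurable (PiM {..<d} (\<lambda>_. std_normal))" by measurable
  have "emeasure (chi_square d) {c} = (\<integral>\<^sup>+x. indicator {c} x \<partial>chi_square d)"
    by (simp add: chi_square_def)
  also have "\<dots> = (\<integral>\<^sup>+z. ?f z \<partial>PiM {..<d} (\<lambda>_. std_normal))"
    unfolding chi_square_def by (subst nn_integral_distr) auto
  also have "\<dots> = (\<integral>\<^sup>+z. (\<integral>\<^sup>+t. ?f (z(d' := t)) \<partial>std_normal) \<partial>PiM {..<d'} (\<lambda>_. std_normal))"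
  proof -
    have "{..<d} = insert d' {..<d'}" using d by auto
    then show ?thesis
      using product_nn_integral_insert[of "{..<d'}" d' ?f] by simp
  qed
  also have "\<dots> = (\<integral>\<^sup>+z. 0 \<partial>PiM {..<d'} (\<lambda>_. std_normal))"
  proof (intro nn_integral_cong)
    fix z :: "nat \<Rightarrow> real"
    let ?S = "{t. (\<Sum>i<d'. (z i)\<^sup>2) + t\<^sup>2 = c}"
    have "?S \<subseteq> {sqrt (c - (\<Sum>i<d'. (z i)\<^sup>2)), - sqrt (c - (\<Sum>i<d'. (z i)\<^sup>2))}"
    proof
      fix t assume "t \<in> ?S"
      then have "t\<^sup>2 = c - (\<Sum>i<d'. (z i)\<^sup>2)" by simp
      then have "\<bar>t\<bar> = sqrt (c - (\<Sum>i<d'. (z i)\<^sup>2))" by (metis real_sqrt_abs)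
      then show "t \<in> {sqrt (c - (\<Sum>i<d'. (z i)\<^sup>2)), - sqrt (c - (\<Sum>i<d'. (z i)\<^sup>2))}" by (auto simp: abs_if split: if_splits)
    qed
    then have fin: "finite ?S" using finite_subset by blast
    have "?f (z(d' := t)) = indicator ?S t" for t
    proof -
      have "(\<Sum>i<d'. ((z(d' := t)) i)\<^sup>2) = (\<Sum>i<d'. (z i)\<^sup>2)" by (intro sum.cong) auto
      then show ?thesis by (auto simp: d indicator_def)
    qed
    then have "(\<integral>\<^sup>+t. ?f (z(d' := t)) \<partial>std_normal) = emeasure std_normal ?S"
      using fin by (simp add: finite_imp_closed borel_closed)
    also have "\<dots> = 0"
      using fin by (subst emeasure_density) (auto simp: finite_imp_closed borel_closed finite_imp_null_set_lborel
        nn_integral_0_iff_AE intro!: AE_I[of _ _ ?S] null_setsD1)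
    finally show "(\<integral>\<^sup>+t. ?f (z(d' := t)) \<partial>std_normal) = 0" .
  qed
  finally show ?thesis by (simp add: measure_def)
qed

text \<open>Without atoms the cdf is continuous. The intermediate value theorem provides a point of
  value p, and the closed set in the definition of \<open>quantile\<close> contains its
  infimum.\<close>

lemma cdf_quantile:
  assumes M: "real_distribution M" and at: "\<And>c. measure M {c} = 0" and p: "0 < p" "p < 1"
  shows "cdf M (quantile M p) = p"
proof -
  interpret real_distribution M by fact
  have c: "isCont (cdf M) x" for x by (simp add: isCont_cdf at)
  let ?S = "{x. p \<le> cdf M x}"
  have "eventually (\<lambda>x. cdf M x < p) at_bot" using order_tendstoD(2)[OF cdf_lim_at_bot p(1)] .
  then obtain l where l: "cdf M l < p" by (auto simp: eventually_at_bot_linorder)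
  have "eventually (\<lambda>x. p < cdf M x) at_top" using order_tendstoD(1)[OF cdf_lim_at_top_prob p(2)] .
  then obtain u where u: "p < cdf M u" by (auto simp: eventually_at_top_linorder)
  have "l \<le> u" using l u cdf_nondecreasing[of u l] by linarith
  then obtain x where x: "cdf M x = p"
    using IVT[of "cdf M" l p u] l u c by auto
  have bdd: "bdd_below ?S"
  proof (rule bdd_belowI[of _ l])
    fix y assume "y \<in> ?S"
    then show "l \<le> y" using l cdf_nondecreasing[of y l] by (metis (no_types, lifting) le_cases linorder_not_less mem_Collect_eq order_trans)
  qed
  have "closed ?S"
    by (intro closed_Collect_le continuous_intros) (simp add: continuous_on_eq_continuous_at c)
  then have "Inf ?S \<in> ?S" using closed_contains_Inf[of ?S] bdd x by auto
  moreover have "Inf ?S \<le> x" using bdd x by (intro cInf_lower) auto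
  then have "cdf M (Inf ?S) \<le> p" using cdf_nondecreasing x by metis
  ultimately show ?thesis by (simp add: quantile_def)
qed

section \<open>A central limit theorem for quadratic statistics\<close>

text \<open>
  Linearising the square by an independent Gaussian vector turns the Laplace transform into an
  average of characteristic functions.
\<close>

lemma (in prob_space) laplace_eq_char:
  fixes x :: "nat \<Rightarrow> 'a \<Rightarrow> real"
  assumes [measurable]: "\<And>j. x j \<in> borel_measurable M"
  shows "complex_of_real (\<integral>\<omega>. exp (- (k * (\<Sum>j<d. (x j \<omega>)\<^sup>2))) \<partial>M)
    = (\<integral>\<zeta>. (\<integral>\<omega>. iexp (\<Sum>j<d. sqrt (2 * real k) * \<zeta> j * x j \<omega>) \<partial>M) \<partial>PiM {..<d} (\<lambda>_. std_normal))"
proof -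
  let ?N = "PiM {..<d} (\<lambda>_. std_normal)"
  interpret N: prob_space ?N by (rule prob_space_PiM_std_normal)
  interpret P: pair_prob_space M ?N ..
  interpret S: prob_space std_normal by (rule prob_space_std_normal)
  interpret L: product_prob_space "\<lambda>_. std_normal" UNIV by (rule product_prob_space_std_normal)
  \<comment> \<open>The factor sqrt (2 k) is chosen so that the normal characteristic function exp
    (- t^2 / 2) at t = sqrt (2 k) x equals exp (- k x^2).\<close>
  have point: "complex_of_real (exp (- (k * (\<Sum>j<d. (x j \<omega>)\<^sup>2)))) = (\<integral>\<zeta>. iexp (\<Sum>j<d. sqrt (2 * real k) * \<zeta> j * x j \<omega>) \<partial>?N)" for \<omega>
  proof -
    have "(\<integral>\<zeta>. iexp (\<Sum>j<d. sqrt (2 * real k) * \<zeta> j * x j \<omega>) \<partial>?N) = (\<integral>\<zeta>. (\<Prod>j<d. iexp (sqrt (2 * real k) * x j \<omega> * \<zeta> j)) \<partial>?N)"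
      by (simp add: exp_sum sum_distrib_left mult_ac)
    also have "\<dots> = (\<Prod>j<d. \<integral>t. iexp (sqrt (2 * real k) * x j \<omega> * t) \<partial>std_normal)"
      by (rule L.product_integral_prod) (auto intro!: S.integrable_const_bound[of _ 1])
    also have "\<dots> = (\<Prod>j<d. char std_normal_distribution (sqrt (2 * real k) * x j \<omega>))"
      by (simp add: char_def)
    also have "\<dots> = (\<Prod>j<d. complex_of_real (exp (- (k * (x j \<omega>)\<^sup>2))))"
      by (simp add: char_std_normal_distribution power_mult_distrib)
    also have "\<dots> = complex_of_real (exp (- (k * (\<Sum>j<d. (x j \<omega>)\<^sup>2))))"
      by (simp add: exp_sum sum_distrib_left sum_negf[symmetric] del: sum_negf of_real_exp flip: of_real_prod)
    finally show ?thesis by simp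
  qed
  have "complex_of_real (\<integral>\<omega>. exp (- (k * (\<Sum>j<d. (x j \<omega>)\<^sup>2))) \<partial>M) = (\<integral>\<omega>. (\<integral>\<zeta>. iexp (\<Sum>j<d. sqrt (2 * real k) * \<zeta> j * x j \<omega>) \<partial>?N) \<partial>M)"
    unfolding point[symmetric] by (rule integral_complex_of_real[symmetric])
  also have "\<dots> = (\<integral>\<zeta>. (\<integral>\<omega>. iexp (\<Sum>j<d. sqrt (2 * real k) * \<zeta> j * x j \<omega>) \<partial>M) \<partial>?N)"
  proof (rule P.Fubini_integral[symmetric])
    show "integrable (M \<Otimes>\<^sub>M ?N) (\<lambda>(\<omega>, \<zeta>). iexp (\<Sum>j<d. sqrt (2 * real k) * \<zeta> j * x j \<omega>))"
    proof (rule P.integrable_const_bound[of _ 1])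
      show "(\<lambda>(\<omega>, \<zeta>). iexp (\<Sum>j<d. sqrt (2 * real k) * \<zeta> j * x j \<omega>)) \<in> borel_measurable (M \<Otimes>\<^sub>M ?N)"
        by measurable
    qed (auto simp: split_beta')
  qed
  finally show ?thesis .
qed

lemma exp_minus_approx:
  assumes "0 \<le> (x::real)"
  shows "\<bar>exp (- x) - (1 - x)\<bar> \<le> x\<^sup>2"
proof -
  have 1: "1 - x \<le> exp (- x)" using exp_ge_add_one_self[of "- x"] by simp
  have "exp (- x) \<le> inverse (1 + x)"
    unfolding exp_minus using assms by (intro le_imp_inverse_le exp_ge_add_one_self) auto
  also have "\<dots> \<le> 1 - x + x\<^sup>2"
  proof -
    have "1 \<le> (1 + x) * (1 - x + x\<^sup>2)" using assms by (simp add: algebra_simps power2_eq_square)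
    then show ?thesis using assms by (simp add: field_simps)
  qed
  finally show ?thesis using 1 by simp
qed

text \<open>Third-order Taylor estimate of the characteristic function at 1, with the remainder
  measured by a Lyapunov moment, followed by the replacement of 1 - v / 2 by exp (- v / 2), which
  costs at most v^2.\<close>

lemma (in prob_space) char_normal_approx:
  assumes [measurable]: "X \<in> borel_measurable M" and "integrable M X" "integrable M (\<lambda>x. (X x)\<^sup>2)"
    and 0: "expectation X = 0" and v: "expectation (\<lambda>x. (X x)\<^sup>2) = v" and "0 < \<eta>" "\<eta> \<le> 1"
    and B: "(\<integral>\<^sup>+x. ennreal (\<bar>X x\<bar> powr (2 + \<eta>)) \<partial>M) \<le> ennreal B" "0 \<le> B"
  shows "norm ((CLINT x|M. iexp (X x)) - complex_of_real (exp (- (v / 2)))) \<le> B + v\<^sup>2"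
proof -
  have v0: "0 \<le> v" unfolding v[symmetric] by simp
  have "norm (char (distr M borel X) 1 - (1 - 1\<^sup>2 * v / 2)) \<le> (1\<^sup>2 / 6) * expectation (\<lambda>x. min (6 * (X x)\<^sup>2) (\<bar>1\<bar> * \<bar>X x\<bar> ^ 3))"
    by (rule char_approx3') (use assms in auto)
  also have "\<dots> \<le> B"
  proof -
    \<comment> \<open>For |X| \<le> 1 the cubic term is the smaller one because 2 + \<eta> \<le> 3;
      otherwise the square is below the power 2 + \<eta>. The factor 6 cancels against the 1 / 6 of
      the Taylor estimate.\<close>
    have le: "min (6 * (X x)\<^sup>2) (\<bar>1\<bar> * \<bar>X x\<bar> ^ 3) \<le> 6 * (\<bar>X x\<bar> powr (2 + \<eta>))" for x
    proof (cases "\<bar>X x\<bar> \<le> 1")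
      case True
      show ?thesis
      proof (cases "X x = 0")
        case False
        have "\<bar>X x\<bar> ^ 3 = \<bar>X x\<bar> powr 3" using False by (simp add: powr_numeral)
        also have "\<dots> \<le> \<bar>X x\<bar> powr (2 + \<eta>)"
          using True False \<open>\<eta> \<le> 1\<close> by (intro powr_mono') auto
        finally have le: "\<bar>X x\<bar> ^ 3 \<le> \<bar>X x\<bar> powr (2 + \<eta>)" .
        have "min (6 * (X x)\<^sup>2) (\<bar>1\<bar> * \<bar>X x\<bar> ^ 3) \<le> \<bar>X x\<bar> ^ 3" by simp
        also have "\<dots> \<le> 6 * (\<bar>X x\<bar> powr (2 + \<eta>))"
          using le powr_ge_zero[of "\<bar>X x\<bar>" "2 + \<eta>"] by linarith
        finally show ?thesis .
      qed simp
    next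
      case False
      have "(X x)\<^sup>2 = \<bar>X x\<bar> powr 2" using False by (simp add: powr_numeral)
      also have "\<dots> \<le> \<bar>X x\<bar> powr (2 + \<eta>)" using False \<open>0 < \<eta>\<close> by (intro powr_mono) auto
      finally show ?thesis by simp
    qed
    have "ennreal (expectation (\<lambda>x. min (6 * (X x)\<^sup>2) (\<bar>1\<bar> * \<bar>X x\<bar> ^ 3))) = (\<integral>\<^sup>+x. ennreal (min (6 * (X x)\<^sup>2) (\<bar>1\<bar> * \<bar>X x\<bar> ^ 3)) \<partial>M)"
    proof (rule nn_integral_eq_integral[symmetric])
      show "integrable M (\<lambda>x. min (6 * (X x)\<^sup>2) (\<bar>1\<bar> * \<bar>X x\<bar> ^ 3))"
        by (rule Bochner_Integration.integrable_bound[of _ "\<lambda>x. 6 * (X x)\<^sup>2"]) (use assms(3) in \<open>auto simp: min_def\<close>)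
    qed auto
    also have "\<dots> \<le> (\<integral>\<^sup>+x. 6 * ennreal (\<bar>X x\<bar> powr (2 + \<eta>)) \<partial>M)"
      using le by (intro nn_integral_mono) (auto simp: ennreal_mult'[symmetric] ennreal_numeral[symmetric] simp del: ennreal_numeral intro!: ennreal_leI)
    also have "\<dots> = 6 * (\<integral>\<^sup>+x. ennreal (\<bar>X x\<bar> powr (2 + \<eta>)) \<partial>M)"
      by (rule nn_integral_cmult) measurable
    also have "\<dots> \<le> 6 * ennreal B" by (intro mult_left_mono B) simp
    also have "\<dots> = ennreal (6 * B)" using B(2) by (simp add: ennreal_mult' ennreal_numeral[symmetric] del: ennreal_numeral)
    finally show ?thesis using B(2) by simp
  qed
  finally have 1: "norm (char (distr M borel X) 1 - (1 - v / 2)) \<le> B" by simp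
  have "char (distr M borel X) 1 = (CLINT x|M. iexp (X x))"
    unfolding char_def by (subst integral_distr) auto
  with 1 have 1: "norm ((CLINT x|M. iexp (X x)) - (1 - v / 2)) \<le> B" by simp
  have "norm ((1 - complex_of_real v / 2) - complex_of_real (exp (- (v / 2)))) = \<bar>exp (- (v / 2)) - (1 - v / 2)\<bar>"
  proof -
    have "(1 - complex_of_real v / 2) - complex_of_real (exp (- (v / 2))) = complex_of_real (- (exp (- (v / 2)) - (1 - v / 2)))"
      by (simp del: of_real_exp)
    then show ?thesis by (simp only: norm_of_real abs_minus_cancel)
  qed
  also have "\<dots> \<le> (v / 2)\<^sup>2" by (rule exp_minus_approx) (use v0 in simp)
  also have "\<dots> \<le> v\<^sup>2" using v0 by (simp add: power2_eq_square)
  finally have 2: "norm ((1 - complex_of_real v / 2) - complex_of_real (exp (- (v / 2)))) \<le> v\<^sup>2" .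
  show ?thesis using norm_triangle_le_diff norm_diff_triangle_le[OF 1[simplified] 2] by simp
qed


lemma measurable_matrix_vector_mult [measurable]:
  fixes A :: "real^'n^'m"
  assumes "g \<in> borel_measurable M"
  shows "(\<lambda>x. A *v g x) \<in> borel_measurable M"
  by (rule measurable_compose[OF assms]) (intro borel_measurable_continuous_onI continuous_intros)

lemma inner_sum_matrix_mult:
  fixes V :: "'i \<Rightarrow> real^'n^'n"
  shows "w \<bullet> ((\<Sum>i\<in>A. V i) *v u) = (\<Sum>i\<in>A. w \<bullet> (V i *v u))"
  by (induction A rule: infinite_finite_induct) (simp_all add: matrix_vector_mult_add_rdistrib inner_add_right)

text \<open>F \<zeta> is the characteristic function of the sum S at a vector that depends linearly
  on \<zeta>. It factorises over the observations, and each factor is close to its Gaussian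
  counterpart. Since a is of order 1 / n, one factor contributes errors of orders 1 + \<eta> / 2 and
  2 in 1 / n, so that n of them still vanish. The estimate is pointwise in \<zeta>; |F| \<le> 1
  supplies domination.\<close>

lemma laplace_quadratic_approx:
  fixes M :: "nat \<Rightarrow> 'y measure" and U :: "nat \<Rightarrow> 'y \<Rightarrow> real^'d" and V :: "nat \<Rightarrow> real^'d^'d" and k n :: nat
  assumes prob: "\<And>i. prob_space (M i)" and meas: "\<And>i. U i \<in> borel_measurable (M i)"
    and int1: "\<And>i w. integrable (M i) (\<lambda>y. w \<bullet> U i y)" and mean: "\<And>i w. (\<integral>y. w \<bullet> U i y \<partial>M i) = 0"
    and int2: "\<And>i w. integrable (M i) (\<lambda>y. (w \<bullet> U i y)\<^sup>2)"
    and var: "\<And>i w. (\<integral>y. (w \<bullet> U i y)\<^sup>2 \<partial>M i) = w \<bullet> (V i *v w)"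
    and mom: "\<And>i w. (\<integral>\<^sup>+y. ennreal (\<bar>w \<bullet> U i y\<bar> powr (2 + \<eta>)) \<partial>M i) \<le> ennreal (B * norm w powr (2 + \<eta>))"
    and par: "0 \<le> B" "0 < \<eta>" "\<eta> \<le> 1" "0 < lo"
    and sym: "\<And>i. transpose (V i) = V i"
    and lo: "\<And>i w. lo * (w \<bullet> w) \<le> w \<bullet> (V i *v w)" and up: "\<And>i w. w \<bullet> (V i *v w) \<le> up * (w \<bullet> w)"
    and n: "1 \<le> n"
  defines "S \<equiv> \<lambda>y. \<Sum>i=1..n. U i (y i)"
  shows "\<exists>F. F \<in> borel_measurable (PiM {..<CARD('d)} (\<lambda>_. std_normal)) \<and>
    complex_of_real (\<integral>y. exp (- (k * (S y \<bullet> (matrix_inv (\<Sum>i=1..n. V i) *v S y)))) \<partial>PiM {1..n} M)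
      = (\<integral>\<zeta>. F \<zeta> \<partial>PiM {..<CARD('d)} (\<lambda>_. std_normal)) \<and>
    (\<forall>\<zeta> :: nat \<Rightarrow> real. norm (F \<zeta>) \<le> 1 \<and> (let a = 2 * real k * (\<Sum>j<CARD('d). (\<zeta> j)\<^sup>2) / (real n * lo) in
       norm (F \<zeta> - complex_of_real (exp (- (k * (\<Sum>j<CARD('d). (\<zeta> j)\<^sup>2)))))
         \<le> real n * (B * (a powr (1 + \<eta> / 2))) + real n * (up * a)\<^sup>2))"
proof -
  let ?P = "PiM {1..n} M" and ?D = "CARD('d)"
  let ?N = "PiM {..<?D} (\<lambda>_. std_normal)"
  note meas[measurable]
  interpret PP: product_prob_space M UNIV by (intro product_prob_spaceI prob)
  interpret P: prob_space ?P by (intro prob_space_PiM prob)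
  interpret N: prob_space ?N by (rule prob_space_PiM_std_normal)
  have [measurable]: "S \<in> borel_measurable ?P" unfolding S_def by measurable
  define Vn where "Vn = (\<Sum>i=1..n. V i)"
  have Vw: "w \<bullet> (Vn *v w) = (\<Sum>i=1..n. w \<bullet> (V i *v w))" for w
    unfolding Vn_def by (rule inner_sum_matrix_mult)
  have symn: "transpose Vn = Vn"
    using sym unfolding Vn_def by (simp add: vec_eq_iff transpose_def)
  define \<kappa> where "\<kappa> = real n * lo"
  have \<kappa>: "0 < \<kappa>" using n par(4) by (simp add: \<kappa>_def)
  have low: "\<kappa> * (w \<bullet> w) \<le> w \<bullet> (Vn *v w)" for w
  proof -
    have "\<kappa> * (w \<bullet> w) = (\<Sum>i=1..n. lo * (w \<bullet> w))" by (simp add: \<kappa>_def)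
    also have "\<dots> \<le> w \<bullet> (Vn *v w)" unfolding Vw by (intro sum_mono lo)
    finally show ?thesis .
  qed
  note inv = coercive_invertible[OF \<kappa> low]
  obtain v :: "'d \<Rightarrow> real^'d" and c where on': "\<forall>j k. v j \<bullet> v k = (if j = k then 1 else 0)"
    and ev': "\<forall>j. Vn *v v j = c j *\<^sub>R v j"
    by (rule spectral_basis[OF symn])
  note on = on'[rule_format] and ev = ev'[rule_format]
  have c: "0 < c j" for j
    using low[of "v j"] \<kappa> by (simp add: ev on)
  have evi: "matrix_inv Vn *v v j = (1 / c j) *\<^sub>R v j" for j
  proof -
    have "matrix_inv Vn *v (c j *\<^sub>R v j) = v j" by (simp add: matrix_inv_cancel[OF inv] flip: ev)
    then have "c j *\<^sub>R (matrix_inv Vn *v v j) = v j" by (simp add: matrix_vector_mult_scaleR)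
    then have "(1 / c j) *\<^sub>R (c j *\<^sub>R (matrix_inv Vn *v v j)) = (1 / c j) *\<^sub>R v j" by simp
    then show ?thesis using c[of j] by simp
  qed
  have "card {..<?D} = card (UNIV :: 'd set)" by simp
  \<comment> \<open>The chi-square law numbers its coordinates by {..<D}, the parameter by a type; b
    carries one indexing to the other.\<close>
  then obtain b where b: "bij_betw b {..<?D} (UNIV :: 'd set)"
    using finite_same_card_bij[of "{..<?D}" "UNIV :: 'd set"] by auto
  have reb: "(\<Sum>l\<in>UNIV. g l) = (\<Sum>j<?D. g (b j))" for g :: "'d \<Rightarrow> real"
    using sum.reindex_bij_betw[OF b, of g] by simp
  \<comment> \<open>Standardised principal components of S: in the eigenbasis of the total
    covariance the statistic is a plain sum of squares.\<close>
  define x where "x j y = v (b j) \<bullet> S y / sqrt (c (b j))" for j y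
  have [measurable]: "x j \<in> borel_measurable ?P" for j unfolding x_def by measurable
  have T: "S y \<bullet> (matrix_inv Vn *v S y) = (\<Sum>j<?D. (x j y)\<^sup>2)" for y
    using spectral_form[of v "matrix_inv Vn" "\<lambda>j. 1 / c j" "S y" "S y", OF on evi] c
    by (simp add: reb x_def power2_eq_square less_imp_le)
  \<comment> \<open>The direction whose inner product with S is the exponent in
    \<open>laplace_eq_char\<close>; in the total covariance its squared length is 2 k
    |\<zeta>|^2.\<close>
  define W where "W \<zeta> = (\<Sum>j<?D. (sqrt (2 * real k) * \<zeta> j / sqrt (c (b j))) *\<^sub>R v (b j))" for \<zeta>
  have WS: "(\<Sum>j<?D. sqrt (2 * real k) * \<zeta> j * x j y) = W \<zeta> \<bullet> S y" for \<zeta> y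
    by (simp add: W_def x_def inner_sum_left)
  have Wv: "v (b j) \<bullet> W \<zeta> = sqrt (2 * real k) * \<zeta> j / sqrt (c (b j))" if "j < ?D" for j \<zeta>
  proof -
    have "(v (b j) \<bullet> v (b i)) = (if i = j then 1 else 0)" if "i < ?D" for i
      using b \<open>j < ?D\<close> that on by (auto simp: bij_betw_def inj_on_def)
    then have "v (b j) \<bullet> W \<zeta> = (\<Sum>i<?D. (sqrt (2 * real k) * \<zeta> i / sqrt (c (b i))) * (if i = j then 1 else 0))"
      unfolding W_def inner_sum_right by (intro sum.cong) auto
    also have "\<dots> = sqrt (2 * real k) * \<zeta> j / sqrt (c (b j))"
      using that by (simp add: if_distrib[of "\<lambda>x. _ * x"] sum.delta cong: if_cong)
    finally show ?thesis .
  qed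
  have WV: "W \<zeta> \<bullet> (Vn *v W \<zeta>) = 2 * real k * (\<Sum>j<?D. (\<zeta> j)\<^sup>2)" for \<zeta> :: "nat \<Rightarrow> real"
  proof -
    have "W \<zeta> \<bullet> (Vn *v W \<zeta>) = (\<Sum>j<?D. c (b j) * (v (b j) \<bullet> W \<zeta>)\<^sup>2)"
      using spectral_form[of v Vn c "W \<zeta>" "W \<zeta>", OF on ev] by (simp add: reb power2_eq_square mult.assoc)
    also have "\<dots> = (\<Sum>j<?D. 2 * real k * (\<zeta> j)\<^sup>2)"
      using c by (intro sum.cong refl) (simp add: Wv power_divide power_mult_distrib less_imp_le less_imp_neq[symmetric])
    finally show ?thesis by (simp add: sum_distrib_left)
  qed
  define F where "F \<zeta> = (\<integral>y. iexp (W \<zeta> \<bullet> S y) \<partial>?P)" for \<zeta>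
  have F_meas: "F \<in> borel_measurable ?N"
  proof -
    have "(\<lambda>(\<zeta>, y). iexp (\<Sum>j<?D. sqrt (2 * real k) * \<zeta> j * x j y)) \<in> borel_measurable (?N \<Otimes>\<^sub>M ?P)"
      by measurable
    then show ?thesis
      unfolding F_def WS[symmetric] by (rule P.borel_measurable_lebesgue_integral)
  qed
  have F_prod: "F \<zeta> = (\<Prod>i=1..n. \<integral>y. iexp (W \<zeta> \<bullet> U i y) \<partial>M i)" for \<zeta>
  proof -
    have "F \<zeta> = (\<integral>y. (\<Prod>i=1..n. iexp (W \<zeta> \<bullet> U i (y i))) \<partial>?P)"
      by (simp add: F_def S_def inner_sum_right exp_sum sum_distrib_left)
    also have "\<dots> = (\<Prod>i=1..n. \<integral>y. iexp (W \<zeta> \<bullet> U i y) \<partial>M i)"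
      by (rule PP.product_integral_prod) (auto intro!: PP.M.integrable_const_bound[of _ 1])
    finally show ?thesis .
  qed
  have char1: "norm (CLINT y|M i. iexp (w \<bullet> U i y)) \<le> 1" for i w
  proof -
    have "norm (CLINT y|M i. iexp (w \<bullet> U i y)) \<le> (\<integral>y. norm (iexp (w \<bullet> U i y)) \<partial>M i)"
      by (rule integral_norm_bound)
    then show ?thesis by (simp add: PP.M.prob_space)
  qed
  have F1: "norm (F \<zeta>) \<le> 1" for \<zeta>
    unfolding F_prod prod_norm[symmetric] by (intro prod_le_1) (simp add: char1)
  have F2: "norm (F \<zeta> - complex_of_real (exp (- (k * (\<Sum>j<?D. (\<zeta> j)\<^sup>2)))))
         \<le> real n * (B * (a powr (1 + \<eta> / 2))) + real n * (up * a)\<^sup>2"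
    if a: "a = 2 * real k * (\<Sum>j<?D. (\<zeta> j)\<^sup>2) / (real n * lo)" for \<zeta> :: "nat \<Rightarrow> real" and a
  proof -
    let ?w = "W \<zeta>"
    define u where "u i = ?w \<bullet> (V i *v ?w)" for i
    \<comment> \<open>The lower bound n lo on the total covariance turns the identity
      \<open>WV\<close> into a bound on the Euclidean length of W, of order 1 / n.\<close>
    have wa: "?w \<bullet> ?w \<le> a"
      using low[of ?w] \<kappa> unfolding WV a \<kappa>_def[symmetric] by (simp add: field_simps)
    have up0: "0 \<le> up" using lo[where i = 0 and w = "axis undefined 1"] up[where i = 0 and w = "axis undefined 1"] par(4)
      by (simp add: inner_axis_axis)
    have u: "0 \<le> u i" "u i \<le> up * a" for i
    proof -
      have "0 \<le> lo * (?w \<bullet> ?w)" using par(4) by simp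
      also have "\<dots> \<le> u i" unfolding u_def by (rule lo)
      finally show "0 \<le> u i" .
      have "u i \<le> up * (?w \<bullet> ?w)" unfolding u_def by (rule up)
      also have "\<dots> \<le> up * a" by (intro mult_left_mono wa up0)
      finally show "u i \<le> up * a" .
    qed
    have pw: "norm ?w powr (2 + \<eta>) \<le> a powr (1 + \<eta> / 2)"
    proof -
      have "norm ?w powr (2 + \<eta>) = (norm ?w powr 2) powr (1 + \<eta> / 2)"
        by (simp only: powr_powr) (simp add: algebra_simps)
      also have "\<dots> = (?w \<bullet> ?w) powr (1 + \<eta> / 2)"
        by (cases "?w = 0") (simp_all add: powr_numeral power2_norm_eq_inner)
      also have "\<dots> \<le> a powr (1 + \<eta> / 2)"
        using par by (intro powr_mono2 wa) auto
      finally show ?thesis .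
    qed
    have each: "norm ((CLINT y|M i. iexp (?w \<bullet> U i y)) - complex_of_real (exp (- (u i / 2)))) \<le> B * (a powr (1 + \<eta> / 2)) + (up * a)\<^sup>2" for i
    proof -
      have "norm ((CLINT y|M i. iexp (?w \<bullet> U i y)) - complex_of_real (exp (- (u i / 2)))) \<le> B * norm ?w powr (2 + \<eta>) + (u i)\<^sup>2"
        by (rule PP.M.char_normal_approx[OF _ int1 int2 mean _ par(2,3) mom])
          (use par in \<open>auto simp: var u_def\<close>)
      also have "\<dots> \<le> B * (a powr (1 + \<eta> / 2)) + (up * a)\<^sup>2"
        by (intro add_mono mult_left_mono pw par power_mono u)
      finally show ?thesis .
    qed
    have "(\<Sum>i=1..n. u i) = 2 * real k * (\<Sum>j<?D. (\<zeta> j)\<^sup>2)"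
      unfolding u_def Vw[symmetric] by (rule WV)
    then have "complex_of_real (exp (- (k * (\<Sum>j<?D. (\<zeta> j)\<^sup>2)))) = complex_of_real (exp (\<Sum>i=1..n. - (u i / 2)))"
      by (simp add: sum_negf sum_divide_distrib[symmetric] del: of_real_exp)
    also have "\<dots> = (\<Prod>i=1..n. complex_of_real (exp (- (u i / 2))))"
      by (simp add: exp_sum del: of_real_exp)
    \<comment> \<open>For factors in the unit disc, the difference of two products is at most the
      sum of the differences of the factors.\<close>
    finally have "norm (F \<zeta> - complex_of_real (exp (- (k * (\<Sum>j<?D. (\<zeta> j)\<^sup>2)))))
      \<le> (\<Sum>i=1..n. norm ((CLINT y|M i. iexp (?w \<bullet> U i y)) - complex_of_real (exp (- (u i / 2)))))"
      unfolding F_prod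
      by (simp only:) (intro norm_prod_diff char1, simp add: u del: of_real_exp)
    also have "\<dots> \<le> (\<Sum>i=1..n. B * (a powr (1 + \<eta> / 2)) + (up * a)\<^sup>2)"
      by (intro sum_mono each)
    finally show ?thesis by (simp add: distrib_left)
  qed
  have F_eq: "complex_of_real (\<integral>y. exp (- (k * (S y \<bullet> (matrix_inv Vn *v S y)))) \<partial>?P) = (\<integral>\<zeta>. F \<zeta> \<partial>?N)"
    unfolding T F_def WS[symmetric] by (rule P.laplace_eq_char) measurable
  show ?thesis
    unfolding Vn_def[symmetric] Let_def
    by (intro exI[of _ F] conjI allI F_meas F_eq F1 F2[OF refl])
qed

text \<open>A triangular array is needed because uniform coverage lets the parameter, and with it
  every law, score and covariance, move with n. The constants B, lo and up, common to all n and i,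
  replace identical distribution. Convergence at the quantile is legitimate because the limit law
  has no atoms.\<close>

theorem quadratic_clt:
  fixes M :: "nat \<Rightarrow> nat \<Rightarrow> 'y measure" and U :: "nat \<Rightarrow> nat \<Rightarrow> 'y \<Rightarrow> real^'d" and V :: "nat \<Rightarrow> nat \<Rightarrow> real^'d^'d"
  assumes prob: "\<And>n i. prob_space (M n i)" and meas: "\<And>n i. U n i \<in> borel_measurable (M n i)"
    and int1: "\<And>n i w. integrable (M n i) (\<lambda>y. w \<bullet> U n i y)" and mean: "\<And>n i w. (\<integral>y. w \<bullet> U n i y \<partial>M n i) = 0"
    and int2: "\<And>n i w. integrable (M n i) (\<lambda>y. (w \<bullet> U n i y)\<^sup>2)"
    and var: "\<And>n i w. (\<integral>y. (w \<bullet> U n i y)\<^sup>2 \<partial>M n i) = w \<bullet> (V n i *v w)"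
    and mom: "\<And>n i w. (\<integral>\<^sup>+y. ennreal (\<bar>w \<bullet> U n i y\<bar> powr (2 + \<eta>)) \<partial>M n i) \<le> ennreal (B * norm w powr (2 + \<eta>))"
    and par: "0 \<le> B" "0 < \<eta>" "\<eta> \<le> 1" "0 < lo"
    and sym: "\<And>n i. transpose (V n i) = V n i"
    and lo: "\<And>n i w. lo * (w \<bullet> w) \<le> w \<bullet> (V n i *v w)" and up: "\<And>n i w. w \<bullet> (V n i *v w) \<le> up * (w \<bullet> w)"
    and \<alpha>: "0 < \<alpha>" "\<alpha> < 1"
  defines "S \<equiv> \<lambda>n y. \<Sum>i=1..n. U n i (y i)"
  defines "T \<equiv> \<lambda>n y. S n y \<bullet> (matrix_inv (\<Sum>i=1..n. V n i) *v S n y)"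
  shows "(\<lambda>n. measure (PiM {1..n} (M n)) {y \<in> space (PiM {1..n} (M n)). T n y \<le> quantile (chi_square CARD('d)) (1 - \<alpha>)})
    \<longlonglongrightarrow> 1 - \<alpha>"
proof -
  let ?D = "CARD('d)"
  let ?N = "PiM {..<?D} (\<lambda>_. std_normal)"
  let ?q = "quantile (chi_square ?D) (1 - \<alpha>)"
  interpret N: prob_space ?N by (rule prob_space_PiM_std_normal)
  have P: "prob_space (PiM {1..n} (M n))" for n by (intro prob_space_PiM prob)
  note meas[measurable]
  have T_meas: "T n \<in> borel_measurable (PiM {1..n} (M n))" for n
    unfolding T_def S_def by measurable
  note T_meas[measurable]
  have max_meas: "(\<lambda>y. max 0 (T n y)) \<in> borel_measurable (PiM {1..n} (M n))" for n
    by (intro borel_measurable_max T_meas) simp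
  \<comment> \<open>For n \<ge> 1 the maximum changes nothing by \<open>Tpos\<close>; it makes
    nonnegativity of the support hold for every n without a case distinction.\<close>
  define \<mu> where "\<mu> n = distr (PiM {1..n} (M n)) borel (\<lambda>y. max 0 (T n y))" for n
  have dist: "real_distribution (\<mu> n)" for n
    unfolding \<mu>_def by (rule prob_space.real_distribution_distr[OF P max_meas])
  have Tpos: "0 \<le> T n y" if "1 \<le> n" for n y
  proof -
    let ?V = "\<Sum>i=1..n. V n i"
    have "lo * (w \<bullet> w) \<le> w \<bullet> (?V *v w)" for w
    proof -
      have "w \<bullet> (?V *v w) = (\<Sum>i=1..n. w \<bullet> (V n i *v w))"
        by (rule inner_sum_matrix_mult)
      moreover have "lo * (w \<bullet> w) \<le> w \<bullet> (V n i *v w)" for i by (rule lo)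
      moreover have "lo * (w \<bullet> w) \<le> (\<Sum>i=1..n. lo * (w \<bullet> w))"
        using mult_right_mono[of 1 "real n" "lo * (w \<bullet> w)"] that par(4) by simp
      ultimately show ?thesis
        by (metis (no_types, lifting) order_trans sum_mono)
    qed
    note inv = coercive_invertible[OF par(4) this] and lw = this
    let ?x = "matrix_inv ?V *v S n y"
    have "0 \<le> lo * (?x \<bullet> ?x)" using par(4) by simp
    also have "\<dots> \<le> ?x \<bullet> (?V *v ?x)" by (rule lw)
    finally show ?thesis unfolding T_def matrix_inv_cancel(1)[OF inv] by (simp only: inner_commute)
  qed
  have "weak_conv_m \<mu> (chi_square ?D)"
  proof (rule weak_conv_laplace[OF dist real_distribution_chi_square _ AE_chi_square_nonneg])
    show "AE x in \<mu> n. 0 \<le> x" for n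
      unfolding \<mu>_def by (subst AE_distr_iff[OF max_meas]) auto
    fix k :: nat
    define Q where "Q \<zeta> = (\<Sum>j<?D. (\<zeta> j :: real)\<^sup>2)" for \<zeta>
    have Q0: "0 \<le> Q \<zeta>" for \<zeta> by (simp add: Q_def sum_nonneg)
    have "\<forall>n. \<exists>F. 1 \<le> n \<longrightarrow> F \<in> borel_measurable ?N \<and>
      complex_of_real (\<integral>y. exp (- (k * T n y)) \<partial>PiM {1..n} (M n)) = (\<integral>\<zeta>. F \<zeta> \<partial>?N) \<and>
      (\<forall>\<zeta>. norm (F \<zeta>) \<le> 1 \<and> (let a = 2 * real k * Q \<zeta> / (real n * lo) in
         norm (F \<zeta> - complex_of_real (exp (- (k * Q \<zeta>))))
           \<le> real n * (B * (a powr (1 + \<eta> / 2))) + real n * (up * a)\<^sup>2))"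
    proof (rule allI, goal_cases)
      case (1 n)
      show ?case
      proof (cases "1 \<le> n")
        case True
        show ?thesis
          unfolding T_def S_def Q_def
          using laplace_quadratic_approx[where M = "M n" and U = "U n" and V = "V n" and k = k and n = n,
            OF prob meas int1 mean int2 var mom par sym lo up True]
          by (elim exE) (rule exI, rule impI, assumption)
      qed simp
    qed
    then obtain F where "\<forall>n. 1 \<le> n \<longrightarrow> F n \<in> borel_measurable ?N \<and>
      complex_of_real (\<integral>y. exp (- (k * T n y)) \<partial>PiM {1..n} (M n)) = (\<integral>\<zeta>. F n \<zeta> \<partial>?N) \<and>
      (\<forall>\<zeta>. norm (F n \<zeta>) \<le> 1 \<and> (let a = 2 * real k * Q \<zeta> / (real n * lo) in
         norm (F n \<zeta> - complex_of_real (exp (- (k * Q \<zeta>))))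
           \<le> real n * (B * (a powr (1 + \<eta> / 2))) + real n * (up * a)\<^sup>2))"
      by (elim choice[elim_format] exE)
    then have F: "F (Suc n) \<in> borel_measurable ?N"
      "complex_of_real (\<integral>y. exp (- (k * T (Suc n) y)) \<partial>PiM {1..Suc n} (M (Suc n))) = (\<integral>\<zeta>. F (Suc n) \<zeta> \<partial>?N)"
      "norm (F (Suc n) \<zeta>) \<le> 1"
      "norm (F (Suc n) \<zeta> - complex_of_real (exp (- (k * Q \<zeta>))))
           \<le> real (Suc n) * (B * ((2 * real k * Q \<zeta> / (real (Suc n) * lo)) powr (1 + \<eta> / 2))) + real (Suc n) * (up * (2 * real k * Q \<zeta> / (real (Suc n) * lo)))\<^sup>2"
      for n \<zeta> by (simp_all only: Let_def)
    \<comment> \<open>Dominated convergence in \<zeta> with bound 1. The error estimate is not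
      uniform in \<zeta>, but it need only vanish pointwise.\<close>
    have "(\<lambda>n. \<integral>\<zeta>. F (Suc n) \<zeta> \<partial>?N) \<longlonglongrightarrow> (\<integral>\<zeta>. complex_of_real (exp (- (k * Q \<zeta>))) \<partial>?N)"
    proof (rule integral_dominated_convergence[where w = "\<lambda>_. 1"])
      show "AE \<zeta> in ?N. (\<lambda>n. F (Suc n) \<zeta>) \<longlonglongrightarrow> complex_of_real (exp (- (k * Q \<zeta>)))"
      proof (rule AE_I2)
        fix \<zeta>
        define a where "a = 2 * real k * Q \<zeta> / lo"
        have a0: "0 \<le> a" using Q0 par by (simp add: a_def)
        \<comment> \<open>With the dependence on n extracted, the Lyapunov error n (a / n)^(1 +
          \<eta> / 2) becomes a multiple of n^(- \<eta> / 2).\<close>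
        have e1: "real (Suc n) * (B * ((2 * real k * Q \<zeta> / (real (Suc n) * lo)) powr (1 + \<eta> / 2)))
          = B * a powr (1 + \<eta> / 2) * (real (Suc n) powr (- (\<eta> / 2)))" for n
        proof -
          have "(2 * real k * Q \<zeta> / (real (Suc n) * lo)) = a / real (Suc n)" by (simp add: a_def)
          then have "(2 * real k * Q \<zeta> / (real (Suc n) * lo)) powr (1 + \<eta> / 2) = a powr (1 + \<eta> / 2) / (real (Suc n) powr (1 + \<eta> / 2))"
            using a0 by (simp add: powr_divide)
          moreover have "real (Suc n) / (real (Suc n) powr (1 + \<eta> / 2)) = real (Suc n) powr (- (\<eta> / 2))"
            unfolding powr_add powr_minus_divide by (simp del: of_nat_Suc)
          moreover have "N * (B * (A / s)) = B * A * (N / s)" for N A s :: real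
            by (simp add: divide_inverse mult_ac)
          ultimately show ?thesis by (simp only:)
        qed
        have e2: "real (Suc n) * (up * (2 * real k * Q \<zeta> / (real (Suc n) * lo)))\<^sup>2 = (up * a)\<^sup>2 / real (Suc n)" for n
        proof -
          have "N * (up * (b / (N * lo)))\<^sup>2 = (up * (b / lo))\<^sup>2 / N" for N b :: real
            by (cases "N = 0") (simp_all add: power2_eq_square mult_ac)
          then show ?thesis by (simp only: a_def)
        qed
        have "(\<lambda>n. real n powr (- (\<eta> / 2))) \<longlonglongrightarrow> 0"
          using par by (intro tendsto_neg_powr filterlim_real_sequentially) auto
        from LIMSEQ_Suc[OF this] have l1: "(\<lambda>n. real (Suc n) powr (- (\<eta> / 2))) \<longlonglongrightarrow> 0" .
        have "(\<lambda>n. B * a powr (1 + \<eta> / 2) * (real (Suc n) powr (- (\<eta> / 2))) + (up * a)\<^sup>2 * (1 / real (Suc n))) \<longlonglongrightarrow>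
          B * a powr (1 + \<eta> / 2) * 0 + (up * a)\<^sup>2 * 0"
          by (intro tendsto_intros l1 LIMSEQ_Suc[OF lim_1_over_n])
        then have l: "(\<lambda>n. B * a powr (1 + \<eta> / 2) * (real (Suc n) powr (- (\<eta> / 2))) + (up * a)\<^sup>2 / real (Suc n)) \<longlonglongrightarrow> 0"
          by simp
        have "(\<lambda>n. F (Suc n) \<zeta> - complex_of_real (exp (- (k * Q \<zeta>)))) \<longlonglongrightarrow> 0"
          by (rule Lim_null_comparison[OF _ l]) (use F(4)[of _ \<zeta>] in \<open>simp only: e1 e2 eventually_sequentially, blast\<close>)
        then show "(\<lambda>n. F (Suc n) \<zeta>) \<longlonglongrightarrow> complex_of_real (exp (- (k * Q \<zeta>)))"
          by (simp only: LIM_zero_iff)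
      qed
      show "(\<lambda>\<zeta>. complex_of_real (exp (- (k * Q \<zeta>)))) \<in> borel_measurable ?N"
        unfolding Q_def by measurable
    qed (use F in auto)
    then have "(\<lambda>n. complex_of_real (\<integral>y. exp (- (k * T (Suc n) y)) \<partial>PiM {1..Suc n} (M (Suc n)))) \<longlonglongrightarrow> complex_of_real (\<integral>\<zeta>. exp (- (k * Q \<zeta>)) \<partial>?N)"
      unfolding F(2)[symmetric] by (simp only: integral_complex_of_real)
    then have "(\<lambda>n. (\<integral>y. exp (- (k * T (Suc n) y)) \<partial>PiM {1..Suc n} (M (Suc n)))) \<longlonglongrightarrow> (\<integral>\<zeta>. exp (- (k * Q \<zeta>)) \<partial>?N)"
      by (simp only: tendsto_of_real_iff)
    moreover have "(\<integral>x. exp (- (k * x)) \<partial>\<mu> (Suc n)) = (\<integral>y. exp (- (k * T (Suc n) y)) \<partial>PiM {1..Suc n} (M (Suc n)))" for n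
      unfolding \<mu>_def using Tpos[of "Suc n"] by (subst integral_distr[OF max_meas]) auto
    moreover have "(\<integral>x. exp (- (k * x)) \<partial>chi_square ?D) = (\<integral>\<zeta>. exp (- (k * Q \<zeta>)) \<partial>?N)"
      unfolding chi_square_def Q_def by (subst integral_distr) auto
    ultimately have "(\<lambda>n. \<integral>x. exp (- (k * x)) \<partial>\<mu> (Suc n)) \<longlonglongrightarrow> (\<integral>x. exp (- (k * x)) \<partial>chi_square ?D)" by simp
    then show "(\<lambda>n. \<integral>x. exp (- (k * x)) \<partial>\<mu> n) \<longlonglongrightarrow> (\<integral>x. exp (- (k * x)) \<partial>chi_square ?D)"
      by (rule LIMSEQ_imp_Suc)
  qed
  moreover interpret C: real_distribution "chi_square ?D" by (rule real_distribution_chi_square)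
  have at: "measure (chi_square ?D) {c} = 0" for c by (rule chi_square_atomless) simp
  have "isCont (cdf (chi_square ?D)) ?q" by (simp add: C.isCont_cdf at)
  ultimately have "(\<lambda>n. cdf (\<mu> n) ?q) \<longlonglongrightarrow> cdf (chi_square ?D) ?q"
    by (simp add: weak_conv_m_def weak_conv_def)
  also have "cdf (chi_square ?D) ?q = 1 - \<alpha>"
    using \<alpha> by (intro cdf_quantile real_distribution_chi_square at) auto
  finally have lim: "(\<lambda>n. cdf (\<mu> n) ?q) \<longlonglongrightarrow> 1 - \<alpha>" .
  have "cdf (\<mu> n) ?q = measure (PiM {1..n} (M n)) {y \<in> space (PiM {1..n} (M n)). T n y \<le> ?q}" if "1 \<le> n" for n
    unfolding cdf_def \<mu>_def using Tpos[OF that]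
    by (subst measure_distr[OF max_meas]) (auto intro!: arg_cong[where f = "measure _"])
  then have "\<forall>\<^sub>F n in sequentially. cdf (\<mu> n) ?q = measure (PiM {1..n} (M n)) {y \<in> space (PiM {1..n} (M n)). T n y \<le> ?q}"
    by (auto simp: eventually_sequentially)
  with lim show ?thesis by (rule Lim_transform_eventually)
qed

section \<open>The Gaussian log-likelihood of one observation\<close>

text \<open>
  With \<open>u = y - x \<psi>\<close> and the least squares coefficients \<open>ols u\<close> of \<open>u\<close> on the design, the
  residual does not depend on the random effects and \<open>ols u\<close> has covariance \<open>Nm \<theta>\<close>. Hence
  \<open>B \<theta> u v\<close> is the bilinear form of the inverse covariance matrix of the response, written
  with matrices of the fixed size \<open>'q\<close> only.
\<close>

locale design =
  fixes m :: nat and z :: "nat \<Rightarrow> real^'q::finite" and a :: "'q \<Rightarrow> 'd1::finite" and \<sigma> M :: real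
  assumes sigma_pos: "0 < \<sigma>" and M_pos: "0 < M" and surj_a: "surj a"
    and gram_lower: "\<And>v. inverse M * (v \<bullet> v) \<le> v \<bullet> (gram m z *v v)"
    and gram_upper: "\<And>v. v \<bullet> (gram m z *v v) \<le> M * (v \<bullet> v)"
begin

definition "Gi = matrix_inv (gram m z)"

definition Nm :: "real^('d1 + 'd2::finite) \<Rightarrow> real^'q^'q" where
  "Nm \<theta> = (\<chi> l k. \<sigma>\<^sup>2 * Gi $ l $ k + (if l = k then (\<theta> $ Inl (a l))\<^sup>2 else 0))"

text \<open>With S = Z \<Lambda>^2 Z^T + \<sigma>^2 I the covariance of the response, this is Z^T
  S^-1 Z, obtained without a matrix whose size depends on the observation.\<close>

definition Km :: "real^('d1 + 'd2::finite) \<Rightarrow> real^'q^'q" where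
  "Km \<theta> = matrix_inv (Nm \<theta>)"

definition ip :: "(nat \<Rightarrow> real) \<Rightarrow> (nat \<Rightarrow> real) \<Rightarrow> real" where
  "ip u v = (\<Sum>k<m. u k * v k)"

definition ols :: "(nat \<Rightarrow> real) \<Rightarrow> real^'q" where
  "ols u = Gi *v (\<Sum>k<m. u k *\<^sub>R z k)"

definition B :: "real^('d1 + 'd2::finite) \<Rightarrow> (nat \<Rightarrow> real) \<Rightarrow> (nat \<Rightarrow> real) \<Rightarrow> real" where
  "B \<theta> u v = (ip u v - ols u \<bullet> (gram m z *v ols v)) / \<sigma>\<^sup>2 + ols u \<bullet> (Km \<theta> *v ols v)"

text \<open>In the same notation this is Z^T S^-1 u.\<close>

definition hh :: "real^('d1 + 'd2::finite) \<Rightarrow> (nat \<Rightarrow> real) \<Rightarrow> real^'q" where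
  "hh \<theta> u = Km \<theta> *v ols u"

definition res :: "real^('d1 + 'd2::finite) \<Rightarrow> (nat \<Rightarrow> real) \<Rightarrow> (nat \<Rightarrow> real^'d2) \<Rightarrow> nat \<Rightarrow> real" where
  "res \<theta> y x k = y k - x k \<bullet> lmm_psi \<theta>"

definition col :: "(nat \<Rightarrow> real^'d2::finite) \<Rightarrow> 'd2 \<Rightarrow> nat \<Rightarrow> real" where
  "col x b k = x k $ b"

text \<open>
  The reduced score: its \<open>\<lambda>\<close>-components are those of the score divided by \<open>\<lambda>\<close>, which extend to
  \<open>\<lambda> = 0\<close>.
\<close>

definition rscore :: "real^('d1 + 'd2::finite) \<Rightarrow> (nat \<Rightarrow> real) \<Rightarrow> (nat \<Rightarrow> real^'d2) \<Rightarrow> real^('d1 + 'd2)" where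
  "rscore \<theta> y x = (\<chi> c. case c of
      Inl j \<Rightarrow> (\<Sum>l\<in>{l. a l = j}. (hh \<theta> (res \<theta> y x) $ l)\<^sup>2 - Km \<theta> $ l $ l)
    | Inr b \<Rightarrow> B \<theta> (col x b) (res \<theta> y x))"

text \<open>The second derivatives of the log density by blocks, as \<open>score_deriv\<close>
  verifies. On the hyperplane \<lambda>_j = 0 the j-th diagonal entry reduces to the j-th component
  of \<open>rscore\<close>; this is what order two in the modified score picks up.\<close>

definition hess :: "real^('d1 + 'd2::finite) \<Rightarrow> (nat \<Rightarrow> real) \<Rightarrow> (nat \<Rightarrow> real^'d2) \<Rightarrow> 'd1 + 'd2 \<Rightarrow> 'd1 + 'd2 \<Rightarrow> real" where
  "hess \<theta> y x c c' = (let h = hh \<theta> (res \<theta> y x) in case (c, c') of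
      (Inl j, Inl k) \<Rightarrow> (if j = k then rscore \<theta> y x $ Inl j else 0) + \<theta> $ Inl j * \<theta> $ Inl k *
        (\<Sum>l\<in>{l. a l = j}. \<Sum>i\<in>{i. a i = k}. 2 * (Km \<theta> $ l $ i)\<^sup>2 - 4 * (h $ l * Km \<theta> $ l $ i * h $ i))
    | (Inl j, Inr b) \<Rightarrow> - (2 * \<theta> $ Inl j * (\<Sum>l\<in>{l. a l = j}. h $ l * hh \<theta> (col x b) $ l))
    | (Inr b, Inl j) \<Rightarrow> - (2 * \<theta> $ Inl j * (\<Sum>l\<in>{l. a l = j}. h $ l * hh \<theta> (col x b) $ l))
    | (Inr b, Inr b') \<Rightarrow> - B \<theta> (col x b) (col x b'))"

text \<open>The density depends on \<lambda> only through squares, so a derivative in \<lambda>_j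
  carries the factor \<lambda>_j; this records the factor, and 1 for the \<psi>-coordinates.\<close>

definition dscale :: "real^('d1 + 'd2::finite) \<Rightarrow> 'd1 + 'd2 \<Rightarrow> real" where
  "dscale \<theta> c = (case c of Inl j \<Rightarrow> \<theta> $ Inl j | Inr b \<Rightarrow> 1)"

section \<open>Bounds on the least squares quantities, their covariance and the form
  \<open>B\<close>\<close>

lemma M_ge_1: "1 \<le> M"
proof -
  have "inverse M \<le> M"
    using gram_lower[of "axis undefined 1"] gram_upper[of "axis undefined 1"] by (simp add: inner_axis_axis)
  then have "1 \<le> M * M" using M_pos by (simp add: field_simps)
  then show ?thesis using mult_strict_mono'[of M 1 M 1] M_pos by linarith
qed

lemma transpose_gram: "transpose (gram n x) = gram n x"
  by (simp add: vec_eq_iff transpose_def gram_def mult.commute)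

lemma gram_mult: "gram n x *v v = (\<Sum>k<n. (x k \<bullet> v) *\<^sub>R x k)"
  by (simp add: vec_eq_iff matrix_vector_mult_def gram_def inner_vec_def sum_distrib_right
      sum_distrib_left sum.swap[of _ UNIV] mult_ac)

lemma gram_inv: "invertible (gram m z)"
  using coercive_invertible[of "inverse M" "gram m z"] gram_lower M_pos by simp

lemma Gi_bounds:
  "inverse M * (v \<bullet> v) \<le> v \<bullet> (Gi *v v)" "v \<bullet> (Gi *v v) \<le> M * (v \<bullet> v)" "transpose Gi = Gi"
proof -
  have p: "0 < inverse M" using M_pos by simp
  show "inverse M * (v \<bullet> v) \<le> v \<bullet> (Gi *v v)"
    using coercive_inverse_lower[OF p gram_lower transpose_gram M_pos gram_upper, of v]
    by (simp add: Gi_def divide_inverse mult.commute)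
  show "v \<bullet> (Gi *v v) \<le> M * (v \<bullet> v)"
    using coercive_inverse_bounds(2)[OF p gram_lower, of v] by (simp add: Gi_def divide_inverse mult.commute)
  show "transpose Gi = Gi" unfolding Gi_def by (rule transpose_matrix_inv[OF gram_inv transpose_gram])
qed

lemma Nm_mult: "Nm \<theta> *v v = \<sigma>\<^sup>2 *\<^sub>R (Gi *v v) + (\<chi> l. (\<theta> $ Inl (a l))\<^sup>2 * v $ l)"
  by (simp add: vec_eq_iff matrix_vector_mult_def Nm_def distrib_right sum.distrib sum_distrib_left mult.assoc
      if_distrib[of "\<lambda>x. x * _"] sum.delta cong: if_cong)

lemma Nm_form: "v \<bullet> (Nm \<theta> *v w) = \<sigma>\<^sup>2 * (v \<bullet> (Gi *v w)) + (\<Sum>l\<in>UNIV. (\<theta> $ Inl (a l))\<^sup>2 * v $ l * w $ l)"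
  by (simp add: Nm_mult inner_add_right) (simp add: inner_vec_def mult_ac)

lemma transpose_Nm: "transpose (Nm \<theta>) = Nm \<theta>"
  using Gi_bounds(3) by (auto simp: vec_eq_iff transpose_def Nm_def)

text \<open>The reciprocal of a lower bound for \<open>Nm\<close> in which the random effects are
  dropped, hence free of \<theta>. The upper bound \<open>mu\<close> for \<open>Nm\<close> grows
  with \<theta>. Upper bounds on \<open>Km\<close> are therefore uniform in the parameter, lower
  bounds only locally uniform.\<close>

definition "kap = M / \<sigma>\<^sup>2"

lemma kap_pos: "0 < kap" using M_pos sigma_pos by (simp add: kap_def)

definition "mu \<theta> = \<sigma>\<^sup>2 * M + \<theta> \<bullet> \<theta>"

lemma mu_pos: "0 < mu \<theta>"
  using M_pos sigma_pos by (simp add: mu_def add_pos_nonneg)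

lemma Nm_bounds:
  "inverse kap * (v \<bullet> v) \<le> v \<bullet> (Nm \<theta> *v v)" "v \<bullet> (Nm \<theta> *v v) \<le> mu \<theta> * (v \<bullet> v)"
proof -
  have "inverse kap * (v \<bullet> v) = \<sigma>\<^sup>2 * (inverse M * (v \<bullet> v))" using M_pos sigma_pos by (simp add: kap_def divide_inverse)
  also have "\<dots> \<le> \<sigma>\<^sup>2 * (v \<bullet> (Gi *v v))" using Gi_bounds(1) by (intro mult_left_mono) auto
  also have "\<dots> \<le> v \<bullet> (Nm \<theta> *v v)"
    unfolding Nm_form by (simp add: sum_nonneg mult.assoc flip: power2_eq_square)
  finally show "inverse kap * (v \<bullet> v) \<le> v \<bullet> (Nm \<theta> *v v)" .
  have t: "(\<theta> $ i)\<^sup>2 \<le> \<theta> \<bullet> \<theta>" for i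
    using component_le_norm_cart[of \<theta> i] by (simp add: abs_le_square_iff[symmetric] flip: power2_norm_eq_inner)
  have "(\<Sum>l\<in>UNIV. (\<theta> $ Inl (a l))\<^sup>2 * v $ l * v $ l) \<le> (\<Sum>l\<in>UNIV. (\<theta> \<bullet> \<theta>) * (v $ l * v $ l))"
    unfolding mult.assoc by (intro sum_mono mult_right_mono t) simp
  also have "\<dots> = (\<theta> \<bullet> \<theta>) * (v \<bullet> v)" by (simp add: inner_vec_def[of v] sum_distrib_left)
  finally have "(\<Sum>l\<in>UNIV. (\<theta> $ Inl (a l))\<^sup>2 * v $ l * v $ l) \<le> (\<theta> \<bullet> \<theta>) * (v \<bullet> v)" .
  moreover have "\<sigma>\<^sup>2 * (v \<bullet> (Gi *v v)) \<le> \<sigma>\<^sup>2 * (M * (v \<bullet> v))" using Gi_bounds(2) by (intro mult_left_mono) auto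
  ultimately show "v \<bullet> (Nm \<theta> *v v) \<le> mu \<theta> * (v \<bullet> v)"
    unfolding Nm_form mu_def by (simp add: algebra_simps)
qed

lemma Nm_inv: "invertible (Nm \<theta>)"
  using coercive_invertible[OF _ Nm_bounds(1)] kap_pos by simp

lemma Km_sym: "transpose (Km \<theta>) = Km \<theta>"
  unfolding Km_def by (rule transpose_matrix_inv[OF Nm_inv transpose_Nm])

lemma Km_sym': "Km \<theta> $ l $ i = Km \<theta> $ i $ l"
  using arg_cong[OF Km_sym[of \<theta>], of "\<lambda>A. A $ i $ l"] by (simp add: transpose_def)

lemma Km_bounds:
  "(v \<bullet> v) / mu \<theta> \<le> v \<bullet> (Km \<theta> *v v)" "v \<bullet> (Km \<theta> *v v) \<le> kap * (v \<bullet> v)"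
  "norm (Km \<theta> *v v) \<le> kap * norm v" "\<bar>Km \<theta> $ l $ i\<bar> \<le> kap"
proof -
  have p: "0 < inverse kap" using kap_pos by simp
  show "(v \<bullet> v) / mu \<theta> \<le> v \<bullet> (Km \<theta> *v v)"
    unfolding Km_def by (rule coercive_inverse_lower[OF p Nm_bounds(1) transpose_Nm mu_pos Nm_bounds(2)])
  show "v \<bullet> (Km \<theta> *v v) \<le> kap * (v \<bullet> v)" "norm (Km \<theta> *v v) \<le> kap * norm v" "\<bar>Km \<theta> $ l $ i\<bar> \<le> kap"
    using coercive_inverse_bounds[OF p Nm_bounds(1)] unfolding Km_def by (simp_all add: divide_inverse mult.commute)
qed

lemma gram_ols: "gram m z *v ols u = (\<Sum>k<m. u k *\<^sub>R z k)"
  by (simp add: ols_def Gi_def matrix_inv_cancel[OF gram_inv])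

lemma ols_linear: "ols (\<lambda>k. u k + t * v k) = ols u + t *\<^sub>R ols v"
  by (simp add: ols_def scaleR_add_left sum.distrib matrix_vector_right_distrib
      scaleR_sum_right[symmetric] matrix_vector_mult_scaleR flip: scaleR_scaleR)

lemma ip_linear: "ip (\<lambda>k. u k + t * v k) w = ip u w + t * ip v w"
  by (simp add: ip_def sum.distrib sum_distrib_left algebra_simps)

lemma ip_commute: "ip u v = ip v u" by (simp add: ip_def mult.commute)

lemma B_commute: "B \<theta> u v = B \<theta> v u"
  using sym_dot[OF transpose_gram[of m z], of "ols u" "ols v"] sym_dot[OF Km_sym[of \<theta>], of "ols u" "ols v"]
  by (simp add: B_def ip_commute[of u] inner_commute)

lemma B_linear: "B \<theta> (\<lambda>k. u k + t * v k) w = B \<theta> u w + t * B \<theta> v w"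
  by (simp add: B_def ip_linear ols_linear inner_add_left diff_divide_distrib add_divide_distrib algebra_simps)

text \<open>The normal equations: both cross terms and the fitted term equal the same Gram form, so
  one of them survives with a minus sign.\<close>

lemma residual_ip: "(\<Sum>k<m. (u k - z k \<bullet> ols u) * (v k - z k \<bullet> ols v)) = ip u v - ols u \<bullet> (gram m z *v ols v)"
proof -
  have "(\<Sum>k<m. (u k - z k \<bullet> ols u) * (v k - z k \<bullet> ols v))
    = ip u v - (\<Sum>k<m. u k *\<^sub>R z k) \<bullet> ols v - (\<Sum>k<m. v k *\<^sub>R z k) \<bullet> ols u + (\<Sum>k<m. (z k \<bullet> ols u) * (z k \<bullet> ols v))"
    by (simp add: ip_def inner_sum_left sum_subtractf sum.distrib algebra_simps)
  also have "(\<Sum>k<m. (z k \<bullet> ols u) * (z k \<bullet> ols v)) = ols u \<bullet> (gram m z *v ols v)"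
    by (simp add: gram_mult inner_sum_right mult_ac inner_commute)
  also have "(\<Sum>k<m. u k *\<^sub>R z k) \<bullet> ols v = ols u \<bullet> (gram m z *v ols v)"
    using sym_dot[OF transpose_gram[of m z], of "ols u" "ols v"] by (simp add: gram_ols)
  also have "(\<Sum>k<m. v k *\<^sub>R z k) \<bullet> ols u = ols u \<bullet> (gram m z *v ols v)"
    by (simp add: gram_ols inner_commute)
  finally show ?thesis by simp
qed

definition "nrm u = L2_set u {..<m}"

lemma nrm_sq: "(nrm u)\<^sup>2 = ip u u"
  by (simp add: nrm_def ip_def L2_set_def sum_nonneg power2_eq_square flip: power2_eq_square)

lemma nrm_nonneg: "0 \<le> nrm u" by (simp add: nrm_def)

lemma ols_residual_bound: "ols u \<bullet> (gram m z *v ols u) \<le> ip u u"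
  and nrm_ols: "norm (ols u) \<le> M * nrm u"
proof -
  have "0 \<le> (\<Sum>k<m. (u k - z k \<bullet> ols u) * (u k - z k \<bullet> ols u))" by (intro sum_nonneg) simp
  then show 1: "ols u \<bullet> (gram m z *v ols u) \<le> ip u u" unfolding residual_ip by simp
  have "inverse M * (norm (ols u))\<^sup>2 \<le> (nrm u)\<^sup>2"
    using 1 gram_lower[of "ols u"] unfolding nrm_sq by (simp add: power2_norm_eq_inner)
  then have "(norm (ols u))\<^sup>2 \<le> M * (nrm u)\<^sup>2" using M_pos by (simp add: field_simps)
  also have "\<dots> \<le> M\<^sup>2 * (nrm u)\<^sup>2" using M_ge_1 by (intro mult_right_mono) (simp_all add: power2_eq_square)
  finally have "(norm (ols u))\<^sup>2 \<le> (M * nrm u)\<^sup>2" by (simp add: power_mult_distrib)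
  then show "norm (ols u) \<le> M * nrm u"
    by (rule power2_le_imp_le) (intro mult_nonneg_nonneg nrm_nonneg less_imp_le[OF M_pos])
qed

lemma hh_bound: "norm (hh \<theta> u) \<le> kap * M * nrm u" "\<bar>hh \<theta> u $ l\<bar> \<le> kap * M * nrm u"
proof -
  have "norm (hh \<theta> u) \<le> kap * norm (ols u)" unfolding hh_def by (rule Km_bounds)
  also have "\<dots> \<le> kap * (M * nrm u)" using kap_pos nrm_ols by (intro mult_left_mono) auto
  finally show 1: "norm (hh \<theta> u) \<le> kap * M * nrm u" by (simp add: mult.assoc)
  show "\<bar>hh \<theta> u $ l\<bar> \<le> kap * M * nrm u" using component_le_norm_cart 1 by (rule order_trans)
qed

definition "cB = 1 / \<sigma>\<^sup>2 + kap * M\<^sup>2"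

lemma cB_nonneg: "0 \<le> cB" using kap_pos by (simp add: cB_def)

text \<open>Cauchy-Schwarz separately for the residual part and the fitted part; residuals are not
  longer than the vectors they come from. The two parts give the two summands of
  \<open>cB\<close>.\<close>

lemma B_bound: "\<bar>B \<theta> u v\<bar> \<le> cB * (nrm u * nrm v)"
proof -
  have r: "L2_set (\<lambda>k. u k - z k \<bullet> ols u) {..<m} \<le> nrm u" for u
  proof -
    have "0 \<le> inverse M * (ols u \<bullet> ols u)" using M_pos by simp
    then have "(\<Sum>k<m. (u k - z k \<bullet> ols u)\<^sup>2) \<le> ip u u"
      using residual_ip[of u u] gram_lower[of "ols u"] unfolding power2_eq_square by linarith
    then show ?thesis by (simp add: nrm_def L2_set_def ip_def power2_eq_square)
  qed
  have "\<bar>\<Sum>k<m. (u k - z k \<bullet> ols u) * (v k - z k \<bullet> ols v)\<bar> \<le> (\<Sum>k<m. \<bar>u k - z k \<bullet> ols u\<bar> * \<bar>v k - z k \<bullet> ols v\<bar>)"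
    unfolding abs_mult[symmetric] by (rule sum_abs)
  also have "\<dots> \<le> L2_set (\<lambda>k. u k - z k \<bullet> ols u) {..<m} * L2_set (\<lambda>k. v k - z k \<bullet> ols v) {..<m}"
    by (rule L2_set_mult_ineq)
  also have "\<dots> \<le> nrm u * nrm v" by (intro mult_mono r) (simp_all add: nrm_nonneg)
  finally have 1: "\<bar>ip u v - ols u \<bullet> (gram m z *v ols v)\<bar> \<le> nrm u * nrm v" unfolding residual_ip .
  have "\<bar>ols u \<bullet> (Km \<theta> *v ols v)\<bar> \<le> norm (ols u) * norm (Km \<theta> *v ols v)" by (rule Cauchy_Schwarz_ineq2)
  also have "\<dots> \<le> (M * nrm u) * (kap * M * nrm v)"
    using hh_bound(1)[of \<theta> v] M_pos nrm_nonneg by (intro mult_mono nrm_ols) (auto simp: hh_def)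
  finally have 2: "\<bar>ols u \<bullet> (Km \<theta> *v ols v)\<bar> \<le> kap * M\<^sup>2 * (nrm u * nrm v)" by (simp add: power2_eq_square mult_ac)
  have 3: "\<bar>(ip u v - ols u \<bullet> (gram m z *v ols v)) / \<sigma>\<^sup>2\<bar> \<le> 1 / \<sigma>\<^sup>2 * (nrm u * nrm v)"
    using 1 by (simp add: abs_divide divide_right_mono)
  show ?thesis unfolding B_def cB_def distrib_right
    by (rule order_trans[OF abs_triangle_ineq add_mono[OF 3 2]])
qed

text \<open>The length of u splits into a residual and a fitted part. The first is weighted by 1 /
  \<sigma>^2, which is at least 1 / (M mu); the second by \<open>Km\<close>, at least 1 / mu, while
  the Gram form is at most M times the square.\<close>

lemma B_lower: "ip u u / (M * mu \<theta>) \<le> B \<theta> u u"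
proof -
  let ?r = "ip u u - ols u \<bullet> (gram m z *v ols u)"
  have r: "0 \<le> ?r" using ols_residual_bound[of u] by simp
  have "\<sigma>\<^sup>2 * 1 \<le> \<sigma>\<^sup>2 * (M * M)" using M_ge_1 by (intro mult_left_mono) (auto intro: order_trans[OF _ mult_mono[of 1 M 1 M]])
  also have "\<dots> \<le> M * mu \<theta>" using M_pos by (simp add: mu_def algebra_simps)
  finally have "?r / (M * mu \<theta>) \<le> ?r / \<sigma>\<^sup>2" using r sigma_pos
    by (intro divide_left_mono mult_pos_pos M_pos mu_pos) auto
  moreover have "(ols u \<bullet> (gram m z *v ols u)) / (M * mu \<theta>) \<le> ols u \<bullet> (Km \<theta> *v ols u)"
  proof -
    have "(ols u \<bullet> (gram m z *v ols u)) / (M * mu \<theta>) \<le> (M * (ols u \<bullet> ols u)) / (M * mu \<theta>)"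
      using M_pos mu_pos[of \<theta>] gram_upper by (intro divide_right_mono) auto
    also have "\<dots> = (ols u \<bullet> ols u) / mu \<theta>" using M_pos by simp
    also have "\<dots> \<le> ols u \<bullet> (Km \<theta> *v ols u)" by (rule Km_bounds)
    finally show ?thesis .
  qed
  ultimately show ?thesis unfolding B_def by (simp add: diff_divide_distrib)
qed

section \<open>Partial derivatives of the covariance, of \<open>B\<close> and of the reduced
  score\<close>

lemma Nm_deriv:
  "((\<lambda>t. Nm (\<theta> + t *\<^sub>R axis (Inl j) 1) $ l $ k) has_real_derivative
    (\<chi> l k. if l = k \<and> a l = j then 2 * \<theta> $ Inl j else 0) $ l $ k) (at 0)"
  by (cases "l = k"; cases "a l = j") (auto simp: Nm_def axis_def intro!: derivative_eq_intros)

lemma Nm_psi: "Nm (\<theta> + t *\<^sub>R axis (Inr b) 1) = Nm \<theta>"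
  by (simp add: Nm_def axis_def vec_eq_iff)

lemma Km_psi: "Km (\<theta> + t *\<^sub>R axis (Inr b) 1) = Km \<theta>"
  by (simp add: Km_def Nm_psi)

text \<open>K' = - K N' K, where N' is diagonal and supported on the positions l with a l =
  j.\<close>

lemma Km_deriv:
  "((\<lambda>t. Km (\<theta> + t *\<^sub>R axis (Inl j) 1) $ l $ k) has_real_derivative
    - (2 * \<theta> $ Inl j * (\<Sum>i\<in>{i. a i = j}. Km \<theta> $ l $ i * Km \<theta> $ i $ k))) (at 0)"
proof -
  have "((\<lambda>t. Km (\<theta> + t *\<^sub>R axis (Inl j) 1) $ l $ k) has_real_derivative
    - (Km \<theta> ** (\<chi> l k. if l = k \<and> a l = j then 2 * \<theta> $ Inl j else 0) ** Km \<theta>) $ l $ k) (at 0)"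
    using has_real_derivative_matrix_inv[of "\<lambda>t. Nm (\<theta> + t *\<^sub>R axis (Inl j) 1)" _ 0 l k, OF Nm_deriv Nm_inv]
    by (simp add: Km_def)
  also have "(Km \<theta> ** (\<chi> l k. if l = k \<and> a l = j then 2 * \<theta> $ Inl j else 0) ** Km \<theta>) $ l $ k
    = (\<Sum>i\<in>UNIV. (if a i = j then 2 * \<theta> $ Inl j * (Km \<theta> $ l $ i * Km \<theta> $ i $ k) else 0))"
    unfolding matrix_matrix_mult_def
    by (auto simp: if_distrib[of "\<lambda>x. _ * x"] if_distrib[of "\<lambda>x. x * _"] if_if_eq_conj[symmetric] sum.delta mult_ac
        intro!: sum.cong cong: if_cong)
  also have "\<dots> = 2 * \<theta> $ Inl j * (\<Sum>i\<in>{i. a i = j}. Km \<theta> $ l $ i * Km \<theta> $ i $ k)"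
    by (simp add: sum.If_cases sum_distrib_left)
  finally show ?thesis .
qed

lemma Km_form_deriv:
  "((\<lambda>t. v \<bullet> (Km (\<theta> + t *\<^sub>R axis (Inl j) 1) *v w)) has_real_derivative
    - (2 * \<theta> $ Inl j * (\<Sum>i\<in>{i. a i = j}. (Km \<theta> *v v) $ i * (Km \<theta> *v w) $ i))) (at 0)"
proof -
  have "((\<lambda>t. v \<bullet> (Km (\<theta> + t *\<^sub>R axis (Inl j) 1) *v w)) has_real_derivative
    (\<Sum>l\<in>UNIV. v $ l * (\<Sum>k\<in>UNIV. - (2 * \<theta> $ Inl j * (\<Sum>i\<in>{i. a i = j}. Km \<theta> $ l $ i * Km \<theta> $ i $ k)) * w $ k))) (at 0)"
    unfolding inner_vec_def matrix_vector_mult_def vec_lambda_beta inner_real_def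
    by (auto intro!: derivative_eq_intros Km_deriv sum.cong simp: mult_ac)
  also have "(\<Sum>l\<in>UNIV. v $ l * (\<Sum>k\<in>UNIV. - (2 * \<theta> $ Inl j * (\<Sum>i\<in>{i. a i = j}. Km \<theta> $ l $ i * Km \<theta> $ i $ k)) * w $ k))
    = (\<Sum>l\<in>UNIV. \<Sum>k\<in>UNIV. \<Sum>i\<in>{i. a i = j}. - (2 * \<theta> $ Inl j * ((Km \<theta> $ i $ l * v $ l) * (Km \<theta> $ i $ k * w $ k))))"
    by (simp add: sum_distrib_left sum_distrib_right sum_negf Km_sym'[of \<theta> _ _] mult_ac)
  also have "\<dots> = (\<Sum>i\<in>{i. a i = j}. \<Sum>l\<in>UNIV. \<Sum>k\<in>UNIV. - (2 * \<theta> $ Inl j * ((Km \<theta> $ i $ l * v $ l) * (Km \<theta> $ i $ k * w $ k))))"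
    by (subst sum.swap[of _ "{i. a i = j}"], subst sum.swap[of _ "{i. a i = j}"]) (rule refl)
  also have "\<dots> = - (2 * \<theta> $ Inl j * (\<Sum>i\<in>{i. a i = j}. (Km \<theta> *v v) $ i * (Km \<theta> *v w) $ i))"
    by (simp only: matrix_vector_mult_def vec_lambda_beta sum_product) (simp only: sum_distrib_left sum_negf)
  finally show ?thesis .
qed


lemma hess_sym: "hess \<theta> y x c c' = hess \<theta> y x c' c"
proof (cases c; cases c')
  fix j k assume [simp]: "c = Inl j" "c' = Inl k"
  have "(\<Sum>l\<in>{l. a l = j}. \<Sum>i\<in>{i. a i = k}. F l i) = (\<Sum>i\<in>{i. a i = k}. \<Sum>l\<in>{l. a l = j}. F l i)" for F :: "'q \<Rightarrow> 'q \<Rightarrow> real"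
    by (rule sum.swap)
  then show ?thesis
    by (auto simp: hess_def Let_def Km_sym'[of \<theta> _ _] mult_ac intro!: sum.cong)
qed (auto simp: hess_def Let_def B_commute)

lemma res_lambda: "res (\<theta> + t *\<^sub>R axis (Inl j) 1) y x = res \<theta> y x"
  by (simp add: res_def[abs_def] lmm_psi_def axis_def)

lemma res_psi: "res (\<theta> + t *\<^sub>R axis (Inr b) 1) y x = (\<lambda>k. res \<theta> y x k + (- t) * col x b k)"
proof -
  have "lmm_psi (\<theta> + t *\<^sub>R axis (Inr b) 1) = lmm_psi \<theta> + t *\<^sub>R axis b 1"
    by (simp add: lmm_psi_def vec_eq_iff axis_def)
  then show ?thesis by (simp add: res_def[abs_def] col_def inner_add_right inner_axis fun_eq_iff)
qed

lemma B_psi: "B (\<theta> + t *\<^sub>R axis (Inr b) 1) = B \<theta>"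
  by (simp add: B_def[abs_def] Km_psi)

lemma hh_psi: "hh (\<theta> + t *\<^sub>R axis (Inr b) 1) = hh \<theta>"
  by (simp add: hh_def[abs_def] Km_psi)

lemma hh_linear: "hh \<theta> (\<lambda>k. u k + t * v k) = hh \<theta> u + t *\<^sub>R hh \<theta> v"
  by (simp add: hh_def ols_linear matrix_vector_right_distrib matrix_vector_mult_scaleR)

lemma B_linear': "B \<theta> w (\<lambda>k. u k + t * v k) = B \<theta> w u + t * B \<theta> w v"
  using B_linear[of \<theta> u t v w] by (simp only: B_commute[of \<theta> w])

lemma B_deriv:
  "((\<lambda>t. B (\<theta> + t *\<^sub>R axis (Inl j) 1) u v) has_real_derivative
    - (2 * \<theta> $ Inl j * (\<Sum>i\<in>{i. a i = j}. hh \<theta> u $ i * hh \<theta> v $ i))) (at 0)"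
  unfolding B_def hh_def by (auto intro!: derivative_eq_intros Km_form_deriv)

lemma hh_deriv:
  "((\<lambda>t. hh (\<theta> + t *\<^sub>R axis (Inl j) 1) u $ l) has_real_derivative
    - (2 * \<theta> $ Inl j * (\<Sum>i\<in>{i. a i = j}. Km \<theta> $ l $ i * hh \<theta> u $ i))) (at 0)"
proof -
  have *: "(Km \<theta> *v axis l 1) $ i = Km \<theta> $ l $ i" for i
    by (simp add: matrix_vector_mult_basis column_def Km_sym'[of \<theta> i])
  show ?thesis
    using Km_form_deriv[of "axis l 1" \<theta> j "ols u"] by (simp add: inner_axis' * hh_def)
qed

lemma quad_deriv:
  "((\<lambda>t. B (\<theta> + t *\<^sub>R axis c 1) (res (\<theta> + t *\<^sub>R axis c 1) y x) (res (\<theta> + t *\<^sub>R axis c 1) y x)) has_real_derivative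
    (case c of Inl j \<Rightarrow> - (2 * \<theta> $ Inl j * (\<Sum>i\<in>{i. a i = j}. (hh \<theta> (res \<theta> y x) $ i)\<^sup>2))
      | Inr b \<Rightarrow> - (2 * B \<theta> (col x b) (res \<theta> y x)))) (at 0)"
proof (cases c)
  case (Inl j)
  then show ?thesis using B_deriv[of \<theta> j "res \<theta> y x" "res \<theta> y x"] by (simp add: res_lambda power2_eq_square)
next
  case (Inr b)
  let ?u = "res \<theta> y x" and ?v = "col x b"
  have "B \<theta> (\<lambda>k. ?u k + - t * ?v k) (\<lambda>k. ?u k + - t * ?v k) = B \<theta> ?u ?u - 2 * t * B \<theta> ?v ?u + t\<^sup>2 * B \<theta> ?v ?v" for t
    unfolding B_linear B_linear' by (simp add: B_commute[of \<theta> ?u ?v] power2_eq_square algebra_simps)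
  moreover have "((\<lambda>t. B \<theta> ?u ?u - 2 * t * B \<theta> ?v ?u + t\<^sup>2 * B \<theta> ?v ?v) has_real_derivative - (2 * B \<theta> ?v ?u)) (at 0)"
    by (auto intro!: derivative_eq_intros)
  ultimately show ?thesis unfolding Inr by (simp only: B_psi res_psi sum.case)
qed

lemma rscore_deriv_lambda:
  "((\<lambda>t. rscore (\<theta> + t *\<^sub>R axis (Inl k) 1) y x $ Inl j) has_real_derivative
    \<theta> $ Inl k * (\<Sum>l\<in>{l. a l = j}. \<Sum>i\<in>{i. a i = k}. 2 * (Km \<theta> $ l $ i)\<^sup>2
      - 4 * (hh \<theta> (res \<theta> y x) $ l * Km \<theta> $ l $ i * hh \<theta> (res \<theta> y x) $ i))) (at 0)"
proof -
  let ?h = "hh \<theta> (res \<theta> y x)"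
  have "((\<lambda>t. rscore (\<theta> + t *\<^sub>R axis (Inl k) 1) y x $ Inl j) has_real_derivative
    (\<Sum>l\<in>{l. a l = j}. 2 * ?h $ l * - (2 * \<theta> $ Inl k * (\<Sum>i\<in>{i. a i = k}. Km \<theta> $ l $ i * ?h $ i))
      - - (2 * \<theta> $ Inl k * (\<Sum>i\<in>{i. a i = k}. Km \<theta> $ l $ i * Km \<theta> $ i $ l)))) (at 0)"
    unfolding rscore_def res_lambda
    by (auto intro!: derivative_eq_intros hh_deriv Km_deriv sum.cong)
  also have "(\<Sum>l\<in>{l. a l = j}. 2 * ?h $ l * - (2 * \<theta> $ Inl k * (\<Sum>i\<in>{i. a i = k}. Km \<theta> $ l $ i * ?h $ i))
      - - (2 * \<theta> $ Inl k * (\<Sum>i\<in>{i. a i = k}. Km \<theta> $ l $ i * Km \<theta> $ i $ l)))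
    = \<theta> $ Inl k * (\<Sum>l\<in>{l. a l = j}. \<Sum>i\<in>{i. a i = k}. 2 * (Km \<theta> $ l $ i)\<^sup>2
      - 4 * (?h $ l * Km \<theta> $ l $ i * ?h $ i))"
    unfolding sum_distrib_left
  proof (intro sum.cong refl)
    fix l
    show "2 * ?h $ l * - (\<Sum>i\<in>{i. a i = k}. 2 * \<theta> $ Inl k * (Km \<theta> $ l $ i * ?h $ i))
      - - (\<Sum>i\<in>{i. a i = k}. 2 * \<theta> $ Inl k * (Km \<theta> $ l $ i * Km \<theta> $ i $ l))
      = (\<Sum>i\<in>{i. a i = k}. \<theta> $ Inl k * (2 * (Km \<theta> $ l $ i)\<^sup>2 - 4 * (?h $ l * Km \<theta> $ l $ i * ?h $ i)))"
      unfolding right_diff_distrib sum_subtractf Km_sym'[of \<theta> _ l]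
      by (simp add: sum_distrib_left power2_eq_square mult_ac)
  qed
  finally show ?thesis .
qed

lemma score_deriv:
  "((\<lambda>t. dscale (\<theta> + t *\<^sub>R axis c' 1) c * rscore (\<theta> + t *\<^sub>R axis c' 1) y x $ c) has_real_derivative hess \<theta> y x c c') (at 0)"
proof (cases c; cases c')
  fix j k assume [simp]: "c = Inl j" "c' = Inl k"
  have "((\<lambda>t. (\<theta> $ Inl j + t * (if j = k then 1 else 0)) * rscore (\<theta> + t *\<^sub>R axis (Inl k) 1) y x $ Inl j) has_real_derivative hess \<theta> y x c c') (at 0)"
    by (rule derivative_eq_intros rscore_deriv_lambda refl)+ (auto simp: hess_def Let_def)
  then show ?thesis by (simp add: dscale_def axis_def if_distrib[of "\<lambda>x. _ * x"] cong: if_cong)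
next
  fix j b assume [simp]: "c = Inl j" "c' = Inr b"
  have "((\<lambda>t. \<theta> $ Inl j * (\<Sum>l\<in>{l. a l = j}. (hh \<theta> (res \<theta> y x) $ l + - t * hh \<theta> (col x b) $ l)\<^sup>2 - Km \<theta> $ l $ l)) has_real_derivative hess \<theta> y x c c') (at 0)"
    by (auto intro!: derivative_eq_intros simp: hess_def Let_def sum_negf sum_distrib_left mult_ac)
  then show ?thesis
    unfolding \<open>c = _\<close> \<open>c' = _\<close> rscore_def
    by (simp only: vec_lambda_beta sum.case hh_psi Km_psi res_psi hh_linear vector_add_component vector_scaleR_component)
      (simp add: dscale_def axis_def)
next
  fix b j assume [simp]: "c = Inr b" "c' = Inl j"
  show ?thesis
    using B_deriv[of \<theta> j "col x b" "res \<theta> y x"] by (simp add: dscale_def rscore_def res_lambda hess_def Let_def mult_ac)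
next
  fix b b' assume [simp]: "c = Inr b" "c' = Inr b'"
  have "((\<lambda>t. B \<theta> (col x b) (res \<theta> y x) + - t * B \<theta> (col x b) (col x b')) has_real_derivative hess \<theta> y x c c') (at 0)"
    by (auto intro!: derivative_eq_intros simp: hess_def Let_def)
  then show ?thesis
    unfolding \<open>c = _\<close> \<open>c' = _\<close> rscore_def
    by (simp only: vec_lambda_beta sum.case B_psi res_psi B_linear') (simp add: dscale_def)
qed

section \<open>Joint continuity in the parameter and the data\<close>

lemma Km_tendsto:
  assumes "(g \<longlongrightarrow> \<theta>) F"
  shows "((\<lambda>s. Km (g s) $ l $ k) \<longlongrightarrow> Km \<theta> $ l $ k) F"
proof -
  have "((\<lambda>s. Nm (g s) $ l $ k) \<longlongrightarrow> Nm \<theta> $ l $ k) F" for l k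
    unfolding Nm_def by (cases "l = k") (auto intro!: tendsto_intros assms)
  from tendsto_matrix_inv(1)[of "\<lambda>s. Nm (g s)" "Nm \<theta>" F, OF this Nm_inv] show ?thesis
    by (simp add: Km_def)
qed

lemma Nm_tendsto:
  assumes "(g \<longlongrightarrow> \<theta>) F"
  shows "((\<lambda>s. Nm (g s) $ l $ k) \<longlongrightarrow> Nm \<theta> $ l $ k) F"
  unfolding Nm_def by (cases "l = k") (auto intro!: tendsto_intros assms)

lemma continuous_on_Km:
  assumes "continuous_on S g"
  shows "continuous_on S (\<lambda>s. Km (g s) $ l $ k)"
  using assms unfolding continuous_on_def by (auto intro: Km_tendsto)

lemma continuous_on_ols:
  assumes "\<And>k. continuous_on S (\<lambda>s. u s k)"
  shows "continuous_on S (\<lambda>s. ols (u s))"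
proof -
  have "continuous_on S (\<lambda>s. \<Sum>k<m. u s k *\<^sub>R z k)" by (intro continuous_intros assms)
  then show ?thesis
    unfolding ols_def by (rule continuous_on_compose2[OF matrix_vector_mult_linear_continuous_on[of UNIV]]) auto
qed

lemma continuous_on_hh:
  assumes "continuous_on S g" "\<And>k. continuous_on S (\<lambda>s. u s k)"
  shows "continuous_on S (\<lambda>s. hh (g s) (u s))"
  unfolding hh_def matrix_vector_mult_def
  by (intro continuous_intros continuous_on_Km continuous_on_ols assms)

lemma continuous_on_B:
  assumes "continuous_on S g" "\<And>k. continuous_on S (\<lambda>s. u s k)" "\<And>k. continuous_on S (\<lambda>s. v s k)"
  shows "continuous_on S (\<lambda>s. B (g s) (u s) (v s))"
  unfolding B_def ip_def hh_def[symmetric] inner_vec_def[of _ "hh _ _"] inner_real_def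
  unfolding gram_mult
  by (intro continuous_intros continuous_on_hh continuous_on_ols assms) (use sigma_pos in simp)

lemma continuous_on_res:
  assumes "continuous_on S g" "\<And>k. continuous_on S (\<lambda>s. y s k)" "\<And>k. continuous_on S (\<lambda>s. x s k)"
  shows "continuous_on S (\<lambda>s. res (g s) (y s) (x s) k)"
  unfolding res_def lmm_psi_def by (intro continuous_intros assms)

lemma continuous_on_rscore:
  assumes "continuous_on S g" "\<And>k. continuous_on S (\<lambda>s. y s k)" "\<And>k. continuous_on S (\<lambda>s. x s k)"
  shows "continuous_on S (\<lambda>s. rscore (g s) (y s) (x s))"
  unfolding rscore_def
proof (intro continuous_on_vec_lambda)
  fix c
  show "continuous_on S (\<lambda>s. case c of Inl j \<Rightarrow> \<Sum>l\<in>{l. a l = j}. (hh (g s) (res (g s) (y s) (x s)) $ l)\<^sup>2 - Km (g s) $ l $ l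
      | Inr b \<Rightarrow> B (g s) (col (x s) b) (res (g s) (y s) (x s)))"
    by (cases c) (auto simp: col_def intro!: continuous_intros continuous_on_hh continuous_on_Km continuous_on_B continuous_on_res assms)
qed

lemma continuous_on_hess:
  assumes "continuous_on S g" "\<And>k. continuous_on S (\<lambda>s. y s k)" "\<And>k. continuous_on S (\<lambda>s. x s k)"
  shows "continuous_on S (\<lambda>s. hess (g s) (y s) (x s) c c')"
  unfolding hess_def Let_def
  by (cases "c = c'"; cases c; cases c') (auto simp: col_def intro!: continuous_intros continuous_on_rscore continuous_on_hh continuous_on_Km continuous_on_B continuous_on_res assms)

section \<open>Growth of the score and the Hessian\<close>

definition nrmX :: "(nat \<Rightarrow> real^'d2::finite) \<Rightarrow> real" where
  "nrmX x = (\<Sum>b\<in>UNIV. (nrm (col x b))\<^sup>2)"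

lemma nrm_col: "(nrm (col x b))\<^sup>2 \<le> nrmX x"
  unfolding nrmX_def by (rule member_le_sum) auto

lemma nrmX_nonneg: "0 \<le> nrmX x" unfolding nrmX_def by (simp add: sum_nonneg)

text \<open>\<open>C1\<close> and, for parameters bounded by \<rho>, \<open>C2\<close> are the
  growth constants of the reduced score and the Hessian against 1 + |residual|^2 +
  \<open>nrmX\<close>, the last term being the squared Frobenius norm of the predictors. The number
  of responses does not enter, which makes the bounds uniform over observations.\<close>

definition "C1 = real CARD('q) * ((kap * M)\<^sup>2 + kap) + cB"

definition "C2 \<rho> = C1 + \<rho>\<^sup>2 * ((real CARD('q))\<^sup>2 * (2 * kap\<^sup>2 + 4 * kap * (kap * M)\<^sup>2)) + 2 * \<rho> * (real CARD('q) * (kap * M)\<^sup>2)"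

lemma card_le: "real (card {l. a l = j}) \<le> real CARD('q)"
  by (simp add: card_mono)

lemma mult_le_sum_squares: "(s::real) * t \<le> s\<^sup>2 + t\<^sup>2"
  using sum_squares_bound[of s t] zero_le_power2[of s] zero_le_power2[of t] by linarith

lemma sum_bound_card:
  assumes "\<And>l. l \<in> A \<Longrightarrow> \<bar>f l\<bar> \<le> K" "real (card A) \<le> N" "0 \<le> K"
  shows "\<bar>\<Sum>l\<in>A. f l\<bar> \<le> N * (K::real)"
proof -
  have "\<bar>\<Sum>l\<in>A. f l\<bar> \<le> (\<Sum>l\<in>A. \<bar>f l\<bar>)" by (rule sum_abs)
  also have "\<dots> \<le> real (card A) * K" using assms(1) by (rule sum_bounded_above)
  also have "\<dots> \<le> N * K" by (intro mult_right_mono assms)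
  finally show ?thesis .
qed

lemma rscore_bound: "\<bar>rscore \<theta> y x $ c\<bar> \<le> C1 * (1 + (nrm (res \<theta> y x))\<^sup>2 + nrmX x)"
proof (cases c)
  case (Inl j)
  let ?u = "res \<theta> y x" and ?E = "1 + (nrm (res \<theta> y x))\<^sup>2 + nrmX x"
  have E: "1 \<le> ?E" "(nrm ?u)\<^sup>2 \<le> ?E" using nrmX_nonneg[of x] by auto
  have "\<bar>(hh \<theta> ?u $ l)\<^sup>2 - Km \<theta> $ l $ l\<bar> \<le> ((kap * M)\<^sup>2 + kap) * ?E" for l
  proof -
    have "(hh \<theta> ?u $ l)\<^sup>2 \<le> (kap * M * nrm ?u)\<^sup>2"
      using power_mono[OF hh_bound(2)[of \<theta> ?u l] abs_ge_zero, of 2] by simp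
    also have "\<dots> \<le> (kap * M)\<^sup>2 * ?E" unfolding power_mult_distrib[of _ "nrm ?u"] by (intro mult_left_mono E) simp
    finally have "(hh \<theta> ?u $ l)\<^sup>2 \<le> (kap * M)\<^sup>2 * ?E" .
    moreover have "\<bar>Km \<theta> $ l $ l\<bar> \<le> kap * ?E"
      using order_trans[OF Km_bounds(4)[of \<theta> l l] mult_left_mono[OF E(1), of kap, simplified mult_1_right]] kap_pos by simp
    ultimately show ?thesis using zero_le_power2[of "hh \<theta> ?u $ l"] unfolding distrib_right by linarith
  qed
  from sum_bound_card[where A = "{l. a l = j}" and N = "real CARD('q)", OF this card_le]
  have "\<bar>rscore \<theta> y x $ c\<bar> \<le> real CARD('q) * (((kap * M)\<^sup>2 + kap) * ?E)"
    using kap_pos E by (simp add: rscore_def Inl)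
  also have "\<dots> \<le> C1 * ?E"
    using cB_nonneg E by (simp add: C1_def distrib_right mult.assoc)
  finally show ?thesis .
next
  case (Inr b)
  let ?u = "res \<theta> y x" and ?E = "1 + (nrm (res \<theta> y x))\<^sup>2 + nrmX x"
  have "\<bar>rscore \<theta> y x $ c\<bar> \<le> cB * (nrm (col x b) * nrm ?u)" unfolding Inr rscore_def using B_bound by simp
  also have "\<dots> \<le> cB * ?E"
    using mult_le_sum_squares[of "nrm (col x b)" "nrm ?u"] nrm_col[of x b] by (intro mult_left_mono cB_nonneg) linarith
  also have "\<dots> \<le> C1 * ?E"
    using kap_pos nrmX_nonneg[of x] by (intro mult_right_mono) (simp_all add: C1_def)
  finally show ?thesis .
qed

lemma hess_bound:
  assumes \<rho>: "\<And>c. \<bar>\<theta> $ c\<bar> \<le> \<rho>"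
  shows "\<bar>hess \<theta> y x c c'\<bar> \<le> C2 \<rho> * (1 + (nrm (res \<theta> y x))\<^sup>2 + nrmX x)"
proof -
  let ?u = "res \<theta> y x" and ?E = "1 + (nrm (res \<theta> y x))\<^sup>2 + nrmX x" and ?q = "real CARD('q)"
  have E: "1 \<le> ?E" "(nrm ?u)\<^sup>2 \<le> ?E" "0 \<le> ?E" using nrmX_nonneg[of x] by auto
  have \<rho>0: "0 \<le> \<rho>" using \<rho>[of undefined] by linarith
  define P where "P = ?q\<^sup>2 * (2 * kap\<^sup>2 + 4 * kap * (kap * M)\<^sup>2)"
  define R where "R = ?q * (kap * M)\<^sup>2"
  have nn: "0 \<le> C1" "0 \<le> P" "0 \<le> R" using kap_pos cB_nonneg by (simp_all add: C1_def P_def R_def)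
  have C2: "C2 \<rho> = C1 + \<rho>\<^sup>2 * P + 2 * \<rho> * R" by (simp add: C2_def P_def R_def)
  have part: "C1 * ?E \<le> C2 \<rho> * ?E" "\<rho>\<^sup>2 * P * ?E + C1 * ?E \<le> C2 \<rho> * ?E" "2 * \<rho> * R * ?E \<le> C2 \<rho> * ?E"
  proof -
    have "0 \<le> C1 * ?E" "0 \<le> \<rho>\<^sup>2 * P * ?E" "0 \<le> 2 * \<rho> * R * ?E" using nn E \<rho>0 by simp_all
    then show "C1 * ?E \<le> C2 \<rho> * ?E" "\<rho>\<^sup>2 * P * ?E + C1 * ?E \<le> C2 \<rho> * ?E" "2 * \<rho> * R * ?E \<le> C2 \<rho> * ?E"
      unfolding C2 by (simp_all only: distrib_right)
  qed
  have hx: "\<bar>\<Sum>l\<in>{l. a l = j}. hh \<theta> ?u $ l * hh \<theta> (col x b) $ l\<bar> \<le> R * ?E" for j b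
  proof -
    have "\<bar>hh \<theta> ?u $ l * hh \<theta> (col x b) $ l\<bar> \<le> (kap * M)\<^sup>2 * ?E" for l
    proof -
      have "\<bar>hh \<theta> ?u $ l * hh \<theta> (col x b) $ l\<bar> \<le> (kap * M * nrm ?u) * (kap * M * nrm (col x b))"
        unfolding abs_mult using hh_bound(2)[of \<theta> ?u l] by (intro mult_mono hh_bound(2)) auto
      also have "\<dots> = (kap * M)\<^sup>2 * (nrm ?u * nrm (col x b))" by (simp add: power2_eq_square mult_ac)
      also have "\<dots> \<le> (kap * M)\<^sup>2 * ?E"
        using mult_le_sum_squares[of "nrm ?u" "nrm (col x b)"] nrm_col[of x b] by (intro mult_left_mono) auto
      finally show ?thesis .
    qed
    from sum_bound_card[where A = "{l. a l = j}" and N = ?q, OF this card_le] E show ?thesis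
      by (simp add: R_def mult.assoc)
  qed
  have mixed: "\<bar>- (2 * \<theta> $ Inl j * (\<Sum>l\<in>{l. a l = j}. hh \<theta> ?u $ l * hh \<theta> (col x b) $ l))\<bar> \<le> C2 \<rho> * ?E" for j b
  proof -
    have "\<bar>- (2 * \<theta> $ Inl j * (\<Sum>l\<in>{l. a l = j}. hh \<theta> ?u $ l * hh \<theta> (col x b) $ l))\<bar> \<le> 2 * \<rho> * (R * ?E)"
      unfolding abs_minus_cancel abs_mult by (intro mult_mono \<rho> hx) (use \<rho>0 in auto)
    also have "\<dots> = 2 * \<rho> * R * ?E" by simp
    also note part(3)
    finally show ?thesis .
  qed
  show ?thesis
  proof (cases c; cases c')
    fix j k assume [simp]: "c = Inl j" "c' = Inl k"
    let ?f = "\<lambda>l i. 2 * (Km \<theta> $ l $ i)\<^sup>2 - 4 * (hh \<theta> ?u $ l * Km \<theta> $ l $ i * hh \<theta> ?u $ i)"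
    have f: "\<bar>?f l i\<bar> \<le> (2 * kap\<^sup>2 + 4 * kap * (kap * M)\<^sup>2) * ?E" for l i
    proof -
      have "(Km \<theta> $ l $ i)\<^sup>2 \<le> kap\<^sup>2" using power_mono[OF Km_bounds(4)[of \<theta> l i] abs_ge_zero, of 2] by simp
      also have "\<dots> \<le> kap\<^sup>2 * ?E" using mult_left_mono[OF E(1), of "kap\<^sup>2"] by simp
      finally have 1: "(Km \<theta> $ l $ i)\<^sup>2 \<le> kap\<^sup>2 * ?E" .
      have "\<bar>hh \<theta> ?u $ l * Km \<theta> $ l $ i * hh \<theta> ?u $ i\<bar> \<le> (kap * M * nrm ?u) * kap * (kap * M * nrm ?u)"
        unfolding abs_mult using hh_bound(2)[of \<theta> ?u l] kap_pos M_pos nrm_nonneg[of ?u]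
        by (intro mult_mono hh_bound(2) Km_bounds) auto
      also have "\<dots> = kap * (kap * M)\<^sup>2 * (nrm ?u)\<^sup>2" by (simp add: power2_eq_square mult_ac)
      also have "\<dots> \<le> kap * (kap * M)\<^sup>2 * ?E" using kap_pos E by (intro mult_left_mono) auto
      finally have 2: "\<bar>hh \<theta> ?u $ l * Km \<theta> $ l $ i * hh \<theta> ?u $ i\<bar> \<le> kap * (kap * M)\<^sup>2 * ?E" .
      have "\<bar>2 * s - 4 * t\<bar> \<le> 2 * s' + 4 * t'" if "s \<le> s'" "0 \<le> s" "\<bar>t\<bar> \<le> t'" for s t s' t' :: real
        using that by linarith
      from this[OF 1 _ 2] show ?thesis by (simp add: distrib_right mult.assoc)
    qed
    have "\<bar>\<Sum>l\<in>{l. a l = j}. \<Sum>i\<in>{i. a i = k}. ?f l i\<bar> \<le> ?q * (?q * ((2 * kap\<^sup>2 + 4 * kap * (kap * M)\<^sup>2) * ?E))"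
      using kap_pos E(3) by (intro sum_bound_card f card_le mult_nonneg_nonneg) auto
    also have "\<dots> = P * ?E" by (simp add: P_def power2_eq_square mult_ac)
    finally have S: "\<bar>\<Sum>l\<in>{l. a l = j}. \<Sum>i\<in>{i. a i = k}. ?f l i\<bar> \<le> P * ?E" .
    have "\<bar>hess \<theta> y x c c'\<bar> \<le> \<bar>if j = k then rscore \<theta> y x $ Inl j else 0\<bar>
      + \<bar>\<theta> $ Inl j * \<theta> $ Inl k * (\<Sum>l\<in>{l. a l = j}. \<Sum>i\<in>{i. a i = k}. ?f l i)\<bar>"
      by (simp add: hess_def Let_def abs_triangle_ineq)
    also have "\<dots> \<le> C1 * ?E + \<rho> * \<rho> * (P * ?E)"
      unfolding abs_mult using rscore_bound[of \<theta> y x "Inl j"] nn E \<rho>0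
      by (intro add_mono mult_mono \<rho> S) auto
    also have "\<dots> = \<rho>\<^sup>2 * P * ?E + C1 * ?E" by (simp add: power2_eq_square)
    also note part(2)
    finally show ?thesis .
  next
    fix j b assume "c = Inl j" "c' = Inr b"
    then show ?thesis using mixed[of j b] by (simp add: hess_def Let_def)
  next
    fix b j assume "c = Inr b" "c' = Inl j"
    then show ?thesis using mixed[of j b] by (simp add: hess_def Let_def)
  next
    fix b b' assume [simp]: "c = Inr b" "c' = Inr b'"
    have "\<bar>hess \<theta> y x c c'\<bar> \<le> cB * (nrm (col x b) * nrm (col x b'))" using B_bound by (simp add: hess_def Let_def)
    also have "nrm (col x b) * nrm (col x b') \<le> ?E"
    proof -
      have "2 * (nrm (col x b) * nrm (col x b')) \<le> (nrm (col x b))\<^sup>2 + (nrm (col x b'))\<^sup>2"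
        using sum_squares_bound[of "nrm (col x b)" "nrm (col x b')"] by (simp add: mult.assoc)
      also have "\<dots> \<le> 2 * nrmX x" using nrm_col[of x b] nrm_col[of x b'] by simp
      finally show ?thesis by (simp add: add_increasing)
    qed
    then have "cB * (nrm (col x b) * nrm (col x b')) \<le> cB * ?E" by (intro mult_left_mono cB_nonneg)
    also have "\<dots> \<le> C1 * ?E" using kap_pos E by (intro mult_right_mono) (simp_all add: C1_def)
    also note part(1)
    finally show ?thesis by simp
  qed
qed

end

lemma measurable_vec_nth [measurable (raw)]:
  fixes g :: "'a \<Rightarrow> real^'n"
  assumes "g \<in> borel_measurable M"
  shows "(\<lambda>x. g x $ l) \<in> borel_measurable M"
  by (rule measurable_compose[OF assms]) (intro borel_measurable_continuous_onI continuous_intros)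

section \<open>The marginal density: integrating out the random effects\<close>

context design
begin

definition Lam :: "real^('d1 + 'd2::finite) \<Rightarrow> real^'q \<Rightarrow> real^'q" where
  "Lam \<theta> w = (\<chi> l. \<theta> $ Inl (a l) * w $ l)"

lemma Lambda_mult: "lmm_Lambda a (lmm_lambda \<theta>) *v w = Lam \<theta> w"
  by (simp add: vec_eq_iff Lam_def lmm_Lambda_def lmm_lambda_def matrix_vector_mult_def if_distrib[of "\<lambda>x. x * _"]
      sum.delta cong: if_cong)

lemma Lam_diff: "Lam \<theta> (v - w) = Lam \<theta> v - Lam \<theta> w"
  by (simp add: Lam_def vec_eq_iff algebra_simps)

lemma Lam_dot: "Lam \<theta> v \<bullet> w = v \<bullet> Lam \<theta> w"
  by (simp add: Lam_def inner_vec_def mult_ac)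

lemma Nm_Lam: "Nm \<theta> *v v = \<sigma>\<^sup>2 *\<^sub>R (Gi *v v) + Lam \<theta> (Lam \<theta> v)"
  unfolding Nm_mult by (simp add: Lam_def vec_eq_iff power2_eq_square mult.assoc)

lemma gram_Gi: "gram m z *v (Gi *v v) = v"
  by (simp add: Gi_def matrix_inv_cancel[OF gram_inv])

lemma Nm_Km: "Nm \<theta> *v (Km \<theta> *v v) = v"
  by (simp add: Km_def matrix_inv_cancel[OF Nm_inv])

lemma gram_dot: "v \<bullet> (gram m z *v w) = (\<Sum>k<m. (z k \<bullet> v) * (z k \<bullet> w))"
  by (simp add: gram_mult inner_sum_right inner_commute mult_ac)

lemma residual_sum: "(\<Sum>k<m. (u k - z k \<bullet> v)\<^sup>2)
  = (ip u u - ols u \<bullet> (gram m z *v ols u)) + (ols u - v) \<bullet> (gram m z *v (ols u - v))"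
proof -
  have "(\<Sum>k<m. (u k - z k \<bullet> v)\<^sup>2) = ip u u - 2 * (v \<bullet> (\<Sum>k<m. u k *\<^sub>R z k)) + v \<bullet> (gram m z *v v)"
    unfolding gram_dot
    by (simp add: ip_def inner_sum_right power2_eq_square sum_subtractf sum.distrib sum_distrib_left inner_commute algebra_simps)
  moreover have "ols u \<bullet> (gram m z *v v) = v \<bullet> (gram m z *v ols u)"
    using sym_dot[OF transpose_gram[of m z], of "ols u" v] by (simp add: inner_commute)
  ultimately show ?thesis
    by (simp add: gram_ols[symmetric] matrix_vector_mult_diff_distrib inner_diff_left inner_diff_right)
qed

text \<open>The conditional precision of the random effects given the response, as a quadratic
  form.\<close>

definition Hq :: "real^('d1 + 'd2::finite) \<Rightarrow> real^'q \<Rightarrow> real" where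
  "Hq \<theta> d = d \<bullet> d + (Lam \<theta> d \<bullet> (gram m z *v Lam \<theta> d)) / \<sigma>\<^sup>2"

text \<open>The minimum over w is attained at \<Lambda> h, the conditional mean of the random
  effects, and its value is the \<open>Km\<close> form. This plays the role of the Woodbury identity
  for the response covariance.\<close>

lemma complete_square:
  "w \<bullet> w + ((ols u - Lam \<theta> w) \<bullet> (gram m z *v (ols u - Lam \<theta> w))) / \<sigma>\<^sup>2
    = ols u \<bullet> (Km \<theta> *v ols u) + Hq \<theta> (w - Lam \<theta> (hh \<theta> u))"
proof -
  define \<beta> p d where "\<beta> = ols u" and "p = hh \<theta> u" and "d = w - Lam \<theta> p"
  \<comment> \<open>Writing the coefficients as \<open>Nm\<close> applied to p removes the inverse
    \<open>Km\<close> from the computation; what remains is polynomial in p and d apart from the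
    inverse Gram matrix.\<close>
  have \<beta>: "\<beta> = \<sigma>\<^sup>2 *\<^sub>R (Gi *v p) + Lam \<theta> (Lam \<theta> p)"
    unfolding Nm_Lam[symmetric] p_def hh_def Nm_Km by (simp add: \<beta>_def)
  have w: "w = d + Lam \<theta> p" by (simp add: d_def)
  have bl: "\<beta> - Lam \<theta> w = \<sigma>\<^sup>2 *\<^sub>R (Gi *v p) - Lam \<theta> d"
    by (simp add: \<beta> d_def Lam_diff)
  have G: "gram m z *v (\<sigma>\<^sup>2 *\<^sub>R (Gi *v p) - Lam \<theta> d) = \<sigma>\<^sup>2 *\<^sub>R p - gram m z *v Lam \<theta> d"
    by (simp add: matrix_vector_mult_diff_distrib matrix_vector_mult_scaleR gram_Gi)
  have "(Gi *v p) \<bullet> (gram m z *v Lam \<theta> d) = p \<bullet> Lam \<theta> d"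
    using sym_dot[OF transpose_gram[of m z], of "Gi *v p" "Lam \<theta> d"] by (simp add: gram_Gi)
  then have q: "(\<beta> - Lam \<theta> w) \<bullet> (gram m z *v (\<beta> - Lam \<theta> w))
    = \<sigma>\<^sup>2 * (\<sigma>\<^sup>2 * (p \<bullet> (Gi *v p))) - 2 * (\<sigma>\<^sup>2 * (p \<bullet> Lam \<theta> d)) + Lam \<theta> d \<bullet> (gram m z *v Lam \<theta> d)"
    unfolding bl G by (simp add: inner_diff_left inner_diff_right inner_commute algebra_simps)
  have "((\<beta> - Lam \<theta> w) \<bullet> (gram m z *v (\<beta> - Lam \<theta> w))) / \<sigma>\<^sup>2
    = \<sigma>\<^sup>2 * (p \<bullet> (Gi *v p)) - 2 * (p \<bullet> Lam \<theta> d) + (Lam \<theta> d \<bullet> (gram m z *v Lam \<theta> d)) / \<sigma>\<^sup>2"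
  proof -
    have "(s * A - 2 * (s * C) + D) / s = A - 2 * C + D / s" if "s \<noteq> 0" for s A C D :: real
      using that by (simp add: add_divide_distrib diff_divide_distrib)
    moreover have "\<sigma>\<^sup>2 \<noteq> 0" using sigma_pos by simp
    ultimately show ?thesis unfolding q .
  qed
  moreover have "w \<bullet> w = d \<bullet> d + 2 * (p \<bullet> Lam \<theta> d) + Lam \<theta> p \<bullet> Lam \<theta> p"
    unfolding w by (simp add: inner_add_left inner_add_right Lam_dot[of \<theta> p d, symmetric] inner_commute)
  moreover have "\<beta> \<bullet> p = \<sigma>\<^sup>2 * (p \<bullet> (Gi *v p)) + Lam \<theta> p \<bullet> Lam \<theta> p"
    by (subst \<beta>) (simp add: inner_add_left inner_add_right Lam_dot inner_commute)
  moreover have "Km \<theta> *v \<beta> = p" by (simp add: p_def hh_def \<beta>_def)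
  ultimately show ?thesis
    unfolding Hq_def p_def[symmetric] d_def[symmetric] \<beta>_def[symmetric] by simp
qed

definition "cst = (1 / sqrt (2 * pi)) ^ CARD('q) * (1 / sqrt (2 * pi * \<sigma>\<^sup>2)) ^ m"

lemma cst_pos: "0 < cst" using sigma_pos by (simp add: cst_def)

lemma prod_std_normal: "(\<Prod>l\<in>UNIV. std_normal_density (w $ l)) = (1 / sqrt (2 * pi)) ^ CARD('q) * exp (- (w \<bullet> w) / 2)"
  for w :: "real^'q"
  by (simp add: std_normal_density_def prod_dividef exp_sum[symmetric] sum_divide_distrib[symmetric] sum_negf
      inner_vec_def power2_eq_square power_divide)

lemma joint_eq:
  "lmm_joint_density m z a \<sigma> \<theta> w y x
    = cst * exp (- B \<theta> (res \<theta> y x) (res \<theta> y x) / 2) * exp (- Hq \<theta> (w - Lam \<theta> (hh \<theta> (res \<theta> y x))) / 2)"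
proof -
  let ?u = "res \<theta> y x"
  have "(\<Prod>k<m. normal_density (x k \<bullet> lmm_psi \<theta> + z k \<bullet> Lam \<theta> w) \<sigma> (y k))
    = (1 / sqrt (2 * pi * \<sigma>\<^sup>2)) ^ m * exp (- (\<Sum>k<m. (?u k - z k \<bullet> Lam \<theta> w)\<^sup>2) / (2 * \<sigma>\<^sup>2))"
    by (simp add: normal_density_def prod_dividef exp_sum[symmetric] sum_divide_distrib[symmetric] sum_negf
        power_divide res_def diff_diff_eq)
  then have "lmm_joint_density m z a \<sigma> \<theta> w y x
    = cst * exp (- (w \<bullet> w) / 2 + - (\<Sum>k<m. (?u k - z k \<bullet> Lam \<theta> w)\<^sup>2) / (2 * \<sigma>\<^sup>2))"
    unfolding lmm_joint_density_def Lambda_mult prod_std_normal cst_def exp_add by (simp add: mult_ac)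
  also have "- (w \<bullet> w) / 2 + - (\<Sum>k<m. (?u k - z k \<bullet> Lam \<theta> w)\<^sup>2) / (2 * \<sigma>\<^sup>2)
    = - ((ip ?u ?u - ols ?u \<bullet> (gram m z *v ols ?u)) / \<sigma>\<^sup>2 +
        (w \<bullet> w + ((ols ?u - Lam \<theta> w) \<bullet> (gram m z *v (ols ?u - Lam \<theta> w))) / \<sigma>\<^sup>2)) / 2"
    unfolding residual_sum using sigma_pos by (simp add: field_simps)
  also have "\<dots> = - B \<theta> ?u ?u / 2 + - Hq \<theta> (w - Lam \<theta> (hh \<theta> ?u)) / 2"
    unfolding complete_square B_def by simp
  finally show ?thesis unfolding exp_add by (simp add: mult_ac)
qed

text \<open>Deliberately left as an integral. Its value involves a determinant, but only positivity,
  the size and the derivatives of its logarithm matter, and the entropy inequality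
  \<open>lC_le\<close> supplies the last two.\<close>

definition J :: "real^('d1 + 'd2::finite) \<Rightarrow> real" where
  "J \<theta> = (\<integral>w. exp (- Hq \<theta> w / 2) \<partial>lborel)"

lemma Hq_measurable [measurable]: "Hq \<theta> \<in> borel_measurable borel"
  unfolding Hq_def[abs_def] Lam_def gram_mult
  by (intro borel_measurable_continuous_onI continuous_intros) (use sigma_pos in auto)

lemma J_integrable: "integrable lborel (\<lambda>w. exp (- Hq \<theta> w / 2))"
  and J_pos: "0 < J \<theta>"
proof -
  let ?c = "(1 / sqrt (2 * pi)) ^ CARD('q)"
  have c: "0 < ?c" by simp
  have "(\<integral>\<^sup>+w. ennreal (\<Prod>l\<in>UNIV. std_normal_density (w $ l)) \<partial>(lborel :: (real^'q) measure)) = 1"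
    using nn_integral_std_normal_vec[where F = "\<lambda>_::real^'q. 1"]
      prob_space.emeasure_space_1[OF prob_space_PiM_std_normal, of "UNIV :: 'q set"] by simp
  then have "integrable lborel (\<lambda>w :: real^'q. ?c * exp (- (w \<bullet> w) / 2))"
    unfolding prod_std_normal by (intro integrableI_nonneg) auto
  then have "integrable lborel (\<lambda>w :: real^'q. (1 / ?c) * (?c * exp (- (w \<bullet> w) / 2)))"
    by (rule integrable_mult_right)
  then have i: "integrable lborel (\<lambda>w :: real^'q. exp (- (w \<bullet> w) / 2))" using c by simp
  have "w \<bullet> w \<le> Hq \<theta> w" for w
  proof -
    have "0 \<le> inverse M * (Lam \<theta> w \<bullet> Lam \<theta> w)" using M_pos by simp
    also note gram_lower
    finally show ?thesis by (simp add: Hq_def)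
  qed
  then show I: "integrable lborel (\<lambda>w. exp (- Hq \<theta> w / 2))"
    by (intro Bochner_Integration.integrable_bound[OF i]) auto
  have "J \<theta> \<noteq> 0"
  proof
    assume "J \<theta> = 0"
    then have "AE w in (lborel :: (real^'q) measure). exp (- Hq \<theta> w / 2) = 0"
      using integral_nonneg_eq_0_iff_AE[OF I] by (simp add: J_def)
    then have "AE w in (lborel :: (real^'q) measure). False" by simp
    then show False by (simp add: eventually_False ae_filter_eq_bot_iff emeasure_lborel_UNIV)
  qed
  moreover have "0 \<le> J \<theta>" unfolding J_def by simp
  ultimately show "0 < J \<theta>" by simp
qed

definition dens :: "real^('d1 + 'd2::finite) \<Rightarrow> (nat \<Rightarrow> real) \<Rightarrow> (nat \<Rightarrow> real^'d2) \<Rightarrow> real" where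
  "dens \<theta> y x = (\<integral>w. lmm_joint_density m z a \<sigma> \<theta> w y x \<partial>lborel)"

definition lC :: "real^('d1 + 'd2::finite) \<Rightarrow> real" where
  "lC \<theta> = ln (cst * J \<theta>)"

text \<open>Once the square is completed, w enters only through a translate of \<open>Hq\<close>,
  and Lebesgue measure is translation invariant; so the integral over w is \<open>J\<close> for all
  data.\<close>

lemma joint_integrable: "integrable lborel (\<lambda>w. lmm_joint_density m z a \<sigma> \<theta> w y x)"
  and dens_eq: "dens \<theta> y x = exp (lC \<theta> - B \<theta> (res \<theta> y x) (res \<theta> y x) / 2)"
proof -
  let ?u = "res \<theta> y x" and ?w0 = "Lam \<theta> (hh \<theta> (res \<theta> y x))"
  have d: "distr lborel borel ((+) (- ?w0)) = lborel" by (rule lborel_distr_plus)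
  have "integrable (distr lborel borel ((+) (- ?w0))) (\<lambda>w. exp (- Hq \<theta> w / 2))"
    unfolding d by (rule J_integrable)
  then have i: "integrable lborel (\<lambda>w. exp (- Hq \<theta> (w - ?w0) / 2))"
    by (subst (asm) integrable_distr_eq) auto
  have "J \<theta> = (\<integral>w. exp (- Hq \<theta> w / 2) \<partial>distr lborel borel ((+) (- ?w0)))"
    unfolding d J_def ..
  also have "\<dots> = (\<integral>w. exp (- Hq \<theta> (w - ?w0) / 2) \<partial>lborel)"
    by (subst integral_distr) auto
  finally have e: "(\<integral>w. exp (- Hq \<theta> (w - ?w0) / 2) \<partial>lborel) = J \<theta>" ..
  show "integrable lborel (\<lambda>w. lmm_joint_density m z a \<sigma> \<theta> w y x)"
    unfolding joint_eq using i by (intro integrable_mult_right)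
  have l: "exp (lC \<theta>) = cst * J \<theta>"
    unfolding lC_def by (rule exp_ln) (rule mult_pos_pos[OF cst_pos J_pos])
  have "dens \<theta> y x = cst * exp (- B \<theta> ?u ?u / 2) * (\<integral>w. exp (- Hq \<theta> (w - ?w0) / 2) \<partial>lborel)"
    unfolding dens_def joint_eq by (rule integral_mult_right_zero)
  also have "\<dots> = exp (lC \<theta>) * exp (- B \<theta> ?u ?u / 2)"
    unfolding e l by (rule mult.commute[THEN trans]) (simp only: mult_ac)
  also have "\<dots> = exp (lC \<theta> - B \<theta> ?u ?u / 2)"
    unfolding exp_add[symmetric] by (rule arg_cong[where f = exp]) simp
  finally show "dens \<theta> y x = exp (lC \<theta> - B \<theta> ?u ?u / 2)" .
qed

lemma dens_pos: "0 < dens \<theta> y x"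
  and ln_dens: "ln (dens \<theta> y x) = lC \<theta> - B \<theta> (res \<theta> y x) (res \<theta> y x) / 2"
  unfolding dens_eq by simp_all

definition yobs :: "real^('d1 + 'd2::finite) \<Rightarrow> (nat \<Rightarrow> real^'d2) \<Rightarrow> 'q noise \<Rightarrow> nat \<Rightarrow> real" where
  "yobs \<theta> x \<omega> = (\<lambda>k\<in>{..<m}. x k \<bullet> lmm_psi \<theta> + z k \<bullet> Lam \<theta> (\<chi> l. fst \<omega> l) + \<sigma> * snd \<omega> k)"

text \<open>Tonelli brings the random effects outside; given them the responses are shifted and
  scaled noise. Integrals against the density thus become integrals of \<open>yobs\<close>, the
  response written as a function of noise whose law does not involve the parameter.\<close>

lemma nn_integral_dens:
  fixes F :: "(nat \<Rightarrow> real) \<Rightarrow> ennreal"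
  assumes F[measurable]: "F \<in> borel_measurable (PiM {..<m} (\<lambda>_. lborel))"
  shows "(\<integral>\<^sup>+y. ennreal (dens \<theta> y x) * F y \<partial>PiM {..<m} (\<lambda>_. lborel)) = (\<integral>\<^sup>+\<omega>. F (yobs \<theta> x \<omega>) \<partial>noise m)"
proof -
  let ?L = "PiM {..<m} (\<lambda>_. lborel :: real measure)" and ?N = "PiM {..<m} (\<lambda>_. std_normal)"
  let ?A = "PiM (UNIV :: 'q set) (\<lambda>_. std_normal)"
  interpret L: product_sigma_finite "\<lambda>_::nat. lborel :: real measure"
    by (simp add: product_sigma_finite_def sigma_finite_lborel)
  have sL: "sigma_finite_measure ?L" by (rule L.sigma_finite) simp
  interpret P: pair_sigma_finite ?L "lborel :: (real^'q) measure"
    using sL sigma_finite_lborel by (simp add: pair_sigma_finite_def)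
  interpret N: prob_space ?N by (rule prob_space_PiM_std_normal)
  let ?mu = "\<lambda>w k. x k \<bullet> lmm_psi \<theta> + z k \<bullet> Lam \<theta> w"
  have Lam_meas[measurable]: "(\<lambda>w. z k \<bullet> Lam \<theta> w) \<in> borel_measurable borel" for k
    unfolding Lam_def by (intro borel_measurable_continuous_onI continuous_intros)
  have [measurable]: "(\<lambda>p. lmm_joint_density m z a \<sigma> \<theta> (snd p) (fst p) x) \<in> borel_measurable (?L \<Otimes>\<^sub>M (lborel :: (real^'q) measure))"
    unfolding lmm_joint_density_def Lambda_mult normal_density_def by measurable
  have "(\<integral>\<^sup>+y. ennreal (dens \<theta> y x) * F y \<partial>?L) = (\<integral>\<^sup>+y. (\<integral>\<^sup>+w. ennreal (lmm_joint_density m z a \<sigma> \<theta> w y x) * F y \<partial>lborel) \<partial>?L)"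
  proof (intro nn_integral_cong)
    fix y
    have "(\<integral>\<^sup>+w. ennreal (lmm_joint_density m z a \<sigma> \<theta> w y x) \<partial>lborel) = ennreal (dens \<theta> y x)"
      unfolding dens_def
      by (rule nn_integral_eq_integral[OF joint_integrable]) (auto simp: joint_eq intro!: AE_I2 mult_nonneg_nonneg less_imp_le[OF cst_pos])
    then show "ennreal (dens \<theta> y x) * F y = (\<integral>\<^sup>+w. ennreal (lmm_joint_density m z a \<sigma> \<theta> w y x) * F y \<partial>lborel)"
      using joint_integrable[of \<theta> y x, THEN borel_measurable_integrable]
      by (subst nn_integral_multc) auto
  qed
  also have "\<dots> = (\<integral>\<^sup>+w. (\<integral>\<^sup>+y. ennreal (lmm_joint_density m z a \<sigma> \<theta> w y x) * F y \<partial>?L) \<partial>lborel)"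
    by (rule P.Fubini'[symmetric]) measurable
  also have "\<dots> = (\<integral>\<^sup>+w. ennreal (\<Prod>l\<in>UNIV. std_normal_density (w $ l)) *
      (\<integral>\<^sup>+\<epsilon>. F (\<lambda>k\<in>{..<m}. ?mu w k + \<sigma> * \<epsilon> k) \<partial>?N) \<partial>lborel)"
  proof (intro nn_integral_cong)
    fix w :: "real^'q"
    have "(\<integral>\<^sup>+y. ennreal (lmm_joint_density m z a \<sigma> \<theta> w y x) * F y \<partial>?L)
      = (\<integral>\<^sup>+y. ennreal (\<Prod>l\<in>UNIV. std_normal_density (w $ l)) * (ennreal (\<Prod>k<m. normal_density (?mu w k) \<sigma> (y k)) * F y) \<partial>?L)"
      unfolding lmm_joint_density_def Lambda_mult
      by (intro nn_integral_cong) (simp add: ennreal_mult prod_nonneg normal_density_nonneg mult.assoc)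
    also have "\<dots> = ennreal (\<Prod>l\<in>UNIV. std_normal_density (w $ l)) * (\<integral>\<^sup>+y. ennreal (\<Prod>k<m. normal_density (?mu w k) \<sigma> (y k)) * F y \<partial>?L)"
      by (rule nn_integral_cmult) measurable
    finally show "(\<integral>\<^sup>+y. ennreal (lmm_joint_density m z a \<sigma> \<theta> w y x) * F y \<partial>?L)
      = ennreal (\<Prod>l\<in>UNIV. std_normal_density (w $ l)) * (\<integral>\<^sup>+\<epsilon>. F (\<lambda>k\<in>{..<m}. ?mu w k + \<sigma> * \<epsilon> k) \<partial>?N)"
      unfolding nn_integral_normal_product[OF sigma_pos F] .
  qed
  also have "\<dots> = (\<integral>\<^sup>+v. (\<integral>\<^sup>+\<epsilon>. F (\<lambda>k\<in>{..<m}. ?mu (\<chi> l. v l) k + \<sigma> * \<epsilon> k) \<partial>?N) \<partial>?A)"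
  proof (rule nn_integral_std_normal_vec)
    have "(\<lambda>p. F (\<lambda>k\<in>{..<m}. ?mu (fst p) k + \<sigma> * snd p k)) \<in> borel_measurable (borel \<Otimes>\<^sub>M ?N)"
      by measurable
    then show "(\<lambda>w. \<integral>\<^sup>+\<epsilon>. F (\<lambda>k\<in>{..<m}. ?mu w k + \<sigma> * \<epsilon> k) \<partial>?N) \<in> borel_measurable borel"
      using N.borel_measurable_nn_integral_fst[of "\<lambda>p. F (\<lambda>k\<in>{..<m}. ?mu (fst p) k + \<sigma> * snd p k)" borel] by simp
  qed
  also have "\<dots> = (\<integral>\<^sup>+\<omega>. F (yobs \<theta> x \<omega>) \<partial>noise m)"
  proof -
    have "(\<lambda>v. (\<chi> l. v l) :: real^'q) \<in> borel_measurable ?A"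
      by (subst borel_measurable_euclidean_space) (auto simp: Basis_vec_def inner_axis)
    then have [measurable]: "(\<lambda>p. z k \<bullet> Lam \<theta> (\<chi> l. fst p l)) \<in> borel_measurable (?A \<Otimes>\<^sub>M ?N)" for k
      by measurable
    have "(\<lambda>p. F (yobs \<theta> x p)) \<in> borel_measurable (?A \<Otimes>\<^sub>M ?N)"
      unfolding yobs_def by measurable
    from N.nn_integral_fst[OF this] show ?thesis unfolding noise_def by (simp add: yobs_def)
  qed
  finally show ?thesis .
qed

subsection \<open>Moments of the reduced score\<close>

text \<open>The residual at the generating parameter. The predictors cancel, so conditional moments
  given X reduce to moments of the noise alone.\<close>

definition uobs :: "real^('d1 + 'd2::finite) \<Rightarrow> 'q noise \<Rightarrow> nat \<Rightarrow> real" where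
  "uobs \<theta> \<omega> k = z k \<bullet> Lam \<theta> (\<chi> l. fst \<omega> l) + \<sigma> * snd \<omega> k"

lemma res_yobs: "k < m \<Longrightarrow> res \<theta> (yobs \<theta> x \<omega>) x k = uobs \<theta> \<omega> k"
  by (simp add: res_def yobs_def uobs_def)

lemma ols_cong: "(\<And>k. k < m \<Longrightarrow> u k = v k) \<Longrightarrow> ols u = ols v"
  unfolding ols_def by (rule arg_cong[where f = "(*v) Gi"]) (auto intro: sum.cong)

lemma ip_cong: "(\<And>k. k < m \<Longrightarrow> u k = u' k) \<Longrightarrow> (\<And>k. k < m \<Longrightarrow> v k = v' k) \<Longrightarrow> ip u v = ip u' v'"
  unfolding ip_def by (auto intro: sum.cong)

lemma B_cong: "(\<And>k. k < m \<Longrightarrow> u k = u' k) \<Longrightarrow> (\<And>k. k < m \<Longrightarrow> v k = v' k) \<Longrightarrow> B \<theta> u v = B \<theta> u' v'"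
  unfolding B_def using ols_cong[of u u'] ols_cong[of v v'] ip_cong[of u u' v v'] by simp

lemma hh_cong: "(\<And>k. k < m \<Longrightarrow> u k = v k) \<Longrightarrow> hh \<theta> u = hh \<theta> v"
  unfolding hh_def using ols_cong[of u v] by simp

text \<open>Noise coefficients of the linear functionals entering the reduced score:
  \<open>cf\<close> for p . ols, \<open>rf\<close> for the residual form with v, and
  \<open>cb\<close> for \<open>B\<close> with v. Covariances then become the inner products
  \<open>dotp\<close> of coefficient vectors.\<close>

definition cf :: "real^('d1 + 'd2::finite) \<Rightarrow> real^'q \<Rightarrow> 'q + nat \<Rightarrow> real" where
  "cf \<theta> p s = (case s of Inl l \<Rightarrow> Lam \<theta> p $ l | Inr k \<Rightarrow> \<sigma> * (z k \<bullet> (Gi *v p)))"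

definition rf :: "(nat \<Rightarrow> real) \<Rightarrow> 'q + nat \<Rightarrow> real" where
  "rf v s = (case s of Inl l \<Rightarrow> 0 | Inr k \<Rightarrow> \<sigma> * (v k - z k \<bullet> ols v))"

definition cb :: "real^('d1 + 'd2::finite) \<Rightarrow> (nat \<Rightarrow> real) \<Rightarrow> 'q + nat \<Rightarrow> real" where
  "cb \<theta> v s = rf v s / \<sigma>\<^sup>2 + cf \<theta> (hh \<theta> v) s"

lemma sum_Plus_split: "(\<Sum>s\<in>(UNIV :: 'q set) <+> {..<m}. F s) = (\<Sum>l\<in>UNIV. F (Inl l)) + (\<Sum>k<m. F (Inr k))"
  for F :: "'q + nat \<Rightarrow> real"
  by (subst sum.Plus) auto

lemma lin_split: "lin m p \<omega> = (\<Sum>l\<in>UNIV. p (Inl l) * fst \<omega> l) + (\<Sum>k<m. p (Inr k) * snd \<omega> k)"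
  for p :: "'q + nat \<Rightarrow> real"
  unfolding lin_def sum_Plus_split by (simp add: coord_def)

lemma residual_ortho: "(\<Sum>k<m. (v k - z k \<bullet> ols v) * (z k \<bullet> p)) = 0"
proof -
  have "(\<Sum>k<m. (v k - z k \<bullet> ols v) * (z k \<bullet> p)) = (\<Sum>k<m. v k *\<^sub>R z k) \<bullet> p - ols v \<bullet> (gram m z *v p)"
    unfolding gram_dot by (simp add: inner_sum_left sum_subtractf left_diff_distrib)
  also have "(\<Sum>k<m. v k *\<^sub>R z k) \<bullet> p = ols v \<bullet> (gram m z *v p)"
    using sym_dot[OF transpose_gram[of m z], of "ols v" p] by (simp add: gram_ols)
  finally show ?thesis by simp
qed

lemma lin_cf: "lin m (cf \<theta> p) \<omega> = p \<bullet> ols (uobs \<theta> \<omega>)"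
proof -
  let ?w = "Lam \<theta> (\<chi> l. fst \<omega> l)"
  have "p \<bullet> ols (uobs \<theta> \<omega>) = (Gi *v p) \<bullet> (\<Sum>k<m. uobs \<theta> \<omega> k *\<^sub>R z k)"
    unfolding ols_def using sym_dot[OF Gi_bounds(3), of p] by simp
  also have "\<dots> = (\<Sum>k<m. (z k \<bullet> ?w) * (z k \<bullet> (Gi *v p))) + (\<Sum>k<m. \<sigma> * (z k \<bullet> (Gi *v p)) * snd \<omega> k)"
    by (simp add: inner_sum_right uobs_def sum.distrib inner_commute algebra_simps)
  also have "(\<Sum>k<m. (z k \<bullet> ?w) * (z k \<bullet> (Gi *v p))) = (\<Sum>l\<in>UNIV. Lam \<theta> p $ l * fst \<omega> l)"
    unfolding gram_dot[symmetric] gram_Gi Lam_dot by (simp add: inner_vec_def mult.commute)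
  finally show ?thesis unfolding lin_split by (simp add: cf_def)
qed

lemma lin_rf: "lin m (rf v) \<omega> = ip v (uobs \<theta> \<omega>) - ols v \<bullet> (gram m z *v ols (uobs \<theta> \<omega>))"
proof -
  let ?u = "uobs \<theta> \<omega>"
  have "ip v ?u - ols v \<bullet> (gram m z *v ols ?u) = (\<Sum>k<m. (v k - z k \<bullet> ols v) * ?u k)"
    unfolding gram_ols by (simp add: ip_def inner_sum_right sum_subtractf inner_commute algebra_simps)
  also have "\<dots> = (\<Sum>k<m. (v k - z k \<bullet> ols v) * (z k \<bullet> Lam \<theta> (\<chi> l. fst \<omega> l))) + (\<Sum>k<m. \<sigma> * (v k - z k \<bullet> ols v) * snd \<omega> k)"
    by (simp add: uobs_def distrib_left sum.distrib mult_ac)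
  finally show ?thesis unfolding residual_ortho lin_split by (simp add: rf_def)
qed

lemma dotp_split: "dotp m p p' = (\<Sum>l\<in>UNIV. p (Inl l) * p' (Inl l)) + (\<Sum>k<m. p (Inr k) * p' (Inr k))"
  for p p' :: "'q + nat \<Rightarrow> real"
  unfolding dotp_def sum_Plus_split ..

lemma dotp_cf: "dotp m (cf \<theta> p) (cf \<theta> p') = p \<bullet> (Nm \<theta> *v p')"
proof -
  have "dotp m (cf \<theta> p) (cf \<theta> p') = Lam \<theta> p \<bullet> Lam \<theta> p' + \<sigma>\<^sup>2 * ((Gi *v p) \<bullet> (gram m z *v (Gi *v p')))"
    unfolding dotp_split gram_dot by (simp add: cf_def inner_vec_def sum_distrib_left power2_eq_square mult_ac)
  also have "\<dots> = p \<bullet> (Nm \<theta> *v p')"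
    using sym_dot[OF Gi_bounds(3), of p p'] by (simp add: gram_Gi Nm_Lam inner_add_right Lam_dot)
  finally show ?thesis .
qed

lemma dotp_rf: "dotp m (rf v) (rf v') = \<sigma>\<^sup>2 * (ip v v' - ols v \<bullet> (gram m z *v ols v'))"
  unfolding dotp_split residual_ip[symmetric] by (simp add: rf_def sum_distrib_left power2_eq_square mult_ac)

lemma dotp_rf_cf: "dotp m (rf v) (cf \<theta> p) = 0"
proof -
  have "dotp m (rf v) (cf \<theta> p) = \<sigma>\<^sup>2 * (\<Sum>k<m. (v k - z k \<bullet> ols v) * (z k \<bullet> (Gi *v p)))"
    unfolding dotp_split by (simp add: rf_def cf_def sum_distrib_left power2_eq_square mult_ac)
  then show ?thesis by (simp add: residual_ortho)
qed

text \<open>For u with covariance S, the functionals v . S^-1 u have covariance v . S^-1 v'. In the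
  present coordinates the residual and fitted parts are uncorrelated, and \<open>Nm\<close> cancels
  one of two factors \<open>Km\<close>.\<close>

lemma dotp_cb: "dotp m (cb \<theta> v) (cb \<theta> v') = B \<theta> v v'"
proof -
  have "dotp m (cb \<theta> v) (cb \<theta> v') = dotp m (rf v) (rf v') / (\<sigma>\<^sup>2 * \<sigma>\<^sup>2) + dotp m (rf v) (cf \<theta> (hh \<theta> v')) / \<sigma>\<^sup>2
    + dotp m (rf v') (cf \<theta> (hh \<theta> v)) / \<sigma>\<^sup>2 + dotp m (cf \<theta> (hh \<theta> v)) (cf \<theta> (hh \<theta> v'))"
    unfolding dotp_def cb_def
    by (simp add: sum_divide_distrib sum.distrib[symmetric] algebra_simps add_divide_distrib)
  also have "\<dots> = (ip v v' - ols v \<bullet> (gram m z *v ols v')) / \<sigma>\<^sup>2 + hh \<theta> v \<bullet> ols v'"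
    unfolding dotp_rf dotp_rf_cf dotp_cf hh_def[of \<theta> v'] Nm_Km using sigma_pos by (simp add: power2_eq_square)
  also have "hh \<theta> v \<bullet> ols v' = ols v \<bullet> (Km \<theta> *v ols v')"
    unfolding hh_def by (rule sym_dot[OF Km_sym])
  finally show ?thesis by (simp add: B_def)
qed

abbreviation "ch \<theta> l \<equiv> cf \<theta> (Km \<theta> *v axis l 1)"

lemma dotp_ch: "dotp m (ch \<theta> l) (ch \<theta> i) = Km \<theta> $ l $ i"
  unfolding dotp_cf Nm_Km
  by (simp add: inner_axis matrix_vector_mult_basis column_def Km_sym'[of \<theta> i l])

lemma hh_lin: "hh \<theta> (uobs \<theta> \<omega>) $ l = lin m (ch \<theta> l) \<omega>"
  unfolding lin_cf hh_def using sym_dot[OF Km_sym[of \<theta>], of "axis l 1" "ols (uobs \<theta> \<omega>)"]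
  by (simp add: inner_axis')

lemma B_lin: "B \<theta> v (uobs \<theta> \<omega>) = lin m (cb \<theta> v) \<omega>"
proof -
  have "lin m (cb \<theta> v) \<omega> = lin m (rf v) \<omega> / \<sigma>\<^sup>2 + lin m (cf \<theta> (hh \<theta> v)) \<omega>"
    unfolding lin_def cb_def by (simp add: sum_divide_distrib sum.distrib[symmetric] algebra_simps)
  also have "lin m (cf \<theta> (hh \<theta> v)) \<omega> = ols v \<bullet> (Km \<theta> *v ols (uobs \<theta> \<omega>))"
    unfolding lin_cf hh_def by (rule sym_dot[OF Km_sym])
  finally show ?thesis unfolding lin_rf[of v \<omega> \<theta>] by (simp add: B_def)
qed

text \<open>The conditional covariance matrix of the reduced score given the predictors, by
  \<open>rscore_moments\<close>. Only its \<psi>-block depends on them.\<close>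

definition Vx :: "real^('d1 + 'd2::finite) \<Rightarrow> (nat \<Rightarrow> real^'d2) \<Rightarrow> real^('d1 + 'd2)^('d1 + 'd2)" where
  "Vx \<theta> x = (\<chi> c c'. case (c, c') of
      (Inl j, Inl k) \<Rightarrow> 2 * (\<Sum>l\<in>{l. a l = j}. \<Sum>i\<in>{i. a i = k}. (Km \<theta> $ l $ i)\<^sup>2)
    | (Inr b, Inr b') \<Rightarrow> B \<theta> (col x b) (col x b')
    | _ \<Rightarrow> 0)"

lemma rscore_lin:
  "rscore \<theta> (yobs \<theta> x \<omega>) x $ Inl j = (\<Sum>l\<in>{l. a l = j}. lin m (ch \<theta> l) \<omega> * lin m (ch \<theta> l) \<omega> - Km \<theta> $ l $ l)"
  "rscore \<theta> (yobs \<theta> x \<omega>) x $ Inr b = lin m (cb \<theta> (col x b)) \<omega>"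
proof -
  have h: "hh \<theta> (res \<theta> (yobs \<theta> x \<omega>) x) = hh \<theta> (uobs \<theta> \<omega>)"
    by (rule hh_cong) (rule res_yobs)
  have b: "B \<theta> (col x b) (res \<theta> (yobs \<theta> x \<omega>) x) = B \<theta> (col x b) (uobs \<theta> \<omega>)"
    by (rule B_cong) (simp_all add: res_yobs)
  show "rscore \<theta> (yobs \<theta> x \<omega>) x $ Inl j = (\<Sum>l\<in>{l. a l = j}. lin m (ch \<theta> l) \<omega> * lin m (ch \<theta> l) \<omega> - Km \<theta> $ l $ l)"
    by (simp add: rscore_def h hh_lin power2_eq_square)
  show "rscore \<theta> (yobs \<theta> x \<omega>) x $ Inr b = lin m (cb \<theta> (col x b)) \<omega>"
    by (simp add: rscore_def b B_lin)
qed

text \<open>The \<lambda>-components are sums of centred squares of Gaussians, whose covariances are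
  twice the squared covariances by Wick; the \<psi>-components are linear. Mixed products are of odd
  order, so their means vanish.\<close>

lemma rscore_moments:
  shows "integrable (noise m) (\<lambda>\<omega>. rscore \<theta> (yobs \<theta> x \<omega>) x $ c)"
    "(\<integral>\<omega>. rscore \<theta> (yobs \<theta> x \<omega>) x $ c \<partial>noise m) = 0"
    "integrable (noise m) (\<lambda>\<omega>. rscore \<theta> (yobs \<theta> x \<omega>) x $ c * rscore \<theta> (yobs \<theta> x \<omega>) x $ c')"
    "(\<integral>\<omega>. rscore \<theta> (yobs \<theta> x \<omega>) x $ c * rscore \<theta> (yobs \<theta> x \<omega>) x $ c' \<partial>noise m) = Vx \<theta> x $ c $ c'"
proof -
  interpret prob_space "noise m :: 'q noise measure" by (rule prob_space_noise)
  let ?U = "\<lambda>c \<omega>. rscore \<theta> (yobs \<theta> x \<omega>) x $ c"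
  define L where "L l \<omega> = lin m (ch \<theta> l) \<omega>" for l \<omega>
  define H where "H l \<omega> = L l \<omega> * L l \<omega> - Km \<theta> $ l $ l" for l \<omega>
  define R where "R b \<omega> = lin m (cb \<theta> (col x b)) \<omega>" for b \<omega>
  note lm = lin_moments[where 'a = 'q and m = m]
  have U1: "?U (Inl j) \<omega> = (\<Sum>l\<in>{l. a l = j}. H l \<omega>)" and U2: "?U (Inr b) \<omega> = R b \<omega>" for j b \<omega>
    by (simp_all add: rscore_lin H_def L_def R_def)
  have LL: "integrable (noise m) (\<lambda>\<omega>. L l \<omega> * L i \<omega>)" "expectation (\<lambda>\<omega>. L l \<omega> * L i \<omega>) = Km \<theta> $ l $ i" for l i
    unfolding L_def by (simp_all add: lm dotp_ch)
  have H1: "integrable (noise m) (H l)" "expectation (H l) = 0" for l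
    unfolding H_def by (simp_all add: LL prob_space)
  have HH: "integrable (noise m) (\<lambda>\<omega>. H l \<omega> * H i \<omega>)" "expectation (\<lambda>\<omega>. H l \<omega> * H i \<omega>) = 2 * (Km \<theta> $ l $ i)\<^sup>2" for l i
  proof -
    have e: "H l \<omega> * H i \<omega> = L l \<omega> * L l \<omega> * L i \<omega> * L i \<omega> - Km \<theta> $ i $ i * (L l \<omega> * L l \<omega>)
      - Km \<theta> $ l $ l * (L i \<omega> * L i \<omega>) + Km \<theta> $ l $ l * Km \<theta> $ i $ i" for \<omega>
      by (simp add: H_def algebra_simps)
    have i4: "integrable (noise m) (\<lambda>\<omega>. L l \<omega> * L l \<omega> * L i \<omega> * L i \<omega>)"
      "expectation (\<lambda>\<omega>. L l \<omega> * L l \<omega> * L i \<omega> * L i \<omega>) = Km \<theta> $ l $ l * Km \<theta> $ i $ i + 2 * (Km \<theta> $ l $ i)\<^sup>2"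
      unfolding L_def by (simp_all add: lm dotp_ch power2_eq_square)
    show "integrable (noise m) (\<lambda>\<omega>. H l \<omega> * H i \<omega>)" unfolding e by (simp add: i4 LL)
    show "expectation (\<lambda>\<omega>. H l \<omega> * H i \<omega>) = 2 * (Km \<theta> $ l $ i)\<^sup>2"
      unfolding e by (simp add: i4 LL prob_space)
  qed
  have R1: "integrable (noise m) (R b)" "expectation (R b) = 0" for b
    unfolding R_def by (simp_all add: lm)
  have RR: "integrable (noise m) (\<lambda>\<omega>. R b \<omega> * R b' \<omega>)" "expectation (\<lambda>\<omega>. R b \<omega> * R b' \<omega>) = B \<theta> (col x b) (col x b')" for b b'
    unfolding R_def by (simp_all add: lm dotp_cb)
  have HR: "integrable (noise m) (\<lambda>\<omega>. H l \<omega> * R b \<omega>)" "expectation (\<lambda>\<omega>. H l \<omega> * R b \<omega>) = 0" for l b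
  proof -
    have e: "H l \<omega> * R b \<omega> = L l \<omega> * L l \<omega> * R b \<omega> - Km \<theta> $ l $ l * R b \<omega>" for \<omega>
      by (simp add: H_def algebra_simps)
    have "integrable (noise m) (\<lambda>\<omega>. L l \<omega> * L l \<omega> * R b \<omega>)" "expectation (\<lambda>\<omega>. L l \<omega> * L l \<omega> * R b \<omega>) = 0"
      unfolding L_def R_def by (simp_all add: lm)
    then show "integrable (noise m) (\<lambda>\<omega>. H l \<omega> * R b \<omega>)" "expectation (\<lambda>\<omega>. H l \<omega> * R b \<omega>) = 0"
      unfolding e by (simp_all add: R1)
  qed
  show "integrable (noise m) (?U c)" "expectation (?U c) = 0"
    by (cases c; simp add: U1 U2 H1 R1 Bochner_Integration.integral_sum)+
  have RH: "integrable (noise m) (\<lambda>\<omega>. R b \<omega> * H l \<omega>)" "expectation (\<lambda>\<omega>. R b \<omega> * H l \<omega>) = 0" for l b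
    using HR[of l b] by (simp_all only: mult.commute)
  have "integrable (noise m) (\<lambda>\<omega>. ?U c \<omega> * ?U c' \<omega>) \<and> expectation (\<lambda>\<omega>. ?U c \<omega> * ?U c' \<omega>) = Vx \<theta> x $ c $ c'"
  proof (cases c; cases c')
    fix j k assume c: "c = Inl j" "c' = Inl k"
    have e: "?U c \<omega> * ?U c' \<omega> = (\<Sum>l\<in>{l. a l = j}. \<Sum>i\<in>{i. a i = k}. H l \<omega> * H i \<omega>)" for \<omega>
      unfolding c U1 by (rule sum_product)
    show ?thesis unfolding e by (simp add: HH c Vx_def sum_distrib_left)
  next
    fix j b assume c: "c = Inl j" "c' = Inr b"
    have e: "?U c \<omega> * ?U c' \<omega> = (\<Sum>l\<in>{l. a l = j}. H l \<omega> * R b \<omega>)" for \<omega>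
      unfolding c U1 U2 by (rule sum_distrib_right)
    show ?thesis unfolding e by (simp add: HR c Vx_def)
  next
    fix b j assume c: "c = Inr b" "c' = Inl j"
    have e: "?U c \<omega> * ?U c' \<omega> = (\<Sum>l\<in>{l. a l = j}. R b \<omega> * H l \<omega>)" for \<omega>
      unfolding c U1 U2 by (rule sum_distrib_left)
    show ?thesis unfolding e by (simp add: RH c Vx_def)
  next
    fix b b' assume c: "c = Inr b" "c' = Inr b'"
    show ?thesis unfolding c U2 by (simp add: RR Vx_def)
  qed
  then show "integrable (noise m) (\<lambda>\<omega>. ?U c \<omega> * ?U c' \<omega>)" "expectation (\<lambda>\<omega>. ?U c \<omega> * ?U c' \<omega>) = Vx \<theta> x $ c $ c'"
    by simp_all
qed

section \<open>The conditional covariance as a quadratic form, and the growth of residuals\<close>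

lemma transpose_Vx: "transpose (Vx \<theta> x) = Vx \<theta> x"
proof -
  have "Vx \<theta> x $ c $ c' = Vx \<theta> x $ c' $ c" for c c'
  proof (cases c; cases c')
    fix j k assume "c = Inl j" "c' = Inl k"
    moreover have "(\<Sum>l\<in>{l. a l = j}. \<Sum>i\<in>{i. a i = k}. (Km \<theta> $ l $ i)\<^sup>2) = (\<Sum>i\<in>{i. a i = k}. \<Sum>l\<in>{l. a l = j}. (Km \<theta> $ l $ i)\<^sup>2)"
      by (rule sum.swap)
    ultimately show ?thesis by (simp add: Vx_def Km_sym'[of \<theta> _ _])
  qed (auto simp: Vx_def B_commute)
  then show ?thesis by (simp add: vec_eq_iff transpose_def)
qed

lemma sum_UNIV_Plus: "(\<Sum>c\<in>UNIV. F c) = (\<Sum>j\<in>UNIV. F (Inl j)) + (\<Sum>b\<in>UNIV. F (Inr b))"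
  for F :: "'x::finite + 'y::finite \<Rightarrow> real"
  using sum.Plus[of UNIV UNIV F] by (simp add: UNIV_Plus_UNIV)

lemma sum_pattern: "(\<Sum>j\<in>UNIV. \<Sum>l\<in>{l. a l = j}. F j l) = (\<Sum>l\<in>UNIV. F (a l) l)" for F :: "'d1 \<Rightarrow> 'q \<Rightarrow> real"
proof -
  have "(\<Sum>j\<in>UNIV. \<Sum>l\<in>{l. a l = j}. F j l) = (\<Sum>j\<in>UNIV. \<Sum>l\<in>{l \<in> UNIV. a l = j}. F (a l) l)"
    by (intro sum.cong) auto
  also have "\<dots> = (\<Sum>l\<in>UNIV. F (a l) l)" by (rule sum.group) auto
  finally show ?thesis .
qed

definition vcomb :: "real^('d1 + 'd2::finite) \<Rightarrow> (nat \<Rightarrow> real^'d2) \<Rightarrow> nat \<Rightarrow> real" where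
  "vcomb w x k = x k \<bullet> lmm_psi w"

lemma B_sum:
  assumes "finite A"
  shows "B \<theta> (\<lambda>k. \<Sum>b\<in>A. t b * f b k) v = (\<Sum>b\<in>A. t b * B \<theta> (f b) v)"
  using assms
proof (induction A)
  case empty
  have "B \<theta> (\<lambda>k. 0 + (- 1) * 0) v = B \<theta> (\<lambda>k. 0) v + (- 1) * B \<theta> (\<lambda>k. 0) v" by (rule B_linear)
  then show ?case by simp
next
  case (insert b A)
  then show ?case
    using B_linear[of \<theta> "\<lambda>k. \<Sum>b\<in>A. t b * f b k" "t b" "f b" v] by (simp add: add.commute)
qed

lemma vcomb_eq: "vcomb w x = (\<lambda>k. \<Sum>b\<in>UNIV. w $ Inr b * col x b k)"
  by (simp add: fun_eq_iff vcomb_def lmm_psi_def inner_vec_def col_def mult.commute)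

text \<open>The pattern a is undone: summing over positions l instead of parameters j turns the
  \<lambda>-block into a form to which \<open>hadamard_square_bounds\<close> applies directly. The
  \<psi>-block collapses to \<open>B\<close> by bilinearity.\<close>

lemma Vx_form: "w \<bullet> (Vx \<theta> x *v w)
  = 2 * (\<Sum>l\<in>UNIV. \<Sum>i\<in>UNIV. w $ Inl (a l) * w $ Inl (a i) * (Km \<theta> $ l $ i)\<^sup>2) + B \<theta> (vcomb w x) (vcomb w x)"
proof -
  have "w \<bullet> (Vx \<theta> x *v w) = (\<Sum>c\<in>UNIV. \<Sum>c'\<in>UNIV. w $ c * w $ c' * Vx \<theta> x $ c $ c')"
    by (simp add: inner_vec_def matrix_vector_mult_def sum_distrib_left mult_ac)
  also have "\<dots> = (\<Sum>j\<in>UNIV. \<Sum>k\<in>UNIV. w $ Inl j * w $ Inl k * (2 * (\<Sum>l\<in>{l. a l = j}. \<Sum>i\<in>{i. a i = k}. (Km \<theta> $ l $ i)\<^sup>2)))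
    + (\<Sum>b\<in>UNIV. \<Sum>b'\<in>UNIV. w $ Inr b * w $ Inr b' * B \<theta> (col x b) (col x b'))"
    unfolding sum_UNIV_Plus by (simp add: Vx_def)
  also have "(\<Sum>j\<in>UNIV. \<Sum>k\<in>UNIV. w $ Inl j * w $ Inl k * (2 * (\<Sum>l\<in>{l. a l = j}. \<Sum>i\<in>{i. a i = k}. (Km \<theta> $ l $ i)\<^sup>2)))
    = (\<Sum>j\<in>UNIV. \<Sum>l\<in>{l. a l = j}. \<Sum>k\<in>UNIV. \<Sum>i\<in>{i. a i = k}. 2 * (w $ Inl j * w $ Inl k * (Km \<theta> $ l $ i)\<^sup>2))"
  proof (rule sum.cong[OF refl])
    fix j
    show "(\<Sum>k\<in>UNIV. w $ Inl j * w $ Inl k * (2 * (\<Sum>l\<in>{l. a l = j}. \<Sum>i\<in>{i. a i = k}. (Km \<theta> $ l $ i)\<^sup>2)))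
      = (\<Sum>l\<in>{l. a l = j}. \<Sum>k\<in>UNIV. \<Sum>i\<in>{i. a i = k}. 2 * (w $ Inl j * w $ Inl k * (Km \<theta> $ l $ i)\<^sup>2))"
      by (subst sum.swap) (simp add: sum_distrib_left mult_ac)
  qed
  also have "\<dots> = 2 * (\<Sum>l\<in>UNIV. \<Sum>i\<in>UNIV. w $ Inl (a l) * w $ Inl (a i) * (Km \<theta> $ l $ i)\<^sup>2)"
    unfolding sum_pattern by (simp add: sum_distrib_left)
  also have "(\<Sum>b\<in>UNIV. \<Sum>b'\<in>UNIV. w $ Inr b * w $ Inr b' * B \<theta> (col x b) (col x b')) = B \<theta> (vcomb w x) (vcomb w x)"
  proof -
    have "B \<theta> (vcomb w x) (vcomb w x) = (\<Sum>b\<in>UNIV. w $ Inr b * B \<theta> (vcomb w x) (col x b))"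
      by (subst vcomb_eq, subst B_sum) (simp_all add: B_commute[of \<theta> "vcomb w x"])
    also have "\<dots> = (\<Sum>b\<in>UNIV. w $ Inr b * (\<Sum>b'\<in>UNIV. w $ Inr b' * B \<theta> (col x b') (col x b)))"
      unfolding vcomb_eq by (subst B_sum) simp_all
    finally show ?thesis by (simp add: sum_distrib_left mult.assoc B_commute[of \<theta> "col x _" "col x _"])
  qed
  finally show ?thesis .
qed

lemma ip_vcomb: "ip (vcomb w x) (vcomb w x) = lmm_psi w \<bullet> (gram m x *v lmm_psi w)"
  by (simp add: ip_def vcomb_def gram_mult inner_sum_right inner_commute)

lemma sum_row_norm: "(\<Sum>k<m. (norm (x k))\<^sup>2) = nrmX x" for x :: "nat \<Rightarrow> real^'d2::finite"
proof -
  have "(\<Sum>k<m. (norm (x k))\<^sup>2) = (\<Sum>k<m. \<Sum>b\<in>UNIV. (x k $ b)\<^sup>2)"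
    by (simp add: power2_norm_eq_inner) (simp add: inner_vec_def power2_eq_square)
  also have "\<dots> = nrmX x"
    unfolding nrmX_def nrm_sq by (subst sum.swap) (simp add: ip_def col_def power2_eq_square)
  finally show ?thesis .
qed

lemma vcomb_bound: "ip (vcomb w x) (vcomb w x) \<le> (w \<bullet> w) * nrmX x"
proof -
  have p: "(norm (lmm_psi w))\<^sup>2 \<le> w \<bullet> w"
    by (simp add: power2_norm_eq_inner) (simp add: inner_vec_def lmm_psi_def sum_UNIV_Plus sum_nonneg)
  have "ip (vcomb w x) (vcomb w x) \<le> (\<Sum>k<m. (norm (lmm_psi w))\<^sup>2 * (norm (x k))\<^sup>2)"
    unfolding ip_def vcomb_def
  proof (intro sum_mono)
    fix k
    have "(x k \<bullet> lmm_psi w)\<^sup>2 \<le> (x k \<bullet> x k) * (lmm_psi w \<bullet> lmm_psi w)" by (rule Cauchy_Schwarz_ineq)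
    then show "(x k \<bullet> lmm_psi w) * (x k \<bullet> lmm_psi w) \<le> (norm (lmm_psi w))\<^sup>2 * (norm (x k))\<^sup>2"
      unfolding power2_norm_eq_inner by (simp add: power2_eq_square mult.commute)
  qed
  also have "\<dots> = (norm (lmm_psi w))\<^sup>2 * nrmX x" by (simp add: sum_distrib_left[symmetric] sum_row_norm)
  also have "\<dots> \<le> (w \<bullet> w) * nrmX x" by (intro mult_right_mono p nrmX_nonneg)
  finally show ?thesis .
qed

definition "nz \<omega> = (\<Sum>s\<in>(UNIV :: 'q set) <+> {..<m}. (coord s \<omega>)\<^sup>2)"

lemma nz_nonneg: "0 \<le> nz \<omega>" by (simp add: nz_def sum_nonneg)

text \<open>The factors 4 and 4 come from using (s + t)^2 \<le> 2 s^2 + 2 t^2 twice; 8 n \<rho>^2 is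
  twice the bound n (2 \<rho>)^2 on the squared distance of two \<psi>-vectors; the leading 2
  absorbs the constant and the separate \<open>nrmX\<close>.\<close>

definition "C3 (n :: nat) \<rho> = 2 + (4 * M * \<rho>\<^sup>2 + 4 * \<sigma>\<^sup>2 + 8 * real n * \<rho>\<^sup>2)"

lemma square_sum_le: "(s + t)\<^sup>2 \<le> 2 * s\<^sup>2 + 2 * (t::real)\<^sup>2"
  using sum_squares_bound[of s t] by (simp add: power2_sum)

text \<open>Two parameters occur because the moment condition evaluates derivatives at one point
  under the law of another. The residual at \<theta>' of data generated at \<theta> is noise plus
  predictors applied to the difference of the \<psi>-vectors.\<close>

lemma residual_growth:
  fixes \<theta> \<theta>' :: "real^('d1 + 'd2::finite)"
  assumes \<rho>: "\<And>c. \<bar>\<theta> $ c\<bar> \<le> \<rho>" "\<And>c. \<bar>\<theta>' $ c\<bar> \<le> \<rho>"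
  shows "1 + (nrm (res \<theta>' (yobs \<theta> x \<omega>) x))\<^sup>2 + nrmX x \<le> C3 CARD('d2) \<rho> * (1 + nz \<omega> + nrmX x)"
proof -
  let ?d = "lmm_psi \<theta> - lmm_psi \<theta>'" and ?w = "(\<chi> l. fst \<omega> l) :: real^'q"
  have \<rho>0: "0 \<le> \<rho>" using \<rho>(1)[of undefined] by linarith
  have d: "(norm ?d)\<^sup>2 \<le> 4 * real CARD('d2) * \<rho>\<^sup>2"
  proof -
    have "(norm ?d)\<^sup>2 = (\<Sum>b\<in>UNIV. (\<theta> $ Inr b - \<theta>' $ Inr b)\<^sup>2)"
      by (simp add: power2_norm_eq_inner) (simp add: inner_vec_def lmm_psi_def power2_eq_square)
    also have "\<dots> \<le> (\<Sum>b\<in>(UNIV :: 'd2 set). (2 * \<rho>)\<^sup>2)"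
    proof (intro sum_mono)
      fix b
      have "\<bar>\<theta> $ Inr b - \<theta>' $ Inr b\<bar> \<le> 2 * \<rho>" using \<rho>(1)[of "Inr b"] \<rho>(2)[of "Inr b"] by linarith
      from power_mono[OF this abs_ge_zero, of 2] show "(\<theta> $ Inr b - \<theta>' $ Inr b)\<^sup>2 \<le> (2 * \<rho>)\<^sup>2" by simp
    qed
    finally show ?thesis by (simp add: power_mult_distrib)
  qed
  have nz: "nz \<omega> = (\<Sum>l\<in>UNIV. (fst \<omega> l)\<^sup>2) + (\<Sum>k<m. (snd \<omega> k)\<^sup>2)"
    unfolding nz_def sum_Plus_split by (simp add: coord_def)
  have Lw: "(\<Sum>k<m. (z k \<bullet> Lam \<theta> ?w)\<^sup>2) \<le> M * \<rho>\<^sup>2 * (\<Sum>l\<in>UNIV. (fst \<omega> l)\<^sup>2)"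
  proof -
    have "(\<Sum>k<m. (z k \<bullet> Lam \<theta> ?w)\<^sup>2) \<le> M * (Lam \<theta> ?w \<bullet> Lam \<theta> ?w)"
      using gram_upper[of "Lam \<theta> ?w"] by (simp add: gram_dot power2_eq_square)
    also have "Lam \<theta> ?w \<bullet> Lam \<theta> ?w \<le> (\<Sum>l\<in>UNIV. \<rho>\<^sup>2 * (fst \<omega> l)\<^sup>2)"
      unfolding inner_vec_def
    proof (intro sum_mono)
      fix l
      have "(\<theta> $ Inl (a l))\<^sup>2 \<le> \<rho>\<^sup>2" using power_mono[OF \<rho>(1) abs_ge_zero, of "Inl (a l)" 2] by simp
      then have "(\<theta> $ Inl (a l))\<^sup>2 * (fst \<omega> l)\<^sup>2 \<le> \<rho>\<^sup>2 * (fst \<omega> l)\<^sup>2" by (intro mult_right_mono) auto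
      then show "Lam \<theta> ?w $ l \<bullet> Lam \<theta> ?w $ l \<le> \<rho>\<^sup>2 * (fst \<omega> l)\<^sup>2"
        by (simp add: Lam_def power2_eq_square mult_ac)
    qed
    finally show ?thesis using M_pos by (simp add: sum_distrib_left mult.assoc)
  qed
  have "(nrm (res \<theta>' (yobs \<theta> x \<omega>) x))\<^sup>2 = (\<Sum>k<m. ((z k \<bullet> Lam \<theta> ?w + \<sigma> * snd \<omega> k) + x k \<bullet> ?d)\<^sup>2)"
    unfolding nrm_sq ip_def by (intro sum.cong) (simp_all add: res_def yobs_def power2_eq_square inner_diff_right algebra_simps)
  also have "\<dots> \<le> (\<Sum>k<m. 4 * (z k \<bullet> Lam \<theta> ?w)\<^sup>2 + 4 * \<sigma>\<^sup>2 * (snd \<omega> k)\<^sup>2 + 2 * (norm ?d)\<^sup>2 * (norm (x k))\<^sup>2)"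
  proof (intro sum_mono)
    fix k
    have "(x k \<bullet> ?d)\<^sup>2 \<le> (norm ?d)\<^sup>2 * (norm (x k))\<^sup>2"
      using Cauchy_Schwarz_ineq[of "x k" ?d] by (simp add: power2_norm_eq_inner mult.commute)
    moreover have "(z k \<bullet> Lam \<theta> ?w + \<sigma> * snd \<omega> k)\<^sup>2 \<le> 2 * (z k \<bullet> Lam \<theta> ?w)\<^sup>2 + 2 * (\<sigma>\<^sup>2 * (snd \<omega> k)\<^sup>2)"
      using square_sum_le[of "z k \<bullet> Lam \<theta> ?w" "\<sigma> * snd \<omega> k"] by (simp add: power_mult_distrib)
    moreover note square_sum_le[of "z k \<bullet> Lam \<theta> ?w + \<sigma> * snd \<omega> k" "x k \<bullet> ?d"]
    ultimately show "((z k \<bullet> Lam \<theta> ?w + \<sigma> * snd \<omega> k) + x k \<bullet> ?d)\<^sup>2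
      \<le> 4 * (z k \<bullet> Lam \<theta> ?w)\<^sup>2 + 4 * \<sigma>\<^sup>2 * (snd \<omega> k)\<^sup>2 + 2 * (norm ?d)\<^sup>2 * (norm (x k))\<^sup>2"
      by linarith
  qed
  also have "\<dots> = 4 * (\<Sum>k<m. (z k \<bullet> Lam \<theta> ?w)\<^sup>2) + 4 * \<sigma>\<^sup>2 * (\<Sum>k<m. (snd \<omega> k)\<^sup>2) + 2 * (norm ?d)\<^sup>2 * nrmX x"
    by (simp add: sum.distrib sum_distrib_left[symmetric] sum_row_norm)
  also have "\<dots> \<le> 4 * (M * \<rho>\<^sup>2 * nz \<omega>) + 4 * \<sigma>\<^sup>2 * nz \<omega> + 2 * (4 * real CARD('d2) * \<rho>\<^sup>2) * nrmX x"
  proof (intro add_mono mult_left_mono mult_right_mono d nrmX_nonneg)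
    have "M * \<rho>\<^sup>2 * (\<Sum>l\<in>UNIV. (fst \<omega> l)\<^sup>2) \<le> M * \<rho>\<^sup>2 * nz \<omega>"
      unfolding nz using M_pos by (intro mult_left_mono) (auto simp: sum_nonneg)
    then show "(\<Sum>k<m. (z k \<bullet> Lam \<theta> ?w)\<^sup>2) \<le> M * \<rho>\<^sup>2 * nz \<omega>" using Lw by linarith
  qed (auto simp: nz sum_nonneg)
  finally have le: "(nrm (res \<theta>' (yobs \<theta> x \<omega>) x))\<^sup>2 \<le> (4 * M * \<rho>\<^sup>2 + 4 * \<sigma>\<^sup>2) * nz \<omega> + 8 * real CARD('d2) * \<rho>\<^sup>2 * nrmX x"
    by (simp add: algebra_simps)
  define A where "A = 4 * M * \<rho>\<^sup>2 + 4 * \<sigma>\<^sup>2"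
  define D where "D = 8 * real CARD('d2) * \<rho>\<^sup>2"
  have nn: "0 \<le> A" "0 \<le> D" using M_pos by (simp_all add: A_def D_def)
  have "0 \<le> A * nrmX x" "0 \<le> D * nz \<omega>" using nn nrmX_nonneg[of x] nz_nonneg[of \<omega>] by simp_all
  then have "1 + (A * nz \<omega> + D * nrmX x) + nrmX x \<le> (2 + (A + D)) * (1 + nz \<omega> + nrmX x)"
    using nn nrmX_nonneg[of x] nz_nonneg[of \<omega>] by (simp add: distrib_left distrib_right)
  then show ?thesis using le unfolding C3_def A_def D_def by (simp add: add.assoc)
qed

subsection \<open>Measurability\<close>

lemma measurable_ols:
  assumes "\<And>k. k < m \<Longrightarrow> (\<lambda>p. u p k) \<in> borel_measurable N"
  shows "(\<lambda>p. ols (u p)) \<in> borel_measurable N"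
  unfolding ols_def
  by (intro measurable_matrix_vector_mult borel_measurable_sum borel_measurable_scaleR assms) auto

lemma measurable_hh:
  assumes "\<And>k. k < m \<Longrightarrow> (\<lambda>p. u p k) \<in> borel_measurable N"
  shows "(\<lambda>p. hh \<theta> (u p)) \<in> borel_measurable N"
  unfolding hh_def by (intro measurable_matrix_vector_mult measurable_ols assms)

lemma measurable_B:
  assumes "\<And>k. k < m \<Longrightarrow> (\<lambda>p. u p k) \<in> borel_measurable N" "\<And>k. k < m \<Longrightarrow> (\<lambda>p. v p k) \<in> borel_measurable N"
  shows "(\<lambda>p. B \<theta> (u p) (v p)) \<in> borel_measurable N"
  unfolding B_def ip_def
  by (intro borel_measurable_add borel_measurable_divide borel_measurable_diff borel_measurable_inner
      borel_measurable_sum borel_measurable_times measurable_matrix_vector_mult measurable_ols assms) auto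

lemma measurable_res:
  assumes "\<And>k. k < m \<Longrightarrow> (\<lambda>p. y p k) \<in> borel_measurable N" "\<And>k. k < m \<Longrightarrow> (\<lambda>p. x p k) \<in> borel_measurable N"
    and "k < m"
  shows "(\<lambda>p. res \<theta> (y p) (x p) k) \<in> borel_measurable N"
  unfolding res_def by (intro borel_measurable_diff borel_measurable_inner assms) auto

lemma measurable_col:
  assumes "\<And>k. k < m \<Longrightarrow> (\<lambda>p. x p k) \<in> borel_measurable N" and "k < m"
  shows "(\<lambda>p. col (x p) b k) \<in> borel_measurable N"
  unfolding col_def by (intro measurable_vec_nth assms)

lemma measurable_nrmX:
  assumes "\<And>k. k < m \<Longrightarrow> (\<lambda>p. x p k) \<in> borel_measurable N"
  shows "(\<lambda>p. nrmX (x p)) \<in> borel_measurable N"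
  unfolding nrmX_def nrm_sq ip_def
  by (intro borel_measurable_sum borel_measurable_times measurable_col assms) auto

lemma measurable_vec_lambda:
  fixes g :: "'n::finite \<Rightarrow> 'a \<Rightarrow> real"
  assumes "\<And>c. g c \<in> borel_measurable N"
  shows "(\<lambda>p. \<chi> c. g c p) \<in> borel_measurable N"
  by (subst borel_measurable_euclidean_space) (auto simp: Basis_vec_def inner_axis assms)

lemma measurable_rscore:
  assumes "\<And>k. k < m \<Longrightarrow> (\<lambda>p. y p k) \<in> borel_measurable N" "\<And>k. k < m \<Longrightarrow> (\<lambda>p. x p k) \<in> borel_measurable N"
  shows "(\<lambda>p. rscore \<theta> (y p) (x p)) \<in> borel_measurable N"
  unfolding rscore_def
proof (rule measurable_vec_lambda)
  fix c
  show "(\<lambda>p. case c of Inl j \<Rightarrow> \<Sum>l\<in>{l. a l = j}. (hh \<theta> (res \<theta> (y p) (x p)) $ l)\<^sup>2 - Km \<theta> $ l $ l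
      | Inr b \<Rightarrow> B \<theta> (col (x p) b) (res \<theta> (y p) (x p))) \<in> borel_measurable N"
    by (cases c) (auto intro!: borel_measurable_sum borel_measurable_diff borel_measurable_power measurable_vec_nth
        measurable_hh measurable_B measurable_col measurable_res assms)
qed

lemma measurable_dens:
  assumes "\<And>k. k < m \<Longrightarrow> (\<lambda>p. y p k) \<in> borel_measurable N" "\<And>k. k < m \<Longrightarrow> (\<lambda>p. x p k) \<in> borel_measurable N"
  shows "(\<lambda>p. dens \<theta> (y p) (x p)) \<in> borel_measurable N"
  unfolding dens_eq
  by (intro measurable_compose[OF _ borel_measurable_exp] borel_measurable_diff borel_measurable_divide measurable_B measurable_res assms) auto

lemma measurable_yobs:
  assumes "\<And>k. k < m \<Longrightarrow> (\<lambda>p. x p k) \<in> borel_measurable N"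
    and "\<And>l. (\<lambda>p. fst (w p) l) \<in> borel_measurable N" "\<And>k. k < m \<Longrightarrow> (\<lambda>p. snd (w p) k) \<in> borel_measurable N"
  shows "(\<lambda>p. yobs \<theta> (x p) (w p)) \<in> measurable N (PiM {..<m} (\<lambda>_. lborel))"
proof -
  have "(\<lambda>p. Lam \<theta> (\<chi> l. fst (w p) l)) \<in> borel_measurable N"
    unfolding Lam_def vec_lambda_beta by (intro measurable_vec_lambda borel_measurable_times assms) auto
  then show ?thesis
    unfolding yobs_def
    by (intro measurable_restrict) (auto intro!: borel_measurable_add borel_measurable_inner borel_measurable_times assms)
qed

subsection \<open>The normalising constant\<close>

text \<open>
  Nonnegativity of the relative entropy bounds the increments of the normalising constant from
  both sides by trace expressions, which gives its derivative without determinants.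
\<close>

lemma lC_le: "lC \<theta>' \<le> lC \<theta> + (\<Sum>l\<in>UNIV. \<Sum>k\<in>UNIV. (Km \<theta>' $ l $ k - Km \<theta> $ l $ k) * Nm \<theta> $ l $ k) / 2"
  for \<theta> \<theta>' :: "real^('d1 + 'd2::finite)"
proof -
  interpret prob_space "noise m :: 'q noise measure" by (rule prob_space_noise)
  let ?L = "PiM {..<m} (\<lambda>_. lborel :: real measure)"
  \<comment> \<open>The normalising constant does not involve the predictors, so they are set to
    zero and the residual is the response itself.\<close>
  let ?x = "\<lambda>_. 0 :: real^'d2"
  let ?Y = "yobs \<theta> ?x"
  have r0: "res \<theta>'' y ?x = y" for \<theta>'' y by (simp add: res_def fun_eq_iff)
  have Ymeas: "?Y \<in> measurable (noise m) ?L"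
    by (rule measurable_yobs) (auto simp: noise_def)
  have dm[measurable]: "(\<lambda>y. dens \<theta>'' y ?x) \<in> borel_measurable ?L" for \<theta>'' :: "real^('d1 + 'd2)"
    by (rule measurable_dens) simp_all
  \<comment> \<open>The likelihood ratio has mean one under \<theta>; ln R \<le> R - 1 makes the
    mean of its logarithm nonpositive.\<close>
  define R where "R y = dens \<theta>' y ?x / dens \<theta> y ?x" for y
  have [measurable]: "R \<in> borel_measurable ?L" unfolding R_def by measurable
  have RY[measurable]: "(\<lambda>\<omega>. R (?Y \<omega>)) \<in> borel_measurable (noise m)"
    by (rule measurable_compose[OF Ymeas]) measurable
  have "(\<integral>\<^sup>+\<omega>. ennreal (R (?Y \<omega>)) \<partial>noise m) = (\<integral>\<^sup>+y. ennreal (dens \<theta> y ?x) * ennreal (R y) \<partial>?L)"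
    by (rule nn_integral_dens[symmetric]) measurable
  also have "\<dots> = (\<integral>\<^sup>+y. ennreal (dens \<theta>' y ?x) * 1 \<partial>?L)"
  proof (intro nn_integral_cong)
    fix y
    show "ennreal (dens \<theta> y ?x) * ennreal (R y) = ennreal (dens \<theta>' y ?x) * 1"
      using dens_pos[of \<theta> y ?x] dens_pos[of \<theta>' y ?x]
      by (simp add: R_def ennreal_mult[symmetric] less_imp_le)
  qed
  also have "\<dots> = (\<integral>\<^sup>+\<omega>. 1 \<partial>(noise m :: 'q noise measure))"
    by (rule nn_integral_dens) simp
  also have "\<dots> = 1" using emeasure_space_1 by simp
  finally have nn: "(\<integral>\<^sup>+\<omega>. ennreal (R (?Y \<omega>)) \<partial>noise m) = 1" .
  have Rpos: "0 < R y" for y using dens_pos[of \<theta> y ?x] dens_pos[of \<theta>' y ?x] by (simp add: R_def)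
  have iR: "integrable (noise m) (\<lambda>\<omega>. R (?Y \<omega>))"
    using nn Rpos by (intro integrableI_nonneg) (auto simp: less_imp_le)
  have eR: "expectation (\<lambda>\<omega>. R (?Y \<omega>)) = 1"
    using nn nn_integral_eq_integral[OF iR] Rpos by (simp add: less_imp_le)
  let ?L2 = "\<lambda>l k \<omega>. lin m (cf \<theta> (axis l 1)) \<omega> * lin m (cf \<theta> (axis k 1)) \<omega>"
  \<comment> \<open>The residual part of the exponent does not depend on the parameter and cancels
    in the ratio. What is left is quadratic in the least squares coefficients, whose covariance
    under \<theta> is \<open>Nm\<close> \<theta>.\<close>
  define g where "g \<omega> = (lC \<theta>' - lC \<theta>) - (\<Sum>l\<in>UNIV. \<Sum>k\<in>UNIV. (Km \<theta>' $ l $ k - Km \<theta> $ l $ k) * ?L2 l k \<omega>) / 2" for \<omega>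
  have lnR: "ln (R (?Y \<omega>)) = g \<omega>" for \<omega>
  proof -
    have o: "ols (?Y \<omega>) = ols (uobs \<theta> \<omega>)"
      by (rule ols_cong) (simp add: yobs_def uobs_def)
    have c: "ols (uobs \<theta> \<omega>) $ l = lin m (cf \<theta> (axis l 1)) \<omega>" for l
      unfolding lin_cf by (simp add: inner_axis')
    have "ln (R (?Y \<omega>)) = ln (dens \<theta>' (?Y \<omega>) ?x) - ln (dens \<theta> (?Y \<omega>) ?x)"
      unfolding R_def by (rule ln_divide_pos) (simp_all add: dens_pos)
    also have "\<dots> = (lC \<theta>' - lC \<theta>) - (ols (?Y \<omega>) \<bullet> (Km \<theta>' *v ols (?Y \<omega>)) - ols (?Y \<omega>) \<bullet> (Km \<theta> *v ols (?Y \<omega>))) / 2"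
      unfolding ln_dens r0 B_def by (simp add: diff_divide_distrib add_divide_distrib)
    also have "ols (?Y \<omega>) \<bullet> (Km \<theta>' *v ols (?Y \<omega>)) - ols (?Y \<omega>) \<bullet> (Km \<theta> *v ols (?Y \<omega>))
      = (\<Sum>l\<in>UNIV. \<Sum>k\<in>UNIV. (Km \<theta>' $ l $ k - Km \<theta> $ l $ k) * ?L2 l k \<omega>)"
      unfolding o inner_vec_def matrix_vector_mult_def vec_lambda_beta c inner_real_def
      by (simp add: sum_distrib_left sum_subtractf[symmetric] algebra_simps)
    finally show ?thesis unfolding g_def .
  qed
  have L2: "integrable (noise m) (?L2 l k)" "expectation (?L2 l k) = Nm \<theta> $ l $ k" for l k
    by (simp_all add: lin_moments dotp_cf inner_axis' matrix_vector_mult_basis column_def)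
  have ig: "integrable (noise m) g" unfolding g_def by (simp add: L2)
  have eg: "expectation g = (lC \<theta>' - lC \<theta>) - (\<Sum>l\<in>UNIV. \<Sum>k\<in>UNIV. (Km \<theta>' $ l $ k - Km \<theta> $ l $ k) * Nm \<theta> $ l $ k) / 2"
    unfolding g_def by (simp add: L2 prob_space)
  have "g \<omega> \<le> R (?Y \<omega>) - 1" for \<omega> using ln_le_minus_one[OF Rpos, of "?Y \<omega>"] unfolding lnR .
  then have "expectation g \<le> expectation (\<lambda>\<omega>. R (?Y \<omega>) - 1)"
    using ig iR by (intro integral_mono) auto
  also have "\<dots> = 0" using iR eR by (simp add: prob_space)
  finally show ?thesis unfolding eg by linarith
qed

text \<open>Division by a negative t exchanges the two bounds, so the difference quotient is
  compared with the sum of both errors, which is symmetric.\<close>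

lemma squeeze_deriv:
  fixes f g h :: "real \<Rightarrow> real"
  assumes g: "(g has_real_derivative D) (at 0)" "g 0 = 0" and h: "(h has_real_derivative D) (at 0)" "h 0 = 0"
    and le: "\<And>t. h t \<le> f t - f 0" "\<And>t. f t - f 0 \<le> g t"
  shows "(f has_real_derivative D) (at 0)"
proof -
  have "((\<lambda>t. g t / t) \<longlongrightarrow> D) (at 0)" "((\<lambda>t. h t / t) \<longlongrightarrow> D) (at 0)"
    using g h by (simp_all add: has_field_derivative_iff)
  then have "((\<lambda>t. \<bar>g t / t - D\<bar> + \<bar>h t / t - D\<bar>) \<longlongrightarrow> \<bar>D - D\<bar> + \<bar>D - D\<bar>) (at 0)"
    by (intro tendsto_intros)
  then have l: "((\<lambda>t. \<bar>g t / t - D\<bar> + \<bar>h t / t - D\<bar>) \<longlongrightarrow> 0) (at 0)" by simp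
  have "norm ((f t - f 0) / t - D) \<le> \<bar>g t / t - D\<bar> + \<bar>h t / t - D\<bar>" for t
  proof -
    consider "t = 0" | "0 < t" | "t < 0" by linarith
    then show ?thesis
    proof cases
      case 2
      then have "h t / t \<le> (f t - f 0) / t" "(f t - f 0) / t \<le> g t / t"
        using le[of t] by (auto intro: divide_right_mono)
      then show ?thesis unfolding real_norm_def by linarith
    next
      case 3
      then have "g t / t \<le> (f t - f 0) / t" "(f t - f 0) / t \<le> h t / t"
        using le[of t] by (auto intro: divide_right_mono_neg)
      then show ?thesis unfolding real_norm_def by linarith
    qed simp
  qed
  then have "((\<lambda>t. (f t - f 0) / t - D) \<longlongrightarrow> 0) (at 0)"
    by (intro Lim_null_comparison[OF _ l]) auto
  then show ?thesis by (simp add: has_field_derivative_iff LIM_zero_iff)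
qed

lemma lC_ge: "lC \<theta> + (\<Sum>l\<in>UNIV. \<Sum>k\<in>UNIV. (Km \<theta>' $ l $ k - Km \<theta> $ l $ k) * Nm \<theta>' $ l $ k) / 2 \<le> lC \<theta>'"
  for \<theta> \<theta>' :: "real^('d1 + 'd2::finite)"
proof -
  have "(\<Sum>l\<in>UNIV. \<Sum>k\<in>UNIV. (Km \<theta> $ l $ k - Km \<theta>' $ l $ k) * Nm \<theta>' $ l $ k)
    = - (\<Sum>l\<in>UNIV. \<Sum>k\<in>UNIV. (Km \<theta>' $ l $ k - Km \<theta> $ l $ k) * Nm \<theta>' $ l $ k)"
    by (simp add: sum_negf[symmetric] algebra_simps)
  then show ?thesis using lC_le[of \<theta> \<theta>'] by simp
qed

lemma lC_psi: "lC (\<theta> + t *\<^sub>R axis (Inr b) 1) = lC \<theta>"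
  using lC_le[of "\<theta> + t *\<^sub>R axis (Inr b) 1" \<theta>] lC_le[of \<theta> "\<theta> + t *\<^sub>R axis (Inr b) 1"]
  by (simp add: Km_psi)

lemma Km_mult_Nm: "(\<Sum>k\<in>UNIV. Km \<theta> $ i $ k * Nm \<theta> $ l $ k) = (if i = l then 1 else 0)"
proof -
  have N: "Nm \<theta> $ l $ k = Nm \<theta> $ k $ l" for k
    using arg_cong[OF transpose_Nm[of \<theta>], of "\<lambda>A. A $ k $ l"] by (simp add: transpose_def)
  have "(Km \<theta> ** Nm \<theta>) $ i $ l = (if i = l then 1 else 0)"
    unfolding Km_def matrix_inv_cancel(4)[OF Nm_inv] by (simp add: mat_def)
  then show ?thesis unfolding matrix_matrix_mult_def N by simp
qed

text \<open>Both entropy bounds have the derivative tr (K' N) / 2 at 0: in the lower one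
  \<open>Nm\<close> moves too, but it multiplies a difference that vanishes there. Inserting K' and
  K N = 1 leaves the trace of \<open>Km\<close> over the positions with a l = j.\<close>

lemma lC_deriv:
  "((\<lambda>t. lC (\<theta> + t *\<^sub>R axis (Inl j) 1)) has_real_derivative - (\<theta> $ Inl j * (\<Sum>l\<in>{l. a l = j}. Km \<theta> $ l $ l))) (at 0)"
proof -
  let ?\<theta> = "\<lambda>t. \<theta> + t *\<^sub>R axis (Inl j) 1"
  let ?K' = "\<lambda>l k. - (2 * \<theta> $ Inl j * (\<Sum>i\<in>{i. a i = j}. Km \<theta> $ l $ i * Km \<theta> $ i $ k))"
  have D: "(\<Sum>l\<in>UNIV. \<Sum>k\<in>UNIV. ?K' l k * Nm \<theta> $ l $ k) / 2 = - (\<theta> $ Inl j * (\<Sum>l\<in>{l. a l = j}. Km \<theta> $ l $ l))"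
  proof -
    have "(\<Sum>l\<in>UNIV. \<Sum>k\<in>UNIV. ?K' l k * Nm \<theta> $ l $ k)
      = (\<Sum>l\<in>UNIV. \<Sum>k\<in>UNIV. \<Sum>i\<in>{i. a i = j}. - (2 * \<theta> $ Inl j) * (Km \<theta> $ l $ i * (Km \<theta> $ i $ k * Nm \<theta> $ l $ k)))"
      by (intro sum.cong refl) (simp add: sum_distrib_left sum_distrib_right sum_negf mult_ac)
    also have "\<dots> = (\<Sum>i\<in>{i. a i = j}. \<Sum>l\<in>UNIV. \<Sum>k\<in>UNIV. - (2 * \<theta> $ Inl j) * (Km \<theta> $ l $ i * (Km \<theta> $ i $ k * Nm \<theta> $ l $ k)))"
      by (subst sum.swap[of _ "{i. a i = j}"], subst sum.swap[of _ "{i. a i = j}"]) (rule refl)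
    also have "\<dots> = (\<Sum>i\<in>{i. a i = j}. - (2 * \<theta> $ Inl j) * Km \<theta> $ i $ i)"
    proof (intro sum.cong refl)
      fix i
      have "(\<Sum>k\<in>UNIV. - (2 * \<theta> $ Inl j) * (Km \<theta> $ l $ i * (Km \<theta> $ i $ k * Nm \<theta> $ l $ k)))
        = - (2 * \<theta> $ Inl j) * (Km \<theta> $ l $ i * (if i = l then 1 else 0))" for l
        unfolding Km_mult_Nm[of \<theta> i l, symmetric] sum_distrib_left ..
      then show "(\<Sum>l\<in>UNIV. \<Sum>k\<in>UNIV. - (2 * \<theta> $ Inl j) * (Km \<theta> $ l $ i * (Km \<theta> $ i $ k * Nm \<theta> $ l $ k)))
        = - (2 * \<theta> $ Inl j) * Km \<theta> $ i $ i"
        by (simp add: if_distrib[of "\<lambda>x. _ * x"] sum.delta' cong: if_cong)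
    qed
    also have "\<dots> = - (2 * \<theta> $ Inl j) * (\<Sum>l\<in>{l. a l = j}. Km \<theta> $ l $ l)" by (rule sum_distrib_left[symmetric])
    finally show ?thesis by simp
  qed
  show ?thesis
  proof (rule squeeze_deriv)
    show "((\<lambda>t. (\<Sum>l\<in>UNIV. \<Sum>k\<in>UNIV. (Km (?\<theta> t) $ l $ k - Km \<theta> $ l $ k) * Nm \<theta> $ l $ k) / 2) has_real_derivative
      - (\<theta> $ Inl j * (\<Sum>l\<in>{l. a l = j}. Km \<theta> $ l $ l))) (at 0)"
      unfolding D[symmetric]
      by (intro DERIV_cdivide DERIV_sum DERIV_cmult_right) (auto intro!: derivative_eq_intros Km_deriv)
    show "((\<lambda>t. (\<Sum>l\<in>UNIV. \<Sum>k\<in>UNIV. (Km (?\<theta> t) $ l $ k - Km \<theta> $ l $ k) * Nm (?\<theta> t) $ l $ k) / 2) has_real_derivative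
      - (\<theta> $ Inl j * (\<Sum>l\<in>{l. a l = j}. Km \<theta> $ l $ l))) (at 0)"
      unfolding D[symmetric]
    proof (intro DERIV_cdivide DERIV_sum)
      fix l k
      have "((\<lambda>t. (Km (?\<theta> t) $ l $ k - Km \<theta> $ l $ k)) has_real_derivative ?K' l k) (at 0)"
        by (auto intro!: derivative_eq_intros Km_deriv)
      from DERIV_mult[OF this Nm_deriv[of \<theta> j l k]]
      show "((\<lambda>t. (Km (?\<theta> t) $ l $ k - Km \<theta> $ l $ k) * Nm (?\<theta> t) $ l $ k) has_real_derivative ?K' l k * Nm \<theta> $ l $ k) (at 0)"
        by simp
    qed
    show "(\<Sum>l\<in>UNIV. \<Sum>k\<in>UNIV. (Km (?\<theta> t) $ l $ k - Km \<theta> $ l $ k) * Nm (?\<theta> t) $ l $ k) / 2 \<le> lC (?\<theta> t) - lC (?\<theta> 0)" for t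
      using lC_ge[of \<theta> "?\<theta> t"] by simp
    show "lC (?\<theta> t) - lC (?\<theta> 0) \<le> (\<Sum>l\<in>UNIV. \<Sum>k\<in>UNIV. (Km (?\<theta> t) $ l $ k - Km \<theta> $ l $ k) * Nm \<theta> $ l $ k) / 2" for t
      using lC_le[of "?\<theta> t" \<theta>] by simp
  qed simp_all
qed

lemma lC_tendsto:
  assumes g: "(g \<longlongrightarrow> \<theta>) F"
  shows "((\<lambda>s. lC (g s)) \<longlongrightarrow> lC \<theta>) F"
proof (rule tendsto_sandwich)
  have "((\<lambda>s. lC \<theta> + (\<Sum>l\<in>UNIV. \<Sum>k\<in>UNIV. (Km (g s) $ l $ k - Km \<theta> $ l $ k) * Nm (g s) $ l $ k) / 2)
    \<longlongrightarrow> lC \<theta> + (\<Sum>l\<in>UNIV. \<Sum>k\<in>UNIV. (Km \<theta> $ l $ k - Km \<theta> $ l $ k) * Nm \<theta> $ l $ k) / 2) F"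
    by (intro tendsto_intros Km_tendsto Nm_tendsto g) simp
  then show "((\<lambda>s. lC \<theta> + (\<Sum>l\<in>UNIV. \<Sum>k\<in>UNIV. (Km (g s) $ l $ k - Km \<theta> $ l $ k) * Nm (g s) $ l $ k) / 2) \<longlongrightarrow> lC \<theta>) F" by simp
  have "((\<lambda>s. lC \<theta> + (\<Sum>l\<in>UNIV. \<Sum>k\<in>UNIV. (Km (g s) $ l $ k - Km \<theta> $ l $ k) * Nm \<theta> $ l $ k) / 2)
    \<longlongrightarrow> lC \<theta> + (\<Sum>l\<in>UNIV. \<Sum>k\<in>UNIV. (Km \<theta> $ l $ k - Km \<theta> $ l $ k) * Nm \<theta> $ l $ k) / 2) F"
    by (intro tendsto_intros Km_tendsto g) simp
  then show "((\<lambda>s. lC \<theta> + (\<Sum>l\<in>UNIV. \<Sum>k\<in>UNIV. (Km (g s) $ l $ k - Km \<theta> $ l $ k) * Nm \<theta> $ l $ k) / 2) \<longlongrightarrow> lC \<theta>) F" by simp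
qed (auto intro: always_eventually lC_le lC_ge)

lemma continuous_on_ln_dens:
  assumes "continuous_on S g" "\<And>k. continuous_on S (\<lambda>s. y s k)" "\<And>k. continuous_on S (\<lambda>s. x s k)"
  shows "continuous_on S (\<lambda>s. ln (dens (g s) (y s) (x s)))"
proof -
  have "continuous_on S (\<lambda>s. lC (g s))"
    using assms(1) unfolding continuous_on_def by (auto intro: lC_tendsto)
  then show ?thesis
    unfolding ln_dens by (intro continuous_intros continuous_on_B continuous_on_res assms) auto
qed

lemma ln_dens_deriv:
  "((\<lambda>t. ln (dens (\<theta> + t *\<^sub>R axis c 1) y x)) has_real_derivative dscale \<theta> c * rscore \<theta> y x $ c) (at 0)"
proof (cases c)
  case (Inl j)
  have "((\<lambda>t. ln (dens (\<theta> + t *\<^sub>R axis c 1) y x)) has_real_derivative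
    - (\<theta> $ Inl j * (\<Sum>l\<in>{l. a l = j}. Km \<theta> $ l $ l)) - - (2 * \<theta> $ Inl j * (\<Sum>i\<in>{i. a i = j}. (hh \<theta> (res \<theta> y x) $ i)\<^sup>2)) / 2) (at 0)"
    unfolding ln_dens Inl using quad_deriv[of \<theta> "Inl j" y x]
    by (intro DERIV_diff DERIV_cdivide lC_deriv) simp
  then show ?thesis by (simp add: Inl dscale_def rscore_def sum_subtractf right_diff_distrib)
next
  case (Inr b)
  have "((\<lambda>t. ln (dens (\<theta> + t *\<^sub>R axis c 1) y x)) has_real_derivative 0 - - (2 * B \<theta> (col x b) (res \<theta> y x)) / 2) (at 0)"
    unfolding ln_dens Inr lC_psi using quad_deriv[of \<theta> "Inr b" y x]
    by (intro DERIV_diff DERIV_cdivide DERIV_const) simp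
  then show ?thesis by (simp add: Inr dscale_def rscore_def)
qed

text \<open>r is an upper bound for the number of responses; the constant is stated with r instead
  of m so that it can be shared by all observations.\<close>

definition "C0 (r :: nat) \<rho> = real r * \<bar>ln (1 / sqrt (2 * pi * \<sigma>\<^sup>2))\<bar> + (real CARD('q))\<^sup>2 * (kap * (\<sigma>\<^sup>2 * M + \<rho>\<^sup>2)) + cB"

lemma Nm_entry_bound:
  assumes "\<And>c. \<bar>\<theta> $ c\<bar> \<le> \<rho>"
  shows "\<bar>Nm \<theta> $ l $ k\<bar> \<le> \<sigma>\<^sup>2 * M + \<rho>\<^sup>2"
proof -
  have "\<bar>Gi $ l $ k\<bar> \<le> M"
    using coercive_inverse_bounds(3)[OF _ gram_lower, of l k] M_pos unfolding Gi_def inverse_eq_divide by simp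
  then have "\<bar>\<sigma>\<^sup>2 * Gi $ l $ k\<bar> \<le> \<sigma>\<^sup>2 * M" by (simp add: abs_mult mult_left_mono)
  moreover have "\<bar>if l = k then (\<theta> $ Inl (a l))\<^sup>2 else 0\<bar> \<le> \<rho>\<^sup>2"
    using power_mono[OF assms abs_ge_zero, of "Inl (a l)" 2] by auto
  ultimately show ?thesis unfolding Nm_def vec_lambda_beta by (rule order_trans[OF abs_triangle_ineq add_mono])
qed

text \<open>Anchored at \<theta> = 0, where the random effects drop out and the density at zero data
  is a product of m normal densities. The two entropy bounds then control the distance to this value
  through entries of \<open>Km\<close> and \<open>Nm\<close>.\<close>

lemma lC_bound:
  fixes \<theta> :: "real^('d1 + 'd2::finite)"
  assumes \<rho>: "\<And>c. \<bar>\<theta> $ c\<bar> \<le> \<rho>"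
  shows "\<bar>lC \<theta>\<bar> \<le> real m * \<bar>ln (1 / sqrt (2 * pi * \<sigma>\<^sup>2))\<bar> + (real CARD('q))\<^sup>2 * (kap * (\<sigma>\<^sup>2 * M + \<rho>\<^sup>2))"
proof -
  have \<rho>0: "0 \<le> \<rho>" using \<rho>[of undefined] by linarith
  have "lC (0 :: real^('d1 + 'd2)) = ln ((1 / sqrt (2 * pi * \<sigma>\<^sup>2)) ^ m)"
  proof -
    have "(\<integral>w. (\<Prod>l\<in>UNIV. std_normal_density (w $ l)) \<partial>(lborel :: (real^'q) measure)) = 1"
    proof -
      have "(\<integral>\<^sup>+w. ennreal (\<Prod>l\<in>UNIV. std_normal_density (w $ l)) \<partial>(lborel :: (real^'q) measure)) = 1"
        using nn_integral_std_normal_vec[where F = "\<lambda>_::real^'q. 1"]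
          prob_space.emeasure_space_1[OF prob_space_PiM_std_normal, of "UNIV :: 'q set"] by simp
      then show ?thesis
        by (subst integral_eq_nn_integral) (auto simp: prod_nonneg)
    qed
    moreover have "Lam (0 :: real^('d1 + 'd2)) w = 0" for w by (simp add: Lam_def vec_eq_iff)
    moreover have "normal_density 0 \<sigma> 0 = 1 / sqrt (2 * pi * \<sigma>\<^sup>2)" by (simp add: normal_density_def)
    ultimately have "dens (0 :: real^('d1 + 'd2)) (\<lambda>_. 0) (\<lambda>_. 0) = (1 / sqrt (2 * pi * \<sigma>\<^sup>2)) ^ m"
      unfolding dens_def lmm_joint_density_def Lambda_mult by simp
    moreover have "ln (dens (0 :: real^('d1 + 'd2)) (\<lambda>_. 0) (\<lambda>_. 0)) = lC (0 :: real^('d1 + 'd2))"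
      unfolding ln_dens by (simp add: res_def[abs_def] B_def ols_def ip_def)
    ultimately show ?thesis by simp
  qed
  then have 0: "lC (0 :: real^('d1 + 'd2)) = real m * ln (1 / sqrt (2 * pi * \<sigma>\<^sup>2))"
    using sigma_pos by (simp add: ln_realpow)
  have zero: "\<bar>(0 :: real^('d1 + 'd2)) $ c\<bar> \<le> \<rho>" for c using \<rho>0 by simp
  have S: "\<bar>\<Sum>l\<in>UNIV. \<Sum>k\<in>UNIV. (Km \<theta> $ l $ k - Km (0 :: real^('d1 + 'd2)) $ l $ k) * Nm \<theta>' $ l $ k\<bar> / 2 \<le> (real CARD('q))\<^sup>2 * (kap * (\<sigma>\<^sup>2 * M + \<rho>\<^sup>2))"
    if "\<And>c. \<bar>\<theta>' $ c\<bar> \<le> \<rho>" for \<theta>' :: "real^('d1 + 'd2)"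
  proof -
    have "\<bar>\<Sum>l\<in>UNIV. \<Sum>k\<in>UNIV. (Km \<theta> $ l $ k - Km (0 :: real^('d1 + 'd2)) $ l $ k) * Nm \<theta>' $ l $ k\<bar>
      \<le> real CARD('q) * (real CARD('q) * ((2 * kap) * (\<sigma>\<^sup>2 * M + \<rho>\<^sup>2)))"
    proof (intro sum_bound_card)
      fix l k
      have "\<bar>Km \<theta> $ l $ k - Km (0 :: real^('d1 + 'd2)) $ l $ k\<bar> \<le> 2 * kap"
        using Km_bounds(4)[of \<theta> l k] Km_bounds(4)[of "0 :: real^('d1 + 'd2)" l k] by linarith
      then show "\<bar>(Km \<theta> $ l $ k - Km (0 :: real^('d1 + 'd2)) $ l $ k) * Nm \<theta>' $ l $ k\<bar> \<le> (2 * kap) * (\<sigma>\<^sup>2 * M + \<rho>\<^sup>2)"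
        unfolding abs_mult using kap_pos by (intro mult_mono Nm_entry_bound that) auto
    qed (use kap_pos M_pos in auto)
    then show ?thesis by (simp add: power2_eq_square)
  qed
  have "lC \<theta> \<le> lC (0 :: real^('d1 + 'd2)) + (\<Sum>l\<in>UNIV. \<Sum>k\<in>UNIV. (Km \<theta> $ l $ k - Km (0 :: real^('d1 + 'd2)) $ l $ k) * Nm (0 :: real^('d1 + 'd2)) $ l $ k) / 2" by (rule lC_le)
  moreover have "lC (0 :: real^('d1 + 'd2)) + (\<Sum>l\<in>UNIV. \<Sum>k\<in>UNIV. (Km \<theta> $ l $ k - Km (0 :: real^('d1 + 'd2)) $ l $ k) * Nm \<theta> $ l $ k) / 2 \<le> lC \<theta>" by (rule lC_ge)
  moreover note S[OF \<rho>] S[OF zero]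
  moreover have "\<bar>lC (0 :: real^('d1 + 'd2))\<bar> \<le> real m * \<bar>ln (1 / sqrt (2 * pi * \<sigma>\<^sup>2))\<bar>" unfolding 0 by (simp add: abs_mult)
  ultimately show ?thesis by linarith
qed

lemma ln_dens_bound:
  assumes \<rho>: "\<And>c. \<bar>\<theta> $ c\<bar> \<le> \<rho>" and r: "m \<le> r"
  shows "\<bar>ln (dens \<theta> y x)\<bar> \<le> C0 r \<rho> * (1 + (nrm (res \<theta> y x))\<^sup>2 + nrmX x)"
proof -
  let ?u = "res \<theta> y x" and ?E = "1 + (nrm (res \<theta> y x))\<^sup>2 + nrmX x"
  define A where "A = real r * \<bar>ln (1 / sqrt (2 * pi * \<sigma>\<^sup>2))\<bar> + (real CARD('q))\<^sup>2 * (kap * (\<sigma>\<^sup>2 * M + \<rho>\<^sup>2))"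
  have E: "1 \<le> ?E" "(nrm ?u)\<^sup>2 \<le> ?E" using nrmX_nonneg[of x] by auto
  have A: "\<bar>lC \<theta>\<bar> \<le> A"
    using lC_bound[OF \<rho>] r mult_right_mono[of "real m" "real r" "\<bar>ln (1 / sqrt (2 * pi * \<sigma>\<^sup>2))\<bar>"] unfolding A_def by simp
  then have "0 \<le> A" by linarith
  have "\<bar>B \<theta> ?u ?u\<bar> \<le> cB * (nrm ?u)\<^sup>2" using B_bound[of \<theta> ?u ?u] by (simp add: power2_eq_square)
  also have "\<dots> \<le> cB * ?E" by (intro mult_left_mono E cB_nonneg)
  finally have 1: "\<bar>B \<theta> ?u ?u\<bar> \<le> cB * ?E" .
  have "A \<le> A * ?E" using mult_left_mono[OF E(1) \<open>0 \<le> A\<close>] by simp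
  then have "\<bar>lC \<theta>\<bar> \<le> A * ?E" using A by linarith
  moreover have "C0 r \<rho> * ?E = A * ?E + cB * ?E" by (simp add: C0_def A_def distrib_right)
  moreover have "0 \<le> cB * ?E" using cB_nonneg E by simp
  ultimately show ?thesis unfolding ln_dens using 1 by linarith
qed

end

section \<open>Moments of one observation with random predictors\<close>

text \<open>The sum is at most the number of terms times the largest, and the power of the largest
  is one of the summands on the right. No convexity enters, so all p \<ge> 0 are covered.\<close>

lemma sum_powr_le:
  fixes f :: "'i \<Rightarrow> real"
  assumes "finite A" "\<And>i. i \<in> A \<Longrightarrow> 0 \<le> f i" "0 \<le> p"
  shows "(\<Sum>i\<in>A. f i) powr p \<le> real (card A) powr p * (\<Sum>i\<in>A. f i powr p)"
proof (cases "A = {}")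
  case False
  define t where "t = Max (f ` A)"
  have t: "t \<in> f ` A" "\<And>i. i \<in> A \<Longrightarrow> f i \<le> t"
    using False assms(1) by (auto simp: t_def)
  have "(\<Sum>i\<in>A. f i) \<le> real (card A) * t" using t(2) by (rule sum_bounded_above)
  then have "(\<Sum>i\<in>A. f i) powr p \<le> (real (card A) * t) powr p"
    using assms by (intro powr_mono2 sum_nonneg) auto
  also have "\<dots> = real (card A) powr p * t powr p"
    using t assms by (subst powr_mult) auto
  also have "t powr p \<le> (\<Sum>i\<in>A. f i powr p)"
    using t(1) assms(1) by (auto intro!: member_le_sum)
  finally show ?thesis by (simp add: mult_left_mono)
qed simp

lemma add_powr_le:
  fixes s t :: real
  assumes "0 \<le> s" "0 \<le> t" "0 \<le> p"
  shows "(s + t) powr p \<le> 2 powr p * (s powr p + t powr p)"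
  using sum_powr_le[of "UNIV :: bool set" "\<lambda>b. if b then s else t" p] assms
  by (auto simp: UNIV_bool add.commute)

text \<open>A bound for the moment of t^2 to the real power p: for |t| > 1 the exponent is rounded
  up to an integer, elsewhere the value is at most 1.\<close>

definition normal_absmoment :: "real \<Rightarrow> real" where
  "normal_absmoment p = 1 + (\<integral>t. t ^ (2 * nat \<lceil>p\<rceil>) \<partial>std_normal)"

lemma normal_absmoment_nonneg: "0 \<le> normal_absmoment p"
  unfolding normal_absmoment_def by (intro add_nonneg_nonneg integral_nonneg_AE) auto

lemma nn_integral_normal_powr:
  assumes "0 \<le> p"
  shows "(\<integral>\<^sup>+t. ennreal ((t\<^sup>2) powr p) \<partial>std_normal) \<le> ennreal (normal_absmoment p)"
proof -
  interpret prob_space std_normal by (rule prob_space_std_normal)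
  let ?n = "nat \<lceil>p\<rceil>"
  have le: "(t\<^sup>2) powr p \<le> 1 + t ^ (2 * ?n)" for t :: real
  proof (cases "\<bar>t\<bar> \<le> 1")
    case True
    then have "t\<^sup>2 \<le> 1" by (simp add: abs_square_le_1)
    then have "(t\<^sup>2) powr p \<le> 1" using assms by (auto intro: powr_le1)
    then show ?thesis by (simp add: add_increasing2)
  next
    case False
    then have t: "1 \<le> t\<^sup>2" using abs_square_le_1[of t] by linarith
    have "(t\<^sup>2) powr p \<le> (t\<^sup>2) powr (real ?n)" using t assms by (intro powr_mono) linarith+
    also have "\<dots> = t ^ (2 * ?n)" using t by (subst powr_realpow) (auto simp: power_mult)
    finally show ?thesis by simp
  qed
  have i: "integrable std_normal (\<lambda>t. 1 + t ^ (2 * ?n))"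
    by (intro Bochner_Integration.integrable_add integrable_std_normal_distribution_moment) simp
  have "(\<integral>\<^sup>+t. ennreal ((t\<^sup>2) powr p) \<partial>std_normal) \<le> (\<integral>\<^sup>+t. ennreal (1 + t ^ (2 * ?n)) \<partial>std_normal)"
    by (intro nn_integral_mono ennreal_leI le)
  also have "\<dots> = ennreal (\<integral>t. 1 + t ^ (2 * ?n) \<partial>std_normal)"
    by (rule nn_integral_eq_integral[OF i]) auto
  also have "(\<integral>t. 1 + t ^ (2 * ?n) \<partial>std_normal) = normal_absmoment p"
    unfolding normal_absmoment_def
    by (subst Bochner_Integration.integral_add) (auto intro: integrable_std_normal_distribution_moment simp: prob_space[simplified])
  finally show ?thesis .
qed

lemma nn_integral_coord:
  fixes F :: "real \<Rightarrow> ennreal"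
  assumes s: "s \<in> (UNIV :: 'q::finite set) <+> {..<m}" and [measurable]: "F \<in> borel_measurable borel"
  shows "(\<integral>\<^sup>+\<omega>. F (coord s \<omega>) \<partial>noise m) = (\<integral>\<^sup>+t. F t \<partial>std_normal)"
proof -
  let ?A = "PiM (UNIV :: 'q set) (\<lambda>_. std_normal)" and ?B = "PiM {..<m} (\<lambda>_. std_normal)"
  interpret A: prob_space ?A by (rule prob_space_PiM_std_normal)
  interpret B: prob_space ?B by (rule prob_space_PiM_std_normal)
  have comp: "(\<integral>\<^sup>+v. F (v i) \<partial>PiM I (\<lambda>_. std_normal)) = (\<integral>\<^sup>+t. F t \<partial>std_normal)" if "i \<in> I" for I and i :: 'x
  proof -
    have "distr (PiM I (\<lambda>_. std_normal)) std_normal (\<lambda>v. v i) = std_normal"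
      by (rule distr_PiM_component) (auto intro: prob_space_std_normal that)
    then have "(\<integral>\<^sup>+t. F t \<partial>std_normal) = (\<integral>\<^sup>+t. F t \<partial>distr (PiM I (\<lambda>_. std_normal)) std_normal (\<lambda>v. v i))" by simp
    also have "\<dots> = (\<integral>\<^sup>+v. F (v i) \<partial>PiM I (\<lambda>_. std_normal))"
      using that by (subst nn_integral_distr) auto
    finally show ?thesis ..
  qed
  show ?thesis
  proof (cases s)
    case (Inl l)
    have "(\<integral>\<^sup>+\<omega>. F (coord s \<omega>) \<partial>noise m) = (\<integral>\<^sup>+x. (\<integral>\<^sup>+y. F (x l) \<partial>?B) \<partial>?A)"
      unfolding noise_def Inl coord_def by (subst B.nn_integral_fst[symmetric]) auto
    then show ?thesis using comp[of l UNIV] by (simp add: B.emeasure_space_1)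
  next
    case (Inr k)
    then have k: "k \<in> {..<m}" using s by auto
    have "(\<integral>\<^sup>+\<omega>. F (coord s \<omega>) \<partial>noise m) = (\<integral>\<^sup>+x. (\<integral>\<^sup>+y. F (y k) \<partial>?B) \<partial>?A)"
      unfolding noise_def Inr coord_def using k by (subst B.nn_integral_fst[symmetric]) auto
    then show ?thesis using comp[OF k] by (simp add: A.emeasure_space_1)
  qed
qed

text \<open>One observation with random predictors. The bound r on the number of responses is
  separate from m: constants built from r, M, \<sigma> and \<delta> are then literally the same for
  all observations.\<close>

locale observation = design m z a \<sigma> M
  for m and z :: "nat \<Rightarrow> real^'q::finite" and a :: "'q \<Rightarrow> 'd1::finite" and \<sigma> M +
  fixes \<gamma> :: "(nat \<Rightarrow> real^'d2::finite) measure" and \<delta> :: real and r :: nat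
  assumes prob_gamma: "prob_space \<gamma>" and sets_gamma: "sets \<gamma> = sets (PiM {..<m} (\<lambda>_. borel))"
    and delta_pos: "0 < \<delta>" and m_le: "m \<le> r"
    and X_lower: "inverse M \<le> min_eigenvalue (\<chi> b c. \<integral>x. gram m x $ b $ c \<partial>\<gamma>)"
    and X_moment: "(\<integral>\<^sup>+x. ennreal (spectral_norm m x powr (4 + \<delta>)) \<partial>\<gamma>) \<le> ennreal M"
begin

section \<open>The law of one observation and its representation by noise\<close>

sublocale G: prob_space \<gamma> by (rule prob_gamma)

definition "odom = PiM {..<m} (\<lambda>_. lborel :: real measure) \<Otimes>\<^sub>M \<gamma>"

definition law :: "real^('d1 + 'd2) \<Rightarrow> ((nat \<Rightarrow> real) \<times> (nat \<Rightarrow> real^'d2)) measure" where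
  "law \<theta> = density odom (\<lambda>p. ennreal (dens \<theta> (fst p) (snd p)))"

text \<open>Half of 4 + \<delta>, because the growth envelope is quadratic in the
  predictors.\<close>

definition "pp = 2 + \<delta> / 2"

lemma pp_pos: "0 < pp" "2 < pp" using delta_pos by (simp_all add: pp_def)

lemma measurable_gamma: "(\<lambda>x. x k) \<in> borel_measurable \<gamma>" if "k < m"
  unfolding measurable_cong_sets[OF sets_gamma refl] by (rule measurable_component_singleton) (use that in simp)

lemma measurable_odom: "k < m \<Longrightarrow> (\<lambda>p. fst p k) \<in> borel_measurable odom" "k < m \<Longrightarrow> (\<lambda>p. snd p k) \<in> borel_measurable odom"
  unfolding odom_def
  by (rule measurable_compose[OF measurable_fst], simp) (rule measurable_compose[OF measurable_snd measurable_gamma])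

lemma dens_measurable [measurable]: "(\<lambda>p. dens \<theta> (fst p) (snd p)) \<in> borel_measurable odom"
  by (intro measurable_dens measurable_odom)

lemma rscore_measurable [measurable]: "(\<lambda>p. rscore \<theta> (fst p) (snd p)) \<in> borel_measurable odom"
  by (intro measurable_rscore measurable_odom)

lemma sets_law [measurable_cong]: "sets (law \<theta>) = sets odom" by (simp add: law_def)

lemma space_law: "space (law \<theta>) = space odom" by (simp add: law_def)

lemma nn_integral_law:
  assumes F[measurable]: "F \<in> borel_measurable odom"
  shows "(\<integral>\<^sup>+p. F p \<partial>law \<theta>) = (\<integral>\<^sup>+x. (\<integral>\<^sup>+\<omega>. F (yobs \<theta> x \<omega>, x) \<partial>noise m) \<partial>\<gamma>)"
proof -
  let ?L = "PiM {..<m} (\<lambda>_. lborel :: real measure)"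
  interpret L: product_sigma_finite "\<lambda>_::nat. lborel :: real measure"
    by (simp add: product_sigma_finite_def sigma_finite_lborel)
  interpret P: pair_sigma_finite ?L \<gamma>
    unfolding pair_sigma_finite_def using L.sigma_finite[of "{..<m}"] G.sigma_finite_measure_axioms by simp
  have "(\<integral>\<^sup>+p. F p \<partial>law \<theta>) = (\<integral>\<^sup>+p. ennreal (dens \<theta> (fst p) (snd p)) * F p \<partial>odom)"
    unfolding law_def by (rule nn_integral_density) measurable
  also have "\<dots> = (\<integral>\<^sup>+x. (\<integral>\<^sup>+y. ennreal (dens \<theta> y x) * F (y, x) \<partial>?L) \<partial>\<gamma>)"
    unfolding odom_def by (subst P.nn_integral_snd[symmetric]) (auto simp flip: odom_def)
  also have "\<dots> = (\<integral>\<^sup>+x. (\<integral>\<^sup>+\<omega>. F (yobs \<theta> x \<omega>, x) \<partial>noise m) \<partial>\<gamma>)"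
  proof (intro nn_integral_cong nn_integral_dens)
    fix x assume "x \<in> space \<gamma>"
    then have "(\<lambda>y. (y, x)) \<in> measurable ?L odom" unfolding odom_def by measurable
    then show "(\<lambda>y. F (y, x)) \<in> borel_measurable ?L" by (rule measurable_compose) measurable
  qed
  finally show ?thesis .
qed

lemma prob_space_law: "prob_space (law \<theta>)"
proof
  interpret N: prob_space "noise m :: 'q noise measure" by (rule prob_space_noise)
  have "emeasure (law \<theta>) (space (law \<theta>)) = (\<integral>\<^sup>+p. 1 \<partial>law \<theta>)" by simp
  also have "\<dots> = 1" by (subst nn_integral_law) (simp_all add: N.emeasure_space_1 G.emeasure_space_1)
  finally show "emeasure (law \<theta>) (space (law \<theta>)) = 1" .
qed

lemma noise_push_measurable: "(\<lambda>q. (yobs \<theta> (snd q) (fst q), snd q)) \<in> measurable (noise m \<Otimes>\<^sub>M \<gamma>) odom"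
  unfolding odom_def
proof (rule measurable_Pair)
  have 1: "fst \<in> measurable (noise m \<Otimes>\<^sub>M \<gamma>) (noise m)" by simp
  show "(\<lambda>q. yobs \<theta> (snd q) (fst q)) \<in> measurable (noise m \<Otimes>\<^sub>M \<gamma>) (PiM {..<m} (\<lambda>_. lborel))"
  proof (rule measurable_yobs)
    show "(\<lambda>q. snd q k) \<in> borel_measurable (noise m \<Otimes>\<^sub>M \<gamma>)" if "k < m" for k
      by (rule measurable_compose[OF measurable_snd measurable_gamma[OF that]])
    show "(\<lambda>q. fst (fst q) l) \<in> borel_measurable (noise m \<Otimes>\<^sub>M \<gamma>)" for l
      by (rule measurable_compose[OF 1]) (simp add: noise_def)
    show "(\<lambda>q. snd (fst q) k) \<in> borel_measurable (noise m \<Otimes>\<^sub>M \<gamma>)" if "k < m" for k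
      by (rule measurable_compose[OF 1]) (use that in \<open>simp add: noise_def\<close>)
  qed
qed simp

text \<open>Complements \<open>nn_integral_law\<close>: as an image of noise and predictors under a
  measurable map, the law transfers integrability and signed integrals, to which Fubini then
  applies.\<close>

lemma law_eq_distr: "law \<theta> = distr (noise m \<Otimes>\<^sub>M \<gamma>) odom (\<lambda>q. (yobs \<theta> (snd q) (fst q), snd q))"
proof (rule measure_eqI)
  interpret N: prob_space "noise m :: 'q noise measure" by (rule prob_space_noise)
  interpret P: pair_sigma_finite "noise m :: 'q noise measure" \<gamma> ..
  fix A assume "A \<in> sets (law \<theta>)"
  then have A[measurable]: "A \<in> sets odom" by (simp add: sets_law)
  note noise_push_measurable[measurable]
  have "emeasure (law \<theta>) A = (\<integral>\<^sup>+p. indicator A p \<partial>law \<theta>)" using A by (simp add: sets_law)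
  also have "\<dots> = (\<integral>\<^sup>+x. (\<integral>\<^sup>+\<omega>. indicator A (yobs \<theta> x \<omega>, x) \<partial>noise m) \<partial>\<gamma>)"
    by (rule nn_integral_law) measurable
  also have "\<dots> = (\<integral>\<^sup>+q. indicator A (yobs \<theta> (snd q) (fst q), snd q) \<partial>(noise m \<Otimes>\<^sub>M \<gamma>))"
    by (subst P.nn_integral_snd[symmetric]) auto
  also have "\<dots> = (\<integral>\<^sup>+p. indicator A p \<partial>distr (noise m \<Otimes>\<^sub>M \<gamma>) odom (\<lambda>q. (yobs \<theta> (snd q) (fst q), snd q)))"
    by (subst nn_integral_distr) auto
  also have "\<dots> = emeasure (distr (noise m \<Otimes>\<^sub>M \<gamma>) odom (\<lambda>q. (yobs \<theta> (snd q) (fst q), snd q))) A"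
    by simp
  finally show "emeasure (law \<theta>) A = emeasure (distr (noise m \<Otimes>\<^sub>M \<gamma>) odom (\<lambda>q. (yobs \<theta> (snd q) (fst q), snd q))) A" .
qed (simp add: sets_law)

lemma integral_law:
  fixes F :: "_ \<Rightarrow> real"
  assumes i: "integrable (law \<theta>) F"
  shows "(\<integral>p. F p \<partial>law \<theta>) = (\<integral>x. (\<integral>\<omega>. F (yobs \<theta> x \<omega>, x) \<partial>noise m) \<partial>\<gamma>)"
proof -
  interpret N: prob_space "noise m :: 'q noise measure" by (rule prob_space_noise)
  interpret P: pair_sigma_finite "noise m :: 'q noise measure" \<gamma> ..
  have Fm: "F \<in> borel_measurable odom" using borel_measurable_integrable[OF i] by (simp add: sets_law cong: measurable_cong_sets)
  note noise_push_measurable[measurable] Fm[measurable]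
  have i': "integrable (noise m \<Otimes>\<^sub>M \<gamma>) (\<lambda>q. F (yobs \<theta> (snd q) (fst q), snd q))"
    using i unfolding law_eq_distr by (subst (asm) integrable_distr_eq) auto
  have "(\<integral>p. F p \<partial>law \<theta>) = (\<integral>q. F (yobs \<theta> (snd q) (fst q), snd q) \<partial>(noise m \<Otimes>\<^sub>M \<gamma>))"
    unfolding law_eq_distr by (subst integral_distr) auto
  also have "\<dots> = (\<integral>x. (\<integral>\<omega>. F (yobs \<theta> x \<omega>, x) \<partial>noise m) \<partial>\<gamma>)"
    using P.integral_snd[of "\<lambda>\<omega> x. F (yobs \<theta> x \<omega>, x)"] i' by (simp add: split_beta')
  finally show ?thesis .
qed

section \<open>Moments of the envelope and of everything of quadratic growth\<close>

lemma nrmX_spectral: "nrmX x \<le> real CARD('d2) * (spectral_norm m x)\<^sup>2" and spectral_nonneg: "0 \<le> spectral_norm m x"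
  for x :: "nat \<Rightarrow> real^'d2"
proof -
  let ?S = "{v :: real^'d2. norm v = 1}"
  \<comment> \<open>The supremum defining \<open>spectral_norm\<close> lives in the reals, so a
    column norm can be compared with it only after boundedness is established; columns are images of
    unit axis vectors.\<close>
  have bdd: "bdd_above ((\<lambda>v. L2_set (\<lambda>k. x k \<bullet> v) {..<m}) ` ?S)"
  proof (rule bdd_aboveI2)
    fix v assume "v \<in> ?S"
    then have "\<bar>x k \<bullet> v\<bar> \<le> norm (x k)" for k using Cauchy_Schwarz_ineq2[of "x k" v] by simp
    then have "L2_set (\<lambda>k. \<bar>x k \<bullet> v\<bar>) {..<m} \<le> L2_set (\<lambda>k. norm (x k)) {..<m}"
      by (intro L2_set_mono) auto
    then show "L2_set (\<lambda>k. x k \<bullet> v) {..<m} \<le> L2_set (\<lambda>k. norm (x k)) {..<m}"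
      by (simp add: L2_set_def)
  qed
  have col: "nrm (col x b) \<le> spectral_norm m x" for b
  proof -
    have "nrm (col x b) = L2_set (\<lambda>k. x k \<bullet> axis b 1) {..<m}" by (simp add: nrm_def col_def[abs_def] inner_axis)
    also have "\<dots> \<le> spectral_norm m x" unfolding spectral_norm_def
      by (rule cSUP_upper[OF _ bdd]) (simp add: norm_axis_1)
    finally show ?thesis .
  qed
  show "0 \<le> spectral_norm m x" using col[of undefined] nrm_nonneg[of "col x undefined"] by linarith
  have "nrmX x \<le> (\<Sum>b\<in>(UNIV :: 'd2 set). (spectral_norm m x)\<^sup>2)"
    unfolding nrmX_def by (intro sum_mono power_mono col nrm_nonneg)
  then show "nrmX x \<le> real CARD('d2) * (spectral_norm m x)\<^sup>2" by simp
qed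

definition "CX = real CARD('d2) powr pp * M"

lemma CX_nonneg: "0 \<le> CX" using M_pos by (simp add: CX_def)

lemma nrmX_measurable [measurable]: "nrmX \<in> borel_measurable \<gamma>"
  using measurable_nrmX[of "\<lambda>x. x" \<gamma>] measurable_gamma by simp

lemma nrmX_moment: "(\<integral>\<^sup>+x. ennreal (nrmX x powr pp) \<partial>\<gamma>) \<le> ennreal CX"
proof -
  have "nrmX x powr pp \<le> real CARD('d2) powr pp * (spectral_norm m x powr (4 + \<delta>))" for x :: "nat \<Rightarrow> real^'d2"
  proof -
    have "nrmX x powr pp \<le> (real CARD('d2) * (spectral_norm m x)\<^sup>2) powr pp"
      using pp_pos by (intro powr_mono2 nrmX_spectral nrmX_nonneg) auto
    also have "\<dots> = real CARD('d2) powr pp * ((spectral_norm m x)\<^sup>2 powr pp)"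
      by (subst powr_mult) auto
    also have "(spectral_norm m x)\<^sup>2 powr pp = spectral_norm m x powr (4 + \<delta>)"
    proof (cases "spectral_norm m x = 0")
      case False
      then have "(spectral_norm m x)\<^sup>2 = spectral_norm m x powr 2"
        using spectral_nonneg[of x] by (simp add: powr_numeral)
      moreover have "2 * pp = 4 + \<delta>" by (simp add: pp_def)
      ultimately show ?thesis by (simp only: powr_powr)
    qed simp
    finally show ?thesis .
  qed
  then have "(\<integral>\<^sup>+x. ennreal (nrmX x powr pp) \<partial>\<gamma>) \<le> (\<integral>\<^sup>+x. ennreal (real CARD('d2) powr pp) * ennreal (spectral_norm m x powr (4 + \<delta>)) \<partial>\<gamma>)"
    by (intro nn_integral_mono) (simp add: ennreal_mult'[symmetric] ennreal_leI)
  \<comment> \<open>\<open>nn_integral_cmult\<close> asks for a measurable integrand, and the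
    spectral norm is an uncountable supremum. The constant is therefore moved across the simple
    functions below the integrand, which are measurable by definition.\<close>
  also have "\<dots> \<le> ennreal (real CARD('d2) powr pp) * (\<integral>\<^sup>+x. ennreal (spectral_norm m x powr (4 + \<delta>)) \<partial>\<gamma>)"
  proof -
    define c where "c = real CARD('d2) powr pp"
    have c: "0 < c" by (simp add: c_def)
    have m0: "ennreal (1 / c) * (ennreal c * t) = t" for t :: ennreal
      using c by (simp add: mult.assoc[symmetric] ennreal_mult[symmetric])
    show ?thesis
      unfolding c_def[symmetric] nn_integral_def[of _ "\<lambda>x. ennreal c * _ x"]
    proof (rule SUP_least, clarify)
      fix g assume g: "simple_function \<gamma> g" "g \<le> (\<lambda>x. ennreal c * ennreal (spectral_norm m x powr (4 + \<delta>)))"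
      have "integral\<^sup>S \<gamma> g = (\<integral>\<^sup>+x. g x \<partial>\<gamma>)" using g by (simp add: nn_integral_eq_simple_integral)
      also have "\<dots> = (\<integral>\<^sup>+x. ennreal c * (ennreal (1 / c) * g x) \<partial>\<gamma>)"
        using c by (simp add: mult.assoc[symmetric] ennreal_mult[symmetric])
      also have "\<dots> = ennreal c * (\<integral>\<^sup>+x. ennreal (1 / c) * g x \<partial>\<gamma>)"
        using g(1) by (intro nn_integral_cmult) (auto dest: borel_measurable_simple_function)
      also have "\<dots> \<le> ennreal c * (\<integral>\<^sup>+x. ennreal (spectral_norm m x powr (4 + \<delta>)) \<partial>\<gamma>)"
      proof (intro mult_left_mono nn_integral_mono)
        fix x
        have "ennreal (1 / c) * g x \<le> ennreal (1 / c) * (ennreal c * ennreal (spectral_norm m x powr (4 + \<delta>)))"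
          using g(2) by (intro mult_left_mono) (auto simp: le_fun_def)
        then show "ennreal (1 / c) * g x \<le> ennreal (spectral_norm m x powr (4 + \<delta>))" unfolding m0 .
      qed simp
      finally show "integral\<^sup>S \<gamma> g \<le> ennreal c * (\<integral>\<^sup>+x. ennreal (spectral_norm m x powr (4 + \<delta>)) \<partial>\<gamma>)" .
    qed
  qed
  also have "\<dots> \<le> ennreal (real CARD('d2) powr pp) * ennreal M" by (intro mult_left_mono X_moment) simp
  also have "\<dots> = ennreal CX" using M_pos by (simp add: CX_def ennreal_mult'')
  finally show ?thesis .
qed

definition "CE = 2 powr pp * (2 powr pp * (1 + CX) + real (CARD('q) + r) powr pp * (real (CARD('q) + r) * normal_absmoment pp))"

lemma CE_nonneg: "0 \<le> CE"
  using CX_nonneg normal_absmoment_nonneg[of pp] by (simp add: CE_def)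

lemma measurable_nz [measurable]: "nz \<in> borel_measurable (noise m)"
  unfolding nz_def by measurable

text \<open>The noise and predictor parts are separated by \<open>add_powr_le\<close>, used twice.
  The noise part is bounded by normal moments of at most CARD('q) + r coordinates, which explains
  the shape of \<open>CE\<close>.\<close>

lemma envelope_moment: "(\<integral>\<^sup>+x. (\<integral>\<^sup>+\<omega>. ennreal ((1 + nz \<omega> + nrmX x) powr pp) \<partial>noise m) \<partial>\<gamma>) \<le> ennreal CE"
proof -
  interpret N: prob_space "noise m :: 'q noise measure" by (rule prob_space_noise)
  let ?S = "(UNIV :: 'q set) <+> {..<m}" and ?n = "real (CARD('q) + r)"
  have card: "card ?S = CARD('q) + m" by (subst card_Plus) auto
  have nzp: "(\<integral>\<^sup>+\<omega>. ennreal (nz \<omega> powr pp) \<partial>noise m) \<le> ennreal (?n powr pp * (?n * normal_absmoment pp))"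
  proof -
    have "(\<integral>\<^sup>+\<omega>. ennreal (nz \<omega> powr pp) \<partial>noise m)
      \<le> (\<integral>\<^sup>+\<omega>. ennreal (?n powr pp) * (\<Sum>s\<in>?S. ennreal ((coord s \<omega>)\<^sup>2 powr pp)) \<partial>noise m)"
    proof (intro nn_integral_mono)
      fix \<omega>
      have "nz \<omega> powr pp \<le> real (card ?S) powr pp * (\<Sum>s\<in>?S. (coord s \<omega>)\<^sup>2 powr pp)"
        unfolding nz_def using pp_pos by (intro sum_powr_le) auto
      also have "\<dots> \<le> ?n powr pp * (\<Sum>s\<in>?S. (coord s \<omega>)\<^sup>2 powr pp)"
        unfolding card using pp_pos m_le by (intro mult_right_mono powr_mono2 sum_nonneg) auto
      finally show "ennreal (nz \<omega> powr pp) \<le> ennreal (?n powr pp) * (\<Sum>s\<in>?S. ennreal ((coord s \<omega>)\<^sup>2 powr pp))"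
        by (simp add: sum_ennreal ennreal_mult'[symmetric] ennreal_leI sum_nonneg)
    qed
    also have "\<dots> = ennreal (?n powr pp) * (\<Sum>s\<in>?S. (\<integral>\<^sup>+\<omega>. ennreal ((coord s \<omega>)\<^sup>2 powr pp) \<partial>noise m))"
      by (subst nn_integral_cmult, measurable, subst nn_integral_sum) (auto intro: measurable_coord)
    also have "\<dots> \<le> ennreal (?n powr pp) * (\<Sum>s\<in>?S. ennreal (normal_absmoment pp))"
    proof (intro mult_left_mono sum_mono)
      fix s assume s: "s \<in> ?S"
      show "(\<integral>\<^sup>+\<omega>. ennreal ((coord s \<omega>)\<^sup>2 powr pp) \<partial>noise m) \<le> ennreal (normal_absmoment pp)"
        using nn_integral_coord[OF s, of "\<lambda>t. ennreal (t\<^sup>2 powr pp)"] nn_integral_normal_powr[of pp] pp_pos by simp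
    qed simp
    also have "\<dots> = ennreal (?n powr pp * (real (CARD('q) + m) * normal_absmoment pp))"
      using normal_absmoment_nonneg[of pp] by (simp add: card ennreal_mult' ennreal_of_nat_eq_real_of_nat)
    also have "\<dots> \<le> ennreal (?n powr pp * (?n * normal_absmoment pp))"
      using m_le by (intro ennreal_leI mult_left_mono mult_right_mono normal_absmoment_nonneg) auto
    finally show ?thesis .
  qed
  have pt: "(1 + nz \<omega> + nrmX x) powr pp \<le> 2 powr pp * (2 powr pp * (1 + nrmX x powr pp) + nz \<omega> powr pp)" for \<omega> x
  proof -
    have "(1 + nz \<omega> + nrmX x) powr pp = ((1 + nrmX x) + nz \<omega>) powr pp" by (simp add: add_ac)
    also have "\<dots> \<le> 2 powr pp * ((1 + nrmX x) powr pp + nz \<omega> powr pp)"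
      using nrmX_nonneg[of x] nz_nonneg[of \<omega>] pp_pos by (intro add_powr_le) auto
    also have "(1 + nrmX x) powr pp \<le> 2 powr pp * (1 powr pp + nrmX x powr pp)"
      using nrmX_nonneg[of x] pp_pos by (intro add_powr_le) auto
    finally show ?thesis by simp
  qed
  let ?A = "?n powr pp * (?n * normal_absmoment pp)"
  have A0: "0 \<le> ?A" using normal_absmoment_nonneg[of pp] by simp
  have inner: "(\<integral>\<^sup>+\<omega>. ennreal ((1 + nz \<omega> + nrmX x) powr pp) \<partial>noise m)
    \<le> ennreal (2 powr pp * (2 powr pp * 1 + ?A)) + ennreal (2 powr pp * 2 powr pp) * ennreal (nrmX x powr pp)" for x
  proof -
    have "(\<integral>\<^sup>+\<omega>. ennreal ((1 + nz \<omega> + nrmX x) powr pp) \<partial>noise m)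
      \<le> (\<integral>\<^sup>+\<omega>. ennreal (2 powr pp * (2 powr pp * (1 + nrmX x powr pp))) + ennreal (2 powr pp) * ennreal (nz \<omega> powr pp) \<partial>noise m)"
      using pt by (intro nn_integral_mono) (simp add: ennreal_mult'[symmetric] ennreal_plus[symmetric] distrib_left ennreal_leI del: ennreal_plus)
    also have "\<dots> = ennreal (2 powr pp * (2 powr pp * (1 + nrmX x powr pp))) + ennreal (2 powr pp) * (\<integral>\<^sup>+\<omega>. ennreal (nz \<omega> powr pp) \<partial>noise m)"
      by (subst nn_integral_add) (auto simp: N.emeasure_space_1 nn_integral_cmult)
    also have "\<dots> \<le> ennreal (2 powr pp * (2 powr pp * (1 + nrmX x powr pp))) + ennreal (2 powr pp) * ennreal ?A"
      by (intro add_left_mono mult_left_mono nzp) simp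
    also have "\<dots> = ennreal (2 powr pp * (2 powr pp * 1 + ?A)) + ennreal (2 powr pp * 2 powr pp) * ennreal (nrmX x powr pp)"
    proof -
      have "ennreal (t * (t * (1 + X))) + ennreal t * ennreal A = ennreal (t * (t * 1 + A)) + ennreal (t * t) * ennreal X"
        if "0 \<le> t" "0 \<le> X" "0 \<le> A" for t X A :: real
        using that by (simp add: ennreal_mult'[symmetric] ennreal_plus[symmetric] algebra_simps del: ennreal_plus)
      from this[OF _ _ A0] show ?thesis by simp
    qed
    finally show ?thesis .
  qed
  have "(\<integral>\<^sup>+x. (\<integral>\<^sup>+\<omega>. ennreal ((1 + nz \<omega> + nrmX x) powr pp) \<partial>noise m) \<partial>\<gamma>)
    \<le> (\<integral>\<^sup>+x. ennreal (2 powr pp * (2 powr pp * 1 + ?A)) + ennreal (2 powr pp * 2 powr pp) * ennreal (nrmX x powr pp) \<partial>\<gamma>)"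
    by (intro nn_integral_mono inner)
  also have "\<dots> = ennreal (2 powr pp * (2 powr pp * 1 + ?A)) + ennreal (2 powr pp * 2 powr pp) * (\<integral>\<^sup>+x. ennreal (nrmX x powr pp) \<partial>\<gamma>)"
    by (subst nn_integral_add) (auto simp: G.emeasure_space_1 nn_integral_cmult)
  also have "\<dots> \<le> ennreal (2 powr pp * (2 powr pp * 1 + ?A)) + ennreal (2 powr pp * 2 powr pp) * ennreal CX"
    by (intro add_left_mono mult_left_mono nrmX_moment) simp
  also have "\<dots> = ennreal CE"
  proof -
    have "ennreal (t * (t * 1 + A)) + ennreal (t * t) * ennreal X = ennreal (t * (t * (1 + X) + A))"
      if "0 \<le> t" "0 \<le> X" "0 \<le> A" for t X A :: real
      using that by (simp add: ennreal_mult'[symmetric] ennreal_plus[symmetric] algebra_simps del: ennreal_plus)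
    from this[OF _ CX_nonneg A0] show ?thesis unfolding CE_def by simp
  qed
  finally show ?thesis .
qed

text \<open>The common source of the moment bounds on the log density and its derivatives: quadratic
  growth at \<theta>' yields a moment of order \<open>pp\<close> under the law at \<theta>, with a
  constant depending on both parameters only through \<rho>.\<close>

lemma growth_moment:
  fixes \<theta> \<theta>' :: "real^('d1 + 'd2)"
  assumes \<rho>: "\<And>c. \<bar>\<theta> $ c\<bar> \<le> \<rho>" "\<And>c. \<bar>\<theta>' $ c\<bar> \<le> \<rho>" and C: "0 \<le> C"
    and g: "\<And>y x. \<bar>g (y, x)\<bar> \<le> C * (1 + (nrm (res \<theta>' y x))\<^sup>2 + nrmX x)"
    and gm: "g \<in> borel_measurable odom"
  shows "(\<integral>\<^sup>+p. ennreal (\<bar>g p\<bar> powr pp) \<partial>law \<theta>) \<le> ennreal ((C * C3 CARD('d2) \<rho>) powr pp * CE)"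
proof -
  note gm[measurable]
  let ?c = "(C * C3 CARD('d2) \<rho>) powr pp"
  have C3: "0 \<le> C3 CARD('d2) \<rho>" using M_pos by (simp add: C3_def)
  have le: "\<bar>g (yobs \<theta> x \<omega>, x)\<bar> powr pp \<le> ?c * ((1 + nz \<omega> + nrmX x) powr pp)" for x \<omega>
  proof -
    have E: "0 \<le> 1 + nz \<omega> + nrmX x" using nz_nonneg[of \<omega>] nrmX_nonneg[of x] by linarith
    have "\<bar>g (yobs \<theta> x \<omega>, x)\<bar> \<le> C * (C3 CARD('d2) \<rho> * (1 + nz \<omega> + nrmX x))"
      using g[of "yobs \<theta> x \<omega>" x] mult_left_mono[OF residual_growth[OF \<rho>] C] by (rule order_trans)
    then have "\<bar>g (yobs \<theta> x \<omega>, x)\<bar> powr pp \<le> ((C * C3 CARD('d2) \<rho>) * (1 + nz \<omega> + nrmX x)) powr pp"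
      using pp_pos by (intro powr_mono2) (auto simp: mult.assoc)
    also have "\<dots> = ?c * ((1 + nz \<omega> + nrmX x) powr pp)" using C C3 E by (subst powr_mult) auto
    finally show ?thesis .
  qed
  have "(\<integral>\<^sup>+p. ennreal (\<bar>g p\<bar> powr pp) \<partial>law \<theta>) = (\<integral>\<^sup>+x. (\<integral>\<^sup>+\<omega>. ennreal (\<bar>g (yobs \<theta> x \<omega>, x)\<bar> powr pp) \<partial>noise m) \<partial>\<gamma>)"
    by (rule nn_integral_law) measurable
  also have "\<dots> \<le> (\<integral>\<^sup>+x. (\<integral>\<^sup>+\<omega>. ennreal ?c * ennreal ((1 + nz \<omega> + nrmX x) powr pp) \<partial>noise m) \<partial>\<gamma>)"
    using le by (intro nn_integral_mono) (simp add: ennreal_mult'[symmetric] ennreal_leI)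
  also have "\<dots> = ennreal ?c * (\<integral>\<^sup>+x. (\<integral>\<^sup>+\<omega>. ennreal ((1 + nz \<omega> + nrmX x) powr pp) \<partial>noise m) \<partial>\<gamma>)"
  proof -
    interpret N: prob_space "noise m :: 'q noise measure" by (rule prob_space_noise)
    have "(\<lambda>p. ennreal ((1 + nz (snd p) + nrmX (fst p)) powr pp)) \<in> borel_measurable (\<gamma> \<Otimes>\<^sub>M noise m)" by measurable
    from N.borel_measurable_nn_integral_fst[OF this] show ?thesis
      by (subst nn_integral_cmult[symmetric]) (auto simp: nn_integral_cmult)
  qed
  also have "\<dots> \<le> ennreal ?c * ennreal CE" by (intro mult_left_mono envelope_moment) simp
  also have "\<dots> = ennreal (?c * CE)" by (simp add: ennreal_mult')
  finally show ?thesis .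
qed


definition "Ups \<rho> = (C1 * C3 CARD('d2) \<rho>) powr pp * CE"

lemma C1_nonneg: "0 \<le> C1" using kap_pos cB_nonneg by (simp add: C1_def)

lemma rscore_comp_measurable [measurable]: "(\<lambda>p. rscore \<theta> (fst p) (snd p) $ c) \<in> borel_measurable odom"
  by (intro measurable_vec_nth rscore_measurable)

lemma rscore_powr_moment:
  fixes \<theta> :: "real^('d1 + 'd2)"
  assumes "\<And>c. \<bar>\<theta> $ c\<bar> \<le> \<rho>"
  shows "(\<integral>\<^sup>+p. ennreal (\<bar>rscore \<theta> (fst p) (snd p) $ c\<bar> powr pp) \<partial>law \<theta>) \<le> ennreal (Ups \<rho>)"
  unfolding Ups_def
  by (rule growth_moment[OF assms assms C1_nonneg]) (auto intro: rscore_bound)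

lemma square_le_powr: "(t::real)\<^sup>2 \<le> 1 + \<bar>t\<bar> powr pp"
proof (cases "\<bar>t\<bar> \<le> 1")
  case True
  then have "t\<^sup>2 \<le> 1" by (simp add: abs_square_le_1)
  then show ?thesis by (simp add: add_increasing2)
next
  case False
  then have "t\<^sup>2 = \<bar>t\<bar> powr 2" by (simp add: powr_numeral)
  also have "\<dots> \<le> \<bar>t\<bar> powr pp" using False pp_pos by (intro powr_mono) auto
  finally show ?thesis by simp
qed

lemma rscore_square_integrable: "integrable (law \<theta>) (\<lambda>p. (rscore \<theta> (fst p) (snd p) $ c)\<^sup>2)"
proof -
  interpret prob_space "law \<theta>" by (rule prob_space_law)
  have b: "\<bar>\<theta> $ c\<bar> \<le> norm \<theta>" for c by (rule component_le_norm_cart)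
  have m: "(\<lambda>p. rscore \<theta> (fst p) (snd p) $ c) \<in> borel_measurable (law \<theta>)"
    by (simp add: sets_law cong: measurable_cong_sets)
  have "(\<integral>\<^sup>+p. ennreal ((rscore \<theta> (fst p) (snd p) $ c)\<^sup>2) \<partial>law \<theta>)
    \<le> (\<integral>\<^sup>+p. 1 + ennreal (\<bar>rscore \<theta> (fst p) (snd p) $ c\<bar> powr pp) \<partial>law \<theta>)"
    using square_le_powr by (intro nn_integral_mono) (simp add: ennreal_1[symmetric] ennreal_plus[symmetric] ennreal_leI del: ennreal_1 ennreal_plus)
  also have "\<dots> = 1 + (\<integral>\<^sup>+p. ennreal (\<bar>rscore \<theta> (fst p) (snd p) $ c\<bar> powr pp) \<partial>law \<theta>)"
    using m by (subst nn_integral_add) (auto simp: emeasure_space_1)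
  also have "\<dots> \<le> 1 + ennreal (Ups (norm \<theta>))" by (intro add_left_mono rscore_powr_moment b)
  also have "\<dots> < \<infinity>" by simp
  finally show ?thesis using m by (intro integrableI_nonneg) auto
qed

lemma rscore_prod_integrable: "integrable (law \<theta>) (\<lambda>p. rscore \<theta> (fst p) (snd p) $ c * rscore \<theta> (fst p) (snd p) $ c')"
proof (rule Bochner_Integration.integrable_bound)
  show "integrable (law \<theta>) (\<lambda>p. (rscore \<theta> (fst p) (snd p) $ c)\<^sup>2 + (rscore \<theta> (fst p) (snd p) $ c')\<^sup>2)"
    by (intro Bochner_Integration.integrable_add rscore_square_integrable)
  have "\<bar>s * t\<bar> \<le> s\<^sup>2 + t\<^sup>2" for s t :: real
    using mult_le_sum_squares[of "\<bar>s\<bar>" "\<bar>t\<bar>"] by (simp add: abs_mult)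
  then show "AE p in law \<theta>. norm (rscore \<theta> (fst p) (snd p) $ c * rscore \<theta> (fst p) (snd p) $ c')
    \<le> norm ((rscore \<theta> (fst p) (snd p) $ c)\<^sup>2 + (rscore \<theta> (fst p) (snd p) $ c')\<^sup>2)" by simp
qed (simp add: sets_law cong: measurable_cong_sets)

lemma rscore_integrable: "integrable (law \<theta>) (\<lambda>p. rscore \<theta> (fst p) (snd p) $ c)"
proof -
  interpret prob_space "law \<theta>" by (rule prob_space_law)
  show ?thesis
  proof (rule Bochner_Integration.integrable_bound)
    show "integrable (law \<theta>) (\<lambda>p. 1 + (rscore \<theta> (fst p) (snd p) $ c)\<^sup>2)"
      by (intro Bochner_Integration.integrable_add rscore_square_integrable) simp
    show "(\<lambda>p. rscore \<theta> (fst p) (snd p) $ c) \<in> borel_measurable (law \<theta>)"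
      by (simp add: sets_law cong: measurable_cong_sets)
    have "\<bar>t\<bar> \<le> 1 + t\<^sup>2" for t :: real using mult_le_sum_squares[of 1 "\<bar>t\<bar>"] by simp
    then show "AE p in law \<theta>. norm (rscore \<theta> (fst p) (snd p) $ c) \<le> norm (1 + (rscore \<theta> (fst p) (snd p) $ c)\<^sup>2)"
      by simp
  qed
qed

section \<open>The covariance of the reduced score and its uniform bounds\<close>

definition V :: "real^('d1 + 'd2) \<Rightarrow> real^('d1 + 'd2)^('d1 + 'd2)" where
  "V \<theta> = (\<chi> c c'. \<integral>x. Vx \<theta> x $ c $ c' \<partial>\<gamma>)"

lemma rscore_law_moments:
  "(\<integral>p. rscore \<theta> (fst p) (snd p) $ c \<partial>law \<theta>) = 0"
  "(\<integral>p. rscore \<theta> (fst p) (snd p) $ c * rscore \<theta> (fst p) (snd p) $ c' \<partial>law \<theta>) = V \<theta> $ c $ c'"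
  by (simp_all add: integral_law[OF rscore_integrable] integral_law[OF rscore_prod_integrable] rscore_moments V_def)

lemma transpose_V: "transpose (V \<theta>) = V \<theta>"
proof -
  have "Vx \<theta> x $ c $ c' = Vx \<theta> x $ c' $ c" for x c c'
    using arg_cong[OF transpose_Vx[of \<theta> x], of "\<lambda>A. A $ c' $ c"] by (simp add: transpose_def)
  then show ?thesis by (simp add: V_def transpose_def)
qed

lemma nrmX_integrable: "integrable \<gamma> nrmX" and nrmX_mean: "(\<integral>x. nrmX x \<partial>\<gamma>) \<le> 1 + CX"
proof -
  have le: "t \<le> 1 + t powr pp" if "0 \<le> t" for t :: real
  proof (cases "t \<le> 1")
    case False
    then have "t powr 1 \<le> t powr pp" using pp_pos by (intro powr_mono) auto
    then show ?thesis using False by simp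
  qed (simp add: add_increasing2)
  have "(\<integral>\<^sup>+x. ennreal (nrmX x) \<partial>\<gamma>) \<le> (\<integral>\<^sup>+x. 1 + ennreal (nrmX x powr pp) \<partial>\<gamma>)"
    using le[OF nrmX_nonneg]
    by (intro nn_integral_mono) (simp add: ennreal_1[symmetric] ennreal_plus[symmetric] ennreal_leI del: ennreal_1 ennreal_plus)
  also have "\<dots> = 1 + (\<integral>\<^sup>+x. ennreal (nrmX x powr pp) \<partial>\<gamma>)"
    by (subst nn_integral_add) (auto simp: G.emeasure_space_1)
  also have "\<dots> \<le> 1 + ennreal CX" by (intro add_left_mono nrmX_moment)
  also have "\<dots> = ennreal (1 + CX)" using CX_nonneg by simp
  finally have b: "(\<integral>\<^sup>+x. ennreal (nrmX x) \<partial>\<gamma>) \<le> ennreal (1 + CX)" .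
  then show i: "integrable \<gamma> nrmX"
    by (intro integrableI_nonneg) (auto simp: nrmX_nonneg intro: le_less_trans)
  show "(\<integral>x. nrmX x \<partial>\<gamma>) \<le> 1 + CX"
    using b CX_nonneg nn_integral_eq_integral[OF i] by (simp add: nrmX_nonneg del: ennreal_plus)
qed

lemma B_col_bound: "\<bar>B \<theta> (col x b) (col x b')\<bar> \<le> cB * (2 * nrmX x)"
proof -
  have "\<bar>B \<theta> (col x b) (col x b')\<bar> \<le> cB * (nrm (col x b) * nrm (col x b'))" by (rule B_bound)
  also have "\<dots> \<le> cB * (2 * nrmX x)"
    using mult_le_sum_squares[of "nrm (col x b)" "nrm (col x b')"] nrm_col[of x b] nrm_col[of x b']
    by (intro mult_left_mono cB_nonneg) linarith
  finally show ?thesis .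
qed

lemma measurable_B_col: "(\<lambda>x. B \<theta> (col x b) (col x b')) \<in> borel_measurable \<gamma>"
  by (intro measurable_B measurable_col measurable_gamma)

lemma Vx_integrable: "integrable \<gamma> (\<lambda>x. Vx \<theta> x $ c $ c')"
proof (cases c; cases c')
  fix b b' assume c: "c = Inr b" "c' = Inr b'"
  have "integrable \<gamma> (\<lambda>x. B \<theta> (col x b) (col x b'))"
  proof (rule Bochner_Integration.integrable_bound)
    show "integrable \<gamma> (\<lambda>x. cB * (2 * nrmX x))" using nrmX_integrable by simp
    show "AE x in \<gamma>. norm (B \<theta> (col x b) (col x b')) \<le> norm (cB * (2 * nrmX x))"
      using B_col_bound cB_nonneg nrmX_nonneg by (auto intro!: AE_I2 simp: abs_mult abs_of_nonneg[OF nrmX_nonneg])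
  qed (rule measurable_B_col)
  then show ?thesis by (simp add: c Vx_def)
qed (simp_all add: Vx_def)

lemma V_form: "integrable \<gamma> (\<lambda>x. w \<bullet> (Vx \<theta> x *v w))" "w \<bullet> (V \<theta> *v w) = (\<integral>x. w \<bullet> (Vx \<theta> x *v w) \<partial>\<gamma>)"
  unfolding inner_vec_def matrix_vector_mult_def vec_lambda_beta inner_real_def V_def
  using Vx_integrable[of \<theta>]
  by simp_all

text \<open>A simple common minorant of the block constants 2 / mu^2 and 1 / (M^2 mu), continuous in
  \<theta> and the same for all observations.\<close>

definition lo :: "real^('d1 + 'd2) \<Rightarrow> real" where
  "lo \<theta> = 1 / ((1 + M\<^sup>2) * (1 + mu \<theta>)\<^sup>2)"

definition "up = 2 * kap\<^sup>2 * real CARD('q) + cB * (1 + CX)"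

lemma lo_pos: "0 < lo \<theta>"
  using mu_pos[of \<theta>] by (simp add: lo_def add_pos_nonneg)

lemma norm_split: "(\<Sum>j\<in>UNIV. (w $ Inl j)\<^sup>2) + (norm (lmm_psi w))\<^sup>2 = w \<bullet> w" for w :: "real^('d1 + 'd2)"
  unfolding power2_norm_eq_inner
  by (simp add: inner_vec_def lmm_psi_def sum_UNIV_Plus power2_eq_square)

text \<open>The hypothesis concerns the smallest eigenvalue of the expected Gram matrix. Its entries
  are dominated by \<open>nrmX\<close>, hence integrable, and expectation commutes with the
  quadratic form.\<close>

lemma X_gram_lower: "inverse M * (v \<bullet> v) \<le> (\<integral>x. v \<bullet> (gram m x *v v) \<partial>\<gamma>)" for v :: "real^'d2"
proof -
  let ?A = "(\<chi> b c. \<integral>x. gram m x $ b $ c \<partial>\<gamma>) :: real^'d2^'d2"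
  have e: "gram m x $ b $ c = ip (col x b) (col x c)" for x :: "nat \<Rightarrow> real^'d2" and b c
    by (simp add: gram_def ip_def col_def)
  have i: "integrable \<gamma> (\<lambda>x. gram m x $ b $ c)" for b c
  proof (rule Bochner_Integration.integrable_bound)
    show "integrable \<gamma> (\<lambda>x. 2 * nrmX x)" using nrmX_integrable by simp
    show "(\<lambda>x. gram m x $ b $ c) \<in> borel_measurable \<gamma>"
      unfolding e ip_def by (intro borel_measurable_sum borel_measurable_times measurable_col measurable_gamma) auto
    show "AE x in \<gamma>. norm (gram m x $ b $ c) \<le> norm (2 * nrmX x)"
    proof (rule AE_I2)
      fix x :: "nat \<Rightarrow> real^'d2"
      have "\<bar>ip (col x b) (col x c)\<bar> \<le> (\<Sum>k<m. \<bar>col x b k\<bar> * \<bar>col x c k\<bar>)"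
        unfolding ip_def abs_mult[symmetric] by (rule sum_abs)
      also have "\<dots> \<le> nrm (col x b) * nrm (col x c)" unfolding nrm_def by (rule L2_set_mult_ineq)
      also have "\<dots> \<le> 2 * nrmX x"
        using mult_le_sum_squares[of "nrm (col x b)" "nrm (col x c)"] nrm_col[of x b] nrm_col[of x c] by linarith
      finally show "norm (gram m x $ b $ c) \<le> norm (2 * nrmX x)" using nrmX_nonneg[of x] by (simp add: e)
    qed
  qed
  have sym: "transpose ?A = ?A"
    by (simp add: vec_eq_iff transpose_def gram_def mult.commute)
  have "inverse M * (v \<bullet> v) \<le> min_eigenvalue ?A * (v \<bullet> v)" by (intro mult_right_mono X_lower) simp
  also have "\<dots> \<le> v \<bullet> (?A *v v)" by (rule rayleigh_bounds(1)[OF sym])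
  also have "\<dots> = (\<integral>x. v \<bullet> (gram m x *v v) \<partial>\<gamma>)"
    unfolding inner_vec_def matrix_vector_mult_def vec_lambda_beta inner_real_def using i by simp
  finally show ?thesis .
qed

text \<open>Each \<lambda>_j occupies at least one position, by surjectivity of a, and at most
  CARD('q) positions.\<close>

lemma sum_pattern_bounds:
  fixes w :: "real^('d1 + 'd2)"
  shows "(\<Sum>j\<in>UNIV. (w $ Inl j)\<^sup>2) \<le> (\<Sum>l\<in>UNIV. (w $ Inl (a l))\<^sup>2)"
    "(\<Sum>l\<in>UNIV. (w $ Inl (a l))\<^sup>2) \<le> real CARD('q) * (\<Sum>j\<in>UNIV. (w $ Inl j)\<^sup>2)"
proof -
  have eq: "(\<Sum>l\<in>UNIV. (w $ Inl (a l))\<^sup>2) = (\<Sum>j\<in>UNIV. real (card {l. a l = j}) * (w $ Inl j)\<^sup>2)"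
    using sum_pattern[of "\<lambda>j l. (w $ Inl j)\<^sup>2"] by simp
  have "1 \<le> real (card {l. a l = j})" for j
  proof -
    obtain l where "a l = j" using surj_a by (metis surjD)
    then have "{l. a l = j} \<noteq> {}" by blast
    then show ?thesis by (simp add: Suc_le_eq card_gt_0_iff)
  qed
  then show "(\<Sum>j\<in>UNIV. (w $ Inl j)\<^sup>2) \<le> (\<Sum>l\<in>UNIV. (w $ Inl (a l))\<^sup>2)"
    unfolding eq by (intro sum_mono) (simp add: mult_le_cancel_right1)
  show "(\<Sum>l\<in>UNIV. (w $ Inl (a l))\<^sup>2) \<le> real CARD('q) * (\<Sum>j\<in>UNIV. (w $ Inl j)\<^sup>2)"
    unfolding eq sum_distrib_left by (intro sum_mono mult_right_mono card_le) auto
qed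

text \<open>The two blocks decouple. The Hadamard bounds treat the \<lambda>-block;
  \<open>B_lower\<close> and \<open>B_bound\<close>, averaged over the predictors, treat the
  \<psi>-block by means of \<open>X_gram_lower\<close> and the mean of \<open>nrmX\<close>.\<close>

lemma V_bounds: "lo \<theta> * (w \<bullet> w) \<le> w \<bullet> (V \<theta> *v w)" "w \<bullet> (V \<theta> *v w) \<le> up * (w \<bullet> w)"
proof -
  let ?H = "\<Sum>l\<in>UNIV. \<Sum>i\<in>UNIV. w $ Inl (a l) * w $ Inl (a i) * (Km \<theta> $ l $ i)\<^sup>2"
  let ?B = "\<lambda>x. B \<theta> (vcomb w x) (vcomb w x)"
  let ?s = "\<Sum>j\<in>UNIV. (w $ Inl j)\<^sup>2" and ?t = "(norm (lmm_psi w))\<^sup>2"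
  have iB: "integrable \<gamma> ?B"
  proof -
    have "integrable \<gamma> (\<lambda>x. w \<bullet> (Vx \<theta> x *v w) - 2 * ?H)" using V_form(1)[of w \<theta>] by simp
    then show ?thesis by (simp add: Vx_form)
  qed
  have eq: "w \<bullet> (V \<theta> *v w) = 2 * ?H + (\<integral>x. ?B x \<partial>\<gamma>)"
    unfolding V_form(2) Vx_form using iB by (simp add: G.prob_space)
  have mu: "0 < mu \<theta>" by (rule mu_pos)
  have K1: "(1 / mu \<theta>) * (v \<bullet> v) \<le> v \<bullet> (Km \<theta> *v v)" for v using Km_bounds(1)[of v \<theta>] by simp
  have H: "(1 / mu \<theta>)\<^sup>2 * (\<Sum>l\<in>UNIV. (w $ Inl (a l))\<^sup>2) \<le> ?H" "?H \<le> kap\<^sup>2 * (\<Sum>l\<in>UNIV. (w $ Inl (a l))\<^sup>2)"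
    using hadamard_square_bounds[OF Km_sym[of \<theta>] _ K1 Km_bounds(2), of "\<lambda>l. w $ Inl (a l)"] mu by simp_all
  have H1: "(1 / mu \<theta>)\<^sup>2 * ?s \<le> ?H"
    using H(1) mult_left_mono[OF sum_pattern_bounds(1)[of w], of "(1 / mu \<theta>)\<^sup>2"] by simp
  have H2: "?H \<le> kap\<^sup>2 * (real CARD('q) * ?s)"
    using H(2) mult_left_mono[OF sum_pattern_bounds(2)[of w], of "kap\<^sup>2"] by simp
  have c1: "lo \<theta> \<le> 2 * (1 / mu \<theta>)\<^sup>2"
  proof -
    have "(mu \<theta>)\<^sup>2 * 1 \<le> (1 + mu \<theta>)\<^sup>2 * (1 + M\<^sup>2)" using mu by (intro mult_mono power_mono) auto
    then have "1 / ((1 + mu \<theta>)\<^sup>2 * (1 + M\<^sup>2)) \<le> 1 / (mu \<theta>)\<^sup>2" using mu by (intro divide_left_mono) (auto simp: add_pos_nonneg)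
    then have "lo \<theta> \<le> (1 / mu \<theta>)\<^sup>2" by (simp add: lo_def mult.commute power_divide)
    then show ?thesis using zero_le_power2[of "1 / mu \<theta>"] by linarith
  qed
  have c2: "lo \<theta> \<le> inverse M / (M * mu \<theta>)"
  proof -
    have "M * (M * mu \<theta>) \<le> (1 + M\<^sup>2) * (1 + mu \<theta>)\<^sup>2"
    proof -
      have "mu \<theta> \<le> (1 + mu \<theta>)\<^sup>2" using mu by (simp add: power2_eq_square algebra_simps)
      then have "M\<^sup>2 * mu \<theta> \<le> (1 + M\<^sup>2) * (1 + mu \<theta>)\<^sup>2" using mu by (intro mult_mono) auto
      then show ?thesis by (simp add: power2_eq_square)
    qed
    then have "1 / ((1 + M\<^sup>2) * (1 + mu \<theta>)\<^sup>2) \<le> 1 / (M * (M * mu \<theta>))"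
      using mu M_pos by (intro divide_left_mono) (auto simp: add_pos_nonneg)
    then show ?thesis by (simp add: lo_def divide_inverse mult_ac)
  qed
  have ips: "ip (vcomb w x) (vcomb w x) = lmm_psi w \<bullet> (gram m x *v lmm_psi w)" for x by (rule ip_vcomb)
  have iip: "integrable \<gamma> (\<lambda>x. ip (vcomb w x) (vcomb w x))"
  proof (rule Bochner_Integration.integrable_bound)
    show "integrable \<gamma> (\<lambda>x. (w \<bullet> w) * nrmX x)" using nrmX_integrable by simp
    show "(\<lambda>x. ip (vcomb w x) (vcomb w x)) \<in> borel_measurable \<gamma>"
      unfolding ip_def vcomb_def
      by (intro borel_measurable_sum borel_measurable_times borel_measurable_inner measurable_gamma) auto
    have "0 \<le> ip (vcomb w x) (vcomb w x)" for x unfolding nrm_sq[symmetric] by simp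
    then show "AE x in \<gamma>. norm (ip (vcomb w x) (vcomb w x)) \<le> norm ((w \<bullet> w) * nrmX x)"
      using vcomb_bound[of w] nrmX_nonneg by (auto intro!: AE_I2 simp: abs_mult abs_of_nonneg[OF nrmX_nonneg])
  qed
  have B1: "inverse M / (M * mu \<theta>) * ?t \<le> (\<integral>x. ?B x \<partial>\<gamma>)"
  proof -
    have "inverse M / (M * mu \<theta>) * ?t = (inverse M * (lmm_psi w \<bullet> lmm_psi w)) / (M * mu \<theta>)"
      by (simp add: power2_norm_eq_inner)
    also have "\<dots> \<le> (\<integral>x. ip (vcomb w x) (vcomb w x) \<partial>\<gamma>) / (M * mu \<theta>)"
      unfolding ips using mu M_pos by (intro divide_right_mono X_gram_lower) auto
    also have "\<dots> = (\<integral>x. ip (vcomb w x) (vcomb w x) / (M * mu \<theta>) \<partial>\<gamma>)" using iip by simp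
    also have "\<dots> \<le> (\<integral>x. ?B x \<partial>\<gamma>)" using iip by (intro integral_mono iB B_lower) simp
    finally show ?thesis .
  qed
  have "lo \<theta> * (w \<bullet> w) = lo \<theta> * ?s + lo \<theta> * ?t" unfolding norm_split[symmetric] by (rule distrib_left)
  also have "\<dots> \<le> 2 * (1 / mu \<theta>)\<^sup>2 * ?s + inverse M / (M * mu \<theta>) * ?t"
    by (intro add_mono mult_right_mono c1 c2) (auto simp: sum_nonneg)
  also have "\<dots> \<le> w \<bullet> (V \<theta> *v w)" unfolding eq using H1 B1 by simp
  finally show "lo \<theta> * (w \<bullet> w) \<le> w \<bullet> (V \<theta> *v w)" .
  have "(\<integral>x. ?B x \<partial>\<gamma>) \<le> (\<integral>x. cB * ((w \<bullet> w) * nrmX x) \<partial>\<gamma>)"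
  proof (intro integral_mono iB)
    show "integrable \<gamma> (\<lambda>x. cB * ((w \<bullet> w) * nrmX x))" using nrmX_integrable by simp
    fix x
    have "?B x \<le> cB * ip (vcomb w x) (vcomb w x)"
      using B_bound[of \<theta> "vcomb w x" "vcomb w x"] unfolding nrm_sq[symmetric] by (simp add: power2_eq_square)
    also have "\<dots> \<le> cB * ((w \<bullet> w) * nrmX x)" by (intro mult_left_mono vcomb_bound cB_nonneg)
    finally show "?B x \<le> cB * ((w \<bullet> w) * nrmX x)" .
  qed
  also have "\<dots> = cB * ((w \<bullet> w) * (\<integral>x. nrmX x \<partial>\<gamma>))" using nrmX_integrable by simp
  also have "\<dots> \<le> cB * ((w \<bullet> w) * (1 + CX))" by (intro mult_left_mono nrmX_mean cB_nonneg) simp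
  finally have B2: "(\<integral>x. ?B x \<partial>\<gamma>) \<le> cB * ((w \<bullet> w) * (1 + CX))" .
  have "?s \<le> w \<bullet> w" unfolding norm_split[symmetric] by simp
  then have "kap\<^sup>2 * (real CARD('q) * ?s) \<le> kap\<^sup>2 * (real CARD('q) * (w \<bullet> w))" by (intro mult_left_mono) auto
  then have "w \<bullet> (V \<theta> *v w) \<le> 2 * (kap\<^sup>2 * (real CARD('q) * (w \<bullet> w))) + cB * ((w \<bullet> w) * (1 + CX))"
    unfolding eq using H2 B2 by linarith
  also have "\<dots> = up * (w \<bullet> w)" by (simp add: up_def algebra_simps)
  finally show "w \<bullet> (V \<theta> *v w) \<le> up * (w \<bullet> w)" .
qed

text \<open>Only the \<psi>-block contains an integral over the predictors; dominated convergence
  applies there because \<open>cB\<close>, and so the dominating function, is free of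
  \<theta>.\<close>

lemma V_tendsto:
  assumes "u \<longlonglongrightarrow> \<theta>"
  shows "(\<lambda>n. V (u n) $ c $ c') \<longlonglongrightarrow> V \<theta> $ c $ c'"
proof (cases c; cases c')
  fix j k assume c: "c = Inl j" "c' = Inl k"
  show ?thesis
    unfolding c V_def Vx_def by (simp add: G.prob_space) (intro tendsto_intros Km_tendsto assms)
next
  fix b b' assume c: "c = Inr b" "c' = Inr b'"
  have "(\<lambda>n. \<integral>x. B (u n) (col x b) (col x b') \<partial>\<gamma>) \<longlonglongrightarrow> (\<integral>x. B \<theta> (col x b) (col x b') \<partial>\<gamma>)"
  proof (rule integral_dominated_convergence[where w = "\<lambda>x. cB * (2 * nrmX x)"])
    show "integrable \<gamma> (\<lambda>x. cB * (2 * nrmX x))" using nrmX_integrable by simp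
    show "AE x in \<gamma>. (\<lambda>n. B (u n) (col x b) (col x b')) \<longlonglongrightarrow> B \<theta> (col x b) (col x b')"
    proof (rule AE_I2)
      fix x
      have "continuous_on UNIV (\<lambda>\<theta>. B \<theta> (col x b) (col x b'))" by (intro continuous_on_B continuous_intros)
      from continuous_on_tendsto_compose[OF this assms] show "(\<lambda>n. B (u n) (col x b) (col x b')) \<longlonglongrightarrow> B \<theta> (col x b) (col x b')" by simp
    qed
  qed (auto intro!: measurable_B_col AE_I2 B_col_bound)
  then show ?thesis by (simp add: c V_def Vx_def)
qed (simp_all add: V_def Vx_def)


lemma inner_expand_square: "(w \<bullet> u)\<^sup>2 = (\<Sum>c\<in>UNIV. \<Sum>c'\<in>UNIV. w $ c * w $ c' * (u $ c * u $ c'))" for w u :: "real^'n"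
  by (simp add: inner_vec_def power2_eq_square sum_product mult_ac)

lemma rscore_inner:
  fixes w \<theta> :: "real^('d1 + 'd2)"
  shows "integrable (law \<theta>) (\<lambda>p. w \<bullet> rscore \<theta> (fst p) (snd p))" "(\<integral>p. w \<bullet> rscore \<theta> (fst p) (snd p) \<partial>law \<theta>) = 0"
    "integrable (law \<theta>) (\<lambda>p. (w \<bullet> rscore \<theta> (fst p) (snd p))\<^sup>2)"
    "(\<integral>p. (w \<bullet> rscore \<theta> (fst p) (snd p))\<^sup>2 \<partial>law \<theta>) = w \<bullet> (V \<theta> *v w)"
proof -
  show "integrable (law \<theta>) (\<lambda>p. w \<bullet> rscore \<theta> (fst p) (snd p))" "(\<integral>p. w \<bullet> rscore \<theta> (fst p) (snd p) \<partial>law \<theta>) = 0"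
    unfolding inner_vec_def inner_real_def using rscore_integrable[of \<theta>] by (simp_all add: rscore_law_moments)
  show "integrable (law \<theta>) (\<lambda>p. (w \<bullet> rscore \<theta> (fst p) (snd p))\<^sup>2)"
    unfolding inner_expand_square
    by (intro Bochner_Integration.integrable_sum integrable_mult_right rscore_prod_integrable)
  have "(\<integral>p. (w \<bullet> rscore \<theta> (fst p) (snd p))\<^sup>2 \<partial>law \<theta>) = (\<Sum>c\<in>UNIV. \<Sum>c'\<in>UNIV. w $ c * w $ c' * V \<theta> $ c $ c')"
    unfolding inner_expand_square using rscore_prod_integrable[of \<theta>] by (simp add: rscore_law_moments)
  also have "\<dots> = w \<bullet> (V \<theta> *v w)"
    by (simp add: inner_vec_def matrix_vector_mult_def sum_distrib_left mult_ac)
  finally show "(\<integral>p. (w \<bullet> rscore \<theta> (fst p) (snd p))\<^sup>2 \<partial>law \<theta>) = w \<bullet> (V \<theta> *v w)" .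
qed

definition "Wc \<eta> \<rho> = real CARD('d1 + 'd2) powr (2 + \<eta>) * (real CARD('d1 + 'd2) * (1 + Ups \<rho>))"

lemma Ups_nonneg: "0 \<le> Ups \<rho>" using CE_nonneg by (simp add: Ups_def)

lemma Wc_nonneg: "0 \<le> Wc \<eta> \<rho>" using Ups_nonneg[of \<rho>] by (simp add: Wc_def)

text \<open>The Lyapunov condition of \<open>quadratic_clt\<close>. The exponent \<eta> is kept
  below \<delta> / 2 and independent of it, because the Taylor estimate there also requires \<eta>
  \<le> 1.\<close>

lemma rscore_inner_moment:
  fixes w \<theta> :: "real^('d1 + 'd2)"
  assumes \<rho>: "\<And>c. \<bar>\<theta> $ c\<bar> \<le> \<rho>" and \<eta>: "0 < \<eta>" "\<eta> \<le> \<delta> / 2"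
  shows "(\<integral>\<^sup>+p. ennreal (\<bar>w \<bullet> rscore \<theta> (fst p) (snd p)\<bar> powr (2 + \<eta>)) \<partial>law \<theta>) \<le> ennreal (Wc \<eta> \<rho> * norm w powr (2 + \<eta>))"
proof -
  interpret prob_space "law \<theta>" by (rule prob_space_law)
  let ?d = "real CARD('d1 + 'd2)" and ?U = "\<lambda>p c. rscore \<theta> (fst p) (snd p) $ c"
  have m: "(\<lambda>p. ?U p c) \<in> borel_measurable (law \<theta>)" for c
    by (simp add: sets_law cong: measurable_cong_sets)
  note m[measurable]
  have le: "\<bar>t\<bar> powr (2 + \<eta>) \<le> 1 + \<bar>t\<bar> powr pp" for t :: real
  proof (cases "\<bar>t\<bar> \<le> 1")
    case True
    then have "\<bar>t\<bar> powr (2 + \<eta>) \<le> 1" using \<eta> by (intro powr_le1) auto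
    then show ?thesis by (simp add: add_increasing2)
  next
    case False
    then have "\<bar>t\<bar> powr (2 + \<eta>) \<le> \<bar>t\<bar> powr pp" using \<eta> by (intro powr_mono) (auto simp: pp_def)
    then show ?thesis by simp
  qed
  have pt: "\<bar>w \<bullet> rscore \<theta> (fst p) (snd p)\<bar> powr (2 + \<eta>)
    \<le> norm w powr (2 + \<eta>) * (?d powr (2 + \<eta>) * (\<Sum>c\<in>UNIV. 1 + \<bar>?U p c\<bar> powr pp))" for p
  proof -
    have "\<bar>w \<bullet> rscore \<theta> (fst p) (snd p)\<bar> \<le> norm w * norm (rscore \<theta> (fst p) (snd p))" by (rule Cauchy_Schwarz_ineq2)
    also have "\<dots> \<le> norm w * (\<Sum>c\<in>UNIV. \<bar>?U p c\<bar>)" by (intro mult_left_mono norm_le_l1_cart) simp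
    finally have "\<bar>w \<bullet> rscore \<theta> (fst p) (snd p)\<bar> powr (2 + \<eta>) \<le> (norm w * (\<Sum>c\<in>UNIV. \<bar>?U p c\<bar>)) powr (2 + \<eta>)"
      using \<eta> by (intro powr_mono2) auto
    also have "\<dots> = norm w powr (2 + \<eta>) * (\<Sum>c\<in>UNIV. \<bar>?U p c\<bar>) powr (2 + \<eta>)"
      by (subst powr_mult) (auto simp: sum_nonneg)
    also have "\<dots> \<le> norm w powr (2 + \<eta>) * (?d powr (2 + \<eta>) * (\<Sum>c\<in>UNIV. \<bar>?U p c\<bar> powr (2 + \<eta>)))"
      using \<eta> by (intro mult_left_mono sum_powr_le) auto
    also have "\<dots> \<le> norm w powr (2 + \<eta>) * (?d powr (2 + \<eta>) * (\<Sum>c\<in>UNIV. 1 + \<bar>?U p c\<bar> powr pp))"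
      by (intro mult_left_mono sum_mono le) auto
    finally show ?thesis .
  qed
  let ?K = "norm w powr (2 + \<eta>) * ?d powr (2 + \<eta>)"
  have "(\<integral>\<^sup>+p. ennreal (\<bar>w \<bullet> rscore \<theta> (fst p) (snd p)\<bar> powr (2 + \<eta>)) \<partial>law \<theta>)
    \<le> (\<integral>\<^sup>+p. ennreal ?K * (\<Sum>c\<in>UNIV. 1 + ennreal (\<bar>?U p c\<bar> powr pp)) \<partial>law \<theta>)"
  proof (intro nn_integral_mono)
    fix p
    have "(\<Sum>c\<in>UNIV. 1 + ennreal (\<bar>?U p c\<bar> powr pp)) = ennreal (\<Sum>c\<in>UNIV. 1 + \<bar>?U p c\<bar> powr pp)"
      by (subst sum_ennreal[symmetric]) (auto intro!: sum.cong)
    then have "ennreal ?K * (\<Sum>c\<in>UNIV. 1 + ennreal (\<bar>?U p c\<bar> powr pp)) = ennreal (?K * (\<Sum>c\<in>UNIV. 1 + \<bar>?U p c\<bar> powr pp))"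
      by (simp add: ennreal_mult')
    then show "ennreal (\<bar>w \<bullet> rscore \<theta> (fst p) (snd p)\<bar> powr (2 + \<eta>)) \<le> ennreal ?K * (\<Sum>c\<in>UNIV. 1 + ennreal (\<bar>?U p c\<bar> powr pp))"
      using pt[of p] by (simp add: ennreal_leI mult.assoc)
  qed
  also have "\<dots> = ennreal ?K * (\<Sum>c\<in>UNIV. 1 + (\<integral>\<^sup>+p. ennreal (\<bar>?U p c\<bar> powr pp) \<partial>law \<theta>))"
    by (subst nn_integral_cmult, measurable, subst nn_integral_sum, measurable, subst nn_integral_add)
      (auto simp: emeasure_space_1)
  also have "\<dots> \<le> ennreal ?K * (\<Sum>c\<in>(UNIV :: ('d1 + 'd2) set). 1 + ennreal (Ups \<rho>))"
    by (intro mult_left_mono sum_mono add_left_mono rscore_powr_moment \<rho>) simp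
  also have "(\<Sum>c\<in>(UNIV :: ('d1 + 'd2) set). 1 + ennreal (Ups \<rho>)) = ennreal (?d * (1 + Ups \<rho>))"
  proof -
    have "1 + ennreal (Ups \<rho>) = ennreal (1 + Ups \<rho>)" using Ups_nonneg[of \<rho>] by simp
    then show ?thesis using Ups_nonneg[of \<rho>] by (simp add: ennreal_of_nat_eq_real_of_nat ennreal_mult'[symmetric] del: ennreal_plus)
  qed
  also have "ennreal ?K * ennreal (?d * (1 + Ups \<rho>)) = ennreal (?K * (?d * (1 + Ups \<rho>)))"
    by (rule ennreal_mult'[symmetric]) simp
  also have "?K * (?d * (1 + Ups \<rho>)) = Wc \<eta> \<rho> * norm w powr (2 + \<eta>)"
    by (simp add: Wc_def mult_ac)
  finally show ?thesis .
qed

end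

section \<open>Partial derivatives within the parameter space\<close>

lemma lmm_Theta_iff: "\<theta> \<in> lmm_Theta \<longleftrightarrow> (\<forall>j. 0 \<le> \<theta> $ Inl j)"
  by (simp add: lmm_Theta_def lmm_lambda_def)

text \<open>The explicit formulas extend differentiably across the boundary, so their two-sided
  derivative also computes the one-sided \<open>partial\<close>. Moving by t in {0..1} never leaves
  the parameter space, so 0 is a limit point of the admissible increments and the derivative is
  unique.\<close>

lemma partial_eq:
  fixes \<theta> :: "real^('d1::finite + 'd2::finite)"
  assumes \<theta>: "\<theta> \<in> lmm_Theta" and eq: "\<And>\<theta>. \<theta> \<in> lmm_Theta \<Longrightarrow> g \<theta> = G \<theta>"
    and G: "((\<lambda>t. G (\<theta> + t *\<^sub>R axis j 1)) has_vector_derivative D) (at 0)"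
  shows "partial lmm_Theta j g \<theta> = D"
proof -
  let ?S = "{t. \<theta> + t *\<^sub>R axis j 1 \<in> lmm_Theta}"
  have sub: "{0..1} \<subseteq> ?S"
    using \<theta> by (auto simp: lmm_Theta_iff axis_def)
  have "(0::real) islimpt {0..1}" by (simp add: islimpt_Icc)
  then have "0 islimpt ?S" using islimpt_subset[OF _ sub] by blast
  then have nb: "at 0 within ?S \<noteq> bot" by (simp add: trivial_limit_within)
  have "((\<lambda>t. g (\<theta> + t *\<^sub>R axis j 1)) has_vector_derivative D) (at 0 within ?S)"
    by (rule has_vector_derivative_transform[OF _ _ has_vector_derivative_at_within[OF G]]) (use \<theta> eq in auto)
  from vector_derivative_within[OF nb this] show ?thesis unfolding partial_def .
qed

lemma has_vector_derivative_vec: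
  fixes g :: "real \<Rightarrow> real^'n"
  assumes "\<And>c. ((\<lambda>t. g t $ c) has_real_derivative D $ c) (at x)"
  shows "(g has_vector_derivative D) (at x)"
  unfolding has_vector_derivative_def
proof (subst has_derivative_componentwise_within, rule ballI)
  fix i :: "real^'n" assume "i \<in> Basis"
  then obtain c where "i = axis c 1" by (auto simp: Basis_vec_def)
  then show "((\<lambda>x. g x \<bullet> i) has_derivative (\<lambda>x. (x *\<^sub>R D) \<bullet> i)) (at x)"
    using assms[of c] mult_commute_abs[of "D $ c"] by (simp add: inner_axis has_field_derivative_def)
qed

section \<open>Second moments of sums under product measures\<close>

text \<open>Off-diagonal products integrate to zero: with the constant 1 in all other coordinates
  they become a full product, one factor of which has mean zero.\<close>

lemma PiM_sum_moments:
  fixes M :: "'i \<Rightarrow> 'y measure" and g h :: "'i \<Rightarrow> 'y \<Rightarrow> real"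
  assumes prob: "\<And>i. prob_space (M i)" and I: "finite I"
    and g: "\<And>i. integrable (M i) (g i)" "\<And>i. (\<integral>y. g i y \<partial>M i) = 0"
    and h: "\<And>i. integrable (M i) (h i)" "\<And>i. (\<integral>y. h i y \<partial>M i) = 0"
    and gh: "\<And>i. integrable (M i) (\<lambda>y. g i y * h i y)"
  shows "integrable (PiM I M) (\<lambda>y. \<Sum>i\<in>I. g i (y i))" "(\<integral>y. (\<Sum>i\<in>I. g i (y i)) \<partial>PiM I M) = 0"
    "integrable (PiM I M) (\<lambda>y. (\<Sum>i\<in>I. g i (y i)) * (\<Sum>i\<in>I. h i (y i)))"
    "(\<integral>y. (\<Sum>i\<in>I. g i (y i)) * (\<Sum>i\<in>I. h i (y i)) \<partial>PiM I M) = (\<Sum>i\<in>I. \<integral>y. g i y * h i y \<partial>M i)"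
proof -
  interpret product_prob_space M UNIV by (intro product_prob_spaceI prob)
  have single: "integrable (PiM I M) (\<lambda>y. k (y i)) \<and> (\<integral>y. k (y i) \<partial>PiM I M) = (\<integral>y. k y \<partial>M i)"
    if i: "i \<in> I" and k: "integrable (M i) k" for i and k :: "'y \<Rightarrow> real"
  proof -
    have d: "distr (PiM I M) (M i) (\<lambda>y. y i) = M i"
      by (rule distr_PiM_component) (auto intro: prob i)
    have k': "integrable (distr (PiM I M) (M i) (\<lambda>y. y i)) k" unfolding d by (rule k)
    have m: "(\<lambda>y. y i) \<in> measurable (PiM I M) (M i)" using i by measurable
    have "integrable (PiM I M) (\<lambda>y. k (y i))"
      using k' by (subst (asm) integrable_distr_eq[OF m]) (use k in auto)
    moreover have "(\<integral>y. k (y i) \<partial>PiM I M) = (\<integral>y. k y \<partial>distr (PiM I M) (M i) (\<lambda>y. y i))"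
      by (rule integral_distr[OF m, symmetric]) (use k in auto)
    ultimately show ?thesis unfolding d by simp
  qed
  have pair: "integrable (PiM I M) (\<lambda>y. g i (y i) * h j (y j))
    \<and> (\<integral>y. g i (y i) * h j (y j) \<partial>PiM I M) = (if i = j then \<integral>y. g i y * h i y \<partial>M i else 0)"
    if ij: "i \<in> I" "j \<in> I" for i j
  proof (cases "i = j")
    case True
    then show ?thesis using single[OF ij(1) gh[of i]] by simp
  next
    case False
    define F where "F k = (if k = i then g i else if k = j then h j else (\<lambda>_. 1))" for k
    have F: "integrable (M k) (F k)" for k by (simp add: F_def g h)
    have e: "(\<Prod>k\<in>I. F k (y k)) = g i (y i) * h j (y j)" for y
    proof -
      have "(\<Prod>k\<in>I. F k (y k)) = (\<Prod>k\<in>{i, j}. F k (y k))"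
        by (rule prod.mono_neutral_right) (use I ij in \<open>auto simp: F_def\<close>)
      then show ?thesis using False by (simp add: F_def)
    qed
    have "(\<Prod>k\<in>I. integral\<^sup>L (M k) (F k)) = 0"
      using I ij by (intro prod_zero) (auto intro!: bexI[of _ i] simp: F_def g)
    then show ?thesis
      using product_integrable_prod[OF I F] product_integral_prod[OF I F] False by (simp add: e)
  qed
  show "integrable (PiM I M) (\<lambda>y. \<Sum>i\<in>I. g i (y i))" "(\<integral>y. (\<Sum>i\<in>I. g i (y i)) \<partial>PiM I M) = 0"
    using single[OF _ g(1)] by (simp_all add: g)
  have e: "(\<Sum>i\<in>I. g i (y i)) * (\<Sum>i\<in>I. h i (y i)) = (\<Sum>i\<in>I. \<Sum>j\<in>I. g i (y i) * h j (y j))" for y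
    by (rule sum_product)
  show "integrable (PiM I M) (\<lambda>y. (\<Sum>i\<in>I. g i (y i)) * (\<Sum>i\<in>I. h i (y i)))"
    unfolding e using pair by (intro Bochner_Integration.integrable_sum) auto
  show "(\<integral>y. (\<Sum>i\<in>I. g i (y i)) * (\<Sum>i\<in>I. h i (y i)) \<partial>PiM I M) = (\<Sum>i\<in>I. \<integral>y. g i y * h i y \<partial>M i)"
    unfolding e using pair I by (simp add: sum.delta)
qed

lemma cov_matrix_linear:
  fixes A :: "real^'n^'n"
  assumes S: "\<And>y. y \<in> space M \<Longrightarrow> S y = A *v U y"
    and U: "\<And>c. integrable M (\<lambda>y. U y $ c)" "\<And>c. (\<integral>y. U y $ c \<partial>M) = 0"
    and UU: "\<And>c c'. integrable M (\<lambda>y. U y $ c * U y $ c')" "\<And>c c'. (\<integral>y. U y $ c * U y $ c' \<partial>M) = W $ c $ c'"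
  shows "cov_matrix M S = A ** W ** transpose A"
proof -
  have m: "(\<integral>y. S y $ c \<partial>M) = 0" for c
  proof -
    have "(\<integral>y. S y $ c \<partial>M) = (\<integral>y. (\<Sum>k\<in>UNIV. A $ c $ k * U y $ k) \<partial>M)"
      by (intro Bochner_Integration.integral_cong refl) (simp add: S matrix_vector_mult_def)
    then show ?thesis using U by simp
  qed
  have "(\<integral>y. S y $ c * S y $ c' \<partial>M) = (A ** W ** transpose A) $ c $ c'" for c c'
  proof -
    have "(\<integral>y. S y $ c * S y $ c' \<partial>M) = (\<integral>y. (\<Sum>k\<in>UNIV. \<Sum>l\<in>UNIV. A $ c $ k * A $ c' $ l * (U y $ k * U y $ l)) \<partial>M)"
      by (intro Bochner_Integration.integral_cong refl) (simp add: S matrix_vector_mult_def sum_product, simp add: mult_ac)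
    also have "\<dots> = (\<Sum>k\<in>UNIV. \<Sum>l\<in>UNIV. A $ c $ k * A $ c' $ l * W $ k $ l)" using UU by simp
    also have "\<dots> = (A ** W ** transpose A) $ c $ c'"
      by (subst sum.swap) (simp add: matrix_matrix_mult_def transpose_def sum_distrib_left sum_distrib_right mult_ac)
    finally show ?thesis .
  qed
  then show ?thesis by (simp add: cov_matrix_def m vec_eq_iff)
qed

section \<open>The model\<close>

text \<open>The index \<open>pidx i\<close> makes the facts about one observation unconditional in \<open>i\<close>.\<close>

definition pidx :: "nat \<Rightarrow> nat" where "pidx i = max 1 i"

lemma pidx_eq: "1 \<le> i \<Longrightarrow> pidx i = i" by (simp add: pidx_def)

locale lmm =
  fixes r :: "nat \<Rightarrow> nat" and Z :: "nat \<Rightarrow> nat \<Rightarrow> real^'q::finite" and a :: "'q \<Rightarrow> 'd1::finite"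
    and \<sigma> M \<delta> :: real and \<gamma> :: "nat \<Rightarrow> (nat \<Rightarrow> real^'d2::finite) measure" and R :: nat
  assumes sigma_pos: "0 < \<sigma>" and surj_a: "surj a" and M_pos: "0 < M" and delta_pos: "0 < \<delta>"
    and r_le: "\<And>i. 1 \<le> i \<Longrightarrow> r i \<le> R"
    and prob_gamma: "\<And>i. 1 \<le> i \<Longrightarrow> prob_space (\<gamma> i)"
    and sets_gamma: "\<And>i. 1 \<le> i \<Longrightarrow> sets (\<gamma> i) = sets (PiM {..<r i} (\<lambda>_. borel))"
    and Z_lower: "\<And>i. 1 \<le> i \<Longrightarrow> inverse M \<le> min_eigenvalue (gram (r i) (Z i))"
    and Z_upper: "\<And>i. 1 \<le> i \<Longrightarrow> max_eigenvalue (gram (r i) (Z i)) \<le> M"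
    and X_lower: "\<And>i. 1 \<le> i \<Longrightarrow> inverse M \<le> min_eigenvalue (\<chi> b c. \<integral>x. gram (r i) x $ b $ c \<partial>\<gamma> i)"
    and X_moment: "\<And>i. 1 \<le> i \<Longrightarrow> (\<integral>\<^sup>+x. ennreal (spectral_norm (r i) x powr (4 + \<delta>)) \<partial>\<gamma> i) \<le> ennreal M"
begin

lemma pidx_pos: "1 \<le> pidx i" by (simp add: pidx_def)

sublocale O: observation "r (pidx i)" "Z (pidx i)" a \<sigma> M "\<gamma> (pidx i)" \<delta> R for i
proof (intro observation.intro design.intro observation_axioms.intro)
  let ?i = "pidx i"
  have i: "1 \<le> ?i" by (rule pidx_pos)
  have sym: "transpose (gram (r ?i) (Z ?i)) = gram (r ?i) (Z ?i)"
    by (simp add: vec_eq_iff transpose_def gram_def mult.commute)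
  show "inverse M * (v \<bullet> v) \<le> v \<bullet> (gram (r ?i) (Z ?i) *v v)" for v
    using rayleigh_bounds(1)[OF sym, of v] mult_right_mono[OF Z_lower[OF i], of "v \<bullet> v"] by simp
  show "v \<bullet> (gram (r ?i) (Z ?i) *v v) \<le> M * (v \<bullet> v)" for v
    using rayleigh_bounds(2)[OF sym, of v] mult_right_mono[OF Z_upper[OF i], of "v \<bullet> v"] by simp
qed (use pidx_pos sigma_pos M_pos surj_a delta_pos r_le prob_gamma sets_gamma X_lower X_moment in blast)+

abbreviation "f \<equiv> lmm_density r Z a \<sigma> :: nat \<Rightarrow> real^('d1 + 'd2) \<Rightarrow> _ \<Rightarrow> real"
abbreviation "\<nu> \<equiv> lmm_dominating r \<gamma>"
abbreviation "\<Theta> \<equiv> lmm_Theta :: (real^('d1 + 'd2)) set"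

section \<open>Score and information of the sample in terms of the reduced score\<close>

definition Ui :: "nat \<Rightarrow> real^('d1 + 'd2) \<Rightarrow> (nat \<Rightarrow> real) \<times> (nat \<Rightarrow> real^'d2) \<Rightarrow> real^('d1 + 'd2)" where
  "Ui i \<theta> p = O.rscore i \<theta> (fst p) (snd p)"

definition Usum :: "nat \<Rightarrow> real^('d1 + 'd2) \<Rightarrow> (nat \<Rightarrow> (nat \<Rightarrow> real) \<times> (nat \<Rightarrow> real^'d2)) \<Rightarrow> real^('d1 + 'd2)" where
  "Usum n \<theta> y = (\<Sum>i=1..n. Ui i \<theta> (y i))"

definition Vn :: "nat \<Rightarrow> real^('d1 + 'd2) \<Rightarrow> real^('d1 + 'd2)^('d1 + 'd2)" where
  "Vn n \<theta> = (\<Sum>i=1..n. O.V i \<theta>)"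

definition Dmat :: "real^('d1 + 'd2) \<Rightarrow> real^('d1 + 'd2)^('d1 + 'd2)" where
  "Dmat \<theta> = (\<chi> c c'. if c = c' then O.dscale \<theta> c else 0)"

lemma Dmat_mult: "(Dmat \<theta> *v u) $ c = O.dscale \<theta> c * u $ c"
  by (simp add: Dmat_def matrix_vector_mult_def if_distrib[of "\<lambda>x. x * _"] sum.delta cong: if_cong)

lemma transpose_Dmat: "transpose (Dmat \<theta>) = Dmat \<theta>"
  by (simp add: Dmat_def transpose_def vec_eq_iff)

lemma f_eq:
  assumes "1 \<le> i"
  shows "f i \<theta> p = O.dens i \<theta> (fst p) (snd p)"
  unfolding lmm_density_def O.dens_def by (simp add: split_beta' pidx_eq[OF assms])

lemma loglik_eq: "1 \<le> i \<Longrightarrow> loglik f i \<theta> p = ln (O.dens i \<theta> (fst p) (snd p))"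
  by (simp add: loglik_def f_eq)

lemma loglik_deriv:
  "((\<lambda>t. ln (O.dens i (\<theta> + t *\<^sub>R axis c 1) (fst p) (snd p))) has_real_derivative (Dmat \<theta> *v Ui i \<theta> p) $ c) (at 0)"
  unfolding Dmat_mult Ui_def by (rule O.ln_dens_deriv)

lemma score_eq:
  assumes "\<theta> \<in> \<Theta>" "1 \<le> i"
  shows "score \<Theta> f i \<theta> p = Dmat \<theta> *v Ui i \<theta> p"
proof -
  have "partial \<Theta> c (\<lambda>\<theta>. loglik f i \<theta> p) \<theta> = (Dmat \<theta> *v Ui i \<theta> p) $ c" for c
    by (rule partial_eq[OF assms(1) loglik_eq[OF assms(2)]])
      (simp add: has_real_derivative_iff_has_vector_derivative[symmetric] loglik_deriv)
  then show ?thesis by (simp add: score_def gradient_def vec_eq_iff)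
qed

lemma score_n_eq:
  assumes "\<theta> \<in> \<Theta>"
  shows "score_n \<Theta> f n \<theta> y = Dmat \<theta> *v Usum n \<theta> y"
proof -
  have "partial \<Theta> c (\<lambda>\<theta>. loglik_n f n \<theta> y) \<theta> = (Dmat \<theta> *v Usum n \<theta> y) $ c" for c
  proof (rule partial_eq[OF assms(1)])
    show "loglik_n f n \<theta> y = (\<Sum>i=1..n. ln (O.dens i \<theta> (fst (y i)) (snd (y i))))" for \<theta>
      unfolding loglik_n_def by (intro sum.cong refl) (simp add: loglik_eq)
    have "((\<lambda>t. \<Sum>i=1..n. ln (O.dens i (\<theta> + t *\<^sub>R axis c 1) (fst (y i)) (snd (y i)))) has_real_derivative
      (\<Sum>i=1..n. (Dmat \<theta> *v Ui i \<theta> (y i)) $ c)) (at 0)"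
      by (intro DERIV_sum loglik_deriv)
    moreover have "(\<Sum>i=1..n. (Dmat \<theta> *v Ui i \<theta> (y i)) $ c) = (Dmat \<theta> *v Usum n \<theta> y) $ c"
      by (simp add: Dmat_mult Usum_def sum_distrib_left)
    ultimately show "((\<lambda>t. \<Sum>i=1..n. ln (O.dens i (\<theta> + t *\<^sub>R axis c 1) (fst (y i)) (snd (y i)))) has_vector_derivative
      (Dmat \<theta> *v Usum n \<theta> y) $ c) (at 0)"
      by (simp add: has_real_derivative_iff_has_vector_derivative)
  qed
  then show ?thesis by (simp add: score_n_def gradient_def vec_eq_iff)
qed

lemma scaled_deriv:
  "((\<lambda>t. (Dmat (\<theta> + t *\<^sub>R axis c 1) *v Ui i (\<theta> + t *\<^sub>R axis c 1) p) $ c') has_real_derivative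
    O.hess i \<theta> (fst p) (snd p) c' c) (at 0)"
  unfolding Dmat_mult Ui_def by (rule O.score_deriv)

lemma partial_score:
  assumes "\<theta> \<in> \<Theta>" "1 \<le> i"
  shows "partial \<Theta> c (\<lambda>\<theta>. score \<Theta> f i \<theta> p) \<theta> = (\<chi> c'. O.hess i \<theta> (fst p) (snd p) c' c)"
  by (rule partial_eq[OF assms(1) score_eq[OF _ assms(2)]])
    (auto intro!: has_vector_derivative_vec scaled_deriv)

lemma partial_score_n:
  assumes "\<theta> \<in> \<Theta>"
  shows "partial \<Theta> c (\<lambda>\<theta>. score_n \<Theta> f n \<theta> y) \<theta> = (\<chi> c'. \<Sum>i=1..n. O.hess i \<theta> (fst (y i)) (snd (y i)) c' c)"
proof (rule partial_eq[OF assms(1) score_n_eq])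
  have e: "(Dmat \<theta> *v Usum n \<theta> y) $ c' = (\<Sum>i=1..n. (Dmat \<theta> *v Ui i \<theta> (y i)) $ c')" for \<theta> c'
    by (simp add: Dmat_mult Usum_def sum_distrib_left)
  show "((\<lambda>t. Dmat (\<theta> + t *\<^sub>R axis c 1) *v Usum n (\<theta> + t *\<^sub>R axis c 1) y) has_vector_derivative
    (\<chi> c'. \<Sum>i=1..n. O.hess i \<theta> (fst (y i)) (snd (y i)) c' c)) (at 0)"
  proof (rule has_vector_derivative_vec)
    fix c'
    show "((\<lambda>t. (Dmat (\<theta> + t *\<^sub>R axis c 1) *v Usum n (\<theta> + t *\<^sub>R axis c 1) y) $ c') has_real_derivative
      (\<chi> c'. \<Sum>i=1..n. O.hess i \<theta> (fst (y i)) (snd (y i)) c' c) $ c') (at 0)"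
      unfolding e vec_lambda_beta by (intro DERIV_sum scaled_deriv)
  qed
qed

lemma obs_law_eq:
  assumes "1 \<le> i"
  shows "obs_law f \<nu> \<theta> i = O.law i \<theta>"
  unfolding obs_law_def O.law_def O.odom_def lmm_dominating_def f_eq[OF assms]
  by (simp add: pidx_eq[OF assms])

lemma sample_law_eq: "sample_law f \<nu> n \<theta> = PiM {1..n} (\<lambda>i. O.law i \<theta>)"
  unfolding sample_law_def by (rule PiM_cong) (auto simp: obs_law_eq)

lemma prob_space_sample: "prob_space (sample_law f \<nu> n \<theta>)"
  unfolding sample_law_eq by (intro prob_space_PiM O.prob_space_law)

lemma Ui_moments:
  "integrable (O.law i \<theta>) (\<lambda>p. Ui i \<theta> p $ c)" "(\<integral>p. Ui i \<theta> p $ c \<partial>O.law i \<theta>) = 0"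
  "integrable (O.law i \<theta>) (\<lambda>p. Ui i \<theta> p $ c * Ui i \<theta> p $ c')"
  "(\<integral>p. Ui i \<theta> p $ c * Ui i \<theta> p $ c' \<partial>O.law i \<theta>) = O.V i \<theta> $ c $ c'"
  unfolding Ui_def by (rule O.rscore_integrable O.rscore_law_moments O.rscore_prod_integrable)+

lemma Usum_moments:
  "integrable (sample_law f \<nu> n \<theta>) (\<lambda>y. Usum n \<theta> y $ c)" "(\<integral>y. Usum n \<theta> y $ c \<partial>sample_law f \<nu> n \<theta>) = 0"
  "integrable (sample_law f \<nu> n \<theta>) (\<lambda>y. Usum n \<theta> y $ c * Usum n \<theta> y $ c')"
  "(\<integral>y. Usum n \<theta> y $ c * Usum n \<theta> y $ c' \<partial>sample_law f \<nu> n \<theta>) = Vn n \<theta> $ c $ c'"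
proof -
  have e: "Usum n \<theta> y $ c = (\<Sum>i=1..n. Ui i \<theta> (y i) $ c)" for y c by (simp add: Usum_def)
  note m = PiM_sum_moments[of "\<lambda>i. O.law i \<theta>" "{1..n}" "\<lambda>i p. Ui i \<theta> p $ c" "\<lambda>i p. Ui i \<theta> p $ c'",
      OF O.prob_space_law _ Ui_moments(1) Ui_moments(2) Ui_moments(1) Ui_moments(2) Ui_moments(3)]
  show "integrable (sample_law f \<nu> n \<theta>) (\<lambda>y. Usum n \<theta> y $ c)" "(\<integral>y. Usum n \<theta> y $ c \<partial>sample_law f \<nu> n \<theta>) = 0"
    "integrable (sample_law f \<nu> n \<theta>) (\<lambda>y. Usum n \<theta> y $ c * Usum n \<theta> y $ c')"
    "(\<integral>y. Usum n \<theta> y $ c * Usum n \<theta> y $ c' \<partial>sample_law f \<nu> n \<theta>) = Vn n \<theta> $ c $ c'"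
    unfolding sample_law_eq e using m by (simp_all add: Ui_moments(4) Vn_def)
qed

lemma cov_Usum:
  fixes A :: "real^('d1 + 'd2)^('d1 + 'd2)"
  assumes "\<And>y. S y = A *v Usum n \<theta> y"
  shows "cov_matrix (sample_law f \<nu> n \<theta>) S = A ** Vn n \<theta> ** transpose A"
  by (rule cov_matrix_linear) (rule assms Usum_moments)+

lemma info_n_eq:
  assumes "\<theta> \<in> \<Theta>"
  shows "info_n \<Theta> f \<nu> n \<theta> = Dmat \<theta> ** Vn n \<theta> ** Dmat \<theta>"
  unfolding info_n_def using cov_Usum[of "score_n \<Theta> f n \<theta>" "Dmat \<theta>", OF score_n_eq[OF assms]]
  by (simp add: transpose_Dmat)

lemma info_eq:
  assumes "\<theta> \<in> \<Theta>" "1 \<le> i"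
  shows "info \<Theta> f \<nu> i \<theta> = Dmat \<theta> ** O.V i \<theta> ** Dmat \<theta>"
  unfolding info_def obs_law_eq[OF assms(2)]
  using cov_matrix_linear[of "O.law i \<theta>" "score \<Theta> f i \<theta>" "Dmat \<theta>", OF score_eq[OF assms] Ui_moments]
  by (simp add: transpose_Dmat)

lemma transpose_Vn: "transpose (Vn n \<theta>) = Vn n \<theta>"
proof -
  have "O.V i \<theta> $ c $ c' = O.V i \<theta> $ c' $ c" for i c c'
    using arg_cong[OF O.transpose_V[of i \<theta>], of "\<lambda>A. A $ c' $ c"] by (simp add: transpose_def)
  then show ?thesis by (simp add: Vn_def transpose_def vec_eq_iff)
qed

lemma Vn_lower:
  assumes "1 \<le> n"
  shows "O.lo \<theta> * (w \<bullet> w) \<le> w \<bullet> (Vn n \<theta> *v w)"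
proof -
  have "O.lo \<theta> * (w \<bullet> w) \<le> real n * (O.lo \<theta> * (w \<bullet> w))"
    using mult_right_mono[of 1 "real n" "O.lo \<theta> * (w \<bullet> w)"] assms O.lo_pos[of \<theta>] by simp
  also have "\<dots> = (\<Sum>i=1..n. O.lo \<theta> * (w \<bullet> w))" by simp
  also have "\<dots> \<le> w \<bullet> (Vn n \<theta> *v w)"
    unfolding Vn_def inner_sum_matrix_mult by (intro sum_mono O.V_bounds)
  finally show ?thesis .
qed

lemma Vn_inv: "1 \<le> n \<Longrightarrow> invertible (Vn n \<theta>)"
  by (rule coercive_invertible[OF O.lo_pos Vn_lower])

lemma Dmat_invertible:
  assumes "\<And>j. \<theta> $ Inl j \<noteq> 0"
  shows "invertible (Dmat \<theta>)"
proof -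
  have nz: "O.dscale \<theta> c \<noteq> 0" for c using assms by (cases c) (auto simp: O.dscale_def)
  have "x = 0" if "Dmat \<theta> *v x = 0" for x
  proof -
    have "O.dscale \<theta> c * x $ c = 0" for c using that Dmat_mult[of \<theta> x c] by simp
    then show ?thesis using nz by (simp add: vec_eq_iff)
  qed
  then show ?thesis using invertible_left_inverse matrix_left_invertible_ker by blast
qed

lemma noncriticalI:
  assumes "\<theta> \<in> \<Theta>" "\<And>j. \<theta> $ Inl j \<noteq> 0" "1 \<le> n"
  shows "noncritical \<Theta> f \<nu> n \<theta>"
  unfolding noncritical_def info_n_eq[OF assms(1)]
  by (intro invertible_mult Dmat_invertible Vn_inv assms)

text \<open>The density is strictly positive everywhere, so each law has the null sets of the
  dominating measure.\<close>

lemma common_null_sets: "common_null_sets \<Theta> f \<nu>"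
proof -
  have "null_sets (O.law i \<theta>) = null_sets (O.odom i)" for i \<theta>
  proof (rule set_eqI)
    fix A
    have "A \<in> null_sets (O.law i \<theta>) \<longleftrightarrow> A \<in> sets (O.odom i) \<and> (AE p in O.odom i. p \<in> A \<longrightarrow> ennreal (O.dens i \<theta> (fst p) (snd p)) = 0)"
      unfolding O.law_def by (rule null_sets_density_iff) measurable
    also have "\<dots> \<longleftrightarrow> A \<in> sets (O.odom i) \<and> (AE p in O.odom i. p \<notin> A)"
    proof -
      have "\<not> O.dens i \<theta> (fst p) (snd p) \<le> 0" for p using O.dens_pos[of i \<theta> "fst p" "snd p"] by linarith
      then show ?thesis by (simp add: ennreal_eq_0_iff)
    qed
    also have "\<dots> \<longleftrightarrow> A \<in> null_sets (O.odom i)"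
      using AE_iff_null_sets[of A "O.odom i"] by auto
    finally show "A \<in> null_sets (O.law i \<theta>) \<longleftrightarrow> A \<in> null_sets (O.odom i)" .
  qed
  then show ?thesis unfolding common_null_sets_def by (auto simp: obs_law_eq)
qed

text \<open>Raising every \<lambda>-coordinate by 1 / (k + 1) stays in the parameter space and makes
  all of them positive. The points are non-critical for every n at once, since \<open>Vn\<close> is
  always invertible.\<close>

lemma dense_noncritical: "dense_noncritical \<Theta> f \<nu>"
  unfolding dense_noncritical_def
proof (intro ballI)
  fix \<theta> :: "real^('d1 + 'd2)" assume \<theta>: "\<theta> \<in> \<Theta>"
  define e :: "real^('d1 + 'd2)" where "e = (\<chi> c. case c of Inl j \<Rightarrow> 1 | Inr b \<Rightarrow> 0)"
  define u where "u k = \<theta> + (1 / real (Suc k)) *\<^sub>R e" for k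
  have uc: "u k $ Inl j = \<theta> $ Inl j + 1 / real (Suc k)" for k j by (simp add: u_def e_def)
  have pos: "0 < u k $ Inl j" for k j unfolding uc using \<theta> by (intro add_nonneg_pos) (auto simp: lmm_Theta_iff)
  then have m: "u k \<in> \<Theta>" for k by (auto simp: lmm_Theta_iff intro: less_imp_le)
  have "u \<longlonglongrightarrow> \<theta> + 0 *\<^sub>R e"
    unfolding u_def by (intro tendsto_intros LIMSEQ_Suc[OF lim_1_over_n])
  moreover have "noncritical \<Theta> f \<nu> n (u k)" if "1 \<le> n" for n k
    by (rule noncriticalI[OF m _ that]) (use pos in \<open>auto simp: less_imp_neq[symmetric]\<close>)
  ultimately show "\<exists>u. (\<forall>m. u m \<in> \<Theta> \<and> (\<forall>n\<ge>1. noncritical \<Theta> f \<nu> n (u m))) \<and> u \<longlonglongrightarrow> \<theta>"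
    using m by (intro exI[of _ u]) simp
qed

lemma Dmat_form: "w \<bullet> ((Dmat \<theta> ** A ** Dmat \<theta>) *v u) = (Dmat \<theta> *v w) \<bullet> (A *v (Dmat \<theta> *v u))"
  using sym_dot[OF transpose_Dmat[of \<theta>], of w "A *v (Dmat \<theta> *v u)"] by (simp flip: matrix_vector_mul_assoc)

lemma scaleR_matrix_vector: "(c *\<^sub>R A) *v u = c *\<^sub>R (A *v u)" for A :: "real^'n^'m"
  by (simp add: scaleR_matrix_vector_assoc)

text \<open>All information matrices are D V_i D with the same D, and every V_i lies between lo and
  up times the identity. Conjugation by D preserves the order, so the ratios lo / up and up / lo
  serve as c1 and c2.\<close>

lemma comparable_information: "comparable_information \<Theta> f \<nu>"
proof -
  \<comment> \<open>Positivity follows by comparing the lower and upper bounds on \<open>V\<close>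
    at a unit vector.\<close>
  have up: "0 < O.up"
  proof -
    have "O.lo (0 :: real^('d1 + 'd2)) * (axis undefined 1 \<bullet> (axis undefined 1 :: real^('d1 + 'd2))) \<le> O.up * (axis undefined 1 \<bullet> (axis undefined 1 :: real^('d1 + 'd2)))"
      by (rule order_trans[OF O.V_bounds(1) O.V_bounds(2)])
    then show ?thesis using O.lo_pos[of 0] by (simp add: inner_axis_axis)
  qed
  have clo: "continuous_on UNIV (O.lo :: real^('d1 + 'd2) \<Rightarrow> real)"
    unfolding O.lo_def O.mu_def
  proof (intro continuous_intros ballI)
    fix \<theta> :: "real^('d1 + 'd2)"
    show "(1 + M\<^sup>2) * (1 + (\<sigma>\<^sup>2 * M + \<theta> \<bullet> \<theta>))\<^sup>2 \<noteq> 0"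
      using O.lo_pos[of \<theta>] by (auto simp: O.lo_def O.mu_def)
  qed
  have sym: "transpose (Dmat \<theta> ** O.V i \<theta> ** Dmat \<theta>) = Dmat \<theta> ** O.V i \<theta> ** Dmat \<theta>" for \<theta> i
    by (simp add: matrix_transpose_mul transpose_Dmat O.transpose_V matrix_mul_assoc)
  have symd: "transpose (c *\<^sub>R A - d *\<^sub>R B) = c *\<^sub>R A - d *\<^sub>R B" if "transpose A = A" "transpose B = B"
    for c d and A B :: "real^('d1 + 'd2)^('d1 + 'd2)"
    using that by (simp add: vec_eq_iff transpose_def)
  have le: "loewner_le (c *\<^sub>R (Dmat \<theta> ** O.V i \<theta> ** Dmat \<theta>)) (d *\<^sub>R (Dmat \<theta> ** O.V k \<theta> ** Dmat \<theta>))"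
    if c: "0 \<le> c" "0 \<le> d" "c * O.up \<le> d * O.lo \<theta>" for c d i k \<theta>
    unfolding loewner_le_def pos_semidef_def
  proof (intro conjI allI)
    show "transpose (d *\<^sub>R (Dmat \<theta> ** O.V k \<theta> ** Dmat \<theta>) - c *\<^sub>R (Dmat \<theta> ** O.V i \<theta> ** Dmat \<theta>))
      = d *\<^sub>R (Dmat \<theta> ** O.V k \<theta> ** Dmat \<theta>) - c *\<^sub>R (Dmat \<theta> ** O.V i \<theta> ** Dmat \<theta>)"
      by (intro symd sym)
    fix w
    let ?u = "Dmat \<theta> *v w"
    have "c * (?u \<bullet> (O.V i \<theta> *v ?u)) \<le> c * (O.up * (?u \<bullet> ?u))" by (intro mult_left_mono O.V_bounds c)
    also have "\<dots> \<le> d * (O.lo \<theta> * (?u \<bullet> ?u))"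
      using mult_right_mono[OF c(3), of "?u \<bullet> ?u"] by (simp add: mult.assoc)
    also have "\<dots> \<le> d * (?u \<bullet> (O.V k \<theta> *v ?u))" by (intro mult_left_mono O.V_bounds c)
    finally show "0 \<le> w \<bullet> ((d *\<^sub>R (Dmat \<theta> ** O.V k \<theta> ** Dmat \<theta>) - c *\<^sub>R (Dmat \<theta> ** O.V i \<theta> ** Dmat \<theta>)) *v w)"
      by (simp add: matrix_vector_mult_diff_rdistrib inner_diff_right scaleR_matrix_vector Dmat_form)
  qed
  show ?thesis
    unfolding comparable_information_def
  proof (intro exI conjI ballI allI impI)
    show "continuous_on \<Theta> (\<lambda>\<theta>. O.lo \<theta> / O.up)" "continuous_on \<Theta> (\<lambda>\<theta>. O.up / O.lo \<theta>)"
      using continuous_on_subset[OF clo, of \<Theta>] up O.lo_pos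
      by (auto intro!: continuous_intros simp: less_imp_neq[symmetric])
    fix \<theta> :: "real^('d1 + 'd2)" assume \<theta>: "\<theta> \<in> \<Theta>"
    have lo: "0 < O.lo \<theta>" by (rule O.lo_pos)
    show "0 < O.lo \<theta> / O.up" "0 < O.up / O.lo \<theta>" using up lo by simp_all
    fix i :: nat assume i: "1 \<le> i"
    show "loewner_le ((O.lo \<theta> / O.up) *\<^sub>R info \<Theta> f \<nu> 1 \<theta>) (info \<Theta> f \<nu> i \<theta>)"
      using le[of "O.lo \<theta> / O.up" 1 \<theta> 1 i] up lo by (simp add: info_eq[OF \<theta> i] info_eq[OF \<theta> order_refl, simplified])
    show "loewner_le (info \<Theta> f \<nu> i \<theta>) ((O.up / O.lo \<theta>) *\<^sub>R info \<Theta> f \<nu> 1 \<theta>)"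
      using le[of 1 "O.up / O.lo \<theta>" \<theta> i 1] up lo by (simp add: info_eq[OF \<theta> i] info_eq[OF \<theta> order_refl, simplified])
  qed
qed

end

section \<open>Smoothness and moments\<close>

text \<open>Multi-indices are functions to the naturals. Up to order two they are 0, the unit index
  \<open>midx\<close> c and the sum \<open>midx2\<close> c c' of two unit indices.\<close>

definition midx :: "'a \<Rightarrow> 'a \<Rightarrow> nat" where "midx c = (\<lambda>k. if k = c then 1 else 0)"

definition midx2 :: "'a \<Rightarrow> 'a \<Rightarrow> 'a \<Rightarrow> nat" where "midx2 c c' = (\<lambda>k. midx c k + midx c' k)"

lemma sum_midx: "sum (midx c) UNIV = 1" "sum (midx2 c c') UNIV = 2" for c c' :: "'a::finite"
  by (simp_all add: midx_def midx2_def sum.distrib sum.delta')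

lemma midx_inject: "midx c = midx c' \<Longrightarrow> c = c'"
proof (rule ccontr)
  assume e: "midx c = midx c'" and n: "c \<noteq> c'"
  show False using fun_cong[OF e, of c] n by (simp add: midx_def)
qed

text \<open>A multi-index of order two remembers only the unordered pair of directions, so reading a
  Hessian entry from it is well defined only through \<open>hess_sym\<close>.\<close>

lemma midx2_inject:
  assumes "midx2 a b = midx2 c d"
  shows "a = c \<and> b = d \<or> a = d \<and> b = c"
proof (cases "a = c")
  case True
  have "midx b = midx d"
  proof
    fix k show "midx b k = midx d k" using fun_cong[OF assms, of k] unfolding midx2_def True by linarith
  qed
  then have "b = d" by (rule midx_inject)
  then show ?thesis using True by simp
next
  case False
  have "a = d"
  proof (rule ccontr)
    assume "a \<noteq> d"
    then show False using False fun_cong[OF assms, of a] by (simp add: midx2_def midx_def)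
  qed
  have "midx b k = midx c k" for k using fun_cong[OF assms, of k] unfolding midx2_def \<open>a = d\<close> by linarith
  then have "midx b = midx c" by (rule ext)
  then have "b = c" by (rule midx_inject)
  then show ?thesis using \<open>a = d\<close> by simp
qed

lemma low_order_cases:
  fixes m :: "'a::finite \<Rightarrow> nat"
  assumes "sum m UNIV < 2"
  obtains "m = (\<lambda>_. 0)" | c where "m = midx c"
proof (cases "sum m UNIV = 0")
  case True
  then show ?thesis using that(1) by (auto simp: fun_eq_iff)
next
  case False
  then have "sum m UNIV = Suc 0" using assms by linarith
  then obtain c where c: "m c = Suc 0" "\<forall>b\<in>UNIV. c \<noteq> b \<longrightarrow> m b = 0" using sum_eq_Suc0_iff[of UNIV m] by auto
  then have "m = midx c" by (auto simp: midx_def fun_eq_iff)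
  then show ?thesis by (rule that(2))
qed

lemma midx_step:
  "(\<lambda>_. 0)(j := 0 + 1) = midx j" "(midx c)(j := midx c j + 1) = midx2 c j"
  by (auto simp: midx_def midx2_def fun_eq_iff)

context design
begin

lemma measurable_hess:
  fixes \<theta> :: "real^('d1 + 'd2::finite)"
  assumes "\<And>k. k < m \<Longrightarrow> (\<lambda>p. y p k) \<in> borel_measurable N" "\<And>k. k < m \<Longrightarrow> (\<lambda>p. x p k) \<in> borel_measurable N"
  shows "(\<lambda>p. hess \<theta> (y p) (x p) c c') \<in> borel_measurable N"
proof -
  note [measurable] = measurable_rscore[OF assms] measurable_vec_nth[OF measurable_rscore[OF assms]]
  have [measurable]: "(\<lambda>p. hh \<theta> (res \<theta> (y p) (x p)) $ l) \<in> borel_measurable N" for l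
    by (intro measurable_vec_nth measurable_hh measurable_res assms)
  have [measurable]: "(\<lambda>p. hh \<theta> (col (x p) b) $ l) \<in> borel_measurable N" for b l
    by (intro measurable_vec_nth measurable_hh measurable_col assms)
  have [measurable]: "(\<lambda>p. B \<theta> (col (x p) b) (col (x p) b')) \<in> borel_measurable N" for b b'
    by (intro measurable_B measurable_col assms)
  show ?thesis
    by (cases c; cases c'; simp add: hess_def Let_def; measurable)
qed

end

context lmm
begin

text \<open>The directions are recovered from the multi-index by choice. For orders above two the
  last branch still returns some Hessian entry; continuity, measurability and growth thus hold for
  all multi-indices, while the derivative relation is claimed only below order two.\<close>

definition Dlog :: "nat \<Rightarrow> ('d1 + 'd2 \<Rightarrow> nat) \<Rightarrow> real^('d1 + 'd2) \<Rightarrow> (nat \<Rightarrow> real) \<times> (nat \<Rightarrow> real^'d2) \<Rightarrow> real" where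
  "Dlog i m \<theta> p =
    (if m = (\<lambda>_. 0) then ln (O.dens i \<theta> (fst p) (snd p))
     else if \<exists>c. m = midx c then (let c = SOME c. m = midx c in O.dscale \<theta> c * O.rscore i \<theta> (fst p) (snd p) $ c)
     else (let q = SOME q. m = midx2 (fst q) (snd q) in O.hess i \<theta> (fst p) (snd p) (fst q) (snd q)))"

lemma Dlog_0: "Dlog i (\<lambda>_. 0) \<theta> p = ln (O.dens i \<theta> (fst p) (snd p))"
  by (simp add: Dlog_def)

lemma Dlog_1: "Dlog i (midx c) \<theta> p = O.dscale \<theta> c * O.rscore i \<theta> (fst p) (snd p) $ c"
proof -
  have "midx c \<noteq> (\<lambda>_. 0)" using sum_midx(1)[of c] by auto
  moreover have "(SOME c'. midx c = midx c') = c"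
  proof (rule some_equality)
    fix c' assume "midx c = midx c'"
    then show "c' = c" by (rule midx_inject[symmetric])
  qed (rule refl)
  moreover have "\<exists>c'. midx c = midx c'" by (rule exI[of _ c]) (rule refl)
  ultimately show ?thesis by (simp only: Dlog_def Let_def if_P if_not_P not_False_eq_True)
qed

lemma Dlog_2: "Dlog i (midx2 c c') \<theta> p = O.hess i \<theta> (fst p) (snd p) c c'"
proof -
  have n: "midx2 c c' \<noteq> (\<lambda>_. 0)" using sum_midx(2)[of c c'] by auto
  have "sum (midx2 c c') UNIV \<noteq> sum (midx k) UNIV" for k :: "'d1 + 'd2" by (simp add: sum_midx)
  then have n': "\<not> (\<exists>k. midx2 c c' = midx k)" by metis
  define q where "q = (SOME q. midx2 c c' = midx2 (fst q) (snd q))"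
  have "midx2 c c' = midx2 (fst q) (snd q)"
    unfolding q_def by (rule someI[of "\<lambda>q. midx2 c c' = midx2 (fst q) (snd q)" "(c, c')"]) simp
  from midx2_inject[OF this] have h: "O.hess i \<theta> (fst p) (snd p) (fst q) (snd q) = O.hess i \<theta> (fst p) (snd p) c c'"
    using O.hess_sym[of i \<theta> "fst p" "snd p" c c'] by auto
  show ?thesis unfolding Dlog_def Let_def if_not_P[OF n] if_not_P[OF n'] q_def[symmetric] by (rule h)
qed

lemma Dlog_cases:
  obtains "Dlog i m = (\<lambda>\<theta> p. ln (O.dens i \<theta> (fst p) (snd p)))"
  | c where "Dlog i m = (\<lambda>\<theta> p. O.dscale \<theta> c * O.rscore i \<theta> (fst p) (snd p) $ c)"
  | c c' where "Dlog i m = (\<lambda>\<theta> p. O.hess i \<theta> (fst p) (snd p) c c')"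
proof (cases "m = (\<lambda>_. 0)")
  case True
  then show ?thesis using that(1) by (simp add: Dlog_def fun_eq_iff)
next
  case False
  show ?thesis
  proof (cases "\<exists>c. m = midx c")
    case True
    show ?thesis
    proof (rule that(2))
      show "Dlog i m = (\<lambda>\<theta> p. O.dscale \<theta> (SOME c. m = midx c) * O.rscore i \<theta> (fst p) (snd p) $ (SOME c. m = midx c))"
        by (intro ext) (simp only: Dlog_def Let_def if_not_P[OF False] if_P[OF True])
    qed
  next
    case F: False
    show ?thesis
    proof (rule that(3))
      show "Dlog i m = (\<lambda>\<theta> p. O.hess i \<theta> (fst p) (snd p)
        (fst (SOME q. m = midx2 (fst q) (snd q))) (snd (SOME q. m = midx2 (fst q) (snd q))))"
        by (intro ext) (simp only: Dlog_def Let_def if_not_P[OF False] if_not_P[OF F])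
    qed
  qed
qed

lemma Dlog_deriv:
  assumes "sum m UNIV < 2"
  shows "((\<lambda>t. Dlog i m (\<theta> + t *\<^sub>R axis j 1) p) has_real_derivative Dlog i (m(j := m j + 1)) \<theta> p) (at 0)"
  using assms
proof (cases rule: low_order_cases)
  case 1
  show ?thesis unfolding 1 midx_step Dlog_0 Dlog_1 by (rule O.ln_dens_deriv)
next
  case (2 c)
  show ?thesis unfolding 2 midx_step Dlog_1 Dlog_2 by (rule O.score_deriv)
qed

lemma continuous_on_sample_coords:
  "continuous_on S (\<lambda>s. fst (snd s) k)" "continuous_on S (\<lambda>s. snd (snd s) k)"
  for S :: "('a::topological_space \<times> (nat \<Rightarrow> real) \<times> (nat \<Rightarrow> real^'d2)) set"
proof -
  have s: "continuous_on S (\<lambda>s. snd s)" by (rule continuous_on_snd[OF continuous_on_id])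
  show "continuous_on S (\<lambda>s. fst (snd s) k)"
    by (rule continuous_on_compose2[OF continuous_on_product_coordinates continuous_on_fst[OF s]]) simp
  show "continuous_on S (\<lambda>s. snd (snd s) k)"
    by (rule continuous_on_compose2[OF continuous_on_product_coordinates continuous_on_snd[OF s]]) simp
qed

lemma continuous_on_dscale: "continuous_on S (\<lambda>s. O.dscale (fst s) c)"
  for S :: "((real^('d1 + 'd2)) \<times> 'b::topological_space) set"
proof (cases c)
  case (Inl j)
  show ?thesis unfolding Inl O.dscale_def sum.case
    by (rule continuous_on_component[OF continuous_on_fst[OF continuous_on_id]])
next
  case (Inr b)
  show ?thesis unfolding Inr O.dscale_def sum.case by (rule continuous_on_const)
qed

lemma Dlog_continuous: "continuous_on S (\<lambda>(\<theta>, p). Dlog i m \<theta> p)"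
proof -
  have fst: "continuous_on S (\<lambda>s. fst s)" by (rule continuous_on_fst[OF continuous_on_id])
  show ?thesis
  proof (rule Dlog_cases[of i m])
    assume e: "Dlog i m = (\<lambda>\<theta> p. ln (O.dens i \<theta> (fst p) (snd p)))"
    show ?thesis unfolding e case_prod_beta by (rule O.continuous_on_ln_dens[OF fst continuous_on_sample_coords])
  next
    fix c assume e: "Dlog i m = (\<lambda>\<theta> p. O.dscale \<theta> c * O.rscore i \<theta> (fst p) (snd p) $ c)"
    show ?thesis unfolding e case_prod_beta
      by (rule continuous_on_mult[OF continuous_on_dscale
            continuous_on_component[OF O.continuous_on_rscore[OF fst continuous_on_sample_coords]]])
  next
    fix c c' assume e: "Dlog i m = (\<lambda>\<theta> p. O.hess i \<theta> (fst p) (snd p) c c')"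
    show ?thesis unfolding e case_prod_beta by (rule O.continuous_on_hess[OF fst continuous_on_sample_coords])
  qed
qed

definition "Cgrow \<rho> = O.C0 R \<rho> + (1 + \<rho>) * O.C1 + O.C2 \<rho>"

text \<open>Read off from the growth bounds themselves: a constant whose product with a positive
  envelope dominates an absolute value is nonnegative. The observation and data used for this are
  arbitrary.\<close>

lemma growth_const_nonneg:
  assumes "\<And>c. \<bar>(\<theta> :: real^('d1 + 'd2)) $ c\<bar> \<le> \<rho>"
  shows "0 \<le> O.C0 R \<rho>" "0 \<le> O.C2 \<rho>" "0 \<le> \<rho>"
proof -
  define g where "g = 1 + (O.nrm 0 (O.res \<theta> undefined undefined))\<^sup>2 + O.nrmX 0 (undefined :: nat \<Rightarrow> real^'d2)"
  have g: "0 < g" unfolding g_def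
    by (intro add_pos_nonneg) (auto simp: O.nrmX_def intro: sum_nonneg)
  have c: "0 \<le> X" if "0 \<le> X * g" for X using that g by (simp add: zero_le_mult_iff)
  show "0 \<le> O.C0 R \<rho>"
    by (rule c, unfold g_def) (rule order_trans[OF abs_ge_zero O.ln_dens_bound[OF assms O.m_le]])
  show "0 \<le> O.C2 \<rho>"
    by (rule c, unfold g_def) (rule order_trans[OF abs_ge_zero O.hess_bound[OF assms]])
  show "0 \<le> \<rho>" using assms[of undefined] by linarith
qed

lemma Dlog_bound:
  assumes \<rho>: "\<And>c. \<bar>\<theta> $ c\<bar> \<le> \<rho>"
  shows "\<bar>Dlog i m \<theta> (y, x)\<bar> \<le> Cgrow \<rho> * (1 + (O.nrm i (O.res \<theta> y x))\<^sup>2 + O.nrmX i x)"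
proof -
  note nn = growth_const_nonneg[OF \<rho>]
  define g where "g = 1 + (O.nrm i (O.res \<theta> y x))\<^sup>2 + O.nrmX i x"
  have g: "0 \<le> g" unfolding g_def
    by (intro add_nonneg_nonneg) (auto simp: O.nrmX_def intro: sum_nonneg)
  have le: "O.C0 R \<rho> * g \<le> Cgrow \<rho> * g" "(1 + \<rho>) * O.C1 * g \<le> Cgrow \<rho> * g" "O.C2 \<rho> * g \<le> Cgrow \<rho> * g"
    using nn O.C1_nonneg unfolding Cgrow_def by (auto intro!: mult_right_mono g add_nonneg_nonneg mult_nonneg_nonneg)
  show ?thesis
  proof (rule Dlog_cases[of i m])
    assume e: "Dlog i m = (\<lambda>\<theta> p. ln (O.dens i \<theta> (fst p) (snd p)))"
    show ?thesis using O.ln_dens_bound[OF \<rho> O.m_le, of i y x] le(1) unfolding e g_def fst_conv snd_conv by (rule order_trans)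
  next
    fix c assume e: "Dlog i m = (\<lambda>\<theta> p. O.dscale \<theta> c * O.rscore i \<theta> (fst p) (snd p) $ c)"
    have "\<bar>O.dscale \<theta> c\<bar> \<le> 1 + \<rho>"
      using \<rho>[of c] nn by (cases c) (auto simp: O.dscale_def intro: add_increasing)
    then have "\<bar>O.dscale \<theta> c\<bar> * \<bar>O.rscore i \<theta> y x $ c\<bar> \<le> (1 + \<rho>) * (O.C1 * g)"
      unfolding g_def by (intro mult_mono O.rscore_bound) (use nn in auto)
    then show ?thesis using le(2) unfolding e g_def by (simp add: abs_mult mult.assoc)
  next
    fix c c' assume e: "Dlog i m = (\<lambda>\<theta> p. O.hess i \<theta> (fst p) (snd p) c c')"
    show ?thesis using O.hess_bound[OF \<rho>, of i y x c c'] le(3) unfolding e g_def fst_conv snd_conv by (rule order_trans)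
  qed
qed

lemma Dlog_measurable: "Dlog i m \<theta> \<in> borel_measurable (O.odom i)"
proof (rule Dlog_cases[of i m])
  assume e: "Dlog i m = (\<lambda>\<theta> p. ln (O.dens i \<theta> (fst p) (snd p)))"
  show ?thesis unfolding e by measurable
next
  fix c assume e: "Dlog i m = (\<lambda>\<theta> p. O.dscale \<theta> c * O.rscore i \<theta> (fst p) (snd p) $ c)"
  show ?thesis unfolding e
    by (intro borel_measurable_times borel_measurable_const measurable_vec_nth O.rscore_measurable)
next
  fix c c' assume e: "Dlog i m = (\<lambda>\<theta> p. O.hess i \<theta> (fst p) (snd p) c c')"
  show ?thesis unfolding e by (rule O.measurable_hess[OF O.measurable_odom])
qed

text \<open>The formulas in \<open>Dlog\<close> make sense for negative \<lambda> too, which gives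
  the required extension, and any radius would do; with radius 1 all parameters in the ball have
  coordinates bounded by |\<theta>'| + 1. The exponent 2 + \<delta> / 2 is
  \<open>pp\<close>.\<close>

lemma smoothness_moment: "smoothness_moment \<Theta> f \<nu> (\<lambda>_. 2)"
  unfolding smoothness_moment_def
proof (intro ballI conjI)
  fix \<theta>' :: "real^('d1 + 'd2)" assume "\<theta>' \<in> \<Theta>"
  show "(2::nat) \<le> 2" by simp
  define \<rho> where "\<rho> = norm \<theta>' + 1"
  have \<rho>: "\<bar>\<theta> $ c\<bar> \<le> \<rho>" if "\<theta> \<in> ball \<theta>' 1" for \<theta> c
  proof -
    have "norm \<theta> \<le> norm \<theta>' + norm (\<theta> - \<theta>')" by (rule norm_triangle_sub)
    then show ?thesis using that component_le_norm_cart[of \<theta> c] by (simp add: \<rho>_def dist_norm norm_minus_commute)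
  qed
  have \<theta>': "\<theta>' \<in> ball \<theta>' 1" by simp
  have C: "0 \<le> Cgrow \<rho>"
    using growth_const_nonneg[OF \<rho>[OF \<theta>']] O.C1_nonneg by (simp add: Cgrow_def)
  let ?K = "ennreal ((Cgrow \<rho> * O.C3 CARD('d2) \<rho>) powr O.pp * O.CE)"
  have K: "(\<integral>\<^sup>+p. ennreal (\<bar>Dlog i m \<theta>t p\<bar> powr (2 + \<delta> / 2)) \<partial>obs_law f \<nu> \<theta> i) \<le> ?K"
    if "1 \<le> i" "\<theta> \<in> ball \<theta>' 1" "\<theta>t \<in> ball \<theta>' 1" for i m \<theta> \<theta>t
    unfolding obs_law_eq[OF that(1)] O.pp_def[symmetric]
    by (rule O.growth_moment[OF \<rho>[OF that(2)] \<rho>[OF that(3)] C Dlog_bound[OF \<rho>[OF that(3)]] Dlog_measurable])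
  show "\<exists>\<epsilon>>0. \<exists>\<delta>>0. \<exists>(D :: nat \<Rightarrow> ('d1 + 'd2 \<Rightarrow> nat) \<Rightarrow> real^('d1 + 'd2) \<Rightarrow> _ \<Rightarrow> real) \<Y>.
          (\<forall>i\<ge>1. full_measure \<Theta> (\<lambda>\<theta>. obs_law f \<nu> \<theta> i) (\<Y> i) \<and>
             (\<forall>\<theta>\<in>ball \<theta>' \<epsilon> \<inter> \<Theta>. \<forall>y\<in>\<Y> i. D i (\<lambda>_. 0) \<theta> y = loglik f i \<theta> y) \<and>
             (\<forall>m j. sum m UNIV < 2 \<longrightarrow>
                (\<forall>\<theta>\<in>ball \<theta>' \<epsilon>. \<forall>y\<in>\<Y> i.
                   ((\<lambda>t. D i m (\<theta> + t *\<^sub>R axis j 1) y) has_real_derivative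
                      D i (m(j := m j + 1)) \<theta> y) (at 0))) \<and>
             (\<forall>m. sum m UNIV \<le> 2 \<longrightarrow>
                continuous_on (ball \<theta>' \<epsilon> \<times> \<Y> i) (\<lambda>(\<theta>, y). D i m \<theta> y))) \<and>
          (\<forall>m. sum m UNIV \<le> 2 \<longrightarrow>
             (SUP i\<in>{1..}. SUP \<theta>\<in>ball \<theta>' \<epsilon> \<inter> \<Theta>. SUP \<theta>t\<in>ball \<theta>' \<epsilon>.
                \<integral>\<^sup>+y. ennreal (\<bar>D i m \<theta>t y\<bar> powr (2 + \<delta>)) \<partial>obs_law f \<nu> \<theta> i) < \<infinity>)"
  proof (rule exI[of _ 1], rule conjI, simp, rule exI[of _ "\<delta> / 2"], rule conjI, use delta_pos in simp,
      rule exI[of _ Dlog], rule exI[of _ "\<lambda>i. space (O.odom i)"], intro conjI allI impI)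
    fix i :: nat assume i: "1 \<le> i"
    show "full_measure \<Theta> (\<lambda>\<theta>. obs_law f \<nu> \<theta> i) (space (O.odom i))"
      unfolding full_measure_def obs_law_eq[OF i] O.sets_law using O.space_law AE_space by auto
    show "\<forall>\<theta>\<in>ball \<theta>' 1 \<inter> \<Theta>. \<forall>y\<in>space (O.odom i). Dlog i (\<lambda>_. 0) \<theta> y = loglik f i \<theta> y"
      by (simp add: Dlog_0 loglik_eq[OF i])
    show "continuous_on (ball \<theta>' 1 \<times> space (O.odom i)) (\<lambda>(\<theta>, y). Dlog i m \<theta> y)" for m
      by (rule Dlog_continuous)
    show "\<forall>\<theta>\<in>ball \<theta>' 1. \<forall>y\<in>space (O.odom i). ((\<lambda>t. Dlog i m (\<theta> + t *\<^sub>R axis j 1) y) has_real_derivative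
                      Dlog i (m(j := m j + 1)) \<theta> y) (at 0)" if "sum m UNIV < 2" for m j
      using Dlog_deriv[OF that] by blast
  next
    fix m :: "'d1 + 'd2 \<Rightarrow> nat"
    have "(SUP i\<in>{1..}. SUP \<theta>\<in>ball \<theta>' 1 \<inter> \<Theta>. SUP \<theta>t\<in>ball \<theta>' 1.
                \<integral>\<^sup>+y. ennreal (\<bar>Dlog i m \<theta>t y\<bar> powr (2 + \<delta> / 2)) \<partial>obs_law f \<nu> \<theta> i) \<le> ?K"
      by (intro SUP_least K) auto
    then show "(SUP i\<in>{1..}. SUP \<theta>\<in>ball \<theta>' 1 \<inter> \<Theta>. SUP \<theta>t\<in>ball \<theta>' 1.
                \<integral>\<^sup>+y. ennreal (\<bar>Dlog i m \<theta>t y\<bar> powr (2 + \<delta> / 2)) \<partial>obs_law f \<nu> \<theta> i) < \<infinity>"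
      by (rule le_less_trans) simp
  qed
qed

end

section \<open>Admissible orders and eigenvectors\<close>

lemma inner_transpose_right:
  fixes A :: "real^'n^'n"
  shows "(A *v u) \<bullet> x = u \<bullet> (transpose A *v x)"
  using dot_lmul_matrix[of u "transpose A" x] by (simp add: vector_transpose_matrix)

text \<open>Invariance of a score statistic under an invertible linear change of the score. With A =
  D it removes D from the score statistic, with A = \<open>modmat\<close> it removes the orders and
  eigenvectors from the modified one.\<close>

lemma quadratic_form_congruence:
  fixes A V :: "real^'n^'n"
  assumes A: "invertible A" and V: "invertible V"
  shows "(A *v u) \<bullet> (matrix_inv (A ** V ** transpose A) *v (A *v u)) = u \<bullet> (matrix_inv V *v u)"
proof -
  have tA: "invertible (transpose A)" using A by (simp add: invertible_det_nz det_transpose)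
  have P: "invertible (A ** V ** transpose A)" by (intro invertible_mult A V tA)
  define x where "x = matrix_inv (transpose A) *v (matrix_inv V *v u)"
  have "(A ** V ** transpose A) *v x = A *v (V *v (transpose A *v x))"
    by (simp only: matrix_vector_mul_assoc matrix_mul_assoc)
  also have "\<dots> = A *v u"
    unfolding x_def matrix_inv_cancel(1)[OF tA] matrix_inv_cancel(1)[OF V] by (rule refl)
  finally have "(A ** V ** transpose A) *v x = A *v u" .
  then have "matrix_inv (A ** V ** transpose A) *v (A *v u) = x"
    using matrix_inv_cancel(2)[OF P, of x] by simp
  moreover have "(A *v u) \<bullet> x = u \<bullet> (matrix_inv V *v u)"
    unfolding inner_transpose_right x_def matrix_inv_cancel(1)[OF tA] by (rule refl)
  ultimately show ?thesis by simp
qed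

lemma invertible_matrix_mult_iff:
  fixes A B :: "real^'n^'n"
  shows "invertible (A ** B) \<longleftrightarrow> invertible A \<and> invertible B"
  by (simp add: invertible_det_nz det_mul)

lemma pos_def_invertible:
  fixes A :: "real^'n^'n"
  assumes "pos_def A"
  shows "invertible A"
proof -
  have "x = 0" if "A *v x = 0" for x
  proof (rule ccontr)
    assume "x \<noteq> 0"
    then have "0 < x \<bullet> (A *v x)" using assms by (simp add: pos_def_def)
    then show False using that by simp
  qed
  then show ?thesis using invertible_left_inverse matrix_left_invertible_ker by blast
qed

context lmm
begin

lemma dscale_0_iff: "O.dscale \<theta> c = 0 \<longleftrightarrow> (\<exists>j. c = Inl j \<and> \<theta> $ c = 0)"
  by (cases c) (simp_all add: O.dscale_def)

text \<open>A combination vanishing almost surely has second moment zero, which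
  \<open>Vn_lower\<close> forbids unless the coefficients vanish. This converts the almost sure
  requirements on orders into linear algebra.\<close>

lemma AE_score_combination:
  assumes n: "1 \<le> n" and ae: "AE y in sample_law f \<nu> n \<theta>. w \<bullet> Usum n \<theta> y = 0"
  shows "w = 0"
proof -
  let ?P = "sample_law f \<nu> n \<theta>"
  have "(\<integral>y. (w \<bullet> Usum n \<theta> y)\<^sup>2 \<partial>?P) = (\<integral>y. (\<Sum>c\<in>UNIV. \<Sum>c'\<in>UNIV. w $ c * w $ c' * (Usum n \<theta> y $ c * Usum n \<theta> y $ c')) \<partial>?P)"
    by (simp only: O.inner_expand_square)
  also have "\<dots> = (\<Sum>c\<in>UNIV. \<Sum>c'\<in>UNIV. w $ c * w $ c' * Vn n \<theta> $ c $ c')"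
    by (simp add: Usum_moments)
  also have "\<dots> = w \<bullet> (Vn n \<theta> *v w)"
    by (simp add: inner_vec_def matrix_vector_mult_def sum_distrib_left mult_ac)
  finally have e: "(\<integral>y. (w \<bullet> Usum n \<theta> y)\<^sup>2 \<partial>?P) = w \<bullet> (Vn n \<theta> *v w)" .
  have "AE y in ?P. (w \<bullet> Usum n \<theta> y)\<^sup>2 = 0" using ae by eventually_elim simp
  from integral_eq_zero_AE[OF this] e have "w \<bullet> (Vn n \<theta> *v w) = 0" by simp
  then have "O.lo \<theta> * (w \<bullet> w) \<le> 0" using Vn_lower[OF n, of \<theta> w] by simp
  then have "w \<bullet> w \<le> 0" using O.lo_pos[of \<theta>] by (simp add: mult_le_0_iff)
  then show ?thesis using inner_ge_zero[of w] inner_eq_zero_iff[of w] by linarith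
qed

text \<open>The modified score is linear in the reduced score, with the same matrix for every sample.\<close>

definition modmat :: "('d1 + 'd2 \<Rightarrow> nat) \<Rightarrow> ('d1 + 'd2 \<Rightarrow> real^('d1 + 'd2)) \<Rightarrow> real^('d1 + 'd2)
    \<Rightarrow> real^('d1 + 'd2)^('d1 + 'd2)" where
  "modmat \<kappa> v \<theta> = (\<chi> j. if \<kappa> j = 1 then Dmat \<theta> *v v j else v j)"

text \<open>The only shape that admissible orders and vectors can have, by
  \<open>admissible_second_order\<close>: order two is confined to the vanishing
  \<lambda>-coordinates, where the vector points along its own axis.\<close>

definition second_order :: "('d1 + 'd2 \<Rightarrow> nat) \<Rightarrow> ('d1 + 'd2 \<Rightarrow> real^('d1 + 'd2)) \<Rightarrow> real^('d1 + 'd2) \<Rightarrow> bool" where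
  "second_order \<kappa> v \<theta> \<longleftrightarrow>
    (\<forall>j. \<kappa> j = 1 \<or> \<kappa> j = 2 \<and> O.dscale \<theta> j = 0 \<and> (\<forall>c. c \<noteq> j \<longrightarrow> v j $ c = 0))"

lemma hess_diag:
  assumes "O.dscale \<theta> j = 0"
  shows "O.hess i \<theta> y x j j = O.rscore i \<theta> y x $ j"
  using assms unfolding dscale_0_iff by (auto simp: O.hess_def Let_def)

lemma inner_single:
  fixes v u :: "real^'n"
  assumes "\<And>c. c \<noteq> j \<Longrightarrow> v $ c = 0"
  shows "u \<bullet> v = u $ j * v $ j"
proof -
  have "u \<bullet> v = (\<Sum>c\<in>UNIV. if c = j then u $ j * v $ j else 0)"
    unfolding inner_vec_def by (rule sum.cong) (use assms in auto)
  then show ?thesis by simp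
qed

text \<open>For order one, the symmetric D moves onto the vector. For order two, the vector selects
  the diagonal Hessian entry, which is the reduced score itself by \<open>hess_diag\<close>.\<close>

lemma mod_score_eq:
  assumes \<theta>: "\<theta> \<in> \<Theta>" and so: "second_order \<kappa> v \<theta>"
  shows "mod_score \<Theta> f n \<kappa> v \<theta> y = modmat \<kappa> v \<theta> *v Usum n \<theta> y"
proof (simp only: vec_eq_iff, rule allI)
  fix j
  have e: "mod_score \<Theta> f n \<kappa> v \<theta> y $ j
    = (\<Sum>i=1..n. (partial \<Theta> j ^^ (\<kappa> j - 1)) (\<lambda>\<theta>. score \<Theta> f i \<theta> (y i)) \<theta> \<bullet> v j)"
    by (simp add: mod_score_def)
  have r: "(modmat \<kappa> v \<theta> *v Usum n \<theta> y) $ j = (if \<kappa> j = 1 then Dmat \<theta> *v v j else v j) \<bullet> Usum n \<theta> y"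
    unfolding matrix_vector_mul_component modmat_def vec_lambda_beta by (rule refl)
  have s: "w \<bullet> Usum n \<theta> y = (\<Sum>i=1..n. w \<bullet> Ui i \<theta> (y i))" for w
    by (simp only: Usum_def inner_sum_right)
  show "mod_score \<Theta> f n \<kappa> v \<theta> y $ j = (modmat \<kappa> v \<theta> *v Usum n \<theta> y) $ j"
  proof (cases "\<kappa> j = 1")
    case True
    have "mod_score \<Theta> f n \<kappa> v \<theta> y $ j = (\<Sum>i=1..n. (Dmat \<theta> *v Ui i \<theta> (y i)) \<bullet> v j)"
      unfolding e True by (intro sum.cong refl) (simp add: score_eq[OF \<theta>])
    also have "\<dots> = (\<Sum>i=1..n. (Dmat \<theta> *v v j) \<bullet> Ui i \<theta> (y i))"
      by (intro sum.cong refl) (rule trans[OF sym_dot[OF transpose_Dmat] inner_commute])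
    finally show ?thesis unfolding r s if_P[OF True] .
  next
    case False
    then have k: "\<kappa> j = 2" and d: "O.dscale \<theta> j = 0" and v: "\<And>c. c \<noteq> j \<Longrightarrow> v j $ c = 0"
      using so unfolding second_order_def by blast+
    have iv: "u \<bullet> v j = u $ j * v j $ j" for u by (rule inner_single) (erule v)
    have "mod_score \<Theta> f n \<kappa> v \<theta> y $ j = (\<Sum>i=1..n. partial \<Theta> j (\<lambda>\<theta>. score \<Theta> f i \<theta> (y i)) \<theta> \<bullet> v j)"
      unfolding e k by simp
    also have "\<dots> = (\<Sum>i=1..n. O.rscore i \<theta> (fst (y i)) (snd (y i)) $ j * v j $ j)"
    proof (intro sum.cong refl)
      fix i assume "i \<in> {1..n}"
      then have i: "1 \<le> i" by simp
      show "partial \<Theta> j (\<lambda>\<theta>. score \<Theta> f i \<theta> (y i)) \<theta> \<bullet> v j = O.rscore i \<theta> (fst (y i)) (snd (y i)) $ j * v j $ j"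
        unfolding partial_score[OF \<theta> i] iv vec_lambda_beta hess_diag[OF d] by (rule refl)
    qed
    also have "\<dots> = (modmat \<kappa> v \<theta> *v Usum n \<theta> y) $ j"
      unfolding r s if_not_P[OF False] inner_commute[of "v j"] iv Ui_def by (rule refl)
    finally show ?thesis .
  qed
qed

lemma mod_info_eq:
  assumes "\<theta> \<in> \<Theta>" "second_order \<kappa> v \<theta>"
  shows "mod_info \<Theta> f \<nu> n \<kappa> v \<theta> = modmat \<kappa> v \<theta> ** Vn n \<theta> ** transpose (modmat \<kappa> v \<theta>)"
  unfolding mod_info_def by (rule cov_Usum) (rule mod_score_eq[OF assms])

text \<open>Order at least two makes the score combination vanish throughout the hyperplane
  \<theta>_j fixed; at a point with all scale factors off j nonzero this confines v_j to the axis j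
  and forces \<theta>_j to be a vanishing \<lambda>. Order at least three would annihilate the
  reduced component as well, which is nondegenerate.\<close>

lemma admissible_second_order:
  assumes \<theta>: "\<theta> \<in> \<Theta>" and n: "1 \<le> n" and adm: "admissible_orders \<Theta> f \<nu> k n \<theta> \<kappa> v"
  shows "second_order \<kappa> v \<theta>"
  unfolding second_order_def
proof (rule allI)
  fix j
  note a = adm[unfolded admissible_orders_def]
  have k1: "1 \<le> \<kappa> j" and vv: "v j \<bullet> v j = 1" using a by auto
  have ae: "AE y in sample_law f \<nu> n \<theta>t. (partial \<Theta> j ^^ l) (\<lambda>\<theta>. score_n \<Theta> f n \<theta> y) \<theta>t \<bullet> v j = 0"
    if "l + 2 \<le> \<kappa> j" "\<theta>t \<in> \<Theta>" "\<theta>t $ j = \<theta> $ j" for l \<theta>t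
    using a that by blast
  show "\<kappa> j = 1 \<or> \<kappa> j = 2 \<and> O.dscale \<theta> j = 0 \<and> (\<forall>c. c \<noteq> j \<longrightarrow> v j $ c = 0)"
  proof (cases "\<kappa> j = 1")
    case False
    then have k2: "2 \<le> \<kappa> j" using k1 by simp
    \<comment> \<open>All coordinates other than j are set to 1, so D is nonzero off j, and
      membership in the hyperplane of condition (ii) is kept.\<close>
    define \<theta>t :: "real^('d1 + 'd2)" where "\<theta>t = (\<chi> c. if c = j then \<theta> $ j else 1)"
    have t: "\<theta>t \<in> \<Theta>" "\<theta>t $ j = \<theta> $ j" using \<theta> by (auto simp: \<theta>t_def lmm_Theta_iff)
    have "AE y in sample_law f \<nu> n \<theta>t. score_n \<Theta> f n \<theta>t y \<bullet> v j = 0"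
      using ae[of 0 \<theta>t] k2 t by simp
    then have "AE y in sample_law f \<nu> n \<theta>t. (Dmat \<theta>t *v v j) \<bullet> Usum n \<theta>t y = 0"
      unfolding score_n_eq[OF t(1)] sym_dot[OF transpose_Dmat] inner_commute[of "Usum n _ _"] .
    from AE_score_combination[OF n this] have D0: "O.dscale \<theta>t c * v j $ c = 0" for c
      using Dmat_mult[of \<theta>t "v j" c] by simp
    have z: "v j $ c = 0" if "c \<noteq> j" for c
      using D0[of c] that by (cases c) (auto simp: O.dscale_def \<theta>t_def)
    have iv: "u \<bullet> v j = u $ j * v j $ j" for u by (rule inner_single) (erule z)
    have nz: "v j $ j \<noteq> 0" using vv iv[of "v j"] by auto
    then have d: "O.dscale \<theta> j = 0"
      using D0[of j] by (cases j) (auto simp: O.dscale_def \<theta>t_def)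
    \<comment> \<open>Otherwise condition (ii) with l = 1 at \<theta> itself says that the j-th
      reduced component is almost surely zero.\<close>
    have "\<kappa> j = 2"
    proof (rule ccontr)
      assume "\<kappa> j \<noteq> 2"
      then have "AE y in sample_law f \<nu> n \<theta>. partial \<Theta> j (\<lambda>\<theta>. score_n \<Theta> f n \<theta> y) \<theta> \<bullet> v j = 0"
        using ae[of 1 \<theta>] k2 \<theta> by simp
      then have "AE y in sample_law f \<nu> n \<theta>. v j \<bullet> Usum n \<theta> y = 0"
      proof eventually_elim
        case (elim y)
        have "v j \<bullet> Usum n \<theta> y = (\<Sum>i=1..n. O.rscore i \<theta> (fst (y i)) (snd (y i)) $ j) * v j $ j"
          using iv[of "Usum n \<theta> y"] by (simp add: inner_commute Usum_def Ui_def)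
        also have "\<dots> = partial \<Theta> j (\<lambda>\<theta>. score_n \<Theta> f n \<theta> y) \<theta> \<bullet> v j"
          unfolding partial_score_n[OF \<theta>] iv vec_lambda_beta hess_diag[OF d] by (rule refl)
        finally show ?case using elim by simp
      qed
      from AE_score_combination[OF n this] show False using nz by simp
    qed
    then show ?thesis using d z by blast
  qed simp
qed

definition Tstat :: "nat \<Rightarrow> real^('d1 + 'd2) \<Rightarrow> (nat \<Rightarrow> (nat \<Rightarrow> real) \<times> (nat \<Rightarrow> real^'d2)) \<Rightarrow> real" where
  "Tstat n \<theta> y = Usum n \<theta> y \<bullet> (matrix_inv (Vn n \<theta>) *v Usum n \<theta> y)"

lemma admissible_statistic:
  assumes \<theta>: "\<theta> \<in> \<Theta>" and n: "1 \<le> n" and adm: "admissible_orders \<Theta> f \<nu> k n \<theta> \<kappa> v"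
  shows "mod_statistic \<Theta> f \<nu> n \<kappa> v \<theta> y = Tstat n \<theta> y"
proof -
  note so = admissible_second_order[OF assms]
  have "pos_def (mod_info \<Theta> f \<nu> n \<kappa> v \<theta>)" using adm unfolding admissible_orders_def by blast
  \<comment> \<open>The only use of positive definiteness: the modified information contains
    \<open>modmat\<close> as a factor, so an invertible product makes it invertible.\<close>
  from pos_def_invertible[OF this] have A: "invertible (modmat \<kappa> v \<theta>)"
    unfolding mod_info_eq[OF \<theta> so] invertible_matrix_mult_iff by blast
  show ?thesis
    unfolding mod_statistic_def mod_info_eq[OF \<theta> so] mod_score_eq[OF \<theta> so] Tstat_def
    by (rule quadratic_form_congruence[OF A Vn_inv[OF n]])
qed

lemma noncritical_statistic:
  assumes \<theta>: "\<theta> \<in> \<Theta>" and n: "1 \<le> n" and nc: "noncritical \<Theta> f \<nu> n \<theta>"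
  shows "score_statistic \<Theta> f \<nu> n \<theta> y = Tstat n \<theta> y"
proof -
  have D: "invertible (Dmat \<theta>)"
    using nc unfolding noncritical_def info_n_eq[OF \<theta>] invertible_matrix_mult_iff by blast
  show ?thesis
    unfolding score_statistic_def info_n_eq[OF \<theta>] score_n_eq[OF \<theta>] Tstat_def
    using quadratic_form_congruence[OF D Vn_inv[OF n], of "Usum n \<theta> y"] unfolding transpose_Dmat .
qed

text \<open>Where \<lambda>_j = 0 the axis vector is a null eigenvector and receives order two. The
  other eigenvectors are sought in the span of the remaining axes, which contains the range of D and
  hence that of the information, and receive order one.\<close>

lemma nondegenerate: "nondegenerate_modified_score \<Theta> f \<nu> (\<lambda>_. 2)"
  unfolding nondegenerate_modified_score_def
proof (intro ballI allI impI)
  fix \<theta> :: "real^('d1 + 'd2)" and n :: nat assume \<theta>: "\<theta> \<in> \<Theta>" and n: "1 \<le> n"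
  define J where "J = {j. O.dscale \<theta> j = 0}"
  define F where "F = {v :: real^('d1 + 'd2). \<forall>j. j \<notin> - J \<longrightarrow> v $ j = 0}"
  have sF: "subspace F" by (auto simp: F_def subspace_def)
  have dF: "dim F = card (- J)" unfolding F_def dim_vec_eq[symmetric] by (rule dim_substandard_cart)
  have DF: "Dmat \<theta> *v u \<in> F" for u by (auto simp: F_def Dmat_mult J_def)
  let ?I = "info_n \<Theta> f \<nu> n \<theta>"
  have I: "?I *v u = Dmat \<theta> *v (Vn n \<theta> *v (Dmat \<theta> *v u))" for u
    unfolding info_n_eq[OF \<theta>] by (simp only: matrix_vector_mul_assoc matrix_mul_assoc)
  have tI: "transpose ?I = ?I"
    unfolding info_n_eq[OF \<theta>] by (simp add: matrix_transpose_mul transpose_Dmat transpose_Vn matrix_mul_assoc)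
  have "\<exists>B. B \<subseteq> F \<and> pairwise orthogonal B \<and> (\<forall>x\<in>B. norm x = 1 \<and> (\<exists>c. ?I *v x = c *\<^sub>R x)) \<and> span B = F \<and> card B = dim F"
    by (rule spectral_subspace[OF tI sF]) (unfold I, rule DF)
  then obtain Bs where Bs: "Bs \<subseteq> F" "pairwise orthogonal Bs" "\<And>x. x \<in> Bs \<Longrightarrow> norm x = 1"
    "\<And>x. x \<in> Bs \<Longrightarrow> \<exists>c. ?I *v x = c *\<^sub>R x" "span Bs = F" "card Bs = card (- J)" unfolding dF by blast
  have finB: "finite Bs"
    by (rule pairwise_orthogonal_imp_finite[OF Bs(2)])
  \<comment> \<open>The labelling is forced: an order-two vector with index j is differentiated
    along coordinate j, so the indices in J are taken by their axes, and the other eigenvectors use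
    the indices outside J.\<close>
  obtain e where e: "bij_betw e (- J) Bs" using finite_same_card_bij[OF _ finB, of "- J"] Bs(6) by auto
  define v where "v j = (if j \<in> J then axis j 1 else e j)" for j
  define \<kappa> :: "'d1 + 'd2 \<Rightarrow> nat" where "\<kappa> j = (if j \<in> J then 2 else 1)" for j
  have eB: "e j \<in> Bs" if "j \<notin> J" for j using e that by (auto simp: bij_betw_def)
  have eF: "e j $ c = 0" if "j \<notin> J" "c \<in> J" for j c using eB[OF that(1)] Bs(1) that(2) by (auto simp: F_def)
  have so: "second_order \<kappa> v \<theta>"
    unfolding second_order_def by (auto simp: \<kappa>_def v_def J_def axis_def)
  let ?A = "modmat \<kappa> v \<theta>"
  \<comment> \<open>If A u = 0, the rows in J give u_j = 0 there. The other rows make D u orthogonal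
    to a basis of F, in which D u lies, so D u = 0 and u vanishes off J too.\<close>
  have A: "invertible ?A"
  proof -
    have "u = 0" if u: "?A *v u = 0" for u
    proof -
      have row: "(if j \<in> J then v j else Dmat \<theta> *v v j) \<bullet> u = 0" for j
        using arg_cong[OF u, of "\<lambda>x. x $ j"]
        unfolding matrix_vector_mul_component modmat_def vec_lambda_beta by (simp add: \<kappa>_def split: if_splits)
      have uJ: "u $ j = 0" if "j \<in> J" for j using row[of j] that by (simp add: v_def inner_axis')
      have "orthogonal (Dmat \<theta> *v u) x" if xB: "x \<in> Bs" for x
      proof -
        obtain j where j: "j \<notin> J" "x = e j" using xB bij_betw_imp_surj_on[OF e] by blast
        show ?thesis unfolding orthogonal_def j(2) sym_dot[OF transpose_Dmat]
          using row[of j] j(1) by (simp add: v_def inner_commute)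
      qed
      then have "orthogonal (Dmat \<theta> *v u) (Dmat \<theta> *v u)"
        by (intro orthogonal_to_span[of "Dmat \<theta> *v u" Bs]) (use DF Bs(5) in auto)
      then have "O.dscale \<theta> c * u $ c = 0" for c
        using Dmat_mult[of \<theta> u c] by (simp add: orthogonal_def)
      then have "u $ c = 0" for c using uJ[of c] by (cases "c \<in> J") (auto simp: J_def)
      then show ?thesis by (simp add: vec_eq_iff)
    qed
    then show ?thesis using invertible_left_inverse matrix_left_invertible_ker by blast
  qed
  have "admissible_orders \<Theta> f \<nu> 2 n \<theta> \<kappa> v"
    unfolding admissible_orders_def
  proof (intro conjI allI impI)
    show "1 \<le> \<kappa> j" "\<kappa> j \<le> 2" for j by (auto simp: \<kappa>_def)
    show "\<exists>c. ?I *v v j = c *\<^sub>R v j" for j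
    proof (cases "j \<in> J")
      case True
      have "Dmat \<theta> *v axis j 1 = 0" using True by (auto simp: vec_eq_iff Dmat_mult axis_def J_def)
      then have "?I *v v j = 0 *\<^sub>R v j" unfolding I v_def if_P[OF True] by simp
      then show ?thesis by (rule exI)
    next
      case False
      then show ?thesis using Bs(4)[OF eB[OF False]] by (simp add: v_def)
    qed
    show "v j \<bullet> v l = (if j = l then 1 else 0)" for j l
    proof (cases "j \<in> J \<or> l \<in> J")
      case True
      have ax: "(axis j 1 :: real^('d1 + 'd2)) $ l = (if j = l then 1 else 0)" for j l by (simp add: axis_def)
      show ?thesis using True eF[of j l] eF[of l j] by (auto simp: v_def inner_axis inner_axis' ax)
    next
      case False
      then have jl: "j \<notin> J" "l \<notin> J" by auto
      show ?thesis
      proof (cases "j = l")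
        case True
        then show ?thesis using Bs(3)[OF eB[OF jl(1)]] jl by (simp add: v_def norm_eq_1)
      next
        case False
        have "e j \<noteq> e l" using e jl False by (auto simp: bij_betw_def inj_on_def)
        then have "orthogonal (e j) (e l)" using pairwiseD[OF Bs(2) eB[OF jl(1)] eB[OF jl(2)]] by blast
        then show ?thesis using False jl by (simp add: v_def orthogonal_def)
      qed
    qed
    show "pos_def (mod_info \<Theta> f \<nu> n \<kappa> v \<theta>)"
      unfolding pos_def_def mod_info_eq[OF \<theta> so]
    proof (intro conjI allI impI)
      show "transpose (?A ** Vn n \<theta> ** transpose ?A) = ?A ** Vn n \<theta> ** transpose ?A"
        by (simp add: matrix_transpose_mul transpose_Vn transpose_transpose matrix_mul_assoc)
      fix w :: "real^('d1 + 'd2)" assume w: "w \<noteq> 0"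
      let ?u = "transpose ?A *v w"
      have tA: "invertible (transpose ?A)" using A by (simp add: invertible_det_nz det_transpose)
      have u: "?u \<noteq> 0"
      proof
        assume "?u = 0"
        then have "w = 0" using matrix_inv_cancel(2)[OF tA, of w] by simp
        then show False using w by simp
      qed
      have "w \<bullet> ((?A ** Vn n \<theta> ** transpose ?A) *v w) = w \<bullet> (?A *v (Vn n \<theta> *v ?u))"
        by (simp only: matrix_vector_mul_assoc matrix_mul_assoc)
      also have "\<dots> = ?u \<bullet> (Vn n \<theta> *v ?u)"
        by (rule trans[OF inner_commute trans[OF inner_transpose_right inner_commute]])
      finally have e: "w \<bullet> ((?A ** Vn n \<theta> ** transpose ?A) *v w) = ?u \<bullet> (Vn n \<theta> *v ?u)" .
      have "0 < O.lo \<theta> * (?u \<bullet> ?u)" using u by (intro mult_pos_pos O.lo_pos) simp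
      then show "0 < w \<bullet> ((?A ** Vn n \<theta> ** transpose ?A) *v w)"
        unfolding e by (rule less_le_trans) (rule Vn_lower[OF n])
    qed
    fix j l assume l: "l + 2 \<le> \<kappa> j"
    then have j: "j \<in> J" and l0: "l = 0" by (auto simp: \<kappa>_def split: if_splits)
    show "\<forall>\<theta>t\<in>\<Theta>. \<theta>t $ j = \<theta> $ j \<longrightarrow> (\<forall>\<theta>0\<in>\<Theta>. AE y in sample_law f \<nu> n \<theta>0.
        (partial \<Theta> j ^^ l) (\<lambda>\<theta>. score_n \<Theta> f n \<theta> y) \<theta>t \<bullet> v j = 0)"
    proof (intro ballI impI)
      fix \<theta>t \<theta>0 :: "real^('d1 + 'd2)" assume t: "\<theta>t \<in> \<Theta>" "\<theta>t $ j = \<theta> $ j"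
      have "O.dscale \<theta>t j = 0" using j t(2) by (auto simp: J_def dscale_0_iff)
      then have "score_n \<Theta> f n \<theta>t y \<bullet> v j = 0" for y
        unfolding score_n_eq[OF t(1)] v_def if_P[OF j] inner_axis Dmat_mult by simp
      then show "AE y in sample_law f \<nu> n \<theta>0. (partial \<Theta> j ^^ l) (\<lambda>\<theta>. score_n \<Theta> f n \<theta> y) \<theta>t \<bullet> v j = 0"
        by (simp add: l0)
    qed
  qed
  then show "\<exists>\<kappa> v. admissible_orders \<Theta> f \<nu> 2 n \<theta> \<kappa> v" by blast
qed

end

section \<open>The continuous extension and its law\<close>

context lmm
begin

lemma isCont_Vn_inv: "isCont (\<lambda>\<theta>. matrix_inv (Vn n \<theta>) $ c $ c') \<theta>" if n: "1 \<le> n"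
proof (rule continuous_at_sequentiallyI)
  fix u :: "nat \<Rightarrow> real^('d1 + 'd2)" assume u: "u \<longlonglongrightarrow> \<theta>"
  show "(\<lambda>k. matrix_inv (Vn n (u k)) $ c $ c') \<longlonglongrightarrow> matrix_inv (Vn n \<theta>) $ c $ c'"
  proof (rule tendsto_matrix_inv(1)[OF _ Vn_inv[OF n]])
    fix i j
    have e: "Vn n t $ i $ j = (\<Sum>k=1..n. O.V k t $ i $ j)" for t by (simp add: Vn_def)
    show "(\<lambda>k. Vn n (u k) $ i $ j) \<longlonglongrightarrow> Vn n \<theta> $ i $ j"
      unfolding e by (intro tendsto_sum O.V_tendsto[OF u])
  qed
qed

lemma continuous_on_sample_nth:
  "continuous_on S (\<lambda>s. fst (snd s i) k)" "continuous_on S (\<lambda>s. snd (snd s i) k)"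
  for S :: "('a::topological_space \<times> (nat \<Rightarrow> (nat \<Rightarrow> real) \<times> (nat \<Rightarrow> real^'d2))) set"
proof -
  have s: "continuous_on S (\<lambda>s. snd s i)"
    by (rule continuous_on_compose2[OF continuous_on_product_coordinates continuous_on_snd[OF continuous_on_id]]) simp
  show "continuous_on S (\<lambda>s. fst (snd s i) k)"
    by (rule continuous_on_compose2[OF continuous_on_product_coordinates continuous_on_fst[OF s]]) simp
  show "continuous_on S (\<lambda>s. snd (snd s i) k)"
    by (rule continuous_on_compose2[OF continuous_on_product_coordinates continuous_on_snd[OF s]]) simp
qed

lemma continuous_on_Tstat:
  assumes n: "1 \<le> n"
  shows "continuous_on S (\<lambda>(\<theta>, y). Tstat n \<theta> y)"
proof -
  have U: "continuous_on S (\<lambda>s. Usum n (fst s) (snd s))"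
    unfolding Usum_def Ui_def
    by (intro continuous_on_sum O.continuous_on_rscore continuous_on_fst continuous_on_id continuous_on_sample_nth)
  have "continuous_on UNIV (\<lambda>\<theta>. matrix_inv (Vn n \<theta>) $ c $ c')" for c c'
    using isCont_Vn_inv[OF n] by (intro continuous_at_imp_continuous_on) blast
  then have V: "continuous_on S (\<lambda>s. matrix_inv (Vn n (fst s)) $ c $ c')" for c c'
    by (rule continuous_on_compose2[OF _ continuous_on_fst[OF continuous_on_id]]) simp
  have e: "(\<lambda>(\<theta>, y). Tstat n \<theta> y) = (\<lambda>s. \<Sum>c\<in>UNIV. Usum n (fst s) (snd s) $ c *
      (\<Sum>c'\<in>UNIV. matrix_inv (Vn n (fst s)) $ c $ c' * Usum n (fst s) (snd s) $ c'))"
    by (simp add: fun_eq_iff Tstat_def inner_vec_def matrix_vector_mult_def)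
  show ?thesis
    unfolding e by (intro continuous_on_sum continuous_on_mult continuous_on_component U V)
qed

text \<open>The sample space is the same for all parameters; the parameter 0 merely names
  it.\<close>

lemma Tstat_extension:
  assumes n: "1 \<le> n"
  shows "full_measure \<Theta> (sample_law f \<nu> n) (space (sample_law f \<nu> n 0))"
    "continuous_extension \<Theta> f \<nu> n (space (sample_law f \<nu> n 0)) (Tstat n)"
proof -
  have "sets (sample_law f \<nu> n \<theta>) = sets (sample_law f \<nu> n 0)" for \<theta>
    unfolding sample_law_eq by (rule sets_PiM_cong) (auto simp: O.sets_law)
  then show "full_measure \<Theta> (sample_law f \<nu> n) (space (sample_law f \<nu> n 0))"
    unfolding full_measure_def using sets_eq_imp_space_eq AE_space by (metis sets.top)
  show "continuous_extension \<Theta> f \<nu> n (space (sample_law f \<nu> n 0)) (Tstat n)"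
    unfolding continuous_extension_def
    using continuous_on_Tstat[OF n] noncritical_statistic[OF _ n] by simp
qed

text \<open>Two continuous functions that agree at the non-critical points agree everywhere, since
  these are dense. Coverage for an arbitrary continuous extension thus reduces to
  \<open>Tstat\<close>.\<close>

lemma extension_unique:
  assumes n: "1 \<le> n" and T: "continuous_extension \<Theta> f \<nu> n Y T" and \<theta>: "\<theta> \<in> \<Theta>" and y: "y \<in> Y"
  shows "T \<theta> y = Tstat n \<theta> y"
proof -
  obtain u where u: "\<And>m. u m \<in> \<Theta>" "\<And>m. noncritical \<Theta> f \<nu> n (u m)" "u \<longlonglongrightarrow> \<theta>"
    using dense_noncritical \<theta> n unfolding dense_noncritical_def by blast
  have lim: "(\<lambda>m. (u m, y)) \<longlonglongrightarrow> (\<theta>, y)" by (intro tendsto_Pair u(3) tendsto_const)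
  have "continuous_on (\<Theta> \<times> Y) (\<lambda>(\<theta>, y). T \<theta> y)" using T by (simp add: continuous_extension_def)
  from continuous_on_tendsto_compose[OF this lim] have 1: "(\<lambda>m. T (u m) y) \<longlonglongrightarrow> T \<theta> y"
    using u(1) \<theta> y by simp
  from continuous_on_tendsto_compose[OF continuous_on_Tstat[OF n] lim, of UNIV]
  have 2: "(\<lambda>m. Tstat n (u m) y) \<longlonglongrightarrow> Tstat n \<theta> y" by simp
  have "T (u m) y = Tstat n (u m) y" for m
    using T u(1,2)[of m] y noncritical_statistic[OF u(1) n u(2)] by (auto simp: continuous_extension_def)
  with 1 2 show ?thesis by (auto intro: LIMSEQ_unique)
qed

lemma Ui_measurable: "Ui i \<theta> \<in> borel_measurable (O.law i \<theta>)"
  unfolding Ui_def measurable_cong_sets[OF O.sets_law refl] by (rule O.rscore_measurable)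

lemma Tstat_measurable: "Tstat n \<theta> \<in> borel_measurable (sample_law f \<nu> n \<theta>)"
proof -
  note Ui_measurable[measurable]
  show ?thesis unfolding Tstat_def Usum_def sample_law_eq by measurable
qed

text \<open>Uniformity is encoded by a sequence of parameters: any bounded sequence satisfies the
  hypotheses of \<open>quadratic_clt\<close> with constants depending only on K.\<close>

lemma Tstat_clt:
  assumes \<theta>: "\<And>n. norm (\<theta> n :: real^('d1 + 'd2)) \<le> K" and \<alpha>: "0 < \<alpha>" "\<alpha> < 1"
  shows "(\<lambda>n. measure (sample_law f \<nu> n (\<theta> n)) {y \<in> space (sample_law f \<nu> n (\<theta> n)).
      Tstat n (\<theta> n) y \<le> quantile (chi_square CARD('d1 + 'd2)) (1 - \<alpha>)}) \<longlonglongrightarrow> 1 - \<alpha>"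
proof -
  \<comment> \<open>Capped at 1 for the Taylor estimate and at \<delta> / 2 for the available
    moments.\<close>
  define \<eta> where "\<eta> = min (\<delta> / 2) 1"
  have \<eta>: "0 < \<eta>" "\<eta> \<le> 1" "\<eta> \<le> \<delta> / 2" using delta_pos by (auto simp: \<eta>_def)
  \<comment> \<open>The value of \<open>lo\<close> for a parameter of norm K: \<open>lo\<close>
    decreases in the norm, so this is a lower bound along the sequence.\<close>
  define L where "L = 1 / ((1 + M\<^sup>2) * (1 + (\<sigma>\<^sup>2 * M + K\<^sup>2))\<^sup>2)"
  have mu: "0 \<le> \<sigma>\<^sup>2 * M" using M_pos by simp
  have L0: "0 < L" unfolding L_def using mu
    by (intro divide_pos_pos mult_pos_pos zero_less_power add_pos_nonneg add_nonneg_nonneg) auto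
  have \<theta>c: "\<bar>\<theta> n $ c\<bar> \<le> K" for n c using component_le_norm_cart[of "\<theta> n" c] \<theta>[of n] by linarith
  have L: "L \<le> O.lo (\<theta> n)" for n
  proof -
    have "\<theta> n \<bullet> \<theta> n \<le> K\<^sup>2" using power_mono[OF \<theta>[of n] norm_ge_zero, of 2] by (simp add: power2_norm_eq_inner)
    then have "(1 + M\<^sup>2) * (1 + (\<sigma>\<^sup>2 * M + \<theta> n \<bullet> \<theta> n))\<^sup>2 \<le> (1 + M\<^sup>2) * (1 + (\<sigma>\<^sup>2 * M + K\<^sup>2))\<^sup>2"
      using mu by (intro mult_left_mono power_mono add_left_mono) auto
    moreover have "0 < (1 + M\<^sup>2) * (1 + (\<sigma>\<^sup>2 * M + \<theta> n \<bullet> \<theta> n))\<^sup>2"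
      using mu by (intro mult_pos_pos zero_less_power add_pos_nonneg add_nonneg_nonneg) auto
    ultimately show ?thesis unfolding L_def O.lo_def O.mu_def by (intro divide_left_mono) auto
  qed
  have "(\<lambda>n. measure (PiM {1..n} (\<lambda>i. O.law i (\<theta> n))) {y \<in> space (PiM {1..n} (\<lambda>i. O.law i (\<theta> n))).
      (\<Sum>i=1..n. Ui i (\<theta> n) (y i)) \<bullet> (matrix_inv (\<Sum>i=1..n. O.V i (\<theta> n)) *v (\<Sum>i=1..n. Ui i (\<theta> n) (y i)))
        \<le> quantile (chi_square CARD('d1 + 'd2)) (1 - \<alpha>)}) \<longlonglongrightarrow> 1 - \<alpha>"
  proof (rule quadratic_clt[where lo = L and up = O.up and B = "O.Wc \<eta> K" and \<eta> = \<eta>])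
    show "L * (w \<bullet> w) \<le> w \<bullet> (O.V i (\<theta> n) *v w)" for n i w
      using mult_right_mono[OF L[of n], of "w \<bullet> w"] O.V_bounds(1)[of "\<theta> n" w i] by (meson inner_ge_zero order_trans)
    show "w \<bullet> (O.V i (\<theta> n) *v w) \<le> O.up * (w \<bullet> w)" for n i w by (rule O.V_bounds)
    show "0 \<le> O.Wc \<eta> K" by (rule O.Wc_nonneg)
    show "(\<integral>\<^sup>+y. ennreal (\<bar>w \<bullet> Ui i (\<theta> n) y\<bar> powr (2 + \<eta>)) \<partial>O.law i (\<theta> n)) \<le> ennreal (O.Wc \<eta> K * norm w powr (2 + \<eta>))" for n i w
      unfolding Ui_def by (rule O.rscore_inner_moment[OF \<theta>c \<eta>(1,3)])
    show "Ui i (\<theta> n) \<in> borel_measurable (O.law i (\<theta> n))" for n i by (rule Ui_measurable)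
    show "integrable (O.law i (\<theta> n)) (\<lambda>y. w \<bullet> Ui i (\<theta> n) y)" "(\<integral>y. w \<bullet> Ui i (\<theta> n) y \<partial>O.law i (\<theta> n)) = 0"
      "integrable (O.law i (\<theta> n)) (\<lambda>y. (w \<bullet> Ui i (\<theta> n) y)\<^sup>2)"
      "(\<integral>y. (w \<bullet> Ui i (\<theta> n) y)\<^sup>2 \<partial>O.law i (\<theta> n)) = w \<bullet> (O.V i (\<theta> n) *v w)" for n i w
      unfolding Ui_def by (rule O.rscore_inner)+
  qed (rule O.prob_space_law O.transpose_V \<eta> L0 \<alpha>)+
  then show ?thesis unfolding sample_law_eq Tstat_def Usum_def Vn_def .
qed

text \<open>The model specifies the joint law of (W, Y, X). Integrating the joint density over W by
  Tonelli gives the law of one pair (Y, X), and independence of the triples passes to the pairs, so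
  the sample has a product law.\<close>

lemma lmm_sample_law:
  assumes "1 \<le> n" and model: "linear_mixed_model r Z a \<sigma> \<gamma> \<theta> P Y W X"
  shows "distr P (sample_law f \<nu> n \<theta>) (lmm_sample Y X n) = sample_law f \<nu> n \<theta>"
    and "lmm_sample Y X n \<in> measurable P (sample_law f \<nu> n \<theta>)"
proof -
  let ?N = "\<lambda>i. lborel \<Otimes>\<^sub>M \<nu> i"
  let ?T = "\<lambda>i \<omega>. (W i \<omega>, Y i \<omega>, X i \<omega>)"
  interpret P: prob_space P using model by (simp add: linear_mixed_model_def)
  have ind: "P.indep_vars ?N ?T {1..}" using model by (simp add: linear_mixed_model_def)
  have dst: "distributed P (?N i) (?T i) (\<lambda>(w, y, x). ennreal (lmm_joint_density (r i) (Z i) a \<sigma> \<theta> w y x))" if "1 \<le> i" for i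
    using model that by (simp add: linear_mixed_model_def)
  have odom: "\<nu> i = O.odom i" if "1 \<le> i" for i
    unfolding lmm_dominating_def O.odom_def by (simp add: pidx_eq[OF that])
  have marg: "distr P (\<nu> i) (\<lambda>\<omega>. (Y i \<omega>, X i \<omega>)) = O.law i \<theta>" and meas: "(\<lambda>\<omega>. (Y i \<omega>, X i \<omega>)) \<in> measurable P (\<nu> i)"
    if i: "1 \<le> i" for i
  proof -
    let ?j = "\<lambda>(w, y, x). ennreal (lmm_joint_density (r i) (Z i) a \<sigma> \<theta> w y x)"
    interpret G: prob_space "\<gamma> i" by (rule prob_gamma[OF i])
    interpret pl: product_sigma_finite "\<lambda>_::nat. lborel :: real measure" ..
    interpret py: sigma_finite_measure "PiM {..<r i} (\<lambda>_. lborel :: real measure)" by (rule pl.sigma_finite) simp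
    interpret s: pair_sigma_finite "PiM {..<r i} (\<lambda>_. lborel :: real measure)" "\<gamma> i" ..
    have sf: "sigma_finite_measure (\<nu> i)" unfolding lmm_dominating_def by (rule s.P.sigma_finite_measure_axioms)
    interpret ps: pair_sigma_finite "lborel :: (real^'q) measure" "\<nu> i"
      by (rule pair_sigma_finite.intro) (rule lborel.sigma_finite_measure_axioms sf)+
    have T: "?T i \<in> measurable P (?N i)" by (rule distributed_measurable[OF dst[OF i]])
    have j: "?j \<in> borel_measurable (?N i)" by (rule distributed_borel_measurable[OF dst[OF i]])
    have snd: "(\<lambda>\<omega>. (Y i \<omega>, X i \<omega>)) = (\<lambda>\<omega>. snd (?T i \<omega>))" by simp
    show m: "(\<lambda>\<omega>. (Y i \<omega>, X i \<omega>)) \<in> measurable P (\<nu> i)"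
      unfolding snd by (rule measurable_compose[OF T measurable_snd])
    have "distr P (\<nu> i) (\<lambda>\<omega>. (Y i \<omega>, X i \<omega>)) = distr (distr P (?N i) (?T i)) (\<nu> i) snd"
      unfolding snd by (subst distr_distr[OF measurable_snd T]) (simp add: comp_def)
    also have "\<dots> = distr (density (?N i) ?j) (\<nu> i) snd"
      unfolding distributed_distr_eq_density[OF dst[OF i]] by (rule refl)
    also have "\<dots> = O.law i \<theta>"
    proof (rule measure_eqI)
      show "sets (distr (density (?N i) ?j) (\<nu> i) snd) = sets (O.law i \<theta>)"
        by (simp add: O.sets_law odom[OF i])
      fix A assume "A \<in> sets (distr (density (?N i) ?j) (\<nu> i) snd)"
      then have A[measurable]: "A \<in> sets (\<nu> i)" by simp
      have s: "snd \<in> measurable (density (?N i) ?j) (\<nu> i)" by simp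
      have pre: "snd -` A \<inter> space (?N i) \<in> sets (?N i)" by (rule measurable_sets[OF measurable_snd A])
      have dA: "(\<lambda>p. ennreal (O.dens i \<theta> (fst p) (snd p))) \<in> borel_measurable (\<nu> i)" unfolding odom[OF i] by measurable
      have "emeasure (distr (density (?N i) ?j) (\<nu> i) snd) A = emeasure (density (?N i) ?j) (snd -` A \<inter> space (?N i))"
        by (subst emeasure_distr[OF s A]) simp
      also have "\<dots> = (\<integral>\<^sup>+t. ?j t * indicator (snd -` A \<inter> space (?N i)) t \<partial>?N i)"
        by (rule emeasure_density[OF j pre])
      also have "\<dots> = (\<integral>\<^sup>+t. ?j t * indicator A (snd t) \<partial>?N i)"
        by (intro nn_integral_cong) (auto simp: indicator_def)
      also have "\<dots> = (\<integral>\<^sup>+p. (\<integral>\<^sup>+w. ?j (w, p) * indicator A (snd (w, p)) \<partial>lborel) \<partial>\<nu> i)"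
        by (rule ps.nn_integral_snd[symmetric]) (use j in measurable)
      also have "\<dots> = (\<integral>\<^sup>+p. ennreal (O.dens i \<theta> (fst p) (snd p)) * indicator A p \<partial>\<nu> i)"
      proof (intro nn_integral_cong)
        fix p
        have int: "integrable lborel (\<lambda>w. lmm_joint_density (r i) (Z i) a \<sigma> \<theta> w (fst p) (snd p))"
          using O.joint_integrable[of i \<theta> "fst p" "snd p"] unfolding pidx_eq[OF i] .
        have nn: "0 \<le> lmm_joint_density (r i) (Z i) a \<sigma> \<theta> w (fst p) (snd p)" for w
          unfolding lmm_joint_density_def by (intro mult_nonneg_nonneg prod_nonneg) auto
        have "(\<integral>\<^sup>+w. ?j (w, p) * indicator A (snd (w, p)) \<partial>lborel)
          = (\<integral>\<^sup>+w. ennreal (lmm_joint_density (r i) (Z i) a \<sigma> \<theta> w (fst p) (snd p)) * indicator A p \<partial>lborel)"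
          by (intro nn_integral_cong) (simp add: split_beta)
        also have "\<dots> = (\<integral>\<^sup>+w. ennreal (lmm_joint_density (r i) (Z i) a \<sigma> \<theta> w (fst p) (snd p)) \<partial>lborel) * indicator A p"
          by (rule nn_integral_multc) (use int in measurable)
        also have "(\<integral>\<^sup>+w. ennreal (lmm_joint_density (r i) (Z i) a \<sigma> \<theta> w (fst p) (snd p)) \<partial>lborel) = ennreal (O.dens i \<theta> (fst p) (snd p))"
          unfolding O.dens_def unfolding pidx_eq[OF i] by (rule nn_integral_eq_integral[OF int]) (simp add: nn)
        finally show "(\<integral>\<^sup>+w. ?j (w, p) * indicator A (snd (w, p)) \<partial>lborel) = ennreal (O.dens i \<theta> (fst p) (snd p)) * indicator A p" .
      qed
      also have "\<dots> = emeasure (O.law i \<theta>) A"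
        unfolding O.law_def odom[OF i, symmetric] by (rule emeasure_density[symmetric, OF dA A])
      finally show "emeasure (distr (density (?N i) ?j) (\<nu> i) snd) A = emeasure (O.law i \<theta>) A" .
    qed
    finally show "distr P (\<nu> i) (\<lambda>\<omega>. (Y i \<omega>, X i \<omega>)) = O.law i \<theta>" .
  qed
  have "P.indep_vars ?N ?T {1..n}" by (rule P.indep_vars_subset[OF ind]) auto
  then have "P.indep_vars \<nu> (\<lambda>i \<omega>. snd (?T i \<omega>)) {1..n}"
    by (rule P.indep_vars_compose2) simp
  then have ind': "P.indep_vars \<nu> (\<lambda>i \<omega>. (Y i \<omega>, X i \<omega>)) {1..n}" by simp
  have sl: "sample_law f \<nu> n \<theta> = PiM {1..n} (\<lambda>i. distr P (\<nu> i) (\<lambda>\<omega>. (Y i \<omega>, X i \<omega>)))"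
    unfolding sample_law_eq by (rule PiM_cong) (auto simp: marg)
  have st: "sets (sample_law f \<nu> n \<theta>) = sets (PiM {1..n} \<nu>)"
    unfolding sl by (rule sets_PiM_cong) auto
  have "distr P (PiM {1..n} \<nu>) (\<lambda>\<omega>. \<lambda>i\<in>{1..n}. (Y i \<omega>, X i \<omega>)) = sample_law f \<nu> n \<theta>"
    unfolding sl using ind' by (subst (asm) P.indep_vars_iff_distr_eq_PiM') (use assms(1) meas in auto)
  then show "distr P (sample_law f \<nu> n \<theta>) (lmm_sample Y X n) = sample_law f \<nu> n \<theta>"
    unfolding distr_cong[OF refl st refl] lmm_sample_def[abs_def] .
  show "lmm_sample Y X n \<in> measurable P (sample_law f \<nu> n \<theta>)"
    unfolding measurable_cong_sets[OF refl st] lmm_sample_def[abs_def]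
    by (rule measurable_restrict) (use meas in auto)
qed

text \<open>For each n a parameter in C is chosen whose coverage is within 1 / (n + 1) of the
  infimum. Boundedness of C lets \<open>Tstat_clt\<close> handle this moving parameter, and the
  infimum is squeezed between its coverage and the same minus 1 / (n + 1).\<close>

lemma coverage:
  assumes C: "compact C" "C \<noteq> {}" "C \<subseteq> \<Theta>" and \<alpha>: "0 < \<alpha>" "\<alpha> < 1"
    and model: "\<And>\<theta>. \<theta> \<in> \<Theta> \<Longrightarrow> linear_mixed_model r Z a \<sigma> \<gamma> \<theta> (P \<theta>) Y W X"
    and ext: "\<And>n. 1 \<le> n \<Longrightarrow> full_measure \<Theta> (sample_law f \<nu> n) (\<Y> n)"
      "\<And>n. 1 \<le> n \<Longrightarrow> continuous_extension \<Theta> f \<nu> n (\<Y> n) (T n)"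
  shows "(\<lambda>n. INF \<theta>\<in>C. measure (P \<theta>) {\<omega> \<in> space (P \<theta>). lmm_sample Y X n \<omega> \<in> \<Y> n \<and>
      \<theta> \<in> conf_region \<Theta> (T n) (CARD('d1) + CARD('d2)) \<alpha> (lmm_sample Y X n \<omega>)}) \<longlonglongrightarrow> 1 - \<alpha>"
proof -
  let ?q = "quantile (chi_square (CARD('d1) + CARD('d2))) (1 - \<alpha>)"
  let ?g = "\<lambda>n \<theta>. measure (P \<theta>) {\<omega> \<in> space (P \<theta>). lmm_sample Y X n \<omega> \<in> \<Y> n \<and>
      \<theta> \<in> conf_region \<Theta> (T n) (CARD('d1) + CARD('d2)) \<alpha> (lmm_sample Y X n \<omega>)}"
  let ?A = "\<lambda>n \<theta>. measure (sample_law f \<nu> n \<theta>) {y \<in> space (sample_law f \<nu> n \<theta>). Tstat n \<theta> y \<le> ?q}"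
  \<comment> \<open>On the set of full measure the given extension equals \<open>Tstat\<close>, so
    passing to the whole sample space changes the event only by a null set.\<close>
  have g: "?g n \<theta> = ?A n \<theta>" if n: "1 \<le> n" and \<theta>: "\<theta> \<in> \<Theta>" for n \<theta>
  proof -
    let ?L = "sample_law f \<nu> n \<theta>" and ?X = "lmm_sample Y X n"
    note law = lmm_sample_law[OF n model[OF \<theta>]]
    interpret L: prob_space ?L by (rule prob_space_sample)
    have Y: "\<Y> n \<in> sets ?L" "AE y in ?L. y \<in> \<Y> n" using ext(1)[OF n] \<theta> by (auto simp: full_measure_def)
    have Ts: "{y \<in> space ?L. Tstat n \<theta> y \<le> ?q} \<in> sets ?L" using Tstat_measurable[of n \<theta>] by measurable
    let ?B = "{y \<in> space ?L. Tstat n \<theta> y \<le> ?q} \<inter> \<Y> n"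
    have B: "?B \<in> sets ?L" using Ts Y(1) by (rule sets.Int)
    have "{\<omega> \<in> space (P \<theta>). ?X \<omega> \<in> \<Y> n \<and> \<theta> \<in> conf_region \<Theta> (T n) (CARD('d1) + CARD('d2)) \<alpha> (?X \<omega>)}
      = ?X -` ?B \<inter> space (P \<theta>)"
      using measurable_space[OF law(2)] \<theta> extension_unique[OF n ext(2)[OF n] \<theta>] by (auto simp: conf_region_def)
    then have "?g n \<theta> = measure (distr (P \<theta>) ?L ?X) ?B" by (simp add: measure_distr[OF law(2) B])
    also have "\<dots> = ?A n \<theta>"
      unfolding law(1) by (rule L.finite_measure_eq_AE) (use Y Ts B in auto)
    finally show ?thesis .
  qed
  have bdd: "bdd_below (?g n ` C)" for n by (intro bdd_belowI2[of _ 0]) simp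
  have "\<forall>n. \<exists>t. t \<in> C \<and> ?g n t < (INF \<theta>\<in>C. ?g n \<theta>) + 1 / real (Suc n)"
  proof
    fix n
    have "(INF \<theta>\<in>C. ?g n \<theta>) < (INF \<theta>\<in>C. ?g n \<theta>) + 1 / real (Suc n)" by simp
    then show "\<exists>t. t \<in> C \<and> ?g n t < (INF \<theta>\<in>C. ?g n \<theta>) + 1 / real (Suc n)"
      unfolding cINF_less_iff[OF C(2) bdd] Bex_def .
  qed
  from choice[OF this] obtain t where t: "\<And>n. t n \<in> C" "\<And>n. ?g n (t n) < (INF \<theta>\<in>C. ?g n \<theta>) + 1 / real (Suc n)"
    by blast
  obtain K where K: "\<And>x. x \<in> C \<Longrightarrow> norm x \<le> K" using compact_imp_bounded[OF C(1)] by (auto simp: bounded_iff)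
  have "(\<lambda>n. ?A n (t n)) \<longlonglongrightarrow> 1 - \<alpha>"
    using Tstat_clt[of t K \<alpha>, OF K[OF t(1)] \<alpha>] by simp
  then have lim: "(\<lambda>n. ?g n (t n)) \<longlonglongrightarrow> 1 - \<alpha>"
  proof (rule Lim_transform_eventually)
    show "\<forall>\<^sub>F n in sequentially. ?A n (t n) = ?g n (t n)"
      unfolding eventually_sequentially by (intro exI[of _ 1] allI impI g[symmetric] subsetD[OF C(3)] t(1))
  qed
  have lim': "(\<lambda>n. ?g n (t n) - 1 / real (Suc n)) \<longlonglongrightarrow> 1 - \<alpha> - 0"
    by (intro tendsto_diff lim LIMSEQ_Suc[OF lim_1_over_n])
  show ?thesis
  proof (rule tendsto_sandwich[OF _ _ lim'[unfolded diff_zero] lim])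
    show "\<forall>\<^sub>F n in sequentially. ?g n (t n) - 1 / real (Suc n) \<le> (INF \<theta>\<in>C. ?g n \<theta>)"
      using t(2) by (auto intro!: always_eventually less_imp_le simp: diff_less_eq)
    show "\<forall>\<^sub>F n in sequentially. (INF \<theta>\<in>C. ?g n \<theta>) \<le> ?g n (t n)"
      using cINF_lower[OF bdd t(1)] by (auto intro!: always_eventually)
  qed
qed

lemma extension_exists:
  "\<forall>n\<ge>1. \<exists>\<Y> T. full_measure \<Theta> (sample_law f \<nu> n) \<Y> \<and> continuous_extension \<Theta> f \<nu> n \<Y> T
    \<and> (\<forall>k. smoothness_moment \<Theta> f \<nu> k \<longrightarrow>
         (\<forall>\<theta>\<in>\<Theta>. \<forall>\<kappa> v. admissible_orders \<Theta> f \<nu> (k \<theta>) n \<theta> \<kappa> v \<longrightarrow>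
            (\<forall>y\<in>\<Y>. T \<theta> y = mod_statistic \<Theta> f \<nu> n \<kappa> v \<theta> y)))"
proof (intro allI impI)
  fix n :: nat assume n: "1 \<le> n"
  show "\<exists>\<Y> T. full_measure \<Theta> (sample_law f \<nu> n) \<Y> \<and> continuous_extension \<Theta> f \<nu> n \<Y> T
    \<and> (\<forall>k. smoothness_moment \<Theta> f \<nu> k \<longrightarrow>
         (\<forall>\<theta>\<in>\<Theta>. \<forall>\<kappa> v. admissible_orders \<Theta> f \<nu> (k \<theta>) n \<theta> \<kappa> v \<longrightarrow>
            (\<forall>y\<in>\<Y>. T \<theta> y = mod_statistic \<Theta> f \<nu> n \<kappa> v \<theta> y)))"
    by (intro exI conjI allI ballI impI) (rule Tstat_extension[OF n], rule Tstat_extension[OF n],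
        erule admissible_statistic[OF _ n, symmetric])
qed

end

section \<open>The theorem\<close>

text \<open>The limit superior controls only a tail; the finitely many earlier terms are covered by
  their maximum.\<close>

lemma bounded_of_limsup:
  fixes r :: "nat \<Rightarrow> nat"
  assumes "limsup (\<lambda>i. enat (r i)) < \<infinity>"
  shows "\<exists>R. \<forall>i. r i \<le> R"
proof -
  obtain k where k: "limsup (\<lambda>i. enat (r i)) = enat k" using assms by (cases "limsup (\<lambda>i. enat (r i))") auto
  then have "limsup (\<lambda>i. enat (r i)) < enat (Suc k)" by simp
  then have "\<forall>\<^sub>F i in sequentially. enat (r i) < enat (Suc k)" by (rule Limsup_lessD)
  then obtain N where N: "\<And>i. N \<le> i \<Longrightarrow> r i \<le> k"
    by (auto simp: eventually_sequentially less_Suc_eq_le)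
  have "r i \<le> max k (Max (r ` {..N}))" for i
  proof (cases "N \<le> i")
    case True
    then show ?thesis using N[OF True] by simp
  next
    case False
    then have "r i \<le> Max (r ` {..N})" by (intro Max_ge) auto
    then show ?thesis by simp
  qed
  then show ?thesis by blast
qed

theorem theorem3p9:
  fixes r :: "nat \<Rightarrow> nat"
    and Z :: "nat \<Rightarrow> nat \<Rightarrow> real^'q::finite"
    and a :: "'q \<Rightarrow> 'd1::finite"
    and \<sigma> M \<delta> :: real
    and \<gamma> :: "nat \<Rightarrow> (nat \<Rightarrow> real^'d2::finite) measure"
    and P :: "real^('d1 + 'd2) \<Rightarrow> 'w measure"
    and Y :: "nat \<Rightarrow> 'w \<Rightarrow> nat \<Rightarrow> real"
    and W :: "nat \<Rightarrow> 'w \<Rightarrow> real^'q"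
    and X :: "nat \<Rightarrow> 'w \<Rightarrow> nat \<Rightarrow> real^'d2"
  defines "\<Theta> \<equiv> lmm_Theta :: (real^('d1 + 'd2)) set"
    and "f \<equiv> lmm_density r Z a \<sigma> :: nat \<Rightarrow> real^('d1 + 'd2) \<Rightarrow> _ \<Rightarrow> real"
    and "\<nu> \<equiv> lmm_dominating r \<gamma>"
  assumes "0 < \<sigma>"
    and "surj a"
    and "\<And>i. i \<ge> 1 \<Longrightarrow> prob_space (\<gamma> i)"
    and "\<And>i. i \<ge> 1 \<Longrightarrow> sets (\<gamma> i) = sets (PiM {..<r i} (\<lambda>_. borel))"
    and "\<And>\<theta>. \<theta> \<in> \<Theta> \<Longrightarrow> linear_mixed_model r Z a \<sigma> \<gamma> \<theta> (P \<theta>) Y W X"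
    and "limsup (\<lambda>i. enat (r i)) < \<infinity>"
    and "0 < M" and "0 < \<delta>"
    and "\<And>i. i \<ge> 1 \<Longrightarrow> inverse M \<le> min_eigenvalue (gram (r i) (Z i))"
    and "\<And>i. i \<ge> 1 \<Longrightarrow> max_eigenvalue (gram (r i) (Z i)) \<le> M"
    and "\<And>i. i \<ge> 1 \<Longrightarrow>
           inverse M \<le> min_eigenvalue (\<chi> b c. \<integral>x. gram (r i) x $ b $ c \<partial>\<gamma> i)"
    and "\<And>i. i \<ge> 1 \<Longrightarrow>
           (\<integral>\<^sup>+x. ennreal (spectral_norm (r i) x powr (4 + \<delta>)) \<partial>\<gamma> i) \<le> ennreal M"
  shows "common_null_sets \<Theta> f \<nu>
       \<and> (\<exists>k. smoothness_moment \<Theta> f \<nu> k \<and> nondegenerate_modified_score \<Theta> f \<nu> k)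
       \<and> comparable_information \<Theta> f \<nu>
       \<and> dense_noncritical \<Theta> f \<nu>
       \<and> (\<forall>n\<ge>1. \<exists>\<Y> T. full_measure \<Theta> (sample_law f \<nu> n) \<Y> \<and> continuous_extension \<Theta> f \<nu> n \<Y> T
            \<and> (\<forall>k. smoothness_moment \<Theta> f \<nu> k \<longrightarrow>
                 (\<forall>\<theta>\<in>\<Theta>. \<forall>\<kappa> v. admissible_orders \<Theta> f \<nu> (k \<theta>) n \<theta> \<kappa> v \<longrightarrow>
                    (\<forall>y\<in>\<Y>. T \<theta> y = mod_statistic \<Theta> f \<nu> n \<kappa> v \<theta> y))))
       \<and> (\<forall>\<Y> T. (\<forall>n\<ge>1. full_measure \<Theta> (sample_law f \<nu> n) (\<Y> n)
                     \<and> continuous_extension \<Theta> f \<nu> n (\<Y> n) (T n)) \<longrightarrow>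
            (\<forall>\<alpha> C. 0 < \<alpha> \<and> \<alpha> < 1 \<and> compact C \<and> C \<noteq> {} \<and> C \<subseteq> \<Theta> \<longrightarrow>
               (\<lambda>n. INF \<theta>\<in>C. measure (P \<theta>)
                  {\<omega> \<in> space (P \<theta>). lmm_sample Y X n \<omega> \<in> \<Y> n \<and>
                     \<theta> \<in> conf_region \<Theta> (T n) (CARD('d1) + CARD('d2)) \<alpha> (lmm_sample Y X n \<omega>)})
               \<longlonglongrightarrow> 1 - \<alpha>))"
proof -
  note asm = assms(4-)
  obtain R where R: "\<And>i. r i \<le> R" using bounded_of_limsup[OF asm(6)] by blast
  interpret L: lmm r Z a \<sigma> M \<delta> \<gamma> R
    by (rule lmm.intro) (rule asm(1,2,3,4,7-) R | assumption)+
  have model: "\<And>\<theta>. \<theta> \<in> lmm_Theta \<Longrightarrow> linear_mixed_model r Z a \<sigma> \<gamma> \<theta> (P \<theta>) Y W X"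
    using asm(5) unfolding \<Theta>_def .
  show ?thesis
    unfolding \<Theta>_def f_def \<nu>_def
  \<comment> \<open>The statement asks for one bound k that serves smoothness and nondegeneracy
    together; the constant 2 does.\<close>
  proof (intro conjI exI[of _ "\<lambda>_. 2"] L.common_null_sets L.smoothness_moment L.nondegenerate
      L.comparable_information L.dense_noncritical)
    show "\<forall>n\<ge>1. \<exists>\<Y> T. full_measure lmm_Theta (sample_law (lmm_density r Z a \<sigma>) (lmm_dominating r \<gamma>) n) \<Y>
        \<and> continuous_extension lmm_Theta (lmm_density r Z a \<sigma>) (lmm_dominating r \<gamma>) n \<Y> T
        \<and> (\<forall>k. smoothness_moment lmm_Theta (lmm_density r Z a \<sigma>) (lmm_dominating r \<gamma>) k \<longrightarrow>
             (\<forall>\<theta>\<in>lmm_Theta :: (real^('d1 + 'd2)) set. \<forall>\<kappa> v.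
               admissible_orders lmm_Theta (lmm_density r Z a \<sigma>) (lmm_dominating r \<gamma>) (k \<theta>) n \<theta> \<kappa> v \<longrightarrow>
                 (\<forall>y\<in>\<Y>. T \<theta> y = mod_statistic lmm_Theta (lmm_density r Z a \<sigma>) (lmm_dominating r \<gamma>) n \<kappa> v \<theta> y)))"
      by (rule L.extension_exists)
  qed (intro allI impI, elim conjE, rule L.coverage[OF _ _ _ _ _ model], auto)
qed

end
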